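(* Let $(v,u,\mathbf{w},\mathbf{b},\theta)$ be a sufficiently smooth solution of problem (P) of the context on $[0,1]\times[0,T]$, with initial data satisfying (I). Then there is a constant $C(T)>0$, depending on the initial data and $T$, such that for all $t\in[0,T]$ $$\int_0^1\theta^8(y,t)\,dy+\int_0^t\int_0^1\kappa\,\theta^3\theta_y^2\,dy\,ds\le C(T)+C(T)\left(\int_0^t\int_0^1|\mathbf{w}_{yy}|^2\,dy\,ds\right)^{\frac12}+C(T)\left(\int_0^t\int_0^1|\mathbf{b}_{yy}|^2\,dy\,ds\right)^{\frac12}.$$
   Context: Unknowns, functions of $(y,t)$: $v>0$, $\theta>0$, $u\in\mathbb{R}$, $\mathbf{w},\mathbf{b}\in\mathbb{R}^2$; $\rho=1/v$. Parameters: positive constants $\lambda,\mu,\nu,R,a,C_v,\kappa_1,\kappa_2$ and $q\ge0$. Laws: $p=\frac{R\theta}{v}+\frac a3\theta^4$, $e=C_v\theta+av\theta^4$, and $\kappa=\kappa(\rho,\theta)$ with $\kappa_1(1+\theta^q)\le\kappa\le\kappa_2(1+\theta^q)$. Problem (P): on $(0,1)\times(0,T)$, $$v_t=u_y,\quad u_t=\Big(-p-\tfrac12|\mathbf{b}|^2+\tfrac{\lambda u_y}{v}\Big)_y,\quad \mathbf{w}_t=\Big(\mathbf{b}+\tfrac{\mu\mathbf{w}_y}{v}\Big)_y,\quad (v\mathbf{b})_t=\Big(\mathbf{w}+\tfrac{\nu\mathbf{b}_y}{v}\Big)_y,$$ $$e_t=\Big(\tfrac{\kappa}{v}\theta_y\Big)_y+\Big(-p+\tfrac{\lambda}{v}u_y\Big)u_y+\tfrac{\mu|\mathbf{w}_y|^2}{v}+\tfrac{\nu|\mathbf{b}_y|^2}{v},$$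 $(v,u,\theta,\mathbf{w},\mathbf{b})(y,0)=(v_0,u_0,\theta_0,\mathbf{w}_0,\mathbf{b}_0)(y)$, and $\big(\tfrac{\lambda u_y}{v}-p,\mathbf{w},\mathbf{b},\theta_y\big)=0$ at $y=0$ and $y=1$. (I): $C_0^{-1}\le v_0,\theta_0\le C_0$ for some $C_0>0$, $v_0\in C^{1+\alpha}(0,1)$ and $u_0,\mathbf{w}_0,\mathbf{b}_0,\theta_0$ have components in $C^{2+\alpha}(0,1)$, for some $\alpha\in(0,1)$. Constants may also depend on the fixed parameters and on the function $\kappa$. "Sufficiently smooth" means that all derivatives occurring exist. *)

theory Defs
  imports "HOL-Analysis.Analysis"
begin

text \<open>
  Functions of space and time are curried, space first: \<open>f y t\<close> with \<open>0 \<le> y \<le> 1\<close> and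
  \<open>0 \<le> t \<le> T\<close>. Derivatives are taken within the closed intervals, so they are one-sided at
  \<open>y = 0, 1\<close> and \<open>t = 0, T\<close>.
\<close>

definition Dy :: "(real \<Rightarrow> real \<Rightarrow> 'a::real_normed_vector) \<Rightarrow> real \<Rightarrow> real \<Rightarrow> 'a" where
  "Dy f y t = vector_derivative (\<lambda>x. f x t) (at y within {0..1})"

definition Dt :: "real \<Rightarrow> (real \<Rightarrow> real \<Rightarrow> 'a::real_normed_vector) \<Rightarrow> real \<Rightarrow> real \<Rightarrow> 'a" where
  "Dt T f y t = vector_derivative (\<lambda>s. f y s) (at t within {0..T})"

definition C1_y :: "real \<Rightarrow> (real \<Rightarrow> real \<Rightarrow> 'a::real_normed_vector) \<Rightarrow> bool" where
  "C1_y T f \<longleftrightarrow>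
     (\<forall>y\<in>{0..1}. \<forall>t\<in>{0..T}. (\<lambda>x. f x t) differentiable (at y within {0..1})) \<and>
     continuous_on ({0..1} \<times> {0..T}) (\<lambda>(y, t). Dy f y t)"

definition C1_t :: "real \<Rightarrow> (real \<Rightarrow> real \<Rightarrow> 'a::real_normed_vector) \<Rightarrow> bool" where
  "C1_t T f \<longleftrightarrow>
     (\<forall>y\<in>{0..1}. \<forall>t\<in>{0..T}. (\<lambda>s. f y s) differentiable (at t within {0..T})) \<and>
     continuous_on ({0..1} \<times> {0..T}) (\<lambda>(y, t). Dt T f y t)"

definition pressure :: "real \<Rightarrow> real \<Rightarrow> real \<Rightarrow> real \<Rightarrow> real" where
  "pressure R a v \<theta> = R * \<theta> / v + a / 3 * \<theta> ^ 4"

definition internal_energy :: "real \<Rightarrow> real \<Rightarrow> real \<Rightarrow> real \<Rightarrow> real" where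
  "internal_energy Cv a v \<theta> = Cv * \<theta> + a * v * \<theta> ^ 4"

text \<open>
  Classical regularity up to the boundary of \<open>[0,1] \<times> [0,T]\<close>. The conductivity \<open>\<kappa>\<close> is not
  assumed to be differentiable; instead, the heat flux, which is what the energy equation
  differentiates, is required to be continuously differentiable in \<open>y\<close>.
\<close>

definition smooth_fields ::
  "(real \<Rightarrow> real \<Rightarrow> real) \<Rightarrow> real \<Rightarrow>
   (real \<Rightarrow> real \<Rightarrow> real) \<Rightarrow> (real \<Rightarrow> real \<Rightarrow> real) \<Rightarrow>
   (real \<Rightarrow> real \<Rightarrow> real^2) \<Rightarrow> (real \<Rightarrow> real \<Rightarrow> real^2) \<Rightarrow> (real \<Rightarrow> real \<Rightarrow> real) \<Rightarrow> bool" where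
  "smooth_fields \<kappa> T v u w b \<theta> \<longleftrightarrow>
     C1_y T v \<and> C1_y T u \<and> C1_y T w \<and> C1_y T b \<and> C1_y T \<theta> \<and>
     C1_t T v \<and> C1_t T u \<and> C1_t T w \<and> C1_t T b \<and> C1_t T \<theta> \<and>
     C1_y T (Dy u) \<and> C1_y T (Dy w) \<and> C1_y T (Dy b) \<and>
     C1_y T (\<lambda>y t. \<kappa> (1 / v y t) (\<theta> y t) / v y t * Dy \<theta> y t)"

definition solution_P ::
  "real \<Rightarrow> real \<Rightarrow> real \<Rightarrow> real \<Rightarrow> real \<Rightarrow> real \<Rightarrow> (real \<Rightarrow> real \<Rightarrow> real) \<Rightarrow> real \<Rightarrow>
   (real \<Rightarrow> real) \<Rightarrow> (real \<Rightarrow> real) \<Rightarrow> (real \<Rightarrow> real^2) \<Rightarrow> (real \<Rightarrow> real^2) \<Rightarrow> (real \<Rightarrow> real) \<Rightarrow>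
   (real \<Rightarrow> real \<Rightarrow> real) \<Rightarrow> (real \<Rightarrow> real \<Rightarrow> real) \<Rightarrow>
   (real \<Rightarrow> real \<Rightarrow> real^2) \<Rightarrow> (real \<Rightarrow> real \<Rightarrow> real^2) \<Rightarrow> (real \<Rightarrow> real \<Rightarrow> real) \<Rightarrow> bool" where
  "solution_P lam \<mu> \<nu> R a Cv \<kappa> T v0 u0 w0 b0 \<theta>0 v u w b \<theta> \<longleftrightarrow>
     (\<forall>y\<in>{0..1}. \<forall>t\<in>{0..T}. v y t > 0 \<and> \<theta> y t > 0) \<and>
     (\<forall>y\<in>{0<..<1}. \<forall>t\<in>{0<..<T}.
        Dt T v y t = Dy u y t \<and>
        Dt T u y t =
          Dy (\<lambda>y t. - pressure R a (v y t) (\<theta> y t) - (norm (b y t))\<^sup>2 / 2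
                    + lam * Dy u y t / v y t) y t \<and>
        Dt T w y t = Dy (\<lambda>y t. b y t + (\<mu> / v y t) *\<^sub>R Dy w y t) y t \<and>
        Dt T (\<lambda>y t. v y t *\<^sub>R b y t) y t = Dy (\<lambda>y t. w y t + (\<nu> / v y t) *\<^sub>R Dy b y t) y t \<and>
        Dt T (\<lambda>y t. internal_energy Cv a (v y t) (\<theta> y t)) y t =
          Dy (\<lambda>y t. \<kappa> (1 / v y t) (\<theta> y t) / v y t * Dy \<theta> y t) y t
          + (- pressure R a (v y t) (\<theta> y t) + lam / v y t * Dy u y t) * Dy u y t
          + \<mu> * (norm (Dy w y t))\<^sup>2 / v y t + \<nu> * (norm (Dy b y t))\<^sup>2 / v y t) \<and>
     (\<forall>y\<in>{0..1}. v y 0 = v0 y \<and> u y 0 = u0 y \<and> w y 0 = w0 y \<and> b y 0 = b0 y \<and> \<theta> y 0 = \<theta>0 y) \<and>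
     (\<forall>y\<in>{0, 1}. \<forall>t\<in>{0..T}.
        lam * Dy u y t / v y t - pressure R a (v y t) (\<theta> y t) = 0 \<and>
        w y t = 0 \<and> b y t = 0 \<and> Dy \<theta> y t = 0)"

text \<open>
  The Hoelder space \<open>C\<^sup>k\<^sup>+\<^sup>\<alpha>(0,1)\<close>. On this bounded interval the Hoelder condition on the
  \<open>k\<close>-th derivative already makes all derivatives up to order \<open>k\<close> bounded.
\<close>

definition holder_space :: "nat \<Rightarrow> real \<Rightarrow> (real \<Rightarrow> real) \<Rightarrow> bool" where
  "holder_space k \<alpha> f \<longleftrightarrow>
     (\<forall>j<k. (deriv ^^ j) f differentiable_on {0<..<1}) \<and>
     (\<exists>L. \<forall>x\<in>{0<..<1}. \<forall>y\<in>{0<..<1}.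
        \<bar>(deriv ^^ k) f x - (deriv ^^ k) f y\<bar> \<le> L * \<bar>x - y\<bar> powr \<alpha>)"

definition initial_data_I ::
  "(real \<Rightarrow> real) \<Rightarrow> (real \<Rightarrow> real) \<Rightarrow> (real \<Rightarrow> real^2) \<Rightarrow> (real \<Rightarrow> real^2) \<Rightarrow> (real \<Rightarrow> real) \<Rightarrow> bool"
where
  "initial_data_I v0 u0 w0 b0 \<theta>0 \<longleftrightarrow>
     (\<exists>C0>0. \<forall>y\<in>{0..1}. inverse C0 \<le> v0 y \<and> v0 y \<le> C0 \<and> inverse C0 \<le> \<theta>0 y \<and> \<theta>0 y \<le> C0) \<and>
     (\<exists>\<alpha>. 0 < \<alpha> \<and> \<alpha> < 1 \<and>
        holder_space 1 \<alpha> v0 \<and> holder_space 2 \<alpha> u0 \<and> holder_space 2 \<alpha> \<theta>0 \<and>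
        (\<forall>i. holder_space 2 \<alpha> (\<lambda>y. w0 y $ i) \<and> holder_space 2 \<alpha> (\<lambda>y. b0 y $ i)))"

end

theory Submission
  imports Defs
begin

text \<open>
  Let \<open>\<sigma> = \<lambda> u_y / v - p - |b|\<^sup>2 / 2\<close> be the total stress, so that \<open>u_t = \<sigma>_y\<close> and \<open>\<sigma> = 0\<close> on the boundary.
  Conservation of energy, the entropy identity and the fact that \<open>\<lambda> ln v - \<integral> u\<close> grows at the rate
  \<open>p + |b|\<^sup>2 / 2\<close> bound \<open>v\<close> from above and below, and bound the gradients of \<open>u\<close>, \<open>w\<close>, \<open>b\<close> in \<open>L\<^sup>2\<close> of
  space-time; a further energy estimate bounds \<open>w_y\<close> and \<open>b_y\<close> in \<open>L\<^sup>2(0,1)\<close> uniformly in time. The bound on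
  the temperature then comes from Gronwall's inequality for the sum of \<open>\<integral> v \<theta>^(k+4)\<close>, with \<open>k\<close> about \<open>q + 4\<close>,
  of \<open>\<integral> (\<lambda> v_y / v - u)\<^sup>2\<close>, and of a corrected version of \<open>\<integral> v \<sigma>\<^sup>2\<close>. The correction removes the time derivative
  of the part of the pressure that is not a multiple of the energy density; only the heat flux, and no
  derivative of \<open>\<kappa>\<close>, enters.

  The dependence of the constants on the data alone is obtained by contradiction: a sequence of solutions
  violating every bound shares its data, and all estimates are proved uniformly along the sequence.
\<close>

section \<open>Integral inequalities in one dimension\<close>

text \<open>With only the growth of \<open>\<kappa>\<close> known, \<open>F_y\<close> cannot be
  estimated and has to be integrated by parts. Testing with the stress produces the time derivative
  of the pressure, hence \<open>\<theta>_t\<close>, hence \<open>F_y\<close>; moved off,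
  \<open>F\<close> meets \<open>u_t\<close> and costs \<open>F^2\<close>. The upper growth bound
  turns \<open>F^2\<close> into \<open>F * \<theta>_y\<close> with weight up to
  \<open>\<theta>^(2 m + 3)\<close>, where \<open>m\<close> is the integer part of
  \<open>q / 2\<close>: the heat dissipation of the moment of order \<open>k = 2 m + 4\<close>. The
  same power of \<open>\<theta>\<close> has a supremum integrable in time by the entropy identity,
  which is the Gronwall weight for the source of that moment. Both requirements fix
  \<open>k\<close>.

  The three functionals close only together: the rates of the stress and of the volume gradient
  contain the heat dissipation, which the moment alone supplies with the good sign, while the moment
  source contains the squared stress and the stress rate contains \<open>v_y\<close>.

  No mixed derivative \<open>u_yt\<close> is available; bounds on backward difference quotients
  replace it, at the price of convexity in the gradient, which limits the correction.\<close>

lemma has_integral_derivative_within: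
  fixes f :: "real \<Rightarrow> 'a::banach"
  assumes "\<And>y. y \<in> S \<Longrightarrow> (f has_vector_derivative f' y) (at y within S)"
    and "{a..b} \<subseteq> S" "a \<le> b"
  shows "(f' has_integral f b - f a) {a..b}"
  by (rule fundamental_theorem_of_calculus[OF assms(3)],
      rule has_vector_derivative_within_subset[OF assms(1)]) (use assms in auto)

text \<open>\<open>y\<close> is merely continuous, so the argument differentiates the right-hand
  side \<open>Z\<close> of its bound: multiplied by \<open>exp (- M t)\<close> it is nonincreasing,
  because \<open>y \<le> Z\<close> and \<open>m \<ge> 0\<close>.\<close>

lemma gronwall_integral:
  fixes y m :: "real \<Rightarrow> real"
  assumes "continuous_on {0..T} y" "continuous_on {0..T} m"
    and nonneg: "\<And>t. t \<in> {0..T} \<Longrightarrow> 0 \<le> m t"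
    and le: "\<And>t. t \<in> {0..T} \<Longrightarrow> y t \<le> K + integral {0..t} (\<lambda>s. m s * y s)"
    and t: "t \<in> {0..T}"
  shows "y t \<le> K * exp (integral {0..t} m)"
proof -
  define Z where "Z = (\<lambda>t. K + integral {0..t} (\<lambda>s. m s * y s))"
  define M where "M = (\<lambda>t. integral {0..t} m)"
  have cont: "continuous_on {0..T} (\<lambda>s. m s * y s)"
    by (intro continuous_intros assms)
  have dZ: "(Z has_real_derivative m s * y s) (at s within {0..T})" if "s \<in> {0..T}" for s
    unfolding Z_def using that
    by (auto intro!: derivative_eq_intros integral_has_real_derivative cont)
  have dM: "(M has_real_derivative m s) (at s within {0..T})" if "s \<in> {0..T}" for s
    unfolding M_def using that by (auto intro!: integral_has_real_derivative assms)
  define W where "W = (\<lambda>t. Z t * exp (- M t))"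
  have dW: "(W has_real_derivative m s * (y s - Z s) * exp (- M s)) (at s within {0..T})"
    if "s \<in> {0..T}" for s
    unfolding W_def
    by (rule derivative_eq_intros dZ[OF that] dM[OF that] refl | simp add: algebra_simps)+
  have "((\<lambda>s. m s * (y s - Z s) * exp (- M s)) has_integral W t - W 0) {0..t}"
    using t dW
    by (intro has_integral_derivative_within[of "{0..T}"])
      (auto simp flip: has_real_derivative_iff_has_vector_derivative)
  moreover have "m s * (y s - Z s) * exp (- M s) \<le> 0" if "s \<in> {0..t}" for s
  proof -
    have "y s \<le> Z s" "0 \<le> m s" using that t le nonneg by (auto simp: Z_def)
    then show ?thesis by (simp add: mult_nonneg_nonpos mult_nonpos_nonneg)
  qed
  ultimately have "W t - W 0 \<le> 0"
    by (rule has_integral_le[OF _ has_integral_0])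
  then have "Z t * exp (- M t) \<le> K"
    by (simp add: W_def M_def Z_def)
  then have "Z t \<le> K * exp (M t)"
    by (simp add: exp_minus field_simps)
  with le[OF t] show ?thesis by (simp add: Z_def M_def)
qed

text \<open>Induction to the left: the set of \<open>s \<le> t\<close> with
  \<open>G t \<le> G s\<close> is compact, so it has a least element, and the hypothesis would push
  a positive least element further down.\<close>

lemma left_decreasing_imp_le:
  fixes G :: "real \<Rightarrow> real"
  assumes cont: "continuous_on {0..T} G"
    and dec: "\<And>t. 0 < t \<Longrightarrow> t \<le> T \<Longrightarrow> \<exists>s. 0 \<le> s \<and> s < t \<and> G t \<le> G s"
    and t: "t \<in> {0..T}"
  shows "G t \<le> G 0"
proof -
  define S where "S = {0..t} \<inter> {s. G t \<le> G s}"
  have "closed S"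
  proof -
    have "continuous_on {0..t} G" using cont t by (auto intro: continuous_on_subset)
    then have "closed {s \<in> {0..t}. G t \<le> G s}"
      by (intro continuous_on_closed_Collect_le continuous_intros) auto
    then show ?thesis by (simp add: S_def Int_def)
  qed
  then have "compact S"
    by (metis S_def bounded_Int bounded_closed_interval compact_eq_bounded_closed)
  moreover have "t \<in> S" using t by (simp add: S_def)
  ultimately obtain s0 where s0: "s0 \<in> S" "\<And>s. s \<in> S \<Longrightarrow> s0 \<le> s"
    by (metis compact_attains_inf empty_iff)
  show ?thesis
  proof (cases "s0 = 0")
    case True
    then show ?thesis using s0 by (simp add: S_def)
  next
    case False
    with s0 t have "0 < s0" "s0 \<le> T" by (auto simp: S_def)
    from dec[OF this] obtain s where "0 \<le> s" "s < s0" "G s0 \<le> G s" by blast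
    with s0 t have "s \<in> S" by (auto simp: S_def)
    with s0(2) \<open>s < s0\<close> show ?thesis by fastforce
  qed
qed

text \<open>Replaces the fundamental theorem for functionals of which only backward difference
  quotients are bounded. Subtracting \<open>integral {0..t} g\<close> and a small slope
  \<open>e * t\<close> leads to the hypothesis of \<open>left_decreasing_imp_le\<close>; half of the
  slope pays for the Dini error, half for the oscillation of \<open>g\<close>.\<close>

lemma dini_le_integral:
  fixes F g :: "real \<Rightarrow> real"
  assumes contF: "continuous_on {0..T} F" and contg: "continuous_on {0..T} g"
    and dini: "\<And>t \<epsilon>. 0 < t \<Longrightarrow> t \<le> T \<Longrightarrow> 0 < \<epsilon> \<Longrightarrow>
      \<exists>\<delta>>0. \<forall>h. 0 < h \<longrightarrow> h < \<delta> \<longrightarrow> h \<le> t \<longrightarrow> F t - F (t - h) \<le> h * (g t + \<epsilon>)"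
    and t: "t \<in> {0..T}"
  shows "F t \<le> F 0 + integral {0..t} g"
proof -
  have "F t \<le> F 0 + integral {0..t} g + \<epsilon>" if "\<epsilon> > 0" for \<epsilon>
  proof -
    define e where "e = \<epsilon> / (1 + t)"
    have "e > 0" "e * t \<le> \<epsilon>" using that t by (auto simp: e_def field_simps)
    define G where "G = (\<lambda>t. F t - integral {0..t} g - e * t)"
    have "G t \<le> G 0"
    proof (rule left_decreasing_imp_le[OF _ _ t])
      have "continuous_on {0..T} (\<lambda>t. integral {0..t} g)"
        using contg by (intro indefinite_integral_continuous_1 integrable_continuous_interval)
      then show "continuous_on {0..T} G" unfolding G_def by (intro continuous_intros contF)
    next
      fix t assume t: "0 < t" "t \<le> T"
      from dini[OF t, of "e/2"] \<open>e > 0\<close> obtain d where d: "d > 0"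
        "\<And>h. 0 < h \<Longrightarrow> h < d \<Longrightarrow> h \<le> t \<Longrightarrow> F t - F (t - h) \<le> h * (g t + e/2)" by auto
      from contg t \<open>e > 0\<close> obtain d' where d': "d' > 0"
        "\<And>s. s \<in> {0..T} \<Longrightarrow> dist s t < d' \<Longrightarrow> dist (g s) (g t) < e/2"
        unfolding continuous_on_iff by (metis atLeastAtMost_iff half_gt_zero less_eq_real_def)
      define h where "h = min t (min (d/2) (d'/2))"
      have h: "0 < h" "h < d" "h \<le> t" "h < d'" using t d(1) d'(1) by (auto simp: h_def)
      have int: "g integrable_on {a..b}" if "0 \<le> a" "b \<le> T" for a b
        using contg that by (auto intro!: integrable_continuous_interval intro: continuous_on_subset)
      have "integral {0..t} g - integral {0..t-h} g = integral {t-h..t} g"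
        using h t int[of 0 t] Henstock_Kurzweil_Integration.integral_combine[of 0 "t-h" t g] by simp
      also have "\<dots> \<ge> integral {t-h..t} (\<lambda>_. g t - e/2)"
      proof (rule Henstock_Kurzweil_Integration.integral_le)
        fix s assume "s \<in> {t-h..t}"
        then have "dist (g s) (g t) < e/2" using h t by (intro d') (auto simp: dist_real_def)
        then show "g t - e/2 \<le> g s" by (auto simp: dist_real_def abs_if split: if_splits)
      qed (use h t int in auto)
      also have "integral {t-h..t} (\<lambda>_. g t - e/2) = h * (g t - e/2)" using h by simp
      finally have "h * (g t - e/2) \<le> integral {0..t} g - integral {0..t-h} g" .
      with d(2)[OF h(1-3)] have "G t \<le> G (t - h)"
        by (simp add: G_def algebra_simps)
      then show "\<exists>s. 0 \<le> s \<and> s < t \<and> G t \<le> G s" using h by (intro exI[of _ "t-h"]) auto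
    qed
    with \<open>e * t \<le> \<epsilon>\<close> show ?thesis by (simp add: G_def)
  qed
  then show ?thesis by (meson field_le_epsilon)
qed

lemma integral_derivative_eq:
  fixes f :: "real \<Rightarrow> 'a::banach"
  assumes "\<And>y. y \<in> {0..1} \<Longrightarrow> (f has_vector_derivative f' y) (at y within {0..1})"
    and "y \<in> {0..1}"
  shows "integral {0..y} f' = f y - f 0"
  using assms
  by (intro integral_unique has_integral_derivative_within[of "{0..1}"]) auto

lemma integral_by_parts_inner:
  fixes f g :: "real \<Rightarrow> 'a::euclidean_space"
  assumes f: "\<And>y. y \<in> {0..1} \<Longrightarrow> (f has_vector_derivative f' y) (at y within {0..1})"
    and g: "\<And>y. y \<in> {0..1} \<Longrightarrow> (g has_vector_derivative g' y) (at y within {0..1})"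
    and cont: "continuous_on {0..1} f'" "continuous_on {0..1} g'"
    and bdry: "f 1 \<bullet> g 1 = f 0 \<bullet> g 0"
  shows "integral {0..1} (\<lambda>y. f y \<bullet> g' y) = - integral {0..1} (\<lambda>y. f' y \<bullet> g y)"
proof -
  have cf: "continuous_on {0..1} f" "continuous_on {0..1} g"
    using f g by (blast intro: continuous_on_vector_derivative)+
  have "((\<lambda>y. f y \<bullet> g y) has_vector_derivative f y \<bullet> g' y + f' y \<bullet> g y) (at y within {0..1})"
    if "y \<in> {0..1}" for y
    by (rule bounded_bilinear.has_vector_derivative[OF bounded_bilinear_inner f[OF that] g[OF that]])
  from integral_derivative_eq[OF this, of 1] bdry
  have "integral {0..1} (\<lambda>y. f y \<bullet> g' y + f' y \<bullet> g y) = 0" by simp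
  then show ?thesis
    by (subst (asm) integral_add)
      (auto intro!: integrable_continuous_interval continuous_intros cf cont)
qed

lemma integral_by_parts_real:
  fixes f g :: "real \<Rightarrow> real"
  assumes "\<And>y. y \<in> {0..1} \<Longrightarrow> (f has_real_derivative f' y) (at y within {0..1})"
    and "\<And>y. y \<in> {0..1} \<Longrightarrow> (g has_real_derivative g' y) (at y within {0..1})"
    and "continuous_on {0..1} f'" "continuous_on {0..1} g'"
    and "f 1 * g 1 = f 0 * g 0"
  shows "integral {0..1} (\<lambda>y. f y * g' y) = - integral {0..1} (\<lambda>y. f' y * g y)"
  using integral_by_parts_inner[of f f' g g'] assms
  by (simp add: has_real_derivative_iff_has_vector_derivative)

lemma integral_Cauchy_Schwarz:
  fixes f g :: "real \<Rightarrow> real"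
  assumes f: "continuous_on {0..1} f" and g: "continuous_on {0..1} g"
  shows "(integral {0..1} (\<lambda>y. f y * g y))\<^sup>2 \<le>
    integral {0..1} (\<lambda>y. (f y)\<^sup>2) * integral {0..1} (\<lambda>y. (g y)\<^sup>2)"
proof -
  define A B C where "A = integral {0..1} (\<lambda>y. (f y)\<^sup>2)" and "B = integral {0..1} (\<lambda>y. (g y)\<^sup>2)"
    and "C = integral {0..1} (\<lambda>y. f y * g y)"
  have int: "h integrable_on {0..1}" if "continuous_on {0..1} h" for h :: "real \<Rightarrow> real"
    using that by (rule integrable_continuous_interval)
  have q: "0 \<le> p\<^sup>2 * A - 2 * p * r * C + r\<^sup>2 * B" for p r
  proof -
    have "0 \<le> integral {0..1} (\<lambda>y. (p * f y - r * g y)\<^sup>2)"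
      by (intro integral_nonneg int continuous_intros f g) auto
    also have "\<dots> = integral {0..1} (\<lambda>y. p\<^sup>2 * (f y)\<^sup>2 - 2 * p * r * (f y * g y) + r\<^sup>2 * (g y)\<^sup>2)"
      by (intro arg_cong[where f="integral _"] ext) (simp add: power2_eq_square algebra_simps)
    also have "\<dots> = p\<^sup>2 * A - 2 * p * r * C + r\<^sup>2 * B"
      unfolding A_def B_def C_def
      by (simp add: integral_add integral_diff int continuous_intros f g)
    finally show ?thesis .
  qed
  have "0 \<le> A" "0 \<le> B" unfolding A_def B_def
    by (intro integral_nonneg int continuous_intros f g; simp)+
  show "C\<^sup>2 \<le> A * B"
  proof (cases "B = 0")
    case True
    have "C = 0"
    proof (rule ccontr)
      assume "C \<noteq> 0"
      \<comment> \<open>With \<open>B = 0\<close> and \<open>p = 1\<close> the form is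
        \<open>A - 2 * r * C\<close>; this \<open>r\<close> makes it equal to -1.\<close>
      from q[of 1 "(A + 1) / (2 * C)"] True \<open>C \<noteq> 0\<close> show False by (simp add: field_simps)
    qed
    then show ?thesis using True by simp
  next
    case False
    with \<open>0 \<le> B\<close> have "B > 0" by simp
    from q[of B C] have "0 \<le> B * (A * B - C\<^sup>2)" by (simp add: power2_eq_square algebra_simps)
    with \<open>B > 0\<close> show ?thesis by (simp add: zero_le_mult_iff)
  qed
qed

lemma norm_diff_le_integral_derivative:
  fixes f :: "real \<Rightarrow> 'a::banach"
  assumes f: "\<And>y. y \<in> {0..1} \<Longrightarrow> (f has_vector_derivative f' y) (at y within {0..1})"
    and cont: "continuous_on {0..1} f'"
    and x: "x \<in> {0..1}" and y: "y \<in> {0..1}"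
  shows "norm (f y - f x) \<le> integral {0..1} (\<lambda>y. norm (f' y))"
proof -
  have le: "norm (f y - f x) \<le> integral {0..1} (\<lambda>y. norm (f' y))" if "x \<le> y" "x \<in> {0..1}" "y \<in> {0..1}" for x y
  proof -
    have "integral {x..y} f' = f y - f x"
      using that
      by (intro integral_unique has_integral_derivative_within[of "{0..1}"] f) auto
    then have "norm (f y - f x) = norm (integral {x..y} f')" by simp
    also have "\<dots> \<le> integral {x..y} (\<lambda>y. norm (f' y))"
      using that cont
      by (intro integral_norm_bound_integral integrable_continuous_interval continuous_intros)
        (auto intro: continuous_on_subset)
    also have "\<dots> \<le> integral {0..1} (\<lambda>y. norm (f' y))"
      using that cont
      by (intro integral_subset_le integrable_continuous_interval continuous_intros)
        (auto intro: continuous_on_subset)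
    finally show ?thesis .
  qed
  show ?thesis
    using le[of x y] le[of y x] x y by (cases "x \<le> y") (auto simp: norm_minus_commute)
qed

lemma norm_diff_square_le_integral_derivative:
  fixes f :: "real \<Rightarrow> 'a::banach"
  assumes f: "\<And>y. y \<in> {0..1} \<Longrightarrow> (f has_vector_derivative f' y) (at y within {0..1})"
    and cont: "continuous_on {0..1} f'"
    and x: "x \<in> {0..1}" and y: "y \<in> {0..1}"
  shows "(norm (f y - f x))\<^sup>2 \<le> integral {0..1} (\<lambda>y. (norm (f' y))\<^sup>2)"
proof -
  have "norm (f y - f x) \<le> integral {0..1} (\<lambda>y. norm (f' y))"
    by (rule norm_diff_le_integral_derivative[OF assms])
  then have "(norm (f y - f x))\<^sup>2 \<le> (integral {0..1} (\<lambda>y. norm (f' y)))\<^sup>2"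
    by (simp add: power_mono)
  also have "\<dots> \<le> integral {0..1} (\<lambda>y. (norm (f' y))\<^sup>2)"
    using integral_Cauchy_Schwarz[of "\<lambda>y. norm (f' y)" "\<lambda>_. 1"] cont
    by (simp add: continuous_intros)
  finally show ?thesis .
qed

lemma exists_le_integral:
  fixes f :: "real \<Rightarrow> real"
  assumes cont: "continuous_on {0..1} f"
  shows "\<exists>x\<in>{0..1}. f x \<le> integral {0..1} f"
proof -
  obtain x where x: "x \<in> {0..1}" "\<And>y. y \<in> {0..1} \<Longrightarrow> f x \<le> f y"
    using continuous_attains_inf[OF compact_Icc _ cont] by auto
  have "integral {0..1::real} (\<lambda>_. f x) \<le> integral {0..1} f"
    by (rule Henstock_Kurzweil_Integration.integral_le) (use x cont in \<open>auto intro: integrable_continuous_interval\<close>)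
  then show ?thesis using x by auto
qed

text \<open>The point of comparison is one where the squared norm lies below its mean; the increment
  from there is an integral of the derivative. The factor 2 comes from squaring a sum of two
  terms.\<close>

lemma norm_square_le_H1:
  fixes f :: "real \<Rightarrow> 'a::banach"
  assumes f: "\<And>y. y \<in> {0..1} \<Longrightarrow> (f has_vector_derivative f' y) (at y within {0..1})"
    and cont: "continuous_on {0..1} f'"
    and y: "y \<in> {0..1}"
  shows "(norm (f y))\<^sup>2 \<le> 2 * integral {0..1} (\<lambda>y. (norm (f y))\<^sup>2)
    + 2 * integral {0..1} (\<lambda>y. (norm (f' y))\<^sup>2)"
proof -
  have "continuous_on {0..1} f" using f by (blast intro: continuous_on_vector_derivative)
  then obtain x where x: "x \<in> {0..1}" "(norm (f x))\<^sup>2 \<le> integral {0..1} (\<lambda>y. (norm (f y))\<^sup>2)"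
    using exists_le_integral[of "\<lambda>y. (norm (f y))\<^sup>2"]
    by (metis continuous_on_norm continuous_on_power)
  have "norm (f y) \<le> norm (f x) + norm (f y - f x)" by (metis add.commute norm_triangle_sub)
  then have "(norm (f y))\<^sup>2 \<le> (norm (f x) + norm (f y - f x))\<^sup>2" by (simp add: power_mono)
  also have "\<dots> \<le> 2 * (norm (f x))\<^sup>2 + 2 * (norm (f y - f x))\<^sup>2"
    using sum_squares_bound[of "norm (f x)" "norm (f y - f x)"] by (simp add: power2_sum)
  finally show ?thesis
    using x norm_diff_square_le_integral_derivative[OF f cont x(1) y] by linarith
qed

text \<open>Joint continuity is stated once per field; in this form it is an introduction rule for
  slices in \<open>y\<close>, slices in \<open>t\<close> and functions of the pair alike, since
  \<open>g\<close> and \<open>h\<close> are found by unification.\<close>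

lemma continuous_on_slices:
  assumes "continuous_on (A \<times> B) (\<lambda>(y, t). f y t)"
    and "continuous_on S g" "continuous_on S h"
    and "\<And>x. x \<in> S \<Longrightarrow> g x \<in> A" "\<And>x. x \<in> S \<Longrightarrow> h x \<in> B"
  shows "continuous_on S (\<lambda>x. f (g x) (h x))"
proof -
  have "continuous_on S (\<lambda>x. (\<lambda>(y, t). f y t) (g x, h x))"
    by (rule continuous_on_compose2[OF assms(1)]) (use assms in \<open>auto intro!: continuous_intros\<close>)
  then show ?thesis by simp
qed

lemma continuous_on_integral_param:
  fixes f :: "real \<Rightarrow> real \<Rightarrow> 'a::banach"
  assumes "continuous_on ({a..b} \<times> U) (\<lambda>(y, t). f y t)"
  shows "continuous_on U (\<lambda>t. integral {a..b} (\<lambda>y. f y t))"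
proof -
  have "continuous_on (U \<times> cbox a b) (\<lambda>(t, y). f y t)"
    unfolding case_prod_unfold
    by (rule continuous_on_slices[OF assms]) (auto intro!: continuous_intros)
  from integral_continuous_on_param[OF this] show ?thesis by simp
qed

lemma has_real_derivative_integral:
  fixes f :: "real \<Rightarrow> real \<Rightarrow> real"
  assumes "\<And>y t. y \<in> {a..b} \<Longrightarrow> t \<in> {c..d} \<Longrightarrow>
      ((\<lambda>s. f y s) has_real_derivative f' y t) (at t within {c..d})"
    and "\<And>t. t \<in> {c..d} \<Longrightarrow> continuous_on {a..b} (\<lambda>y. f y t)"
    and cont: "continuous_on ({a..b} \<times> {c..d}) (\<lambda>(y, t). f' y t)"
    and "t \<in> {c..d}"
  shows "((\<lambda>t. integral {a..b} (\<lambda>y. f y t)) has_real_derivative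
    integral {a..b} (\<lambda>y. f' y t)) (at t within {c..d})"
proof -
  have "continuous_on ({c..d} \<times> cbox a b) (\<lambda>(t, y). f' y t)"
    unfolding case_prod_unfold
    by (rule continuous_on_slices[OF cont]) (auto intro!: continuous_intros)
  then show ?thesis
    using leibniz_rule_field_derivative[of "{c..d}" a b "\<lambda>t y. f y t" "\<lambda>t y. f' y t" t] assms
    by (simp add: integrable_continuous_interval)
qed

text \<open>
  The integrand depends on a derivative \<open>P = z_y\<close> which need not be differentiable in time. Convexity bounds
  the backward increment in \<open>P\<close> by its linear part, and an integration by parts moves the derivative off \<open>z\<close>.
\<close>

lemma convex_functional_dini:
  fixes z z' P :: "real \<Rightarrow> real \<Rightarrow> 'p::euclidean_space"
    and \<Phi> \<Phi>' :: "real \<Rightarrow> real \<Rightarrow> 'p \<Rightarrow> real"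
  assumes t: "0 < t" "t \<le> T"
    and z: "\<And>y s. y \<in> {0..1} \<Longrightarrow> s \<in> {0..T} \<Longrightarrow>
      ((\<lambda>s. z y s) has_vector_derivative z' y s) (at s within {0..T})"
    and z': "continuous_on ({0..1} \<times> {0..T}) (\<lambda>(y, s). z' y s)"
    and zy: "\<And>y s. y \<in> {0..1} \<Longrightarrow> s \<in> {0..T} \<Longrightarrow>
      ((\<lambda>y. z y s) has_vector_derivative P y s) (at y within {0..1})"
    and P: "continuous_on ({0..1} \<times> {0..T}) (\<lambda>(y, s). P y s)"
    and \<Phi>: "\<And>y s p. y \<in> {0..1} \<Longrightarrow> s \<in> {0..T} \<Longrightarrow>
      ((\<lambda>s. \<Phi> y s p) has_real_derivative \<Phi>' y s p) (at s within {0..T})"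
    and \<Phi>': "continuous_on ({0..1} \<times> {0..T} \<times> UNIV) (\<lambda>(y, s, p). \<Phi>' y s p)"
    and \<Phi>_cont: "\<And>s. s \<in> {0..T} \<Longrightarrow> continuous_on {0..1} (\<lambda>y. \<Phi> y s (P y s))"
    and convex: "\<And>y p. y \<in> {0..1} \<Longrightarrow> \<Phi> y t (P y t) + M y \<bullet> (p - P y t) \<le> \<Phi> y t p"
    and M: "\<And>y. y \<in> {0..1} \<Longrightarrow> (M has_vector_derivative M' y) (at y within {0..1})"
    and M': "continuous_on {0..1} M'"
    and bdry: "\<And>y. y \<in> {0, 1} \<Longrightarrow> M y = 0 \<or> (\<forall>s\<in>{0..T}. z y s = 0)"
    and \<epsilon>: "0 < \<epsilon>"
  shows "\<exists>\<delta>>0. \<forall>h. 0 < h \<longrightarrow> h < \<delta> \<longrightarrow> h \<le> t \<longrightarrow>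
    integral {0..1} (\<lambda>y. \<Phi> y t (P y t)) - integral {0..1} (\<lambda>y. \<Phi> y (t - h) (P y (t - h)))
    \<le> h * (integral {0..1} (\<lambda>y. \<Phi>' y t (P y t) - M' y \<bullet> z' y t) + \<epsilon>)"
proof -
  define Q where "Q = {0..1::real} \<times> {0..T}"
  have "compact Q" unfolding Q_def by (intro compact_Times compact_Icc)
  have "compact ((\<lambda>(y, s). P y s) ` Q)"
    using P \<open>compact Q\<close> unfolding Q_def by (intro compact_continuous_image)
  then obtain B where B: "\<And>y s. (y, s) \<in> Q \<Longrightarrow> norm (P y s) \<le> B"
    by (force dest!: compact_imp_bounded simp: bounded_iff)
  have "compact (M' ` {0..1})" using M' by (intro compact_continuous_image compact_Icc)
  then obtain B' where B': "\<And>y. y \<in> {0..1} \<Longrightarrow> norm (M' y) \<le> B'"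
    by (force dest!: compact_imp_bounded simp: bounded_iff)
  then have "B' \<ge> 0" by (metis atLeastAtMost_iff norm_ge_zero order_trans order_refl zero_le_one)
  \<comment> \<open>\<open>\<Phi>'\<close> is continuous in an unbounded variable \<open>p\<close>;
    uniform continuity is needed only on a ball that contains all values of
    \<open>P\<close>.\<close>
  define K where "K = {0..1::real} \<times> {0..T} \<times> cball (0::'p) B"
  have "compact K" unfolding K_def by (intro compact_Times compact_Icc compact_cball)
  then have "uniformly_continuous_on K (\<lambda>(y, s, p). \<Phi>' y s p)"
    using \<Phi>' by (intro compact_uniformly_continuous) (auto simp: K_def intro: continuous_on_subset)
  then obtain d1 where d1: "d1 > 0" "\<And>x x'. x \<in> K \<Longrightarrow> x' \<in> K \<Longrightarrow> dist x' x < d1 \<Longrightarrow>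
      dist ((\<lambda>(y, s, p). \<Phi>' y s p) x') ((\<lambda>(y, s, p). \<Phi>' y s p) x) < \<epsilon>/2"
    unfolding uniformly_continuous_on_def using \<epsilon> by (metis half_gt_zero)
  have "uniformly_continuous_on Q (\<lambda>(y, s). P y s)"
    using P \<open>compact Q\<close> unfolding Q_def by (intro compact_uniformly_continuous)
  then obtain d2 where d2: "d2 > 0" "\<And>x x'. x \<in> Q \<Longrightarrow> x' \<in> Q \<Longrightarrow> dist x' x < d2 \<Longrightarrow>
      dist ((\<lambda>(y, s). P y s) x') ((\<lambda>(y, s). P y s) x) < d1/2"
    unfolding uniformly_continuous_on_def using d1(1) by (metis half_gt_zero)
  \<comment> \<open>\<open>e\<close> bounds the error in linearising \<open>z\<close> in time;
    paired with \<open>M'\<close>, whose norm is at most \<open>B'\<close>, this error costs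
    \<open>\<epsilon>/2\<close>. The summand 1 covers \<open>B' = 0\<close>.\<close>
  define e where "e = \<epsilon> / (2 * (1 + B'))"
  have e: "e > 0" "B' * e \<le> \<epsilon>/2" using \<epsilon> \<open>B' \<ge> 0\<close> by (auto simp: e_def field_simps)
  have "uniformly_continuous_on Q (\<lambda>(y, s). z' y s)"
    using z' \<open>compact Q\<close> unfolding Q_def by (intro compact_uniformly_continuous)
  then obtain d3 where d3: "d3 > 0" "\<And>x x'. x \<in> Q \<Longrightarrow> x' \<in> Q \<Longrightarrow> dist x' x < d3 \<Longrightarrow>
      dist ((\<lambda>(y, s). z' y s) x') ((\<lambda>(y, s). z' y s) x) < e"
    unfolding uniformly_continuous_on_def using e(1) by metis
  define \<delta> where "\<delta> = min (d1/2) (min d2 d3)"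
  have "\<delta> > 0" using d1 d2 d3 by (auto simp: \<delta>_def)
  moreover have "integral {0..1} (\<lambda>y. \<Phi> y t (P y t)) - integral {0..1} (\<lambda>y. \<Phi> y (t - h) (P y (t - h)))
    \<le> h * (integral {0..1} (\<lambda>y. \<Phi>' y t (P y t) - M' y \<bullet> z' y t) + \<epsilon>)"
    if h: "0 < h" "h < \<delta>" "h \<le> t" for h
  proof -
    have tt: "t \<in> {0..T}" "t - h \<in> {0..T}" using t h by auto
    have dM: "dist (P y s) (P y t) < d1/2" if "y \<in> {0..1}" "s \<in> {t-h..t}" for y s
      using d2(2)[of "(y, t)" "(y, s)"] that h tt
      by (auto simp: Q_def dist_Pair_Pair dist_real_def \<delta>_def)
    \<comment> \<open>The increment is split at the old value \<open>?p\<close>. The change of time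
      at frozen \<open>?p\<close> is a mean value of \<open>\<Phi>'\<close>; the change from
      \<open>?p\<close> to \<open>P y t\<close> at time \<open>t\<close> is bounded above by the
      tangent at the newer point, which is what convexity provides.\<close>
    have 1: "\<Phi> y t (P y t) - \<Phi> y (t - h) (P y (t - h))
      \<le> M y \<bullet> (P y t - P y (t - h)) + h * (\<Phi>' y t (P y t) + \<epsilon>/2)" if y: "y \<in> {0..1}" for y
    proof -
      let ?p = "P y (t - h)"
      have "\<exists>s\<in>{t-h<..<t}. \<Phi> y t ?p - \<Phi> y (t-h) ?p = \<Phi>' y s ?p * (t - (t-h))"
      proof (rule mvt_simple)
        fix s assume "t - h \<le> s" "s \<le> t"
        then show "((\<lambda>s. \<Phi> y s ?p) has_derivative (*) (\<Phi>' y s ?p)) (at s within {t-h..t})"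
          using has_field_derivative_subset[OF \<Phi>[OF y, of s ?p], of "{t-h..t}"] tt
          by (auto simp: has_field_derivative_def)
      qed (use h in auto)
      then obtain s where s: "s \<in> {t-h<..<t}" "\<Phi> y t ?p - \<Phi> y (t-h) ?p = h * \<Phi>' y s ?p"
        by (auto simp: mult.commute)
      have "dist (y, s, ?p) (y, t, P y t) \<le> dist s t + dist ?p (P y t)"
        by (simp add: dist_Pair_Pair sqrt_sum_squares_le_sum)
      also have "\<dots> < d1/2 + d1/2"
        using dM[OF y, of "t-h"] h s by (intro add_strict_mono) (auto simp: dist_real_def \<delta>_def)
      finally have "dist (\<Phi>' y s ?p) (\<Phi>' y t (P y t)) < \<epsilon>/2"
        using d1(2)[of "(y, t, P y t)" "(y, s, ?p)"] B[of y t] B[of y "t-h"] y s tt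
        by (auto simp: K_def Q_def)
      then have "\<Phi>' y s ?p \<le> \<Phi>' y t (P y t) + \<epsilon>/2" by (simp add: dist_real_def abs_if split: if_splits)
      with h have "h * \<Phi>' y s ?p \<le> h * (\<Phi>' y t (P y t) + \<epsilon>/2)" by simp
      moreover have "M y \<bullet> (P y t - ?p) = - (M y \<bullet> (?p - P y t))" by (simp add: inner_diff_right)
      ultimately show ?thesis using s(2) convex[OF y, of ?p] by linarith
    qed
    have ci: "continuous_on {0..1} (\<lambda>y. P y s)" "continuous_on {0..1} (\<lambda>y. z' y s)" if "s \<in> {0..T}" for s
      using that by (auto intro!: continuous_on_slices[OF P] continuous_on_slices[OF z'] continuous_intros)
    have cM: "continuous_on {0..1} M" by (rule continuous_on_vector_derivative[OF M])
    have cz: "continuous_on {0..1} (\<lambda>y. z y s)" if "s \<in> {0..T}" for s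
      by (rule continuous_on_vector_derivative[OF zy[OF _ that]])
    have c\<Phi>': "continuous_on {0..1} (\<lambda>y. \<Phi>' y t (P y t))"
    proof -
      have "continuous_on {0..1} (\<lambda>y. (\<lambda>(y, s, p). \<Phi>' y s p) (y, t, P y t))"
        by (rule continuous_on_compose2[OF \<Phi>'])
          (use tt in \<open>auto intro!: continuous_intros ci\<close>)
      then show ?thesis by simp
    qed
    note ic = integrable_continuous_interval continuous_intros ci cM cz c\<Phi>' M' \<Phi>_cont tt
    \<comment> \<open>The quotient of \<open>P y t - P y (t - h)\<close> by \<open>h\<close> need
      not converge. The integration by parts trades it for the quotient of \<open>z\<close>, which
      does.\<close>
    have 2: "integral {0..1} (\<lambda>y. M y \<bullet> (P y t - P y (t - h)))
      = - integral {0..1} (\<lambda>y. M' y \<bullet> (z y t - z y (t - h)))"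
    proof (rule integral_by_parts_inner[OF M _ M'])
      show "((\<lambda>y. z y t - z y (t-h)) has_vector_derivative P y t - P y (t-h)) (at y within {0..1})"
        if "y \<in> {0..1}" for y
        using zy that tt by (intro derivative_intros)
      show "continuous_on {0..1} (\<lambda>y. P y t - P y (t - h))" by (intro ic)
      show "M 1 \<bullet> (z 1 t - z 1 (t - h)) = M 0 \<bullet> (z 0 t - z 0 (t - h))"
        using bdry[of 0] bdry[of 1] tt by auto
    qed
    have 3: "- (M' y \<bullet> (z y t - z y (t - h))) \<le> h * (- (M' y \<bullet> z' y t) + \<epsilon>/2)" if y: "y \<in> {0..1}" for y
    proof -
      have "norm (z y t - z y (t-h) - (t - (t-h)) *\<^sub>R z' y t) \<le> norm (t - (t-h)) * e"
      proof (rule vector_differentiable_bound_linearization)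
        show "((\<lambda>s. z y s) has_vector_derivative z' y s) (at s within {t-h..t})" if "s \<in> {t-h..t}" for s
          using that tt by (intro has_vector_derivative_within_subset[OF z[OF y, of s]]) auto
        show "norm (z' y s - z' y t) \<le> e" if "s \<in> {t-h..t}" for s
          using d3(2)[of "(y, t)" "(y, s)"] that y h tt
          by (auto simp: Q_def dist_Pair_Pair dist_norm \<delta>_def less_imp_le)
      qed (use h in \<open>auto simp: closed_segment_eq_real_ivl\<close>)
      then have "norm (z y t - z y (t-h) - h *\<^sub>R z' y t) \<le> h * e" using h by simp
      moreover have "- (M' y \<bullet> (z y t - z y (t-h) - h *\<^sub>R z' y t))
        \<le> norm (M' y) * norm (z y t - z y (t-h) - h *\<^sub>R z' y t)"
        using Cauchy_Schwarz_ineq2 abs_le_D2 by blast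
      moreover have "norm (M' y) * norm (z y t - z y (t-h) - h *\<^sub>R z' y t) \<le> B' * (h * e)"
        using calculation(1) B'[OF y] \<open>B' \<ge> 0\<close> by (intro mult_mono) auto
      moreover have "B' * (h * e) \<le> h * (\<epsilon>/2)" using e(2) h by (simp add: mult.left_commute)
      ultimately show ?thesis by (simp add: inner_diff_right algebra_simps)
    qed
    have "integral {0..1} (\<lambda>y. \<Phi> y t (P y t)) - integral {0..1} (\<lambda>y. \<Phi> y (t - h) (P y (t - h)))
      = integral {0..1} (\<lambda>y. \<Phi> y t (P y t) - \<Phi> y (t - h) (P y (t - h)))"
      by (intro Henstock_Kurzweil_Integration.integral_diff[symmetric] ic)
    also have "\<dots> \<le> integral {0..1} (\<lambda>y. M y \<bullet> (P y t - P y (t - h)) + h * (\<Phi>' y t (P y t) + \<epsilon>/2))"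
      by (intro Henstock_Kurzweil_Integration.integral_le 1 ic)
    also have "\<dots> = integral {0..1} (\<lambda>y. M y \<bullet> (P y t - P y (t - h)))
        + integral {0..1} (\<lambda>y. h * (\<Phi>' y t (P y t) + \<epsilon>/2))"
      by (intro Henstock_Kurzweil_Integration.integral_add ic)
    also have "\<dots> = integral {0..1} (\<lambda>y. - (M' y \<bullet> (z y t - z y (t - h))))
        + integral {0..1} (\<lambda>y. h * (\<Phi>' y t (P y t) + \<epsilon>/2))"
      unfolding 2 by simp
    also have "\<dots> \<le> integral {0..1} (\<lambda>y. h * (- (M' y \<bullet> z' y t) + \<epsilon>/2))
        + integral {0..1} (\<lambda>y. h * (\<Phi>' y t (P y t) + \<epsilon>/2))"
      by (intro add_right_mono Henstock_Kurzweil_Integration.integral_le 3 ic)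
    also have "\<dots> = integral {0..1} (\<lambda>y. h * (- (M' y \<bullet> z' y t) + \<epsilon>/2) + h * (\<Phi>' y t (P y t) + \<epsilon>/2))"
      by (intro Henstock_Kurzweil_Integration.integral_add[symmetric] ic)
    also have "\<dots> = integral {0..1} (\<lambda>y. h * ((\<Phi>' y t (P y t) - M' y \<bullet> z' y t) + \<epsilon>))"
      by (intro arg_cong[where f="integral _"] ext) (simp add: algebra_simps)
    also have "\<dots> = h * (integral {0..1} (\<lambda>y. \<Phi>' y t (P y t) - M' y \<bullet> z' y t) + \<epsilon>)"
      by (subst integral_mult_right, subst Henstock_Kurzweil_Integration.integral_add)
        (auto intro!: ic)
    finally show ?thesis .
  qed
  ultimately show ?thesis by blast
qed

lemma has_real_derivative_inner:
  fixes f g :: "real \<Rightarrow> 'a::euclidean_space"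
  assumes "(f has_vector_derivative f') (at x within S)" "(g has_vector_derivative g') (at x within S)"
    and "D = f x \<bullet> g' + f' \<bullet> g x"
  shows "((\<lambda>x. f x \<bullet> g x) has_real_derivative D) (at x within S)"
  using bounded_bilinear.has_vector_derivative[OF bounded_bilinear_inner assms(1,2)] assms(3)
  by (simp add: has_real_derivative_iff_has_vector_derivative)

section \<open>Identities for one solution\<close>

text \<open>
  Subscripts denote derivatives. The equation \<open>v_t = u_y\<close> is part of the assumption on the time derivative of
  \<open>v\<close>; \<open>F\<close> is the heat flux, \<open>f\<close> the pressure including its magnetic part, and \<open>\<sigma>\<close>, \<open>\<zeta>\<close>, \<open>\<xi>\<close> are the fluxes
  of the three momentum and induction equations.
\<close>

locale mhd =
  fixes lam \<mu> \<nu> R a Cv T :: real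
    and v v_y u u_y u_t \<theta> \<theta>_y \<theta>_t F F_y f \<sigma> :: "real \<Rightarrow> real \<Rightarrow> real"
    and w w_y w_t b b_y b_t \<zeta> \<xi> :: "real \<Rightarrow> real \<Rightarrow> 'e::euclidean_space"
  assumes lam: "0 < lam" and \<mu>: "0 < \<mu>" and \<nu>: "0 < \<nu>" and R: "0 < R" and a: "0 < a"
    and Cv: "0 < Cv" and T: "0 < T"
    and v_pos: "y \<in> {0..1} \<Longrightarrow> t \<in> {0..T} \<Longrightarrow> 0 < v y t"
    and \<theta>_pos: "y \<in> {0..1} \<Longrightarrow> t \<in> {0..T} \<Longrightarrow> 0 < \<theta> y t"
    and f_eq: "f y t = R * \<theta> y t / v y t + a / 3 * \<theta> y t ^ 4 + b y t \<bullet> b y t / 2"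
    and \<sigma>_eq: "\<sigma> y t = lam * u_y y t / v y t - f y t"
    and \<zeta>_eq: "\<zeta> y t = b y t + (\<mu> / v y t) *\<^sub>R w_y y t"
    and \<xi>_eq: "\<xi> y t = w y t + (\<nu> / v y t) *\<^sub>R b_y y t"
    and v_Dy: "y \<in> {0..1} \<Longrightarrow> t \<in> {0..T} \<Longrightarrow> ((\<lambda>y. v y t) has_real_derivative v_y y t) (at y within {0..1})"
    and u_Dy: "y \<in> {0..1} \<Longrightarrow> t \<in> {0..T} \<Longrightarrow> ((\<lambda>y. u y t) has_real_derivative u_y y t) (at y within {0..1})"
    and \<theta>_Dy: "y \<in> {0..1} \<Longrightarrow> t \<in> {0..T} \<Longrightarrow> ((\<lambda>y. \<theta> y t) has_real_derivative \<theta>_y y t) (at y within {0..1})"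
    and w_Dy: "y \<in> {0..1} \<Longrightarrow> t \<in> {0..T} \<Longrightarrow> ((\<lambda>y. w y t) has_vector_derivative w_y y t) (at y within {0..1})"
    and b_Dy: "y \<in> {0..1} \<Longrightarrow> t \<in> {0..T} \<Longrightarrow> ((\<lambda>y. b y t) has_vector_derivative b_y y t) (at y within {0..1})"
    and v_Dt: "y \<in> {0..1} \<Longrightarrow> t \<in> {0..T} \<Longrightarrow> ((\<lambda>t. v y t) has_real_derivative u_y y t) (at t within {0..T})"
    and u_Dt: "y \<in> {0..1} \<Longrightarrow> t \<in> {0..T} \<Longrightarrow> ((\<lambda>t. u y t) has_real_derivative u_t y t) (at t within {0..T})"
    and \<theta>_Dt: "y \<in> {0..1} \<Longrightarrow> t \<in> {0..T} \<Longrightarrow> ((\<lambda>t. \<theta> y t) has_real_derivative \<theta>_t y t) (at t within {0..T})"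
    and w_Dt: "y \<in> {0..1} \<Longrightarrow> t \<in> {0..T} \<Longrightarrow> ((\<lambda>t. w y t) has_vector_derivative w_t y t) (at t within {0..T})"
    and b_Dt: "y \<in> {0..1} \<Longrightarrow> t \<in> {0..T} \<Longrightarrow> ((\<lambda>t. b y t) has_vector_derivative b_t y t) (at t within {0..T})"
    and \<sigma>_Dy: "y \<in> {0..1} \<Longrightarrow> t \<in> {0..T} \<Longrightarrow> ((\<lambda>y. \<sigma> y t) has_real_derivative u_t y t) (at y within {0..1})"
    and \<zeta>_Dy: "y \<in> {0..1} \<Longrightarrow> t \<in> {0..T} \<Longrightarrow> ((\<lambda>y. \<zeta> y t) has_vector_derivative w_t y t) (at y within {0..1})"
    and \<xi>_Dy: "y \<in> {0..1} \<Longrightarrow> t \<in> {0..T} \<Longrightarrow>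
      ((\<lambda>y. \<xi> y t) has_vector_derivative u_y y t *\<^sub>R b y t + v y t *\<^sub>R b_t y t) (at y within {0..1})"
    and F_Dy: "y \<in> {0..1} \<Longrightarrow> t \<in> {0..T} \<Longrightarrow> ((\<lambda>y. F y t) has_real_derivative F_y y t) (at y within {0..1})"
    and energy_eq: "y \<in> {0..1} \<Longrightarrow> t \<in> {0..T} \<Longrightarrow>
      (Cv + 4 * a * v y t * \<theta> y t ^ 3) * \<theta>_t y t + a * \<theta> y t ^ 4 * u_y y t
      = F_y y t + (lam * u_y y t / v y t - (R * \<theta> y t / v y t + a / 3 * \<theta> y t ^ 4)) * u_y y t
        + (\<mu> * (w_y y t \<bullet> w_y y t) + \<nu> * (b_y y t \<bullet> b_y y t)) / v y t"
    and cont_v: "continuous_on ({0..1} \<times> {0..T}) (\<lambda>(y, t). v y t)"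
    and cont_v_y: "continuous_on ({0..1} \<times> {0..T}) (\<lambda>(y, t). v_y y t)"
    and cont_u: "continuous_on ({0..1} \<times> {0..T}) (\<lambda>(y, t). u y t)"
    and cont_u_y: "continuous_on ({0..1} \<times> {0..T}) (\<lambda>(y, t). u_y y t)"
    and cont_u_t: "continuous_on ({0..1} \<times> {0..T}) (\<lambda>(y, t). u_t y t)"
    and cont_\<theta>: "continuous_on ({0..1} \<times> {0..T}) (\<lambda>(y, t). \<theta> y t)"
    and cont_\<theta>_y: "continuous_on ({0..1} \<times> {0..T}) (\<lambda>(y, t). \<theta>_y y t)"
    and cont_\<theta>_t: "continuous_on ({0..1} \<times> {0..T}) (\<lambda>(y, t). \<theta>_t y t)"
    and cont_w: "continuous_on ({0..1} \<times> {0..T}) (\<lambda>(y, t). w y t)"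
    and cont_w_y: "continuous_on ({0..1} \<times> {0..T}) (\<lambda>(y, t). w_y y t)"
    and cont_w_t: "continuous_on ({0..1} \<times> {0..T}) (\<lambda>(y, t). w_t y t)"
    and cont_b: "continuous_on ({0..1} \<times> {0..T}) (\<lambda>(y, t). b y t)"
    and cont_b_y: "continuous_on ({0..1} \<times> {0..T}) (\<lambda>(y, t). b_y y t)"
    and cont_b_t: "continuous_on ({0..1} \<times> {0..T}) (\<lambda>(y, t). b_t y t)"
    and cont_F: "continuous_on ({0..1} \<times> {0..T}) (\<lambda>(y, t). F y t)"
    and cont_F_y: "continuous_on ({0..1} \<times> {0..T}) (\<lambda>(y, t). F_y y t)"
    and boundary: "y = 0 \<or> y = 1 \<Longrightarrow> t \<in> {0..T} \<Longrightarrow> \<sigma> y t = 0 \<and> w y t = 0 \<and> b y t = 0 \<and> F y t = 0"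
begin

lemma v_nz [simp]: "y \<in> {0..1} \<Longrightarrow> t \<in> {0..T} \<Longrightarrow> v y t \<noteq> 0"
  and \<theta>_nz [simp]: "y \<in> {0..1} \<Longrightarrow> t \<in> {0..T} \<Longrightarrow> \<theta> y t \<noteq> 0"
  using v_pos[of y t] \<theta>_pos[of y t] by auto

lemmas cont_fields [continuous_intros] =
  continuous_on_slices[OF cont_v] continuous_on_slices[OF cont_v_y]
  continuous_on_slices[OF cont_u] continuous_on_slices[OF cont_u_y] continuous_on_slices[OF cont_u_t]
  continuous_on_slices[OF cont_\<theta>] continuous_on_slices[OF cont_\<theta>_y] continuous_on_slices[OF cont_\<theta>_t]
  continuous_on_slices[OF cont_w] continuous_on_slices[OF cont_w_y] continuous_on_slices[OF cont_w_t]
  continuous_on_slices[OF cont_b] continuous_on_slices[OF cont_b_y] continuous_on_slices[OF cont_b_t]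
  continuous_on_slices[OF cont_F] continuous_on_slices[OF cont_F_y]

lemma cont_f: "continuous_on ({0..1} \<times> {0..T}) (\<lambda>(y, t). f y t)"
  unfolding f_eq case_prod_unfold by (auto intro!: continuous_intros)

lemma cont_\<sigma>: "continuous_on ({0..1} \<times> {0..T}) (\<lambda>(y, t). \<sigma> y t)"
  unfolding \<sigma>_eq f_eq case_prod_unfold by (auto intro!: continuous_intros)

lemma cont_\<zeta>: "continuous_on ({0..1} \<times> {0..T}) (\<lambda>(y, t). \<zeta> y t)"
  unfolding \<zeta>_eq case_prod_unfold by (auto intro!: continuous_intros)

lemma cont_\<xi>: "continuous_on ({0..1} \<times> {0..T}) (\<lambda>(y, t). \<xi> y t)"
  unfolding \<xi>_eq case_prod_unfold by (auto intro!: continuous_intros)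

lemmas cont_fluxes [continuous_intros] =
  continuous_on_slices[OF cont_f] continuous_on_slices[OF cont_\<sigma>]
  continuous_on_slices[OF cont_\<zeta>] continuous_on_slices[OF cont_\<xi>]

section \<open>Balance laws for the energy, the kinetic energy, the entropy and the moments of the
  temperature\<close>

lemma Dt_integral:
  fixes g :: "real \<Rightarrow> real \<Rightarrow> real"
  assumes "\<And>y t. y \<in> {0..1} \<Longrightarrow> t \<in> {0..T} \<Longrightarrow> ((\<lambda>t. g y t) has_real_derivative g' y t) (at t within {0..T})"
    and "\<And>t. t \<in> {0..T} \<Longrightarrow> continuous_on {0..1} (\<lambda>y. g y t)"
    and "continuous_on ({0..1} \<times> {0..T}) (\<lambda>(y, t). g' y t)"
    and "t \<in> {0..T}"
  shows "integral {0..1} (\<lambda>y. g y t) = integral {0..1} (\<lambda>y. g y 0)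
    + integral {0..t} (\<lambda>s. integral {0..1} (\<lambda>y. g' y s))"
proof -
  have "((\<lambda>s. integral {0..1} (\<lambda>y. g' y s)) has_integral
    integral {0..1} (\<lambda>y. g y t) - integral {0..1} (\<lambda>y. g y 0)) {0..t}"
    by (rule has_integral_derivative_within[of "{0..T}"])
      (use assms in \<open>auto simp flip: has_real_derivative_iff_has_vector_derivative
         intro!: has_real_derivative_integral\<close>)
  then show ?thesis by (simp add: integral_unique)
qed

text \<open>Flux of mechanical and magnetic energy. Both \<open>w \<bullet> \<zeta>\<close> and
  \<open>b \<bullet> \<xi>\<close> contain the exchange term \<open>b \<bullet> w\<close>, so one
  copy is taken away.\<close>

definition flux where "flux y t = \<sigma> y t * u y t + w y t \<bullet> \<zeta> y t + b y t \<bullet> \<xi> y t - b y t \<bullet> w y t"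

lemma flux_Dy:
  assumes "y \<in> {0..1}" "t \<in> {0..T}"
  shows "((\<lambda>y. flux y t) has_real_derivative
     u y t * u_t y t + w y t \<bullet> w_t y t + u_y y t * (b y t \<bullet> b y t) / 2 + v y t * (b y t \<bullet> b_t y t)
     - (R * \<theta> y t / v y t + a / 3 * \<theta> y t ^ 4) * u_y y t
     + (lam * (u_y y t)\<^sup>2 + \<mu> * (w_y y t \<bullet> w_y y t) + \<nu> * (b_y y t \<bullet> b_y y t)) / v y t)
     (at y within {0..1})"
  unfolding flux_def
  by (rule derivative_eq_intros \<sigma>_Dy[OF assms] u_Dy[OF assms] refl
      has_real_derivative_inner[OF w_Dy[OF assms] \<zeta>_Dy[OF assms] refl]
      has_real_derivative_inner[OF b_Dy[OF assms] \<xi>_Dy[OF assms] refl]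
      has_real_derivative_inner[OF b_Dy[OF assms] w_Dy[OF assms] refl])+
    (simp add: \<sigma>_eq f_eq \<zeta>_eq \<xi>_eq inner_add_right inner_add_left inner_commute power2_eq_square
      algebra_simps add_divide_distrib)

lemma integral_flux_Dy:
  assumes t: "t \<in> {0..T}"
  shows "integral {0..1} (\<lambda>y. u y t * u_t y t + w y t \<bullet> w_t y t + u_y y t * (b y t \<bullet> b y t) / 2
     + v y t * (b y t \<bullet> b_t y t) - (R * \<theta> y t / v y t + a / 3 * \<theta> y t ^ 4) * u_y y t
     + (lam * (u_y y t)\<^sup>2 + \<mu> * (w_y y t \<bullet> w_y y t) + \<nu> * (b_y y t \<bullet> b_y y t)) / v y t) = 0"
  using integral_derivative_eq[OF flux_Dy[OF _ t, unfolded has_real_derivative_iff_has_vector_derivative], of 1]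
    boundary[of 0 t] boundary[of 1 t] t
  by (simp add: flux_def)

definition energy where "energy t = integral {0..1} (\<lambda>y. Cv * \<theta> y t + a * v y t * \<theta> y t ^ 4
   + (u y t)\<^sup>2 / 2 + w y t \<bullet> w y t / 2 + v y t * (b y t \<bullet> b y t) / 2)"

text \<open>By the energy equation the time derivative of the density is the space derivative of
  \<open>F + flux\<close>, which vanishes at both ends.\<close>

lemma energy_conserved:
  assumes t: "t \<in> {0..T}"
  shows "energy t = energy 0"
proof -
  let ?g = "\<lambda>y t. Cv * \<theta>_t y t + a * (u_y y t * \<theta> y t ^ 4 + v y t * (4 * \<theta> y t ^ 3 * \<theta>_t y t))
    + u y t * u_t y t + w y t \<bullet> w_t y t + (u_y y t * (b y t \<bullet> b y t) / 2 + v y t * (b y t \<bullet> b_t y t))"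
  have "energy t = energy 0 + integral {0..t} (\<lambda>s. integral {0..1} (\<lambda>y. ?g y s))"
    unfolding energy_def
  proof (rule Dt_integral[OF _ _ _ t])
    fix y t :: real assume y: "y \<in> {0..1}" and t: "t \<in> {0..T}"
    show "((\<lambda>t. Cv * \<theta> y t + a * v y t * \<theta> y t ^ 4
      + (u y t)\<^sup>2 / 2 + w y t \<bullet> w y t / 2 + v y t * (b y t \<bullet> b y t) / 2) has_real_derivative ?g y t)
      (at t within {0..T})"
      by (rule derivative_eq_intros \<theta>_Dt[OF y t] v_Dt[OF y t] u_Dt[OF y t] refl numeral_neq_zero
          has_real_derivative_inner[OF w_Dt[OF y t] w_Dt[OF y t] refl]
          has_real_derivative_inner[OF b_Dt[OF y t] b_Dt[OF y t] refl])+
        (simp add: inner_commute algebra_simps)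
  qed (auto intro!: continuous_intros simp: case_prod_unfold)
  moreover have "integral {0..1} (\<lambda>y. ?g y s) = 0" if s: "s \<in> {0..T}" for s
  proof -
    let ?J = "\<lambda>y. F y s + flux y s"
    have "(?J has_real_derivative ?g y s) (at y within {0..1})" if y: "y \<in> {0..1}" for y
    proof (rule DERIV_cong[OF DERIV_add[OF F_Dy[OF y s] flux_Dy[OF y s]]])
      have "(Cv + 4 * a * v y s * \<theta> y s ^ 3) * \<theta>_t y s + a * \<theta> y s ^ 4 * u_y y s
        = F_y y s + (lam * u_y y s / v y s - (R * \<theta> y s / v y s + a / 3 * \<theta> y s ^ 4)) * u_y y s
        + (\<mu> * (w_y y s \<bullet> w_y y s) + \<nu> * (b_y y s \<bullet> b_y y s)) / v y s"
        by (rule energy_eq[OF y s])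
      then show "F_y y s + (u y s * u_t y s + w y s \<bullet> w_t y s + u_y y s * (b y s \<bullet> b y s) / 2 + v y s * (b y s \<bullet> b_t y s)
     - (R * \<theta> y s / v y s + a / 3 * \<theta> y s ^ 4) * u_y y s
     + (lam * (u_y y s)\<^sup>2 + \<mu> * (w_y y s \<bullet> w_y y s) + \<nu> * (b_y y s \<bullet> b_y y s)) / v y s) = ?g y s"
        by (simp add: power2_eq_square algebra_simps add_divide_distrib)
    qed
    from integral_derivative_eq[OF this[unfolded has_real_derivative_iff_has_vector_derivative], of 1]
    show ?thesis
      using boundary[of 0 s] boundary[of 1 s] s by (simp add: flux_def)
  qed
  then have "integral {0..t} (\<lambda>s. integral {0..1} (\<lambda>y. ?g y s)) = integral {0..t} (\<lambda>s. 0)"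
    using t by (intro Henstock_Kurzweil_Integration.integral_cong) auto
  ultimately show ?thesis by simp
qed

definition kinetic where "kinetic t = integral {0..1} (\<lambda>y. (u y t)\<^sup>2 / 2 + w y t \<bullet> w y t / 2
   + v y t * (b y t \<bullet> b y t) / 2)"

text \<open>The balance of \<open>flux\<close> without the heat flux: what is not a space derivative
  is the work of the pressure minus the viscous and resistive dissipation. It is the source of the
  space-time bound on the gradients.\<close>

lemma kinetic_eq:
  assumes t: "t \<in> {0..T}"
  shows "kinetic t = kinetic 0 + integral {0..t} (\<lambda>s. integral {0..1} (\<lambda>y.
    (R * \<theta> y s / v y s + a / 3 * \<theta> y s ^ 4) * u_y y s
     - (lam * (u_y y s)\<^sup>2 + \<mu> * (w_y y s \<bullet> w_y y s) + \<nu> * (b_y y s \<bullet> b_y y s)) / v y s))"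
proof -
  let ?g = "\<lambda>y t. u y t * u_t y t + w y t \<bullet> w_t y t
    + (u_y y t * (b y t \<bullet> b y t) / 2 + v y t * (b y t \<bullet> b_t y t))"
  let ?h = "\<lambda>y s. (R * \<theta> y s / v y s + a / 3 * \<theta> y s ^ 4) * u_y y s
     - (lam * (u_y y s)\<^sup>2 + \<mu> * (w_y y s \<bullet> w_y y s) + \<nu> * (b_y y s \<bullet> b_y y s)) / v y s"
  have "kinetic t = kinetic 0 + integral {0..t} (\<lambda>s. integral {0..1} (\<lambda>y. ?g y s))"
    unfolding kinetic_def
  proof (rule Dt_integral[OF _ _ _ t])
    fix y t :: real assume y: "y \<in> {0..1}" and t: "t \<in> {0..T}"
    show "((\<lambda>t. (u y t)\<^sup>2 / 2 + w y t \<bullet> w y t / 2 + v y t * (b y t \<bullet> b y t) / 2) has_real_derivative ?g y t)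
      (at t within {0..T})"
      by (rule derivative_eq_intros v_Dt[OF y t] u_Dt[OF y t] refl numeral_neq_zero
          has_real_derivative_inner[OF w_Dt[OF y t] w_Dt[OF y t] refl]
          has_real_derivative_inner[OF b_Dt[OF y t] b_Dt[OF y t] refl])+
        (simp add: inner_commute algebra_simps)
  qed (auto intro!: continuous_intros simp: case_prod_unfold)
  also have "integral {0..t} (\<lambda>s. integral {0..1} (\<lambda>y. ?g y s))
    = integral {0..t} (\<lambda>s. integral {0..1} (\<lambda>y. ?h y s))"
  proof (rule Henstock_Kurzweil_Integration.integral_cong)
    fix s assume "s \<in> {0..t}"
    then have s: "s \<in> {0..T}" using t by auto
    have "integral {0..1} (\<lambda>y. ?g y s) - integral {0..1} (\<lambda>y. ?h y s)
      = integral {0..1} (\<lambda>y. ?g y s - ?h y s)"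
      using s by (intro Henstock_Kurzweil_Integration.integral_diff[symmetric] integrable_continuous_interval)
        (auto intro!: continuous_intros)
    also have "\<dots> = 0"
      using integral_flux_Dy[OF s] by (simp add: algebra_simps)
    finally show "integral {0..1} (\<lambda>y. ?g y s) = integral {0..1} (\<lambda>y. ?h y s)" by simp
  qed
  finally show ?thesis .
qed

text \<open>The specific entropy that belongs to the laws for pressure and energy:
  \<open>\<theta>\<close> times the time derivative of its density is the time derivative of the
  internal energy plus the pressure times \<open>u_y\<close>. The last summand is the entropy of
  radiation.\<close>

definition entropy where "entropy t = integral {0..1} (\<lambda>y. Cv * ln (\<theta> y t) + R * ln (v y t)
  + 4 / 3 * a * v y t * \<theta> y t ^ 3)"

definition dissipation where "dissipation t = integral {0..1} (\<lambda>y. F y t * \<theta>_y y t / (\<theta> y t)\<^sup>2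
  + (lam * (u_y y t)\<^sup>2 + \<mu> * (w_y y t \<bullet> w_y y t) + \<nu> * (b_y y t \<bullet> b_y y t)) / (v y t * \<theta> y t))"

text \<open>The energy equation is divided by \<open>\<theta>\<close>, and
  \<open>F_y / \<theta>\<close> is integrated by parts, where the boundary terms vanish with
  \<open>F\<close>. All terms of \<open>dissipation\<close> have a sign as soon as
  \<open>F * \<theta>_y\<close> has one.\<close>

lemma entropy_eq:
  assumes t: "t \<in> {0..T}"
  shows "entropy t = entropy 0 + integral {0..t} dissipation"
proof -
  let ?g = "\<lambda>y t. Cv * \<theta>_t y t / \<theta> y t + R * u_y y t / v y t
    + 4 / 3 * a * (u_y y t * \<theta> y t ^ 3 + v y t * (3 * (\<theta> y t)\<^sup>2 * \<theta>_t y t))"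
  let ?q = "\<lambda>y t. (lam * (u_y y t)\<^sup>2 + \<mu> * (w_y y t \<bullet> w_y y t) + \<nu> * (b_y y t \<bullet> b_y y t)) / (v y t * \<theta> y t)"
  have "entropy t = entropy 0 + integral {0..t} (\<lambda>s. integral {0..1} (\<lambda>y. ?g y s))"
    unfolding entropy_def
  proof (rule Dt_integral[OF _ _ _ t])
    fix y t :: real assume y: "y \<in> {0..1}" and t: "t \<in> {0..T}"
    show "((\<lambda>t. Cv * ln (\<theta> y t) + R * ln (v y t) + 4 / 3 * a * v y t * \<theta> y t ^ 3) has_real_derivative ?g y t)
      (at t within {0..T})"
      by (rule derivative_eq_intros \<theta>_Dt[OF y t] v_Dt[OF y t] refl v_pos[OF y t] \<theta>_pos[OF y t])+
        (simp add: algebra_simps)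
  qed (auto intro!: continuous_intros simp: case_prod_unfold)
  also have "integral {0..t} (\<lambda>s. integral {0..1} (\<lambda>y. ?g y s)) = integral {0..t} dissipation"
  proof (rule Henstock_Kurzweil_Integration.integral_cong)
    fix s assume "s \<in> {0..t}"
    then have s: "s \<in> {0..T}" using t by auto
    have "?g y s = (1 / \<theta> y s) * F_y y s + ?q y s" if y: "y \<in> {0..1}" for y
    proof -
      have "\<theta> y s * ?g y s = (Cv + 4 * a * v y s * \<theta> y s ^ 3) * \<theta>_t y s + a * \<theta> y s ^ 4 * u_y y s
        + (R * \<theta> y s / v y s + a / 3 * \<theta> y s ^ 4) * u_y y s"
        using y s by (simp add: field_simps power3_eq_cube power2_eq_square power4_eq_xxxx)
      also have "\<dots> = F_y y s + \<theta> y s * ?q y s"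
        unfolding energy_eq[OF y s] using y s
        by (simp add: field_simps power2_eq_square)
      finally have "?g y s = (F_y y s + \<theta> y s * ?q y s) / \<theta> y s"
        using y s by (simp add: eq_divide_eq mult.commute)
      then show ?thesis using y s by (simp add: add_divide_distrib)
    qed
    then have "integral {0..1} (\<lambda>y. ?g y s) = integral {0..1} (\<lambda>y. (1 / \<theta> y s) * F_y y s + ?q y s)"
      by (rule Henstock_Kurzweil_Integration.integral_cong)
    also have "\<dots> = integral {0..1} (\<lambda>y. (1 / \<theta> y s) * F_y y s) + integral {0..1} (\<lambda>y. ?q y s)"
      using s by (intro Henstock_Kurzweil_Integration.integral_add integrable_continuous_interval)
        (auto intro!: continuous_intros)
    also have "integral {0..1} (\<lambda>y. (1 / \<theta> y s) * F_y y s)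
      = - integral {0..1} (\<lambda>y. (- (\<theta>_y y s / (\<theta> y s)\<^sup>2)) * F y s)"
    proof (rule integral_by_parts_real)
      show "((\<lambda>y. 1 / \<theta> y s) has_real_derivative - (\<theta>_y y s / (\<theta> y s)\<^sup>2)) (at y within {0..1})"
        if y: "y \<in> {0..1}" for y
        using \<theta>_nz[OF y s]
        by - (rule derivative_eq_intros \<theta>_Dy[OF y s] refl | simp add: power2_eq_square)+
    qed (use s boundary[of 0 s] boundary[of 1 s] F_Dy in \<open>auto intro!: continuous_intros\<close>)
    also have "\<dots> = integral {0..1} (\<lambda>y. F y s * \<theta>_y y s / (\<theta> y s)\<^sup>2)"
      by (simp add: mult.commute)
    also have "integral {0..1} (\<lambda>y. F y s * \<theta>_y y s / (\<theta> y s)\<^sup>2) + integral {0..1} (\<lambda>y. ?q y s)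
      = dissipation s"
      unfolding dissipation_def
      using s by (intro Henstock_Kurzweil_Integration.integral_add[symmetric] integrable_continuous_interval)
        (auto intro!: continuous_intros)
    finally show "integral {0..1} (\<lambda>y. ?g y s) = dissipation s" .
  qed
  finally show ?thesis .
qed

text \<open>The weights make the time derivative of the density equal to \<open>\<theta>^k\<close>
  times the \<open>\<theta>_t\<close> part of the energy equation, up to a term in
  \<open>u_y\<close>. Comparing the factor \<open>4 a / (k + 4)\<close> of that term with the factor
  \<open>a\<close> in the energy equation gives the coefficient \<open>- a k / (k + 4)\<close> in
  \<open>moment_eq\<close>.\<close>

definition moment where "moment k t = integral {0..1} (\<lambda>y. Cv / real (k + 1) * \<theta> y t ^ (k + 1)
  + 4 * a / real (k + 4) * v y t * \<theta> y t ^ (k + 4))"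

lemma moment_eq:
  assumes t: "t \<in> {0..T}"
  shows "moment k t = moment k 0 + integral {0..t} (\<lambda>s. integral {0..1} (\<lambda>y.
    \<theta> y s ^ k * ((lam * u_y y s / v y s - (R * \<theta> y s / v y s + a / 3 * \<theta> y s ^ 4)) * u_y y s
        + (\<mu> * (w_y y s \<bullet> w_y y s) + \<nu> * (b_y y s \<bullet> b_y y s)) / v y s)
    - a * real k / real (k + 4) * \<theta> y s ^ (k + 4) * u_y y s
    - real k * (\<theta> y s ^ (k - 1) * (F y s * \<theta>_y y s))))"
proof -
  let ?g = "\<lambda>y t. Cv * (\<theta>_t y t * \<theta> y t ^ k)
    + 4 * a / real (k + 4) * (u_y y t * \<theta> y t ^ (k + 4) + v y t * (real (k + 4) * (\<theta>_t y t * \<theta> y t ^ (k + 3))))"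
  let ?S = "\<lambda>y s. (lam * u_y y s / v y s - (R * \<theta> y s / v y s + a / 3 * \<theta> y s ^ 4)) * u_y y s
        + (\<mu> * (w_y y s \<bullet> w_y y s) + \<nu> * (b_y y s \<bullet> b_y y s)) / v y s"
  let ?r = "\<lambda>y s. \<theta> y s ^ k * ?S y s - a * real k / real (k + 4) * \<theta> y s ^ (k + 4) * u_y y s"
  let ?h = "\<lambda>y s. ?r y s - real k * (\<theta> y s ^ (k - 1) * (F y s * \<theta>_y y s))"
  have "moment k t = moment k 0 + integral {0..t} (\<lambda>s. integral {0..1} (\<lambda>y. ?g y s))"
    unfolding moment_def
  proof (rule Dt_integral[OF _ _ _ t])
    fix y t :: real assume y: "y \<in> {0..1}" and t: "t \<in> {0..T}"
    have exps: "k + 1 - Suc 0 = k" "k + 4 - Suc 0 = k + 3" by auto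
    have nz: "Cv / real (k + 1) * (real (k + 1) * x) = Cv * x" for x by simp
    show "((\<lambda>t. Cv / real (k + 1) * \<theta> y t ^ (k + 1) + 4 * a / real (k + 4) * v y t * \<theta> y t ^ (k + 4))
      has_real_derivative ?g y t) (at t within {0..T})"
      by (rule derivative_eq_intros \<theta>_Dt[OF y t] v_Dt[OF y t] refl)+
        (unfold exps, use nz[of "\<theta>_t y t * \<theta> y t ^ k"] in \<open>simp add: mult_ac distrib_left\<close>)
  qed (auto intro!: continuous_intros simp: case_prod_unfold)
  also have "integral {0..t} (\<lambda>s. integral {0..1} (\<lambda>y. ?g y s))
    = integral {0..t} (\<lambda>s. integral {0..1} (\<lambda>y. ?h y s))"
  proof (rule Henstock_Kurzweil_Integration.integral_cong)
    fix s assume "s \<in> {0..t}"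
    then have s: "s \<in> {0..T}" using t by auto
    note ci = integrable_continuous_interval continuous_intros
    have "?g y s = \<theta> y s ^ k * F_y y s + ?r y s" if y: "y \<in> {0..1}" for y
    proof -
      have "?g y s = \<theta> y s ^ k * ((Cv + 4 * a * v y s * \<theta> y s ^ 3) * \<theta>_t y s + a * \<theta> y s ^ 4 * u_y y s)
         - a * real k / real (k + 4) * \<theta> y s ^ (k + 4) * u_y y s"
        by (simp add: field_simps power_add)
      then show ?thesis unfolding energy_eq[OF y s] by (simp add: algebra_simps)
    qed
    then have "integral {0..1} (\<lambda>y. ?g y s) = integral {0..1} (\<lambda>y. \<theta> y s ^ k * F_y y s + ?r y s)"
      by (rule Henstock_Kurzweil_Integration.integral_cong)
    also have "\<dots> = integral {0..1} (\<lambda>y. \<theta> y s ^ k * F_y y s) + integral {0..1} (\<lambda>y. ?r y s)"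
      using s by (intro Henstock_Kurzweil_Integration.integral_add ci) auto
    also have "integral {0..1} (\<lambda>y. \<theta> y s ^ k * F_y y s)
      = - integral {0..1} (\<lambda>y. (real k * (\<theta>_y y s * \<theta> y s ^ (k - 1))) * F y s)"
    proof (rule integral_by_parts_real)
      show "((\<lambda>y. \<theta> y s ^ k) has_real_derivative real k * (\<theta>_y y s * \<theta> y s ^ (k - 1))) (at y within {0..1})"
        if y: "y \<in> {0..1}" for y
        by (rule DERIV_cong[OF DERIV_power[OF \<theta>_Dy[OF y s]]]) simp
    qed (use s boundary[of 0 s] boundary[of 1 s] F_Dy in \<open>auto intro!: continuous_intros\<close>)
    also have "\<dots> + integral {0..1} (\<lambda>y. ?r y s)
      = integral {0..1} (\<lambda>y. ?r y s) - integral {0..1} (\<lambda>y. real k * (\<theta> y s ^ (k - 1) * (F y s * \<theta>_y y s)))"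
      by (simp add: mult_ac)
    also have "\<dots> = integral {0..1} (\<lambda>y. ?h y s)"
      using s by (intro Henstock_Kurzweil_Integration.integral_diff[symmetric] ci) auto
    finally show "integral {0..1} (\<lambda>y. ?g y s) = integral {0..1} (\<lambda>y. ?h y s)" .
  qed
  finally show ?thesis .
qed

section \<open>The specific volume and its space derivative\<close>

definition logvol where "logvol y t = lam * ln (v y t) - integral {0..y} (\<lambda>x. u x t)"

text \<open>The momentum equation integrated from the end \<open>y = 0\<close>, where
  \<open>\<sigma>\<close> vanishes, shows that the integral of \<open>u\<close> has time derivative
  \<open>\<sigma>\<close>; subtracted from \<open>lam * u_y / v\<close> this leaves
  \<open>f\<close>.\<close>

lemma logvol_Dt:
  assumes y: "y \<in> {0..1}" and t: "t \<in> {0..T}"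
  shows "((\<lambda>t. logvol y t) has_real_derivative f y t) (at t within {0..T})"
proof -
  have "((\<lambda>t. integral {0..y} (\<lambda>x. u x t)) has_real_derivative integral {0..y} (\<lambda>x. u_t x t)) (at t within {0..T})"
    by (rule has_real_derivative_integral)
      (use y t in \<open>auto intro!: u_Dt continuous_intros simp: case_prod_unfold\<close>)
  moreover have "integral {0..y} (\<lambda>x. u_t x t) = \<sigma> y t"
    using integral_derivative_eq[OF \<sigma>_Dy[OF _ t, unfolded has_real_derivative_iff_has_vector_derivative] y]
      boundary[of 0 t] t by simp
  ultimately have *: "((\<lambda>t. integral {0..y} (\<lambda>x. u x t)) has_real_derivative \<sigma> y t) (at t within {0..T})" by simp
  show ?thesis unfolding logvol_def
    by (rule derivative_eq_intros v_Dt[OF y t] v_pos[OF y t] * refl)+ (simp add: \<sigma>_eq)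
qed

lemma logvol_eq:
  assumes y: "y \<in> {0..1}" and t: "t \<in> {0..T}"
  shows "logvol y t = logvol y 0 + integral {0..t} (\<lambda>s. f y s)"
  using has_integral_derivative_within[OF logvol_Dt[OF y, unfolded has_real_derivative_iff_has_vector_derivative], of 0 t] t
  by (simp add: integral_unique)

text \<open>This is the derivative of \<open>logvol\<close> in space, hence its time derivative contains no derivative of \<open>u\<close>.\<close>

definition n where "n y t = lam * v_y y t / v y t - u y t"

definition f_y where "f_y y t = (R / v y t + 4 * a / 3 * \<theta> y t ^ 3) * \<theta>_y y t
  - R * \<theta> y t * v_y y t / (v y t)\<^sup>2 + b y t \<bullet> b_y y t"

lemma cont_n: "continuous_on ({0..1} \<times> {0..T}) (\<lambda>(y, t). n y t)"
  unfolding n_def case_prod_unfold by (auto intro!: continuous_intros)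

lemma cont_f_y: "continuous_on ({0..1} \<times> {0..T}) (\<lambda>(y, t). f_y y t)"
  unfolding f_y_def case_prod_unfold by (auto intro!: continuous_intros)

lemmas cont_n_f_y [continuous_intros] = continuous_on_slices[OF cont_n] continuous_on_slices[OF cont_f_y]

lemma f_Dy:
  assumes y: "y \<in> {0..1}" and t: "t \<in> {0..T}"
  shows "((\<lambda>y. f y t) has_real_derivative f_y y t) (at y within {0..1})"
  unfolding f_eq f_y_def
  by (rule derivative_eq_intros \<theta>_Dy[OF y t] v_Dy[OF y t] v_nz[OF y t] refl numeral_neq_zero
      has_real_derivative_inner[OF b_Dy[OF y t] b_Dy[OF y t] refl])+
    (use v_nz[OF y t] in \<open>simp add: inner_commute field_simps power2_eq_square\<close>)

lemma logvol_Dy: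
  assumes y: "y \<in> {0..1}" and t: "t \<in> {0..T}"
  shows "((\<lambda>y. logvol y t) has_real_derivative n y t) (at y within {0..1})"
proof -
  have "continuous_on {0..1} (\<lambda>x. u x t)" using t by (auto intro!: continuous_intros)
  note integral_has_real_derivative[OF this y]
  then show ?thesis unfolding logvol_def n_def
    by - (rule derivative_eq_intros v_Dy[OF y t] v_pos[OF y t] refl | assumption | simp)+
qed

lemma n_eq:
  assumes y: "y \<in> {0..1}" and t: "t \<in> {0..T}"
  shows "n y t = n y 0 + integral {0..t} (\<lambda>s. f_y y s)"
proof -
  have 0: "0 \<in> {0..T}" using T by auto
  have "((\<lambda>y. integral {0..t} (\<lambda>s. f y s)) has_real_derivative integral {0..t} (\<lambda>s. f_y y s)) (at y within {0..1})"
    by (rule has_real_derivative_integral[of 0 t 0 1 "\<lambda>s y. f y s" "\<lambda>s y. f_y y s"])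
      (use y t in \<open>auto intro!: f_Dy continuous_on_slices[OF cont_f] continuous_on_slices[OF cont_f_y]
         continuous_on_fst continuous_on_snd continuous_on_id simp: case_prod_unfold\<close>)
  then have "((\<lambda>y. logvol y 0 + integral {0..t} (\<lambda>s. f y s)) has_real_derivative
    n y 0 + integral {0..t} (\<lambda>s. f_y y s)) (at y within {0..1})"
    by (rule DERIV_add[OF logvol_Dy[OF y 0]])
  then have "((\<lambda>y. logvol y t) has_real_derivative n y 0 + integral {0..t} (\<lambda>s. f_y y s)) (at y within {0..1})"
    by (rule has_field_derivative_transform_within[of _ _ _ _ 1]) (use y logvol_eq[OF _ t, symmetric] in auto)
  then show ?thesis
    using vector_derivative_unique_within_closed_interval[of 0 1 y "\<lambda>y. logvol y t" "n y t"] logvol_Dy[OF y t] y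
    by (simp add: has_real_derivative_iff_has_vector_derivative)
qed

lemma n_Dt:
  assumes y: "y \<in> {0..1}" and t: "t \<in> {0..T}"
  shows "((\<lambda>t. n y t) has_real_derivative f_y y t) (at t within {0..T})"
proof -
  have "continuous_on {0..T} (\<lambda>s. f_y y s)" using y by (auto intro!: continuous_intros)
  note integral_has_real_derivative[OF this t]
  then have "((\<lambda>t. n y 0 + integral {0..t} (\<lambda>s. f_y y s)) has_real_derivative f_y y t) (at t within {0..T})"
    by - (rule derivative_eq_intros refl | assumption | simp)+
  then show ?thesis
    by (rule has_field_derivative_transform_within[of _ _ _ _ 1]) (use y t n_eq[OF y, symmetric] in auto)
qed

lemma n_square_eq:
  assumes t: "t \<in> {0..T}"
  shows "integral {0..1} (\<lambda>y. (n y t)\<^sup>2) = integral {0..1} (\<lambda>y. (n y 0)\<^sup>2)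
    + integral {0..t} (\<lambda>s. integral {0..1} (\<lambda>y. 2 * n y s * f_y y s))"
proof (rule Dt_integral[OF _ _ _ t])
  fix y t :: real assume y: "y \<in> {0..1}" and t: "t \<in> {0..T}"
  show "((\<lambda>t. (n y t)\<^sup>2) has_real_derivative 2 * n y t * f_y y t) (at t within {0..T})"
    by (rule derivative_eq_intros n_Dt[OF y t] refl)+ simp
qed (auto intro!: continuous_intros simp: case_prod_unfold)

end

section \<open>The corrected stress functional\<close>

text \<open>
  The correction to \<open>v \<sigma>\<^sup>2 / 2\<close> behaves like \<open>c \<theta> \<sigma>\<close> for \<open>\<sigma>\<close> large compared with \<open>1 + \<theta>\<close>, is cubic in \<open>\<sigma>\<close> for small
  \<open>\<sigma>\<close>, and keeps the density convex in \<open>\<sigma>\<close> when \<open>L\<close> is large.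
\<close>

definition psi :: "real \<Rightarrow> real \<Rightarrow> real \<Rightarrow> real \<Rightarrow> real \<Rightarrow> real" where
  "psi L c v \<sigma> \<theta> = v * \<sigma>\<^sup>2 / 2 + c * (\<theta> * \<sigma> - \<theta> * (L * (1 + \<theta>)) * arctan (\<sigma> / (L * (1 + \<theta>))))"

text \<open>Partial derivative of \<open>psi\<close> in \<open>\<sigma>\<close>: with
  \<open>l = L * (1 + \<theta>)\<close>, the function
  \<open>\<sigma> - l * arctan (\<sigma> / l)\<close> is the primitive of
  \<open>1 - 1 / (1 + (\<sigma> / l)^2)\<close> that vanishes at 0. \<open>psi_\<theta>\<close> is
  the partial derivative in \<open>\<theta>\<close>, which also acts through
  \<open>l\<close>.\<close>

definition psi_\<sigma> :: "real \<Rightarrow> real \<Rightarrow> real \<Rightarrow> real \<Rightarrow> real \<Rightarrow> real" where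
  "psi_\<sigma> L c v \<sigma> \<theta> = v * \<sigma> + c * \<theta> * (1 - 1 / (1 + (\<sigma> / (L * (1 + \<theta>)))\<^sup>2))"

definition psi_\<theta> :: "real \<Rightarrow> real \<Rightarrow> real \<Rightarrow> real \<Rightarrow> real" where
  "psi_\<theta> L c \<sigma> \<theta> = c * (\<sigma> - (L * (1 + \<theta>) + L * \<theta>) * arctan (\<sigma> / (L * (1 + \<theta>)))
    + L * \<theta> * (\<sigma> / (L * (1 + \<theta>))) / (1 + (\<sigma> / (L * (1 + \<theta>)))\<^sup>2))"

lemma one_plus_square_nz [simp]: "1 + x\<^sup>2 \<noteq> (0::real)"
  by (metis add_pos_nonneg less_irrefl zero_le_power2 zero_less_one)

lemma inverse_one_plus_square_derivative:
  "((\<lambda>s. 1 / (1 + s\<^sup>2)) has_real_derivative - (2 * s / (1 + s\<^sup>2)\<^sup>2)) (at (s::real) within S)"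
proof -
  have "((\<lambda>s. 1 + s\<^sup>2) has_real_derivative 2 * s) (at s within S)"
    by (rule derivative_eq_intros refl)+ simp
  from DERIV_divide[OF DERIV_const this one_plus_square_nz, of 1] show ?thesis
    by (simp add: power2_eq_square)
qed

lemma psi_has_derivative:
  assumes v: "(v has_real_derivative v') (at x within S)"
    and \<sigma>: "(\<sigma> has_real_derivative \<sigma>') (at x within S)"
    and \<theta>: "(\<theta> has_real_derivative \<theta>') (at x within S)"
    and pos: "0 < \<theta> x" "0 < L"
  shows "((\<lambda>x. psi L c (v x) (\<sigma> x) (\<theta> x)) has_real_derivative
    v' * (\<sigma> x)\<^sup>2 / 2 + psi_\<sigma> L c (v x) (\<sigma> x) (\<theta> x) * \<sigma>' + psi_\<theta> L c (\<sigma> x) (\<theta> x) * \<theta>') (at x within S)"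
proof -
  define l where "l = L * (1 + \<theta> x)"
  have l: "l \<noteq> 0" using pos by (simp add: l_def)
  define s where "s = \<sigma> x / l"
  have "((\<lambda>x. \<sigma> x / (L * (1 + \<theta> x))) has_real_derivative \<sigma>' / l - s * (L * \<theta>') / l) (at x within S)"
    by (rule derivative_eq_intros \<sigma> \<theta> refl)+
      (use l in \<open>simp_all add: s_def flip: l_def, simp add: field_simps\<close>)
  then have A: "((\<lambda>x. arctan (\<sigma> x / (L * (1 + \<theta> x)))) has_real_derivative
     (\<sigma>' / l - s * (L * \<theta>') / l) / (1 + s\<^sup>2)) (at x within S)"
    by (rule DERIV_chain2[OF DERIV_arctan, THEN DERIV_cong]) (simp add: s_def l_def inverse_eq_divide)
  have "((\<lambda>x. psi L c (v x) (\<sigma> x) (\<theta> x)) has_real_derivative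
    v' * (\<sigma> x)\<^sup>2 / 2 + v x * \<sigma> x * \<sigma>' + c * (\<theta>' * \<sigma> x + \<theta> x * \<sigma>'
      - ((\<theta>' * l + \<theta> x * (L * \<theta>')) * arctan s + \<theta> x * l * ((\<sigma>' / l - s * (L * \<theta>') / l) / (1 + s\<^sup>2)))))
    (at x within S)"
    unfolding psi_def
    by (rule derivative_eq_intros v \<sigma> \<theta> A refl numeral_neq_zero)+
      (simp add: s_def l_def algebra_simps)
  moreover have "l * ((\<sigma>' / l - s * (L * \<theta>') / l) / (1 + s\<^sup>2)) = (\<sigma>' - s * L * \<theta>') / (1 + s\<^sup>2)"
    using l by (simp add: right_diff_distrib diff_divide_distrib mult.assoc)
  ultimately show ?thesis
    unfolding psi_\<sigma>_def psi_\<theta>_def l_def[symmetric] s_def[symmetric]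
    by (simp add: mult.assoc) (simp add: algebra_simps diff_divide_distrib)
qed

text \<open>The second derivative in \<open>\<sigma>\<close> is \<open>v\<close> plus
  \<open>c * \<theta> / l\<close> times \<open>2 s / (1 + s^2)^2\<close>, and the latter has modulus
  at most 1. Since \<open>\<theta> / l \<le> 1 / L\<close>, the condition on \<open>c\<close> makes
  the sum nonnegative; a convex function lies above its tangents.\<close>

lemma psi_convex:
  assumes pos: "0 < \<theta>" "0 < L" and c: "\<bar>c\<bar> \<le> L * v"
  shows "psi L c v \<sigma> \<theta> + psi_\<sigma> L c v \<sigma> \<theta> * (\<sigma>' - \<sigma>) \<le> psi L c v \<sigma>' \<theta>"
proof -
  define l where "l = L * (1 + \<theta>)"
  have l: "l > 0" using pos by (simp add: l_def)
  have d1: "((\<lambda>\<sigma>. psi L c v \<sigma> \<theta>) has_real_derivative psi_\<sigma> L c v x \<theta>) (at x)" for x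
    using psi_has_derivative[of "\<lambda>_. v" 0 x UNIV "\<lambda>x. x" 1 "\<lambda>_. \<theta>" 0] pos by simp
  have d2: "((\<lambda>\<sigma>. psi_\<sigma> L c v \<sigma> \<theta>) has_real_derivative
      v + c * \<theta> * (2 * (x / l) * (1 / l) / (1 + (x / l)\<^sup>2)\<^sup>2)) (at x)" for x
  proof -
    have "((\<lambda>\<sigma>. 1 / (1 + (\<sigma> / l)\<^sup>2)) has_real_derivative - (2 * (x / l) / (1 + (x / l)\<^sup>2)\<^sup>2) * (1 / l)) (at x)"
      by (rule DERIV_chain2[OF inverse_one_plus_square_derivative DERIV_cdivide[OF DERIV_ident]])
    note * = DERIV_cmult[OF DERIV_diff[OF DERIV_const[of 1] this], of "c * \<theta>"]
    show ?thesis
      unfolding psi_\<sigma>_def l_def[symmetric]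
      by (rule DERIV_cong[OF DERIV_add[OF DERIV_cmult[OF DERIV_ident] *]]) simp
  qed
  have "v + c * \<theta> * (2 * (x / l) * (1 / l) / (1 + (x / l)\<^sup>2)\<^sup>2) \<ge> 0" for x
  proof -
    define s where "s = x / l"
    have 1: "\<bar>2 * s\<bar> \<le> 1 + s\<^sup>2"
      using sum_squares_bound[of 1 s] sum_squares_bound[of 1 "-s"] by (auto simp: abs_if)
    have "1 + s\<^sup>2 \<le> (1 + s\<^sup>2)\<^sup>2" by (intro self_le_power) auto
    with 1 have "\<bar>2 * s / (1 + s\<^sup>2)\<^sup>2\<bar> \<le> 1"
      by (simp add: abs_mult divide_le_eq_1)
    moreover have "\<bar>c * \<theta> / l\<bar> \<le> v"
    proof -
      have "\<bar>c\<bar> * \<theta> \<le> L * v * \<theta>" using c pos by (intro mult_right_mono) auto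
      also have "\<dots> \<le> v * l"
      proof -
        have "0 \<le> L * v" using c by linarith
        then show ?thesis by (simp add: l_def algebra_simps)
      qed
      finally show ?thesis using l pos by (simp add: abs_mult divide_le_eq)
    qed
    ultimately have "\<bar>c * \<theta> / l\<bar> * \<bar>2 * s / (1 + s\<^sup>2)\<^sup>2\<bar> \<le> v * 1"
      by (intro mult_mono) linarith+
    then have "\<bar>c * \<theta> * (2 * s * (1 / l) / (1 + s\<^sup>2)\<^sup>2)\<bar> \<le> v" by (simp add: abs_mult mult_ac)
    then show ?thesis unfolding s_def by linarith
  qed
  then have "convex_on UNIV (\<lambda>\<sigma>. psi L c v \<sigma> \<theta>)"
    using d1 d2 by (intro f''_ge0_imp_convex) auto
  from convex_on_imp_above_tangent[OF this _ _ _ d1, of \<sigma> \<sigma>'] show ?thesis by simp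
qed

section \<open>Evolution of the gradients of the transverse fields\<close>

context mhd begin

text \<open>The mixed term \<open>b \<bullet> w_y\<close> makes the partial derivatives of the
  density in \<open>w_y\<close> and \<open>b_y\<close> equal to \<open>\<zeta>\<close> and
  \<open>\<xi> - w\<close>, whose space derivatives are given by the equations.\<close>

definition transverse where "transverse t = integral {0..1} (\<lambda>y.
  (\<mu> * (w_y y t \<bullet> w_y y t) + \<nu> * (b_y y t \<bullet> b_y y t)) / (2 * v y t) + b y t \<bullet> w_y y t)"

definition transverse_rate where "transverse_rate y t =
   - (w_t y t \<bullet> w_t y t) - v y t * (b_t y t \<bullet> b_t y t) - u_y y t * (b y t \<bullet> b_t y t) + 2 * (w_y y t \<bullet> b_t y t)
   - u_y y t * (\<mu> * (w_y y t \<bullet> w_y y t) + \<nu> * (b_y y t \<bullet> b_y y t)) / (2 * (v y t)\<^sup>2)"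

lemma cont_transverse_rate: "continuous_on ({0..1} \<times> {0..T}) (\<lambda>(y, t). transverse_rate y t)"
  unfolding transverse_rate_def case_prod_unfold by (auto intro!: continuous_intros)

text \<open>An instance of \<open>convex_functional_dini\<close> for the pair \<open>(w, b)\<close>:
  pairing the derivatives of the fluxes with \<open>(w_t, b_t)\<close> produces the dissipation in
  \<open>w_t\<close> and \<open>b_t\<close>. The boundary condition holds because both fields vanish
  at the ends.\<close>

lemma transverse_le:
  assumes t: "t \<in> {0..T}"
  shows "transverse t \<le> transverse 0 + integral {0..t} (\<lambda>s. integral {0..1} (\<lambda>y. transverse_rate y s))"
proof (rule dini_le_integral[OF _ _ _ t])
  show "continuous_on {0..T} transverse"
    unfolding transverse_def
    by (rule continuous_on_integral_param) (auto intro!: continuous_intros simp: case_prod_unfold)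
  show "continuous_on {0..T} (\<lambda>s. integral {0..1} (\<lambda>y. transverse_rate y s))"
    by (rule continuous_on_integral_param[OF cont_transverse_rate])
next
  fix t \<epsilon> :: real assume t: "0 < t" "t \<le> T" and \<epsilon>: "0 < \<epsilon>"
  then have tT: "t \<in> {0..T}" by auto
  let ?\<Phi> = "\<lambda>y s (p::'e \<times> 'e). (\<mu> * (fst p \<bullet> fst p) + \<nu> * (snd p \<bullet> snd p)) / (2 * v y s) + b y s \<bullet> fst p"
  let ?\<Phi>' = "\<lambda>y s (p::'e \<times> 'e). - u_y y s * (\<mu> * (fst p \<bullet> fst p) + \<nu> * (snd p \<bullet> snd p)) / (2 * (v y s)\<^sup>2)
    + b_t y s \<bullet> fst p"
  let ?P = "\<lambda>y s. (w_y y s, b_y y s)"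
  let ?M = "\<lambda>y. (\<zeta> y t, \<xi> y t - w y t)"
  let ?M' = "\<lambda>y. (w_t y t, u_y y t *\<^sub>R b y t + v y t *\<^sub>R b_t y t - w_y y t)"
  have "\<exists>\<delta>>0. \<forall>h. 0 < h \<longrightarrow> h < \<delta> \<longrightarrow> h \<le> t \<longrightarrow>
    integral {0..1} (\<lambda>y. ?\<Phi> y t (?P y t)) - integral {0..1} (\<lambda>y. ?\<Phi> y (t - h) (?P y (t - h)))
    \<le> h * (integral {0..1} (\<lambda>y. ?\<Phi>' y t (?P y t) - ?M' y \<bullet> (w_t y t, b_t y t)) + \<epsilon>)"
  proof (rule convex_functional_dini[where z="\<lambda>y s. (w y s, b y s)" and z'="\<lambda>y s. (w_t y s, b_t y s)"
        and P="?P" and \<Phi>="?\<Phi>" and \<Phi>'="?\<Phi>'" and M="?M" and M'="?M'", OF t])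
    fix y s :: real and p :: "'e \<times> 'e" assume y: "y \<in> {0..1}" and s: "s \<in> {0..T}"
    show "((\<lambda>s. (w y s, b y s)) has_vector_derivative (w_t y s, b_t y s)) (at s within {0..T})"
      by (rule has_vector_derivative_Pair[OF w_Dt[OF y s] b_Dt[OF y s]])
    show "((\<lambda>y. (w y s, b y s)) has_vector_derivative (w_y y s, b_y y s)) (at y within {0..1})"
      by (rule has_vector_derivative_Pair[OF w_Dy[OF y s] b_Dy[OF y s]])
    have nz: "2 * v y s \<noteq> 0" using v_nz[OF y s] by simp
    show "((\<lambda>s. ?\<Phi> y s p) has_real_derivative ?\<Phi>' y s p) (at s within {0..T})"
      by (rule derivative_eq_intros v_Dt[OF y s] refl nz
          has_real_derivative_inner[OF b_Dt[OF y s] has_vector_derivative_const refl])+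
        (use v_nz[OF y s] in \<open>simp_all add: field_simps power2_eq_square\<close>)
  next
    fix s assume "s \<in> {0..T}"
    then show "continuous_on {0..1} (\<lambda>y. ?\<Phi> y s (?P y s))" by (auto intro!: continuous_intros)
  next
    fix y :: real and p :: "'e \<times> 'e" assume y: "y \<in> {0..1}"
    \<comment> \<open>For a quadratic density the gap above the tangent is the quadratic form of the
      difference.\<close>
    have "0 \<le> \<mu> * ((fst p - w_y y t) \<bullet> (fst p - w_y y t)) + \<nu> * ((snd p - b_y y t) \<bullet> (snd p - b_y y t))"
      using \<mu> \<nu> by simp
    then have "0 \<le> (\<mu> * ((fst p - w_y y t) \<bullet> (fst p - w_y y t))
        + \<nu> * ((snd p - b_y y t) \<bullet> (snd p - b_y y t))) / (2 * v y t)"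
      using v_pos[OF y tT] by simp
    also have "\<dots> = ?\<Phi> y t p - (?\<Phi> y t (?P y t) + ?M y \<bullet> (p - ?P y t))"
      using v_nz[OF y tT]
      by (cases p) (simp add: \<zeta>_eq \<xi>_eq inner_diff_left inner_diff_right inner_add_left inner_add_right
          inner_commute field_simps)
    finally show "?\<Phi> y t (?P y t) + ?M y \<bullet> (p - ?P y t) \<le> ?\<Phi> y t p" by simp
  next
    fix y :: real assume y: "y \<in> {0..1}"
    show "(?M has_vector_derivative ?M' y) (at y within {0..1})"
      by (intro has_vector_derivative_Pair has_vector_derivative_diff \<zeta>_Dy \<xi>_Dy w_Dy y tT)
  next
    fix y :: real assume "y \<in> {0, 1}"
    then show "?M y = 0 \<or> (\<forall>s\<in>{0..T}. (w y s, b y s) = 0)"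
      using boundary[of y] by (auto simp: zero_prod_def)
  qed (use tT \<epsilon> in \<open>auto intro!: continuous_intros simp: case_prod_unfold\<close>)
  moreover have "?\<Phi>' y t (?P y t) - ?M' y \<bullet> (w_t y t, b_t y t) = transverse_rate y t" for y
    by (simp add: transverse_rate_def inner_diff_left inner_add_left inner_diff_right inner_add_right inner_commute)
  ultimately show "\<exists>\<delta>>0. \<forall>h. 0 < h \<longrightarrow> h < \<delta> \<longrightarrow> h \<le> t \<longrightarrow> transverse t - transverse (t - h)
    \<le> h * (integral {0..1} (\<lambda>y. transverse_rate y t) + \<epsilon>)"
    unfolding transverse_def by simp
qed

end

text \<open>
  The pressure satisfies \<open>v p = e / 3 + c \<theta>\<close>. The part \<open>c \<theta>\<close> is not controlled by the energy equation at
  large stress, while the multiplier \<open>\<sigma> + c \<theta> / v\<close>, which would remove it, does not vanish on the boundary.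
  The multiplier \<open>H\<close> interpolates between the two: it vanishes with \<open>\<sigma>\<close>, and it is
  \<open>\<sigma> + c \<theta> / v\<close> up to a bounded error once \<open>\<sigma>\<close> is large compared with \<open>1 + \<theta>\<close>.
\<close>

locale mhd_stress = mhd +
  fixes L c :: real
  assumes c_eq: "c = R - Cv / 3" and L: "0 < L"
    and L_large: "y \<in> {0..1} \<Longrightarrow> t \<in> {0..T} \<Longrightarrow> \<bar>c\<bar> \<le> L * v y t"
begin

definition l where "l y t = L * (1 + \<theta> y t)"
definition s where "s y t = \<sigma> y t / l y t"
definition r where "r y t = 1 / (1 + (s y t)\<^sup>2)"
definition s_y where "s_y y t = (u_t y t - L * s y t * \<theta>_y y t) / l y t"
definition r_y where "r_y y t = - (2 * s y t * (r y t)\<^sup>2 * s_y y t)"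
definition H where "H y t = \<sigma> y t + c / v y t * \<theta> y t * (1 - r y t)"
definition H_y where "H_y y t = u_t y t + c / v y t * \<theta>_y y t * (1 - r y t)
  - c * v_y y t / (v y t)\<^sup>2 * \<theta> y t * (1 - r y t) - c / v y t * \<theta> y t * r_y y t"
text \<open>What remains of \<open>psi_\<theta>\<close> after \<open>c * H\<close> has been split
  off; the part \<open>c * H * \<theta>_t\<close> cancels in \<open>psi_rate_eq\<close>.\<close>

definition K where "K y t = - c * ((l y t + L * \<theta> y t) * arctan (s y t) - L * \<theta> y t * (s y t * r y t))
  - c\<^sup>2 / v y t * \<theta> y t * (1 - r y t)"
definition K_y where "K_y y t = - c * (2 * L * \<theta>_y y t * arctan (s y t) + (l y t + L * \<theta> y t) * (r y t * s_y y t)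
    - L * \<theta>_y y t * (s y t * r y t) - L * \<theta> y t * (s_y y t * r y t + s y t * r_y y t))
  - c\<^sup>2 / v y t * \<theta>_y y t * (1 - r y t) + c\<^sup>2 * v_y y t / (v y t)\<^sup>2 * \<theta> y t * (1 - r y t)
  + c\<^sup>2 / v y t * \<theta> y t * r_y y t"
text \<open>The heat capacity: partial derivative of the internal energy in \<open>\<theta>\<close>,
  which is the factor of \<open>\<theta>_t\<close> in the energy equation.\<close>

definition e where "e y t = Cv + 4 * a * v y t * \<theta> y t ^ 3"
definition e_y where "e_y y t = 4 * a * (v_y y t * \<theta> y t ^ 3 + 3 * v y t * (\<theta> y t)\<^sup>2 * \<theta>_y y t)"
text \<open>The total coefficient of \<open>F_y\<close> in the rate of \<open>stress\<close>:
  \<open>- H / 3\<close> from the part of the pressure that is a multiple of the energy density,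
  \<open>K / e\<close> from the elimination of \<open>\<theta>_t\<close>.\<close>

definition Z where "Z y t = - H y t / 3 + K y t / e y t"
definition Z_y where "Z_y y t = - H_y y t / 3 + K_y y t / e y t - K y t * e_y y t / (e y t)\<^sup>2"

section \<open>Differentiability and continuity of the multiplier\<close>

lemma l_pos: "y \<in> {0..1} \<Longrightarrow> t \<in> {0..T} \<Longrightarrow> 0 < l y t"
  unfolding l_def using L \<theta>_pos[of y t] by simp

lemma l_nz [simp]: "y \<in> {0..1} \<Longrightarrow> t \<in> {0..T} \<Longrightarrow> l y t \<noteq> 0"
  using l_pos[of y t] by simp

lemma e_pos: "y \<in> {0..1} \<Longrightarrow> t \<in> {0..T} \<Longrightarrow> 0 < e y t"
  unfolding e_def using Cv a \<theta>_pos[of y t] v_pos[of y t] by (simp add: add_pos_pos)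

lemma e_nz [simp]: "y \<in> {0..1} \<Longrightarrow> t \<in> {0..T} \<Longrightarrow> e y t \<noteq> 0"
  using e_pos[of y t] by simp

lemma l_Dy:
  assumes y: "y \<in> {0..1}" and t: "t \<in> {0..T}"
  shows "((\<lambda>y. l y t) has_real_derivative L * \<theta>_y y t) (at y within {0..1})"
  unfolding l_def by (rule derivative_eq_intros \<theta>_Dy[OF y t] refl)+ simp

lemma s_Dy:
  assumes y: "y \<in> {0..1}" and t: "t \<in> {0..T}"
  shows "((\<lambda>y. s y t) has_real_derivative s_y y t) (at y within {0..1})"
  unfolding s_def
  by (rule DERIV_cong[OF DERIV_divide[OF \<sigma>_Dy[OF y t] l_Dy[OF y t] l_nz[OF y t]]])
    (use l_nz[OF y t] in \<open>simp add: s_y_def s_def field_simps\<close>)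

lemma r_Dy:
  assumes y: "y \<in> {0..1}" and t: "t \<in> {0..T}"
  shows "((\<lambda>y. r y t) has_real_derivative r_y y t) (at y within {0..1})"
  unfolding r_def
  by (rule DERIV_cong[OF DERIV_chain2[OF inverse_one_plus_square_derivative s_Dy[OF y t]]])
    (simp add: r_y_def r_def power_one_over)

lemma arctan_s_Dy:
  assumes y: "y \<in> {0..1}" and t: "t \<in> {0..T}"
  shows "((\<lambda>y. arctan (s y t)) has_real_derivative r y t * s_y y t) (at y within {0..1})"
  by (rule DERIV_cong[OF DERIV_chain2[OF DERIV_arctan s_Dy[OF y t]]])
    (simp add: r_def inverse_eq_divide)

lemma H_Dy:
  assumes y: "y \<in> {0..1}" and t: "t \<in> {0..T}"
  shows "((\<lambda>y. H y t) has_real_derivative H_y y t) (at y within {0..1})"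
  unfolding H_def
  by (rule derivative_eq_intros \<sigma>_Dy[OF y t] v_Dy[OF y t] v_nz[OF y t] \<theta>_Dy[OF y t] r_Dy[OF y t] refl)+
    (use v_nz[OF y t] in \<open>simp add: H_y_def field_simps power2_eq_square\<close>)

lemma K_Dy:
  assumes y: "y \<in> {0..1}" and t: "t \<in> {0..T}"
  shows "((\<lambda>y. K y t) has_real_derivative K_y y t) (at y within {0..1})"
  unfolding K_def
  by (rule derivative_eq_intros v_Dy[OF y t] v_nz[OF y t] \<theta>_Dy[OF y t] r_Dy[OF y t]
      arctan_s_Dy[OF y t] s_Dy[OF y t] l_Dy[OF y t] refl)+
    (use v_nz[OF y t] in \<open>simp add: K_y_def field_simps power2_eq_square\<close>)

lemma e_Dy:
  assumes y: "y \<in> {0..1}" and t: "t \<in> {0..T}"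
  shows "((\<lambda>y. e y t) has_real_derivative e_y y t) (at y within {0..1})"
  unfolding e_def
  by (rule derivative_eq_intros v_Dy[OF y t] \<theta>_Dy[OF y t] refl)+
    (simp add: e_y_def algebra_simps)

lemma Z_Dy:
  assumes y: "y \<in> {0..1}" and t: "t \<in> {0..T}"
  shows "((\<lambda>y. Z y t) has_real_derivative Z_y y t) (at y within {0..1})"
  unfolding Z_def
  by (rule derivative_eq_intros H_Dy[OF y t] K_Dy[OF y t] e_Dy[OF y t] e_nz[OF y t] refl numeral_neq_zero)+
    (use e_nz[OF y t] in \<open>simp add: Z_y_def field_simps power2_eq_square\<close>)

lemma cont_l: "continuous_on ({0..1} \<times> {0..T}) (\<lambda>(y, t). l y t)"
  unfolding l_def case_prod_unfold by (auto intro!: continuous_intros)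

lemma cont_e: "continuous_on ({0..1} \<times> {0..T}) (\<lambda>(y, t). e y t)"
  unfolding e_def case_prod_unfold by (auto intro!: continuous_intros)

lemma cont_e_y: "continuous_on ({0..1} \<times> {0..T}) (\<lambda>(y, t). e_y y t)"
  unfolding e_y_def case_prod_unfold by (auto intro!: continuous_intros)

lemmas cont_l_e [continuous_intros] =
  continuous_on_slices[OF cont_l] continuous_on_slices[OF cont_e] continuous_on_slices[OF cont_e_y]

lemma cont_s: "continuous_on ({0..1} \<times> {0..T}) (\<lambda>(y, t). s y t)"
  unfolding s_def case_prod_unfold by (auto intro!: continuous_intros)

lemmas cont_s' [continuous_intros] = continuous_on_slices[OF cont_s]

lemma cont_r: "continuous_on ({0..1} \<times> {0..T}) (\<lambda>(y, t). r y t)"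
  unfolding r_def case_prod_unfold by (auto intro!: continuous_intros)

lemma cont_s_y: "continuous_on ({0..1} \<times> {0..T}) (\<lambda>(y, t). s_y y t)"
  unfolding s_y_def case_prod_unfold by (auto intro!: continuous_intros)

lemmas cont_r' [continuous_intros] = continuous_on_slices[OF cont_r] continuous_on_slices[OF cont_s_y]

lemma cont_r_y: "continuous_on ({0..1} \<times> {0..T}) (\<lambda>(y, t). r_y y t)"
  unfolding r_y_def case_prod_unfold by (auto intro!: continuous_intros)

lemmas cont_r_y' [continuous_intros] = continuous_on_slices[OF cont_r_y]

lemma cont_H: "continuous_on ({0..1} \<times> {0..T}) (\<lambda>(y, t). H y t)"
  unfolding H_def case_prod_unfold by (auto intro!: continuous_intros)

lemma cont_H_y: "continuous_on ({0..1} \<times> {0..T}) (\<lambda>(y, t). H_y y t)"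
  unfolding H_y_def case_prod_unfold by (auto intro!: continuous_intros)

lemma cont_K: "continuous_on ({0..1} \<times> {0..T}) (\<lambda>(y, t). K y t)"
  unfolding K_def case_prod_unfold by (auto intro!: continuous_intros)

lemma cont_K_y: "continuous_on ({0..1} \<times> {0..T}) (\<lambda>(y, t). K_y y t)"
  unfolding K_y_def case_prod_unfold by (auto intro!: continuous_intros)

lemmas cont_H_K [continuous_intros] =
  continuous_on_slices[OF cont_H] continuous_on_slices[OF cont_H_y]
  continuous_on_slices[OF cont_K] continuous_on_slices[OF cont_K_y]

lemma cont_Z: "continuous_on ({0..1} \<times> {0..T}) (\<lambda>(y, t). Z y t)"
  unfolding Z_def case_prod_unfold by (auto intro!: continuous_intros)

lemma cont_Z_y: "continuous_on ({0..1} \<times> {0..T}) (\<lambda>(y, t). Z_y y t)"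
  unfolding Z_y_def case_prod_unfold by (auto intro!: continuous_intros)

lemmas cont_Z' [continuous_intros] = continuous_on_slices[OF cont_Z] continuous_on_slices[OF cont_Z_y]

section \<open>Evolution of the stress functional\<close>

definition stress where "stress t = integral {0..1} (\<lambda>y. psi L c (v y t) (\<sigma> y t) (\<theta> y t))"

text \<open>The rate after two integrations by parts: \<open>F_y\<close> has moved onto
  \<open>Z\<close>, and the space derivative of \<open>\<xi>\<close> onto \<open>H * b\<close>, so
  that neither a derivative of the heat flux nor \<open>b_t\<close> is left. The first term carries
  the dissipation.\<close>

definition stress_rate where "stress_rate y t =
  - lam * (H_y y t * u_t y t) + ((\<sigma> y t)\<^sup>2 / 2 - H y t * \<sigma> y t) * u_y y t - F y t * Z_y y t
  + Z y t * ((\<sigma> y t + b y t \<bullet> b y t / 2) * u_y y t + (\<mu> * (w_y y t \<bullet> w_y y t) + \<nu> * (b_y y t \<bullet> b_y y t)) / v y t)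
  - K y t / e y t * (a * \<theta> y t ^ 4 * u_y y t)
  + (H_y y t * (b y t \<bullet> \<xi> y t) + H y t * (b_y y t \<bullet> \<xi> y t)) + H y t * u_y y t * (b y t \<bullet> b y t) / 2"

lemma cont_stress_rate: "continuous_on ({0..1} \<times> {0..T}) (\<lambda>(y, t). stress_rate y t)"
  unfolding stress_rate_def case_prod_unfold by (auto intro!: continuous_intros)

definition f_t where "f_t y t = R * \<theta>_t y t / v y t - R * \<theta> y t * u_y y t / (v y t)\<^sup>2
  + 4 * a / 3 * \<theta> y t ^ 3 * \<theta>_t y t + b y t \<bullet> b_t y t"

lemma f_Dt:
  assumes y: "y \<in> {0..1}" and t: "t \<in> {0..T}"
  shows "((\<lambda>t. f y t) has_real_derivative f_t y t) (at t within {0..T})"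
  unfolding f_eq f_t_def
  by (rule derivative_eq_intros \<theta>_Dt[OF y t] v_Dt[OF y t] v_nz[OF y t] refl numeral_neq_zero
      has_real_derivative_inner[OF b_Dt[OF y t] b_Dt[OF y t] refl])+
    (use v_nz[OF y t] in \<open>simp add: inner_commute field_simps power2_eq_square\<close>)

lemma cont_f_t: "continuous_on ({0..1} \<times> {0..T}) (\<lambda>(y, t). f_t y t)"
  unfolding f_t_def case_prod_unfold by (auto intro!: continuous_intros)

text \<open>Up to terms in \<open>u_y\<close> and \<open>b_t\<close>, \<open>v * f_t\<close> is a
  third of the time derivative of the internal energy plus \<open>c * \<theta>_t\<close>. Multiplied
  by \<open>H\<close>, the second part cancels against the share \<open>c * H\<close> of
  \<open>psi_\<theta>\<close>: this is the purpose of the correction. The remaining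
  \<open>K * \<theta>_t\<close> is removed by the energy equation divided by
  \<open>e\<close>.\<close>

lemma psi_rate_eq:
  assumes y: "y \<in> {0..1}" and t: "t \<in> {0..T}"
  shows "u_y y t * (\<sigma> y t)\<^sup>2 / 2
      + psi_\<sigma> L c (v y t) (\<sigma> y t) (\<theta> y t) * (- lam * u_y y t * u_y y t / (v y t)\<^sup>2 - f_t y t)
      + psi_\<theta> L c (\<sigma> y t) (\<theta> y t) * \<theta>_t y t
    = ((\<sigma> y t)\<^sup>2 / 2 - H y t * \<sigma> y t) * u_y y t
      + Z y t * ((\<sigma> y t + b y t \<bullet> b y t / 2) * u_y y t + (\<mu> * (w_y y t \<bullet> w_y y t) + \<nu> * (b_y y t \<bullet> b_y y t)) / v y t)
      - K y t / e y t * (a * \<theta> y t ^ 4 * u_y y t) + H y t * u_y y t * (b y t \<bullet> b y t) / 2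
      + Z y t * F_y y t - (H y t *\<^sub>R b y t) \<bullet> (u_y y t *\<^sub>R b y t + v y t *\<^sub>R b_t y t)"
proof -
  have nz: "v y t \<noteq> 0" "e y t \<noteq> 0" "l y t \<noteq> 0" using y t by simp_all
  define E where "E = F_y y t + (\<sigma> y t + b y t \<bullet> b y t / 2) * u_y y t
    + (\<mu> * (w_y y t \<bullet> w_y y t) + \<nu> * (b_y y t \<bullet> b_y y t)) / v y t"
  define B where "B = (b y t \<bullet> b y t)"
  define B' where "B' = (b y t \<bullet> b_t y t)"
  have E: "e y t * \<theta>_t y t + a * \<theta> y t ^ 4 * u_y y t = E"
    using energy_eq[OF y t] by (simp add: e_def E_def \<sigma>_eq f_eq)
  have psi\<sigma>: "psi_\<sigma> L c (v y t) (\<sigma> y t) (\<theta> y t) = v y t * H y t"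
    unfolding psi_\<sigma>_def l_def[symmetric] s_def[symmetric] r_def[symmetric] H_def
    using nz by (simp add: field_simps)
  have psi\<theta>: "psi_\<theta> L c (\<sigma> y t) (\<theta> y t) = K y t + c * H y t"
    unfolding psi_\<theta>_def l_def[symmetric] s_def[symmetric] H_def K_def
    using nz by (simp add: r_def power2_eq_square algebra_simps)
  \<comment> \<open>Here \<open>c = R - Cv / 3\<close> enters: \<open>v\<close> times the pressure
    is a third of the internal energy plus \<open>c * \<theta>\<close>, and this relation is
    differentiated in time.\<close>
  have vf: "v y t * (- lam * u_y y t * u_y y t / (v y t)\<^sup>2 - f_t y t)
    = - (\<sigma> y t * u_y y t) - (e y t * \<theta>_t y t + a * \<theta> y t ^ 4 * u_y y t) / 3 - c * \<theta>_t y t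
      - u_y y t * B / 2 - v y t * B'"
    using nz by (simp add: \<sigma>_eq f_eq f_t_def e_def c_eq B_def B'_def field_simps power2_eq_square
        power3_eq_cube power4_eq_xxxx)
  have \<theta>t: "K y t * \<theta>_t y t = K y t / e y t * E - K y t / e y t * (a * \<theta> y t ^ 4 * u_y y t)"
    using nz unfolding E[symmetric] by (simp add: field_simps)
  have "u_y y t * (\<sigma> y t)\<^sup>2 / 2
      + psi_\<sigma> L c (v y t) (\<sigma> y t) (\<theta> y t) * (- lam * u_y y t * u_y y t / (v y t)\<^sup>2 - f_t y t)
      + psi_\<theta> L c (\<sigma> y t) (\<theta> y t) * \<theta>_t y t
    = u_y y t * (\<sigma> y t)\<^sup>2 / 2
      + H y t * (v y t * (- lam * u_y y t * u_y y t / (v y t)\<^sup>2 - f_t y t))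
      + c * H y t * \<theta>_t y t + K y t * \<theta>_t y t"
    unfolding psi\<sigma> psi\<theta> by (simp add: algebra_simps)
  also have "\<dots> = u_y y t * (\<sigma> y t)\<^sup>2 / 2 + H y t * (- (\<sigma> y t * u_y y t) - E / 3 - u_y y t * B / 2 - v y t * B')
      + K y t / e y t * E - K y t / e y t * (a * \<theta> y t ^ 4 * u_y y t)"
    unfolding vf \<theta>t E by (simp add: algebra_simps)
  also have "\<dots> = ((\<sigma> y t)\<^sup>2 / 2 - H y t * \<sigma> y t) * u_y y t + Z y t * E
      - K y t / e y t * (a * \<theta> y t ^ 4 * u_y y t) - H y t * (u_y y t * B / 2 + v y t * B')"
    by (simp add: Z_def algebra_simps)
  finally show ?thesis
    unfolding E_def by (simp add: B_def B'_def inner_add_right algebra_simps)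
qed

lemma stress_le:
  assumes t: "t \<in> {0..T}"
  shows "stress t \<le> stress 0 + integral {0..t} (\<lambda>s. integral {0..1} (\<lambda>y. stress_rate y s))"
proof (rule dini_le_integral[OF _ _ _ t])
  show "continuous_on {0..T} stress"
    unfolding stress_def psi_def
    by (rule continuous_on_integral_param)
      (auto intro!: continuous_intros simp: case_prod_unfold simp flip: l_def)
  show "continuous_on {0..T} (\<lambda>s. integral {0..1} (\<lambda>y. stress_rate y s))"
    by (rule continuous_on_integral_param[OF cont_stress_rate])
next
  fix t \<epsilon> :: real assume t: "0 < t" "t \<le> T" and \<epsilon>: "0 < \<epsilon>"
  then have tT: "t \<in> {0..T}" by auto
  let ?\<sigma> = "\<lambda>y s p. lam * p / v y s - f y s"
  let ?\<Phi> = "\<lambda>y s p. psi L c (v y s) (?\<sigma> y s p) (\<theta> y s)"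
  let ?\<Phi>' = "\<lambda>y s p. u_y y s * (?\<sigma> y s p)\<^sup>2 / 2
    + psi_\<sigma> L c (v y s) (?\<sigma> y s p) (\<theta> y s) * (- lam * p * u_y y s / (v y s)\<^sup>2 - f_t y s)
    + psi_\<theta> L c (?\<sigma> y s p) (\<theta> y s) * \<theta>_t y s"
  have "\<exists>\<delta>>0. \<forall>h. 0 < h \<longrightarrow> h < \<delta> \<longrightarrow> h \<le> t \<longrightarrow>
    integral {0..1} (\<lambda>y. ?\<Phi> y t (u_y y t)) - integral {0..1} (\<lambda>y. ?\<Phi> y (t - h) (u_y y (t - h)))
    \<le> h * (integral {0..1} (\<lambda>y. ?\<Phi>' y t (u_y y t) - (lam * H_y y t) \<bullet> u_t y t) + \<epsilon>)"
  proof (rule convex_functional_dini[where z=u and z'=u_t and P=u_y and \<Phi>="?\<Phi>" and \<Phi>'="?\<Phi>'"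
        and M="\<lambda>y. lam * H y t" and M'="\<lambda>y. lam * H_y y t", OF t])
    fix y s p :: real assume y: "y \<in> {0..1}" and s: "s \<in> {0..T}"
    show "((\<lambda>s. u y s) has_vector_derivative u_t y s) (at s within {0..T})"
      using u_Dt[OF y s] by (simp add: has_real_derivative_iff_has_vector_derivative)
    show "((\<lambda>y. u y s) has_vector_derivative u_y y s) (at y within {0..1})"
      using u_Dy[OF y s] by (simp add: has_real_derivative_iff_has_vector_derivative)
    have "((\<lambda>s. ?\<sigma> y s p) has_real_derivative - lam * p * u_y y s / (v y s)\<^sup>2 - f_t y s) (at s within {0..T})"
      by (rule derivative_eq_intros v_Dt[OF y s] v_nz[OF y s] f_Dt[OF y s] refl)+
        (use v_nz[OF y s] in \<open>simp add: field_simps power2_eq_square\<close>)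
    then show "((\<lambda>s. ?\<Phi> y s p) has_real_derivative ?\<Phi>' y s p) (at s within {0..T})"
      by (rule psi_has_derivative[OF v_Dt[OF y s] _ \<theta>_Dt[OF y s] \<theta>_pos[OF y s] L])
  next
    show "continuous_on ({0..1} \<times> {0..T} \<times> UNIV) (\<lambda>(y, s, p). ?\<Phi>' y s p)"
      unfolding psi_\<sigma>_def psi_\<theta>_def l_def[symmetric]
      by (auto intro!: continuous_intros continuous_on_slices[OF cont_f_t] simp: case_prod_unfold)
  next
    fix s assume "s \<in> {0..T}"
    then show "continuous_on {0..1} (\<lambda>y. ?\<Phi> y s (u_y y s))"
      unfolding psi_def by (auto intro!: continuous_intros simp flip: l_def)
  next
    fix y p :: real assume y: "y \<in> {0..1}"
    have nz: "v y t \<noteq> 0" "l y t \<noteq> 0" using y tT by simp_all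
    have "psi_\<sigma> L c (v y t) (\<sigma> y t) (\<theta> y t) = v y t * H y t"
      unfolding psi_\<sigma>_def l_def[symmetric] s_def[symmetric] r_def[symmetric] H_def
      using nz by (simp add: field_simps)
    moreover have "?\<sigma> y t p - \<sigma> y t = lam / v y t * (p - u_y y t)"
      by (simp add: \<sigma>_eq diff_divide_distrib right_diff_distrib)
    ultimately have "(lam * H y t) \<bullet> (p - u_y y t) = psi_\<sigma> L c (v y t) (\<sigma> y t) (\<theta> y t) * (?\<sigma> y t p - \<sigma> y t)"
      using nz by simp
    then show "?\<Phi> y t (u_y y t) + (lam * H y t) \<bullet> (p - u_y y t) \<le> ?\<Phi> y t p"
      using psi_convex[OF \<theta>_pos[OF y tT] L L_large[OF y tT], of "\<sigma> y t" "?\<sigma> y t p"]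
      by (simp add: \<sigma>_eq)
  next
    fix y :: real assume y: "y \<in> {0..1}"
    show "((\<lambda>y. lam * H y t) has_vector_derivative lam * H_y y t) (at y within {0..1})"
      using DERIV_cmult[OF H_Dy[OF y tT], of lam] by (simp add: has_real_derivative_iff_has_vector_derivative)
  next
    fix y :: real assume "y \<in> {0, 1}"
    \<comment> \<open>At the ends \<open>\<sigma> = 0\<close>, hence \<open>s = 0\<close> and
      \<open>r = 1\<close>, and both terms of \<open>H\<close> vanish. The velocity itself is not
      prescribed there, so the first alternative has to hold.\<close>
    then show "lam * H y t = 0 \<or> (\<forall>s\<in>{0..T}. u y s = 0)"
      using boundary[of y t] tT by (auto simp: H_def s_def r_def)
  qed (use tT \<epsilon> in \<open>auto intro!: continuous_intros simp: case_prod_unfold\<close>)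
  moreover have "integral {0..1} (\<lambda>y. ?\<Phi>' y t (u_y y t) - (lam * H_y y t) \<bullet> u_t y t)
    = integral {0..1} (\<lambda>y. stress_rate y t)"
  proof -
    note ci = integrable_continuous_interval continuous_intros
    let ?\<xi>' = "\<lambda>y. u_y y t *\<^sub>R b y t + v y t *\<^sub>R b_t y t"
    \<comment> \<open>The part of the integrand that is left alone by the two integrations by
      parts.\<close>
    define G where "G y = stress_rate y t + F y t * Z_y y t
      - (H_y y t * (b y t \<bullet> \<xi> y t) + H y t * (b_y y t \<bullet> \<xi> y t))" for y
    have "?\<Phi>' y t (u_y y t) - (lam * H_y y t) \<bullet> u_t y t
      = G y + (Z y t * F_y y t - (H y t *\<^sub>R b y t) \<bullet> ?\<xi>' y)" if y: "y \<in> {0..1}" for y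
      unfolding \<sigma>_eq[symmetric]
      using psi_rate_eq[OF y tT] by (simp add: G_def stress_rate_def algebra_simps)
    then have "integral {0..1} (\<lambda>y. ?\<Phi>' y t (u_y y t) - (lam * H_y y t) \<bullet> u_t y t)
      = integral {0..1} (\<lambda>y. G y + (Z y t * F_y y t - (H y t *\<^sub>R b y t) \<bullet> ?\<xi>' y))"
      by (rule Henstock_Kurzweil_Integration.integral_cong)
    also have "\<dots> = integral {0..1} G + integral {0..1} (\<lambda>y. Z y t * F_y y t - (H y t *\<^sub>R b y t) \<bullet> ?\<xi>' y)"
      unfolding G_def using tT
      by (intro Henstock_Kurzweil_Integration.integral_add ci continuous_on_slices[OF cont_stress_rate]) auto
    also have "integral {0..1} (\<lambda>y. Z y t * F_y y t - (H y t *\<^sub>R b y t) \<bullet> ?\<xi>' y)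
      = integral {0..1} (\<lambda>y. Z y t * F_y y t) - integral {0..1} (\<lambda>y. (H y t *\<^sub>R b y t) \<bullet> ?\<xi>' y)"
      using tT by (intro Henstock_Kurzweil_Integration.integral_diff ci) auto
    also have "integral {0..1} (\<lambda>y. Z y t * F_y y t) = - integral {0..1} (\<lambda>y. Z_y y t * F y t)"
      by (rule integral_by_parts_real)
        (use tT boundary[of 0 t] boundary[of 1 t] in \<open>auto intro!: continuous_intros Z_Dy F_Dy\<close>)
    also have "integral {0..1} (\<lambda>y. (H y t *\<^sub>R b y t) \<bullet> ?\<xi>' y)
      = - integral {0..1} (\<lambda>y. (H y t *\<^sub>R b_y y t + H_y y t *\<^sub>R b y t) \<bullet> \<xi> y t)"
    proof (rule integral_by_parts_inner)
      show "((\<lambda>y. H y t *\<^sub>R b y t) has_vector_derivative H y t *\<^sub>R b_y y t + H_y y t *\<^sub>R b y t) (at y within {0..1})"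
        if y: "y \<in> {0..1}" for y
        by (rule has_vector_derivative_scaleR[OF H_Dy[OF y tT] b_Dy[OF y tT]])
      show "((\<lambda>y. \<xi> y t) has_vector_derivative ?\<xi>' y) (at y within {0..1})" if y: "y \<in> {0..1}" for y
        by (rule \<xi>_Dy[OF y tT])
    qed (use tT boundary[of 0 t] boundary[of 1 t] in \<open>auto intro!: continuous_intros\<close>)
    also have "integral {0..1} G + (- integral {0..1} (\<lambda>y. Z_y y t * F y t)
        - - integral {0..1} (\<lambda>y. (H y t *\<^sub>R b_y y t + H_y y t *\<^sub>R b y t) \<bullet> \<xi> y t))
      = integral {0..1} G + integral {0..1} (\<lambda>y. (H y t *\<^sub>R b_y y t + H_y y t *\<^sub>R b y t) \<bullet> \<xi> y t - Z_y y t * F y t)"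
      using tT by (subst Henstock_Kurzweil_Integration.integral_diff) (auto intro!: ci)
    also have "\<dots> = integral {0..1} (\<lambda>y. G y + ((H y t *\<^sub>R b_y y t + H_y y t *\<^sub>R b y t) \<bullet> \<xi> y t - Z_y y t * F y t))"
      unfolding G_def using tT
      by (intro Henstock_Kurzweil_Integration.integral_add[symmetric] ci continuous_on_slices[OF cont_stress_rate]) auto
    also have "\<dots> = integral {0..1} (\<lambda>y. stress_rate y t)"
      by (simp add: G_def inner_add_left algebra_simps)
    finally show ?thesis .
  qed
  ultimately show "\<exists>\<delta>>0. \<forall>h. 0 < h \<longrightarrow> h < \<delta> \<longrightarrow> h \<le> t \<longrightarrow> stress t - stress (t - h)
    \<le> h * (integral {0..1} (\<lambda>y. stress_rate y t) + \<epsilon>)"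
    unfolding stress_def \<sigma>_eq by simp
qed

end

text \<open>The regularity assumptions state continuity of the first derivatives, not of the
  functions. The derivatives are bounded on the compact rectangle, so the function is Lipschitz
  along each axis, and two points are joined through a corner.\<close>

lemma continuous_on_of_partials:
  fixes g :: "real \<Rightarrow> real \<Rightarrow> 'a::banach"
  assumes gy: "\<And>y t. y \<in> {0..1} \<Longrightarrow> t \<in> {0..T} \<Longrightarrow> ((\<lambda>y. g y t) has_vector_derivative g1 y t) (at y within {0..1})"
    and gt: "\<And>y t. y \<in> {0..1} \<Longrightarrow> t \<in> {0..T} \<Longrightarrow> ((\<lambda>t. g y t) has_vector_derivative g2 y t) (at t within {0..T})"
    and c1: "continuous_on ({0..1} \<times> {0..T}) (\<lambda>(y, t). g1 y t)"
    and c2: "continuous_on ({0..1} \<times> {0..T}) (\<lambda>(y, t). g2 y t)"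
  shows "continuous_on ({0..1} \<times> {0..T}) (\<lambda>(y, t). g y t)"
proof -
  have lip: "norm (h x - h x') \<le> B * \<bar>x - x'\<bar>"
    if "\<And>x. x \<in> {p..q} \<Longrightarrow> (h has_vector_derivative h' x) (at x within {p..q})"
      "\<And>x. x \<in> {p..q} \<Longrightarrow> norm (h' x) \<le> B" "x \<in> {p..q}" "x' \<in> {p..q}"
    for h h' :: "real \<Rightarrow> 'a" and p q B x x'
  proof -
    have "norm (h x - h x') \<le> B * norm (x - x')"
    proof (rule differentiable_bound[where S="{p..q}" and f'="\<lambda>x k. k *\<^sub>R h' x"])
      show "onorm (\<lambda>k. k *\<^sub>R h' x) \<le> B" if "x \<in> {p..q}" for x
        using that \<open>\<And>x. x \<in> {p..q} \<Longrightarrow> norm (h' x) \<le> B\<close>[OF that]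
        by (intro onorm_le) (auto simp: mult.commute[of B] intro: mult_left_mono)
    qed (use that in \<open>auto simp: has_vector_derivative_def\<close>)
    then show ?thesis by simp
  qed
  have "compact ({0..1::real} \<times> {0..T})" by (intro compact_Times compact_Icc)
  from compact_continuous_image[OF c1 this] compact_continuous_image[OF c2 this]
  obtain B1 B2 where B: "\<And>y t. y \<in> {0..1} \<Longrightarrow> t \<in> {0..T} \<Longrightarrow> norm (g1 y t) \<le> B1"
    "\<And>y t. y \<in> {0..1} \<Longrightarrow> t \<in> {0..T} \<Longrightarrow> norm (g2 y t) \<le> B2"
    by (fastforce dest!: compact_imp_bounded simp: bounded_iff)
  define B where "B = max 1 (max B1 B2)"
  have "B > 0" by (simp add: B_def)
  show ?thesis unfolding continuous_on_iff
  proof (intro ballI allI impI)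
    fix x :: "real \<times> real" and \<epsilon> assume x: "x \<in> {0..1} \<times> {0..T}" and "0 < (\<epsilon>::real)"
    obtain y0 t0 where yt0: "x = (y0, t0)" "y0 \<in> {0..1}" "t0 \<in> {0..T}" using x by auto
    have "dist (g y t) (g y0 t0) < \<epsilon>"
      if "y \<in> {0..1}" "t \<in> {0..T}" "dist (y, t) (y0, t0) < \<epsilon> / (2 * B)" for y t
    proof -
      have d: "\<bar>y - y0\<bar> < \<epsilon> / (2 * B)" "\<bar>t - t0\<bar> < \<epsilon> / (2 * B)"
        using that(3) dist_fst_le[of "(y, t)" "(y0, t0)"] dist_snd_le[of "(y, t)" "(y0, t0)"]
        by (auto simp: dist_real_def)
      have "norm (g y t - g y0 t) \<le> B * \<bar>y - y0\<bar>"
        by (rule lip[of 0 1 "\<lambda>y. g y t" "\<lambda>y. g1 y t"])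
          (use that yt0 gy B(1) in \<open>auto simp: B_def le_max_iff_disj\<close>)
      moreover have "norm (g y0 t - g y0 t0) \<le> B * \<bar>t - t0\<bar>"
        by (rule lip[of 0 T "\<lambda>t. g y0 t" "\<lambda>t. g2 y0 t"])
          (use that yt0 gt B(2) in \<open>auto simp: B_def le_max_iff_disj\<close>)
      moreover have "B * \<bar>y - y0\<bar> < \<epsilon> / 2" "B * \<bar>t - t0\<bar> < \<epsilon> / 2"
        using d \<open>B > 0\<close> by (auto simp: field_simps)
      moreover have "norm (g y t - g y0 t0) \<le> norm (g y t - g y0 t) + norm (g y0 t - g y0 t0)"
        by (metis diff_add_cancel add_diff_eq norm_triangle_ineq)
      ultimately show ?thesis by (simp add: dist_norm)
    qed
    then show "\<exists>d>0. \<forall>x'\<in>{0..1} \<times> {0..T}. dist x' x < d \<longrightarrow>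
        dist ((\<lambda>(y, t). g y t) x') ((\<lambda>(y, t). g y t) x) < \<epsilon>"
      using \<open>\<epsilon> > 0\<close> \<open>B > 0\<close> yt0 by (intro exI[of _ "\<epsilon> / (2 * B)"]) auto
  qed
qed

lemma integral_mono_cont:
  fixes f g :: "real \<Rightarrow> real"
  assumes "continuous_on {a..b} f" "continuous_on {a..b} g" "\<And>y. y \<in> {a..b} \<Longrightarrow> f y \<le> g y"
  shows "integral {a..b} f \<le> integral {a..b} g"
  using assms by (intro Henstock_Kurzweil_Integration.integral_le integrable_continuous_interval)

lemma integral_nonneg_Icc:
  fixes f :: "real \<Rightarrow> real"
  assumes "\<And>y. y \<in> {a..b} \<Longrightarrow> 0 \<le> f y"
  shows "0 \<le> integral {a..b} f"
  by (cases "f integrable_on {a..b}")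
    (use assms in \<open>auto intro: Henstock_Kurzweil_Integration.integral_nonneg simp: not_integrable_integral\<close>)

section \<open>Uniform bounds on energy, entropy and volume\<close>

text \<open>
  The conductivity enters only through the two growth conditions on the heat flux, with \<open>2 m \<le> q \<le> 2 m + 3\<close>.
\<close>

locale mhd_family =
  fixes lam \<mu> \<nu> R a Cv T k1 k2 :: real and m :: nat
    and v v_y u u_y u_t \<theta> \<theta>_y \<theta>_t F F_y f \<sigma> :: "'i \<Rightarrow> real \<Rightarrow> real \<Rightarrow> real"
    and w w_y w_t b b_y b_t \<zeta> \<xi> :: "'i \<Rightarrow> real \<Rightarrow> real \<Rightarrow> 'e::euclidean_space"
  assumes mhd: "mhd lam \<mu> \<nu> R a Cv T (v i) (v_y i) (u i) (u_y i) (u_t i) (\<theta> i) (\<theta>_y i) (\<theta>_t i) (F i) (F_y i)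
      (f i) (\<sigma> i) (w i) (w_y i) (w_t i) (b i) (b_y i) (b_t i) (\<zeta> i) (\<xi> i)"
    and k1: "0 < k1" and k2: "0 < k2"
    and F_lower: "y \<in> {0..1} \<Longrightarrow> t \<in> {0..T} \<Longrightarrow>
      k1 * (1 + \<theta> i y t ^ (2 * m)) * (\<theta>_y i y t)\<^sup>2 \<le> v i y t * (F i y t * \<theta>_y i y t)"
    and F_upper: "y \<in> {0..1} \<Longrightarrow> t \<in> {0..T} \<Longrightarrow>
      (v i y t * F i y t)\<^sup>2 \<le> k2 * (1 + \<theta> i y t ^ (2 * m + 3)) * (v i y t * (F i y t * \<theta>_y i y t))"
    and initial: "y \<in> {0..1} \<Longrightarrow> v i y 0 = v j y 0 \<and> v_y i y 0 = v_y j y 0 \<and> u i y 0 = u j y 0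
      \<and> u_y i y 0 = u_y j y 0 \<and> \<theta> i y 0 = \<theta> j y 0 \<and> w i y 0 = w j y 0 \<and> w_y i y 0 = w_y j y 0
      \<and> b i y 0 = b j y 0 \<and> b_y i y 0 = b_y j y 0"
begin

sublocale S: mhd lam \<mu> \<nu> R a Cv T "v i" "v_y i" "u i" "u_y i" "u_t i" "\<theta> i" "\<theta>_y i" "\<theta>_t i" "F i" "F_y i"
      "f i" "\<sigma> i" "w i" "w_y i" "w_t i" "b i" "b_y i" "b_t i" "\<zeta> i" "\<xi> i" for i
  by (rule mhd)

lemmas consts_pos = S.lam S.\<mu> S.\<nu> S.R S.a S.Cv S.T k1 k2

lemma zero_in: "0 \<in> {0..T}" using S.T by simp

text \<open>The initial values are shared, so one member, named by the index
  \<open>undefined\<close>, serves as reference; adding 1 makes the bound positive.\<close>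

lemma initial_integral:
  assumes "\<And>i y. y \<in> {0..1} \<Longrightarrow> g i y = g undefined y"
  shows "\<exists>B>0. \<forall>i::'i. \<bar>integral {0..1} (g i :: real \<Rightarrow> real)\<bar> \<le> B"
proof (intro exI conjI allI)
  fix i :: 'i
  have "integral {0..1} (g i) = integral {0..1} (g undefined)"
    by (intro Henstock_Kurzweil_Integration.integral_cong assms)
  then show "\<bar>integral {0..1} (g i)\<bar> \<le> \<bar>integral {0..1} (g undefined)\<bar> + 1" by simp
qed simp

lemma energy_bounds:
  "\<exists>E>0. \<forall>i. \<forall>t\<in>{0..T}. integral {0..1} (\<lambda>y. \<theta> i y t) \<le> E
     \<and> integral {0..1} (\<lambda>y. v i y t * \<theta> i y t ^ 4) \<le> E
     \<and> integral {0..1} (\<lambda>y. (u i y t)\<^sup>2) \<le> E \<and> integral {0..1} (\<lambda>y. w i y t \<bullet> w i y t) \<le> E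
     \<and> integral {0..1} (\<lambda>y. v i y t * (b i y t \<bullet> b i y t)) \<le> E"
proof -
  have "\<exists>E>0. \<forall>i. \<bar>S.energy i 0\<bar> \<le> E"
    unfolding S.energy_def
  proof (rule initial_integral)
    fix i :: 'i and y :: real assume y: "y \<in> {0..1}"
    show "Cv * \<theta> i y 0 + a * v i y 0 * \<theta> i y 0 ^ 4 + (u i y 0)\<^sup>2 / 2 + w i y 0 \<bullet> w i y 0 / 2
        + v i y 0 * (b i y 0 \<bullet> b i y 0) / 2
      = Cv * \<theta> undefined y 0 + a * v undefined y 0 * \<theta> undefined y 0 ^ 4 + (u undefined y 0)\<^sup>2 / 2
        + w undefined y 0 \<bullet> w undefined y 0 / 2 + v undefined y 0 * (b undefined y 0 \<bullet> b undefined y 0) / 2"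
      using initial[OF y, of i undefined] by simp
  qed
  then obtain E where E: "E > 0" "\<And>i. \<bar>S.energy i 0\<bar> \<le> E" by blast
  have en: "S.energy i t \<le> E" if "t \<in> {0..T}" for i t
    using S.energy_conserved[OF that, of i] E(2)[of i] by simp
  \<comment> \<open>The sum of the bounds that belong to the weights \<open>Cv\<close>,
    \<open>a\<close> and \<open>1/2\<close> in the energy density, so that one constant serves all
    five terms.\<close>
  define C where "C = E / Cv + E / a + 2 * E"
  have "C > 0" using E S.Cv S.a by (simp add: C_def add_pos_pos)
  have part: "integral {0..1} g \<le> C"
    if t: "t \<in> {0..T}" and g: "continuous_on {0..1} g" and k: "E / k \<le> C" "0 < k"
      and le: "\<And>y. y \<in> {0..1} \<Longrightarrow> k * g y \<le> Cv * \<theta> i y t + a * v i y t * \<theta> i y t ^ 4 + (u i y t)\<^sup>2 / 2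
        + w i y t \<bullet> w i y t / 2 + v i y t * (b i y t \<bullet> b i y t) / 2" for g i t k
  proof -
    have "k * integral {0..1} g = integral {0..1} (\<lambda>y. k * g y)" by simp
    also have "\<dots> \<le> S.energy i t" unfolding S.energy_def
      by (rule integral_mono_cont[OF _ _ le]) (use t g in \<open>auto intro!: continuous_intros\<close>)
    also have "\<dots> \<le> E" by (rule en[OF t])
    finally have "integral {0..1} g \<le> E / k" using k by (simp add: field_simps)
    then show ?thesis using k by simp
  qed
  have le: "E / Cv \<le> C" "E / a \<le> C" "E / (1/2) \<le> C" using E S.Cv S.a by (simp_all add: C_def)
  have pos: "0 \<le> Cv * \<theta> i y t" "0 \<le> a * (v i y t * \<theta> i y t ^ 4)" "0 \<le> v i y t * (b i y t \<bullet> b i y t)"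
    "0 \<le> (u i y t)\<^sup>2" "0 \<le> w i y t \<bullet> w i y t"
    if "y \<in> {0..1}" "t \<in> {0..T}" for i y t
    using that S.v_pos[of y t i] S.\<theta>_pos[of y t i] S.Cv S.a by simp_all
  show ?thesis
  proof (intro exI[of _ C] conjI allI ballI)
    fix i t assume t: "t \<in> {0..T}"
    show "integral {0..1} (\<lambda>y. \<theta> i y t) \<le> C"
    proof (rule part[OF t _ le(1), of _ i])
      show "Cv * (\<theta> i y t) \<le> Cv * \<theta> i y t + a * v i y t * \<theta> i y t ^ 4 + (u i y t)\<^sup>2 / 2
        + w i y t \<bullet> w i y t / 2 + v i y t * (b i y t \<bullet> b i y t) / 2" if "y \<in> {0..1}" for y
        using pos[OF that t, of i] by (simp add: mult.assoc)
    qed (use t consts_pos in \<open>auto intro!: continuous_intros\<close>)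
    show "integral {0..1} (\<lambda>y. v i y t * \<theta> i y t ^ 4) \<le> C"
    proof (rule part[OF t _ le(2), of _ i])
      show "a * (v i y t * \<theta> i y t ^ 4) \<le> Cv * \<theta> i y t + a * v i y t * \<theta> i y t ^ 4 + (u i y t)\<^sup>2 / 2
        + w i y t \<bullet> w i y t / 2 + v i y t * (b i y t \<bullet> b i y t) / 2" if "y \<in> {0..1}" for y
        using pos[OF that t, of i] by (simp add: mult.assoc)
    qed (use t consts_pos in \<open>auto intro!: continuous_intros\<close>)
    show "integral {0..1} (\<lambda>y. (u i y t)\<^sup>2) \<le> C"
    proof (rule part[OF t _ le(3), of _ i])
      show "1/2 * ((u i y t)\<^sup>2) \<le> Cv * \<theta> i y t + a * v i y t * \<theta> i y t ^ 4 + (u i y t)\<^sup>2 / 2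
        + w i y t \<bullet> w i y t / 2 + v i y t * (b i y t \<bullet> b i y t) / 2" if "y \<in> {0..1}" for y
        using pos[OF that t, of i] by (simp add: mult.assoc)
    qed (use t consts_pos in \<open>auto intro!: continuous_intros\<close>)
    show "integral {0..1} (\<lambda>y. w i y t \<bullet> w i y t) \<le> C"
    proof (rule part[OF t _ le(3), of _ i])
      show "1/2 * (w i y t \<bullet> w i y t) \<le> Cv * \<theta> i y t + a * v i y t * \<theta> i y t ^ 4 + (u i y t)\<^sup>2 / 2
        + w i y t \<bullet> w i y t / 2 + v i y t * (b i y t \<bullet> b i y t) / 2" if "y \<in> {0..1}" for y
        using pos[OF that t, of i] by (simp add: mult.assoc)
    qed (use t consts_pos in \<open>auto intro!: continuous_intros\<close>)
    show "integral {0..1} (\<lambda>y. v i y t * (b i y t \<bullet> b i y t)) \<le> C"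
    proof (rule part[OF t _ le(3), of _ i])
      show "1/2 * (v i y t * (b i y t \<bullet> b i y t)) \<le> Cv * \<theta> i y t + a * v i y t * \<theta> i y t ^ 4 + (u i y t)\<^sup>2 / 2
        + w i y t \<bullet> w i y t / 2 + v i y t * (b i y t \<bullet> b i y t) / 2" if "y \<in> {0..1}" for y
        using pos[OF that t, of i] by (simp add: mult.assoc)
    qed (use t consts_pos in \<open>auto intro!: continuous_intros\<close>)
  qed fact
qed

text \<open>By \<open>|u| \<le> 1 + u^2\<close> the kinetic energy bounds the integral of
  \<open>u\<close> over any subinterval.\<close>

lemma displacement_bound:
  "\<exists>B>0. \<forall>i. \<forall>y\<in>{0..1}. \<forall>t\<in>{0..T}. \<bar>integral {0..y} (\<lambda>x. u i x t)\<bar> \<le> B"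
proof -
  obtain E where E: "E > 0" "\<And>i t. t \<in> {0..T} \<Longrightarrow> integral {0..1} (\<lambda>y. (u i y t)\<^sup>2) \<le> E"
    using energy_bounds by blast
  have "\<bar>integral {0..y} (\<lambda>x. u i x t)\<bar> \<le> 1 + E" if y: "y \<in> {0..1}" and t: "t \<in> {0..T}" for i y t
  proof -
    have c: "continuous_on {0..y} (\<lambda>x. u i x t)" "continuous_on {0..1} (\<lambda>x. u i x t)"
      using y t by (auto intro!: continuous_intros)
    have "norm (integral {0..y} (\<lambda>x. u i x t)) \<le> integral {0..y} (\<lambda>x. 1 + (u i x t)\<^sup>2)"
    proof (rule integral_norm_bound_integral)
      show "norm (u i x t) \<le> 1 + (u i x t)\<^sup>2" for x
        using sum_squares_bound[of 1 "\<bar>u i x t\<bar>"] by simp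
    qed (auto intro!: integrable_continuous_interval continuous_intros c)
    also have "\<dots> \<le> integral {0..1} (\<lambda>x. 1 + (u i x t)\<^sup>2)"
      using y by (intro integral_subset_le integrable_continuous_interval continuous_intros c) auto
    also have "\<dots> = 1 + integral {0..1} (\<lambda>x. (u i x t)\<^sup>2)"
      by (subst Henstock_Kurzweil_Integration.integral_add)
        (auto intro!: integrable_continuous_interval continuous_intros c)
    also have "\<dots> \<le> 1 + E" using E(2)[OF t] by simp
    finally show ?thesis by simp
  qed
  then show ?thesis using E(1) by (intro exI[of _ "1 + E"]) auto
qed

lemma initial_logvol_bound: "\<exists>B>0. \<forall>i. \<forall>y\<in>{0..1}. \<bar>S.logvol i y 0\<bar> \<le> B"
proof -
  have "continuous_on {0..1} (\<lambda>y. S.logvol undefined y 0)"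
    using S.logvol_Dy[OF _ zero_in]
    by (intro continuous_on_vector_derivative) (auto simp: has_real_derivative_iff_has_vector_derivative)
  from compact_continuous_image[OF this compact_Icc]
  obtain B where B: "\<And>y. y \<in> {0..1} \<Longrightarrow> \<bar>S.logvol undefined y 0\<bar> \<le> B"
    by (force dest!: compact_imp_bounded simp: bounded_iff)
  have eq: "S.logvol i y 0 = S.logvol undefined y 0" if y: "y \<in> {0..1}" for i y
  proof -
    have "integral {0..y} (\<lambda>x. u i x 0) = integral {0..y} (\<lambda>x. u undefined x 0)"
      using y initial[of _ i undefined] by (intro Henstock_Kurzweil_Integration.integral_cong) auto
    then show ?thesis using initial[OF y, of i undefined] by (simp add: S.logvol_def)
  qed
  then have "\<bar>S.logvol i y 0\<bar> \<le> \<bar>B\<bar> + 1" if "y \<in> {0..1}" for i y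
    using B[OF that] eq[OF that, of i] by linarith
  then show ?thesis by (intro exI[of _ "\<bar>B\<bar> + 1"]) auto
qed

lemma f_pos: "y \<in> {0..1} \<Longrightarrow> t \<in> {0..T} \<Longrightarrow> 0 \<le> f i y t"
  using S.v_pos[of y t i] S.\<theta>_pos[of y t i] S.R S.a by (simp add: S.f_eq)

text \<open>\<open>logvol\<close> does not decrease in time, as \<open>f \<ge> 0\<close>, and it
  differs from \<open>lam * ln v\<close> only by the bounded integral of \<open>u\<close>.\<close>

lemma v_lower: "\<exists>c>0. \<forall>i. \<forall>y\<in>{0..1}. \<forall>t\<in>{0..T}. c \<le> v i y t"
proof -
  obtain B where B: "\<And>i y t. y \<in> {0..1} \<Longrightarrow> t \<in> {0..T} \<Longrightarrow> \<bar>integral {0..y} (\<lambda>x. u i x t)\<bar> \<le> B"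
    using displacement_bound by metis
  obtain B' where B': "\<And>i y. y \<in> {0..1} \<Longrightarrow> \<bar>S.logvol i y 0\<bar> \<le> B'"
    using initial_logvol_bound by metis
  have "exp ((- B' - B) / lam) \<le> v i y t" if y: "y \<in> {0..1}" and t: "t \<in> {0..T}" for i y t
  proof -
    have "0 \<le> integral {0..t} (\<lambda>s. f i y s)"
      using t y f_pos by (intro integral_nonneg_Icc) auto
    then have "- B' - B \<le> lam * ln (v i y t)"
      using S.logvol_eq[OF y t, of i] B[OF y t, of i] B'[OF y, of i] by (simp add: S.logvol_def)
    then have "(- B' - B) / lam \<le> ln (v i y t)" using S.lam by (simp add: field_simps)
    then show ?thesis using S.v_pos[OF y t, of i] by (simp add: ln_ge_iff)
  qed
  then show ?thesis by (intro exI[of _ "exp ((- B' - B) / lam)"]) auto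
qed

text \<open>A pointwise upper bound needs the dissipation, and the bound on the dissipation needs
  this one for the term \<open>R * ln v\<close>. The function \<open>W = exp (logvol / lam)\<close>
  is comparable with \<open>v\<close> and has time derivative \<open>W * f / lam\<close>; since
  \<open>v * f\<close> is controlled by the energy density, the integral of \<open>W\<close> grows
  at most linearly.\<close>

lemma v_integral_upper: "\<exists>C>0. \<forall>i. \<forall>t\<in>{0..T}. integral {0..1} (\<lambda>y. v i y t) \<le> C"
proof -
  obtain B where B: "\<And>i y t. y \<in> {0..1} \<Longrightarrow> t \<in> {0..T} \<Longrightarrow> \<bar>integral {0..y} (\<lambda>x. u i x t)\<bar> \<le> B"
    using displacement_bound by metis
  obtain E where E: "E > 0" "\<And>i t. t \<in> {0..T} \<Longrightarrow> integral {0..1} (\<lambda>y. \<theta> i y t) \<le> E"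
    "\<And>i t. t \<in> {0..T} \<Longrightarrow> integral {0..1} (\<lambda>y. v i y t * \<theta> i y t ^ 4) \<le> E"
    "\<And>i t. t \<in> {0..T} \<Longrightarrow> integral {0..1} (\<lambda>y. v i y t * (b i y t \<bullet> b i y t)) \<le> E"
    using energy_bounds by blast
  define W where "W = (\<lambda>i y t. exp (S.logvol i y t / lam))"
  define A where "A = exp (B / lam)"
  have vW: "v i y t \<le> A * W i y t" "W i y t \<le> A * v i y t" if y: "y \<in> {0..1}" and t: "t \<in> {0..T}" for i y t
  proof -
    let ?U = "integral {0..y} (\<lambda>x. u i x t)"
    have "v i y t = exp (ln (v i y t))" using S.v_pos[OF y t] by simp
    also have "ln (v i y t) = S.logvol i y t / lam + ?U / lam"
      using S.lam by (simp add: S.logvol_def field_simps)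
    finally have v: "v i y t = W i y t * exp (?U / lam)" by (simp add: W_def exp_add)
    have "?U / lam \<le> B / lam" "- (?U / lam) \<le> B / lam"
      using B[OF y t, of i] S.lam by (auto simp: field_simps abs_le_iff)
    then have "exp (?U / lam) \<le> A" "exp (- (?U / lam)) \<le> A" by (simp_all add: A_def)
    moreover have "W i y t = v i y t * exp (- (?U / lam))" by (simp add: v mult.assoc flip: exp_add)
    moreover have "0 < W i y t" by (simp add: W_def)
    ultimately show "v i y t \<le> A * W i y t" "W i y t \<le> A * v i y t"
      using v S.v_pos[OF y t, of i]
      by (metis less_imp_le mult.commute mult_left_mono)+
  qed
  have contW: "continuous_on ({0..1} \<times> {0..T}) (\<lambda>(y, t). W i y t)" for i
  proof -
    have "continuous_on ({0..1} \<times> {0..T}) (\<lambda>(y, t). S.logvol i y t)"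
      by (rule continuous_on_of_partials[OF _ _ S.cont_n[of i] S.cont_f[of i]])
        (use S.logvol_Dy[of _ _ i] S.logvol_Dt[of _ _ i] in
          \<open>auto simp: has_real_derivative_iff_has_vector_derivative\<close>)
    then show ?thesis unfolding W_def case_prod_unfold using S.lam by (intro continuous_intros) auto
  qed
  note cW = continuous_on_slices[OF contW]
  obtain B0 where B0: "B0 > 0" "\<And>i y. y \<in> {0..1} \<Longrightarrow> \<bar>S.logvol i y 0\<bar> \<le> B0"
    using initial_logvol_bound by blast
  define D where "D = A / lam * ((R + a / 3 + 1 / 2) * E)"
  have "A > 0" by (simp add: A_def)
  then have "D > 0" using S.lam S.R S.a E(1) by (simp add: D_def add_pos_pos)
  have "integral {0..1} (\<lambda>y. v i y t) \<le> A * (exp (B0 / lam) + T * D)" if t: "t \<in> {0..T}" for i t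
  proof -
    have "integral {0..1} (\<lambda>y. W i y t) = integral {0..1} (\<lambda>y. W i y 0)
      + integral {0..t} (\<lambda>s. integral {0..1} (\<lambda>y. W i y s * f i y s / lam))"
    proof (rule S.Dt_integral[OF _ _ _ t])
      fix y t :: real assume y: "y \<in> {0..1}" and t: "t \<in> {0..T}"
      show "((\<lambda>t. W i y t) has_real_derivative W i y t * f i y t / lam) (at t within {0..T})"
        unfolding W_def by (rule DERIV_chain2[OF DERIV_exp DERIV_cdivide[OF S.logvol_Dt[OF y t]], THEN DERIV_cong]) simp
    qed (use S.lam in \<open>auto intro!: continuous_intros cW simp: case_prod_unfold\<close>)
    also have "integral {0..1} (\<lambda>y. W i y 0) \<le> integral {0..1} (\<lambda>y::real. exp (B0 / lam))"
    proof (rule integral_mono_cont)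
      show "W i y 0 \<le> exp (B0 / lam)" if y: "y \<in> {0..1}" for y
        using B0(2)[OF y, of i] S.lam by (simp add: W_def divide_right_mono)
    qed (use zero_in in \<open>auto intro!: continuous_intros cW\<close>)
    also have "integral {0..t} (\<lambda>s. integral {0..1} (\<lambda>y. W i y s * f i y s / lam)) \<le> integral {0..t} (\<lambda>s. D)"
    proof (rule integral_mono_cont)
      show "continuous_on {0..t} (\<lambda>s. integral {0..1} (\<lambda>y. W i y s * f i y s / lam))"
        by (rule continuous_on_integral_param)
          (use t S.lam in \<open>auto intro!: continuous_intros cW simp: case_prod_unfold\<close>)
      fix s assume "s \<in> {0..t}"
      then have s: "s \<in> {0..T}" using t by auto
      have "integral {0..1} (\<lambda>y. W i y s * f i y s / lam) \<le> integral {0..1} (\<lambda>y. A / lam * (R * \<theta> i y s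
        + (a / 3 * (v i y s * \<theta> i y s ^ 4) + 1 / 2 * (v i y s * (b i y s \<bullet> b i y s)))))"
      proof (rule integral_mono_cont)
        fix y :: real assume y: "y \<in> {0..1}"
        have "W i y s * f i y s \<le> (A * v i y s) * f i y s"
          using vW(2)[OF y s] f_pos[OF y s] by (rule mult_right_mono)
        also have "\<dots> = A * (R * \<theta> i y s
        + (a / 3 * (v i y s * \<theta> i y s ^ 4) + 1 / 2 * (v i y s * (b i y s \<bullet> b i y s))))"
          using S.v_nz[OF y s, of i] by (simp add: S.f_eq field_simps)
        finally show "W i y s * f i y s / lam \<le> A / lam * (R * \<theta> i y s
        + (a / 3 * (v i y s * \<theta> i y s ^ 4) + 1 / 2 * (v i y s * (b i y s \<bullet> b i y s))))"
          using S.lam by (simp add: divide_right_mono)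
      qed (use s S.lam in \<open>auto intro!: continuous_intros cW\<close>)
      also have "\<dots> = A / lam * (R * integral {0..1} (\<lambda>y. \<theta> i y s)
        + (a / 3 * integral {0..1} (\<lambda>y. v i y s * \<theta> i y s ^ 4)
        + 1 / 2 * integral {0..1} (\<lambda>y. v i y s * (b i y s \<bullet> b i y s))))"
        using s
        by (simp only: integral_mult_right, subst Henstock_Kurzweil_Integration.integral_add,
            (auto intro!: integrable_continuous_interval continuous_intros)[2],
            subst Henstock_Kurzweil_Integration.integral_add,
            (auto intro!: integrable_continuous_interval continuous_intros)[2], simp only: integral_mult_right)
      also have "\<dots> \<le> A / lam * (R * E + (a / 3 * E + 1 / 2 * E))"
        using \<open>A > 0\<close> S.lam S.R S.a E(2,3,4)[OF s, of i]
        by (intro mult_left_mono add_mono) auto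
      also have "\<dots> = D" by (simp add: D_def algebra_simps)
      finally show "integral {0..1} (\<lambda>y. W i y s * f i y s / lam) \<le> D" .
    qed auto
    finally have "integral {0..1} (\<lambda>y. W i y t) \<le> exp (B0 / lam) + t * D" using t by simp
    also have "\<dots> \<le> exp (B0 / lam) + T * D" using t \<open>D > 0\<close> by simp
    finally have W: "integral {0..1} (\<lambda>y. W i y t) \<le> exp (B0 / lam) + T * D" .
    have "integral {0..1} (\<lambda>y. v i y t) \<le> integral {0..1} (\<lambda>y. A * W i y t)"
      by (rule integral_mono_cont[OF _ _ vW(1)]) (use t in \<open>auto intro!: continuous_intros cW\<close>)
    also have "\<dots> = A * integral {0..1} (\<lambda>y. W i y t)" by simp
    also have "\<dots> \<le> A * (exp (B0 / lam) + T * D)" using W \<open>A > 0\<close> by simp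
    finally show ?thesis .
  qed
  moreover have "0 < A * (exp (B0 / lam) + T * D)"
    using \<open>A > 0\<close> \<open>D > 0\<close> S.T by (intro mult_pos_pos add_pos_pos) auto
  ultimately show ?thesis by blast
qed

end

lemma power_le_one_plus_power:
  assumes "0 \<le> (x::real)" "j \<le> k"
  shows "x ^ j \<le> 1 + x ^ k"
proof (cases "x \<le> 1")
  case True
  then have "x ^ j \<le> 1" using assms by (simp add: power_le_one)
  then show ?thesis using assms by (simp add: add_increasing2)
next
  case False
  then have "x ^ j \<le> x ^ k" using assms by (intro power_increasing) auto
  then show ?thesis by simp
qed

lemma square_sum_le: "(x + y)\<^sup>2 \<le> 2 * x\<^sup>2 + 2 * (y::real)\<^sup>2"
  using sum_squares_bound[of x y] by (simp add: power2_sum)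

lemma young: "0 < (k::real) \<Longrightarrow> x * y \<le> k * x\<^sup>2 / 2 + y\<^sup>2 / (2 * k)"
proof -
  assume k: "0 < k"
  have "0 \<le> (k * x - y)\<^sup>2 / (2 * k)" using k by simp
  also have "\<dots> = k * x\<^sup>2 / 2 + y\<^sup>2 / (2 * k) - x * y"
    using k by (simp add: power2_diff field_simps power2_eq_square)
  finally show ?thesis by simp
qed

section \<open>Entropy dissipation and the pointwise bounds that follow from it\<close>

context mhd_family begin

lemma F_\<theta>_y_nonneg: "y \<in> {0..1} \<Longrightarrow> t \<in> {0..T} \<Longrightarrow> 0 \<le> F i y t * \<theta>_y i y t"
proof -
  assume y: "y \<in> {0..1}" and t: "t \<in> {0..T}"
  have "0 \<le> k1 * (1 + \<theta> i y t ^ (2 * m)) * (\<theta>_y i y t)\<^sup>2" using k1 S.\<theta>_pos[OF y t, of i] by simp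
  also note F_lower[OF y t, of i]
  finally show ?thesis using S.v_pos[OF y t, of i] by (simp add: zero_le_mult_iff)
qed

lemma viscous_nonneg: "0 \<le> lam * (u_y i y t)\<^sup>2 + \<mu> * (w_y i y t \<bullet> w_y i y t) + \<nu> * (b_y i y t \<bullet> b_y i y t)"
  using S.lam S.\<mu> S.\<nu> by simp

lemma dissipation_nonneg: "t \<in> {0..T} \<Longrightarrow> 0 \<le> S.dissipation i t"
  unfolding S.dissipation_def using F_\<theta>_y_nonneg[of _ t i] S.lam S.\<mu> S.\<nu> S.v_pos[of _ t i] S.\<theta>_pos[of _ t i]
  by (intro integral_nonneg_Icc add_nonneg_nonneg divide_nonneg_nonneg) (auto simp: less_imp_le)

lemma cont_dissipation: "continuous_on {0..T} (S.dissipation i)"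
  unfolding S.dissipation_def
  by (rule continuous_on_integral_param) (auto intro!: continuous_intros simp: case_prod_unfold)

text \<open>The time integral of the dissipation is the increase of the entropy. By
  \<open>ln x \<le> x - 1\<close> and \<open>\<theta>^3 \<le> 1 + \<theta>^4\<close> the entropy is
  bounded above by the energy and the total volume.\<close>

lemma dissipation_bound: "\<exists>C>0. \<forall>i. \<forall>t\<in>{0..T}. integral {0..t} (S.dissipation i) \<le> C"
proof -
  obtain E where E: "E > 0" "\<And>i t. t \<in> {0..T} \<Longrightarrow> integral {0..1} (\<lambda>y. \<theta> i y t) \<le> E"
    "\<And>i t. t \<in> {0..T} \<Longrightarrow> integral {0..1} (\<lambda>y. v i y t * \<theta> i y t ^ 4) \<le> E"
    using energy_bounds by blast
  obtain V where V: "V > 0" "\<And>i t. t \<in> {0..T} \<Longrightarrow> integral {0..1} (\<lambda>y. v i y t) \<le> V"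
    using v_integral_upper by blast
  have "\<exists>B>0. \<forall>i. \<bar>S.entropy i 0\<bar> \<le> B"
    unfolding S.entropy_def
  proof (rule initial_integral)
    fix i :: 'i and y :: real assume y: "y \<in> {0..1}"
    show "Cv * ln (\<theta> i y 0) + R * ln (v i y 0) + 4 / 3 * a * v i y 0 * \<theta> i y 0 ^ 3
      = Cv * ln (\<theta> undefined y 0) + R * ln (v undefined y 0) + 4 / 3 * a * v undefined y 0 * \<theta> undefined y 0 ^ 3"
      using initial[OF y, of i undefined] by simp
  qed
  then obtain B where B: "B > 0" "\<And>i. \<bar>S.entropy i 0\<bar> \<le> B" by blast
  define C where "C = B + (Cv * E + ((R + 4 / 3 * a) * V + 4 / 3 * a * E))"
  have "integral {0..t} (S.dissipation i) \<le> C" if t: "t \<in> {0..T}" for i t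
  proof -
    have "S.entropy i t \<le> integral {0..1} (\<lambda>y. Cv * \<theta> i y t + ((R + 4 / 3 * a) * v i y t
        + 4 / 3 * a * (v i y t * \<theta> i y t ^ 4)))"
      unfolding S.entropy_def
    proof (rule integral_mono_cont)
      fix y :: real assume y: "y \<in> {0..1}"
      note p = S.v_pos[OF y t, of i] S.\<theta>_pos[OF y t, of i]
      have "Cv * ln (\<theta> i y t) \<le> Cv * \<theta> i y t" "R * ln (v i y t) \<le> R * v i y t"
        using ln_le_minus_one[OF p(1)] ln_le_minus_one[OF p(2)] S.Cv S.R by auto
      moreover have "4 / 3 * a * v i y t * \<theta> i y t ^ 3 \<le> 4 / 3 * a * v i y t * (1 + \<theta> i y t ^ 4)"
        using p S.a by (intro mult_left_mono power_le_one_plus_power) auto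
      ultimately show "Cv * ln (\<theta> i y t) + R * ln (v i y t) + 4 / 3 * a * v i y t * \<theta> i y t ^ 3
        \<le> Cv * \<theta> i y t + ((R + 4 / 3 * a) * v i y t + 4 / 3 * a * (v i y t * \<theta> i y t ^ 4))"
        by (simp add: algebra_simps)
    qed (use t in \<open>auto intro!: continuous_intros\<close>)
    also have "\<dots> = Cv * integral {0..1} (\<lambda>y. \<theta> i y t) + ((R + 4 / 3 * a) * integral {0..1} (\<lambda>y. v i y t)
        + 4 / 3 * a * integral {0..1} (\<lambda>y. v i y t * \<theta> i y t ^ 4))"
      using t
      by (subst Henstock_Kurzweil_Integration.integral_add,
          (auto intro!: integrable_continuous_interval continuous_intros)[2],
          subst Henstock_Kurzweil_Integration.integral_add,
          (auto intro!: integrable_continuous_interval continuous_intros)[2], simp only: integral_mult_right)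
    also have "\<dots> \<le> Cv * E + ((R + 4 / 3 * a) * V + 4 / 3 * a * E)"
      using S.Cv S.R S.a E(2,3)[OF t, of i] V(2)[OF t, of i] by (intro add_mono mult_left_mono) auto
    finally show ?thesis using S.entropy_eq[OF t, of i] B(2)[of i] by (simp add: C_def)
  qed
  moreover have "C > 0" using B(1) E(1) V(1) S.Cv S.R S.a by (simp add: C_def add_pos_pos)
  ultimately show ?thesis by blast
qed

text \<open>The derivative of \<open>\<theta>^(m + 2)\<close> is split into
  \<open>\<theta>^m * |\<theta>_y| / (\<theta> * sqrt v)\<close> and
  \<open>sqrt v * \<theta>^2\<close>. By the lower growth condition the square of the first factor
  is controlled by the dissipation, while the square of the second is energy density. The weights
  \<open>sqrt v\<close> avoid an upper bound on \<open>v\<close>, which is derived only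
  afterwards.\<close>

lemma \<theta>_power_bound:
  "\<exists>C>0. \<forall>i. \<forall>y\<in>{0..1}. \<forall>t\<in>{0..T}. \<theta> i y t ^ (2 * m + 4) \<le> C * (1 + S.dissipation i t)"
proof -
  obtain E where E: "E > 0" "\<And>i t. t \<in> {0..T} \<Longrightarrow> integral {0..1} (\<lambda>y. \<theta> i y t) \<le> E"
    "\<And>i t. t \<in> {0..T} \<Longrightarrow> integral {0..1} (\<lambda>y. v i y t * \<theta> i y t ^ 4) \<le> E"
    using energy_bounds by blast
  define A where "A = (real (m + 2))\<^sup>2 * (E / k1)"
  define C where "C = 2 * E ^ (2 * m + 4) + 2 * A"
  have A: "A > 0" using E(1) k1 by (simp add: A_def)
  have "\<theta> i y t ^ (2 * m + 4) \<le> C * (1 + S.dissipation i t)" if y: "y \<in> {0..1}" and t: "t \<in> {0..T}" for i y t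
  proof -
    let ?D = "S.dissipation i t"
    have D: "0 \<le> ?D" by (rule dissipation_nonneg[OF t])
    have "continuous_on {0..1} (\<lambda>y. \<theta> i y t)" using t by (auto intro!: continuous_intros)
    then obtain z where z: "z \<in> {0..1}" "\<theta> i z t \<le> E"
      using exists_le_integral[of "\<lambda>y. \<theta> i y t"] E(2)[OF t, of i] by force
    let ?f' = "\<lambda>y. real (m + 2) * (\<theta>_y i y t * \<theta> i y t ^ (m + 1))"
    have "((\<lambda>y. \<theta> i y t ^ (m + 2)) has_real_derivative ?f' y) (at y within {0..1})" if y: "y \<in> {0..1}" for y
      by (rule DERIV_cong[OF DERIV_power[OF S.\<theta>_Dy[OF y t]]]) simp
    then have "norm (\<theta> i y t ^ (m + 2) - \<theta> i z t ^ (m + 2)) \<le> integral {0..1} (\<lambda>y. norm (?f' y))"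
      by (intro norm_diff_le_integral_derivative[OF _ _ z(1) y])
        (use t in \<open>auto intro!: continuous_intros simp flip: has_real_derivative_iff_has_vector_derivative\<close>)
    also have "\<dots> = real (m + 2) * integral {0..1} (\<lambda>y. \<theta> i y t ^ m * \<bar>\<theta>_y i y t\<bar> / (\<theta> i y t * sqrt (v i y t))
        * (sqrt (v i y t) * (\<theta> i y t)\<^sup>2))"
    proof -
      have "integral {0..1} (\<lambda>y. norm (?f' y)) = integral {0..1} (\<lambda>y. real (m + 2) *
        (\<theta> i y t ^ m * \<bar>\<theta>_y i y t\<bar> / (\<theta> i y t * sqrt (v i y t)) * (sqrt (v i y t) * (\<theta> i y t)\<^sup>2)))"
      proof (rule Henstock_Kurzweil_Integration.integral_cong)
        fix y :: real assume y: "y \<in> {0..1}"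
        show "norm (?f' y) = real (m + 2) *
          (\<theta> i y t ^ m * \<bar>\<theta>_y i y t\<bar> / (\<theta> i y t * sqrt (v i y t)) * (sqrt (v i y t) * (\<theta> i y t)\<^sup>2))"
        proof -
          have "norm (?f' y) = real (m + 2) * (\<theta> i y t ^ (m + 1) * \<bar>\<theta>_y i y t\<bar>)"
            using S.\<theta>_pos[OF y t, of i] by (simp add: abs_mult mult_ac del: of_nat_add)
          moreover have "\<theta> i y t ^ (m + 1) * \<bar>\<theta>_y i y t\<bar>
            = \<theta> i y t ^ m * \<bar>\<theta>_y i y t\<bar> / (\<theta> i y t * sqrt (v i y t)) * (sqrt (v i y t) * (\<theta> i y t)\<^sup>2)"
            using S.v_pos[OF y t, of i] S.\<theta>_pos[OF y t, of i] by (simp add: power2_eq_square field_simps)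
          ultimately show ?thesis by simp
        qed
      qed
      then show ?thesis by simp
    qed
    finally have 0: "norm (\<theta> i y t ^ (m + 2) - \<theta> i z t ^ (m + 2)) \<le> real (m + 2) * integral {0..1}
        (\<lambda>y. \<theta> i y t ^ m * \<bar>\<theta>_y i y t\<bar> / (\<theta> i y t * sqrt (v i y t)) * (sqrt (v i y t) * (\<theta> i y t)\<^sup>2))" .
    have "(\<theta> i y t ^ (m + 2) - \<theta> i z t ^ (m + 2))\<^sup>2 \<le> (real (m + 2) * integral {0..1}
        (\<lambda>y. \<theta> i y t ^ m * \<bar>\<theta>_y i y t\<bar> / (\<theta> i y t * sqrt (v i y t)) * (sqrt (v i y t) * (\<theta> i y t)\<^sup>2)))\<^sup>2"
      using power_mono[OF 0 norm_ge_zero, of 2] unfolding real_norm_def power2_abs .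
    also have "\<dots> \<le> (real (m + 2))\<^sup>2 *
      (integral {0..1} (\<lambda>y. (\<theta> i y t ^ m * \<bar>\<theta>_y i y t\<bar> / (\<theta> i y t * sqrt (v i y t)))\<^sup>2)
       * integral {0..1} (\<lambda>y. (sqrt (v i y t) * (\<theta> i y t)\<^sup>2)\<^sup>2))"
      unfolding power_mult_distrib[of "real (m + 2)"]
      by (intro mult_left_mono integral_Cauchy_Schwarz)
        (use t in \<open>auto intro!: continuous_intros simp: less_imp_le[OF S.v_pos]\<close>)
    also have "\<dots> \<le> (real (m + 2))\<^sup>2 * ((?D / k1) * E)"
    proof (intro mult_left_mono mult_mono)
      have "integral {0..1} (\<lambda>y. (\<theta> i y t ^ m * \<bar>\<theta>_y i y t\<bar> / (\<theta> i y t * sqrt (v i y t)))\<^sup>2)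
        \<le> integral {0..1} (\<lambda>y. (1 / k1) * (F i y t * \<theta>_y i y t / (\<theta> i y t)\<^sup>2
          + (lam * (u_y i y t)\<^sup>2 + \<mu> * (w_y i y t \<bullet> w_y i y t) + \<nu> * (b_y i y t \<bullet> b_y i y t)) / (v i y t * \<theta> i y t)))"
      proof (rule integral_mono_cont)
        fix y :: real assume y: "y \<in> {0..1}"
        note p = S.v_pos[OF y t, of i] S.\<theta>_pos[OF y t, of i]
        have "(\<theta> i y t ^ m * \<bar>\<theta>_y i y t\<bar> / (\<theta> i y t * sqrt (v i y t)))\<^sup>2
          = \<theta> i y t ^ (2 * m) * (\<theta>_y i y t)\<^sup>2 / (v i y t * (\<theta> i y t)\<^sup>2)"
          using p by (simp add: power_mult_distrib power_divide power_mult[symmetric] mult.commute)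
        also have "\<dots> \<le> (v i y t * (F i y t * \<theta>_y i y t) / k1) / (v i y t * (\<theta> i y t)\<^sup>2)"
        proof (rule divide_right_mono)
          have "k1 * (\<theta> i y t ^ (2 * m) * (\<theta>_y i y t)\<^sup>2) \<le> k1 * (1 + \<theta> i y t ^ (2 * m)) * (\<theta>_y i y t)\<^sup>2"
            using k1 by (simp add: algebra_simps)
          also note F_lower[OF y t, of i]
          finally show "\<theta> i y t ^ (2 * m) * (\<theta>_y i y t)\<^sup>2 \<le> v i y t * (F i y t * \<theta>_y i y t) / k1"
            using k1 by (simp add: field_simps)
        qed (use p in simp)
        also have "\<dots> = (1 / k1) * (F i y t * \<theta>_y i y t / (\<theta> i y t)\<^sup>2)" using p by simp
        also have "\<dots> \<le> (1 / k1) * (F i y t * \<theta>_y i y t / (\<theta> i y t)\<^sup>2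
          + (lam * (u_y i y t)\<^sup>2 + \<mu> * (w_y i y t \<bullet> w_y i y t) + \<nu> * (b_y i y t \<bullet> b_y i y t)) / (v i y t * \<theta> i y t))"
          using p k1 viscous_nonneg[of i y t] by (intro mult_left_mono) auto
        finally show "(\<theta> i y t ^ m * \<bar>\<theta>_y i y t\<bar> / (\<theta> i y t * sqrt (v i y t)))\<^sup>2 \<le> \<dots>" .
      qed (use t k1 in \<open>auto intro!: continuous_intros simp: less_imp_le[OF S.v_pos]\<close>)
      also have "\<dots> = ?D / k1" by (simp add: S.dissipation_def)
      finally show "integral {0..1} (\<lambda>y. (\<theta> i y t ^ m * \<bar>\<theta>_y i y t\<bar> / (\<theta> i y t * sqrt (v i y t)))\<^sup>2) \<le> ?D / k1" .
      have "integral {0..1} (\<lambda>y. (sqrt (v i y t) * (\<theta> i y t)\<^sup>2)\<^sup>2) = integral {0..1} (\<lambda>y. v i y t * \<theta> i y t ^ 4)"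
        by (rule Henstock_Kurzweil_Integration.integral_cong)
          (use t S.v_pos[of _ t i] in \<open>simp add: power_mult_distrib less_imp_le power_mult[symmetric]\<close>)
      then show "integral {0..1} (\<lambda>y. (sqrt (v i y t) * (\<theta> i y t)\<^sup>2)\<^sup>2) \<le> E" using E(3)[OF t, of i] by simp
    qed (use D k1 in \<open>auto intro!: integral_nonneg_Icc\<close>)
    also have "\<dots> = A * ?D" by (simp add: A_def)
    finally have 1: "(\<theta> i y t ^ (m + 2) - \<theta> i z t ^ (m + 2))\<^sup>2 \<le> A * ?D" .
    have pw: "x ^ (2 * m + 4) = (x ^ (m + 2))\<^sup>2" for x :: real
    proof -
      have "2 * m + 4 = (m + 2) * 2" by simp
      then show ?thesis by (simp only: power_mult)
    qed
    have "\<theta> i y t ^ (2 * m + 4) = (\<theta> i z t ^ (m + 2) + (\<theta> i y t ^ (m + 2) - \<theta> i z t ^ (m + 2)))\<^sup>2"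
      by (simp add: pw)
    also have "\<dots> \<le> 2 * (\<theta> i z t ^ (m + 2))\<^sup>2 + 2 * (\<theta> i y t ^ (m + 2) - \<theta> i z t ^ (m + 2))\<^sup>2"
      by (rule square_sum_le)
    also have "(\<theta> i z t ^ (m + 2))\<^sup>2 = \<theta> i z t ^ (2 * m + 4)"
      by (simp add: pw)
    also have "\<theta> i z t ^ (2 * m + 4) \<le> E ^ (2 * m + 4)"
      using z S.\<theta>_pos[OF z(1) t, of i] by (intro power_mono) auto
    also note 1
    also have "2 * E ^ (2 * m + 4) + 2 * (A * ?D) \<le> C * (1 + ?D)"
      using E(1) A D by (simp add: C_def algebra_simps)
    finally show ?thesis by simp
  qed
  moreover have "C > 0" using E(1) A by (simp add: C_def add_pos_pos)
  ultimately show ?thesis by blast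
qed

lemma \<theta>_power_bound_le:
  "\<exists>C>0. \<forall>j\<le>2 * m + 4. \<forall>i. \<forall>y\<in>{0..1}. \<forall>t\<in>{0..T}. \<theta> i y t ^ j \<le> C * (1 + S.dissipation i t)"
proof -
  obtain C where C: "C > 0"
    "\<And>i y t. y \<in> {0..1} \<Longrightarrow> t \<in> {0..T} \<Longrightarrow> \<theta> i y t ^ (2 * m + 4) \<le> C * (1 + S.dissipation i t)"
    using \<theta>_power_bound by blast
  have "\<theta> i y t ^ j \<le> (1 + C) * (1 + S.dissipation i t)"
    if "j \<le> 2 * m + 4" and y: "y \<in> {0..1}" and t: "t \<in> {0..T}" for i y t j
  proof -
    have "\<theta> i y t ^ j \<le> 1 + \<theta> i y t ^ (2 * m + 4)"
      using that S.\<theta>_pos[OF y t, of i] by (intro power_le_one_plus_power) auto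
    also have "\<dots> \<le> (1 + C) * (1 + S.dissipation i t)"
      using C(2)[OF y t, of i] dissipation_nonneg[OF t, of i] by (simp add: algebra_simps)
    finally show ?thesis .
  qed
  then show ?thesis using C(1) by (intro exI[of _ "1 + C"]) auto
qed

text \<open>As \<open>b\<close> vanishes at \<open>y = 0\<close>, its square is at most the integral
  of \<open>2 |b| |b_y|\<close>. Young's inequality with weight \<open>v * \<theta>\<close> splits
  this into resistive dissipation and \<open>\<theta>\<close> times magnetic energy, and the
  supremum of \<open>\<theta>\<close> is again bounded by the dissipation.\<close>

lemma b_bound: "\<exists>C>0. \<forall>i. \<forall>y\<in>{0..1}. \<forall>t\<in>{0..T}. b i y t \<bullet> b i y t \<le> C * (1 + S.dissipation i t)"
proof -
  obtain E where E: "E > 0"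
    "\<And>i t. t \<in> {0..T} \<Longrightarrow> integral {0..1} (\<lambda>y. v i y t * (b i y t \<bullet> b i y t)) \<le> E"
    using energy_bounds by blast
  obtain C where C: "C > 0"
    "\<And>j i y t. j \<le> 2 * m + 4 \<Longrightarrow> y \<in> {0..1} \<Longrightarrow> t \<in> {0..T} \<Longrightarrow> \<theta> i y t ^ j \<le> C * (1 + S.dissipation i t)"
    using \<theta>_power_bound_le by blast
  define K where "K = 1 / \<nu> + C * E"
  have "b i y t \<bullet> b i y t \<le> K * (1 + S.dissipation i t)" if y: "y \<in> {0..1}" and t: "t \<in> {0..T}" for i y t
  proof -
    let ?D = "S.dissipation i t"
    have D: "0 \<le> ?D" by (rule dissipation_nonneg[OF t])
    have z: "0 \<in> {0..1::real}" by simp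
    have "((\<lambda>y. b i y t \<bullet> b i y t) has_real_derivative 2 * (b i y t \<bullet> b_y i y t)) (at y within {0..1})"
      if y: "y \<in> {0..1}" for y
      by (rule has_real_derivative_inner[OF S.b_Dy[OF y t] S.b_Dy[OF y t]]) (simp add: inner_commute)
    then have "norm (b i y t \<bullet> b i y t - b i 0 t \<bullet> b i 0 t) \<le> integral {0..1} (\<lambda>y. norm (2 * (b i y t \<bullet> b_y i y t)))"
      by (intro norm_diff_le_integral_derivative[OF _ _ z y])
        (use t in \<open>auto intro!: continuous_intros simp flip: has_real_derivative_iff_has_vector_derivative\<close>)
    then have "b i y t \<bullet> b i y t \<le> integral {0..1} (\<lambda>y. norm (2 * (b i y t \<bullet> b_y i y t)))"
      using S.boundary[of 0 t i] t by simp
    also have "\<dots> \<le> integral {0..1} (\<lambda>y. 1 / \<nu> * (F i y t * \<theta>_y i y t / (\<theta> i y t)\<^sup>2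
          + (lam * (u_y i y t)\<^sup>2 + \<mu> * (w_y i y t \<bullet> w_y i y t) + \<nu> * (b_y i y t \<bullet> b_y i y t)) / (v i y t * \<theta> i y t))
          + C * (1 + ?D) * (v i y t * (b i y t \<bullet> b i y t)))"
    proof (rule integral_mono_cont)
      fix y :: real assume y: "y \<in> {0..1}"
      note p = S.v_pos[OF y t, of i] S.\<theta>_pos[OF y t, of i]
      have "norm (2 * (b i y t \<bullet> b_y i y t)) \<le> 2 * (norm (b i y t) * norm (b_y i y t))"
        using Cauchy_Schwarz_ineq2[of "b i y t" "b_y i y t"] by simp
      also have "\<dots> \<le> b_y i y t \<bullet> b_y i y t / (v i y t * \<theta> i y t) + v i y t * \<theta> i y t * (b i y t \<bullet> b i y t)"
        using young[of "v i y t * \<theta> i y t" "norm (b i y t)" "norm (b_y i y t)"] p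
        by (simp add: power2_norm_eq_inner)
      also have "b_y i y t \<bullet> b_y i y t / (v i y t * \<theta> i y t) \<le> 1 / \<nu> * (F i y t * \<theta>_y i y t / (\<theta> i y t)\<^sup>2
          + (lam * (u_y i y t)\<^sup>2 + \<mu> * (w_y i y t \<bullet> w_y i y t) + \<nu> * (b_y i y t \<bullet> b_y i y t)) / (v i y t * \<theta> i y t))"
      proof -
        have "\<nu> * (b_y i y t \<bullet> b_y i y t) / (v i y t * \<theta> i y t)
          \<le> (lam * (u_y i y t)\<^sup>2 + \<mu> * (w_y i y t \<bullet> w_y i y t) + \<nu> * (b_y i y t \<bullet> b_y i y t)) / (v i y t * \<theta> i y t)"
          using p S.lam S.\<mu> by (intro divide_right_mono) auto
        also have "\<dots> \<le> F i y t * \<theta>_y i y t / (\<theta> i y t)\<^sup>2 + \<dots>" using F_\<theta>_y_nonneg[OF y t, of i] by simp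
        finally show ?thesis using S.\<nu> by (simp add: field_simps)
      qed
      also have "v i y t * \<theta> i y t * (b i y t \<bullet> b i y t) \<le> C * (1 + ?D) * (v i y t * (b i y t \<bullet> b i y t))"
        using mult_right_mono[OF C(2)[OF _ y t, of 1 i], of "v i y t * (b i y t \<bullet> b i y t)"] p by (simp add: mult_ac)
      finally show "norm (2 * (b i y t \<bullet> b_y i y t)) \<le> 1 / \<nu> * (F i y t * \<theta>_y i y t / (\<theta> i y t)\<^sup>2
          + (lam * (u_y i y t)\<^sup>2 + \<mu> * (w_y i y t \<bullet> w_y i y t) + \<nu> * (b_y i y t \<bullet> b_y i y t)) / (v i y t * \<theta> i y t))
          + C * (1 + ?D) * (v i y t * (b i y t \<bullet> b i y t))" by simp
    qed (use t S.\<nu> in \<open>auto intro!: continuous_intros\<close>)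
    also have "\<dots> = 1 / \<nu> * ?D + C * (1 + ?D) * integral {0..1} (\<lambda>y. v i y t * (b i y t \<bullet> b i y t))"
      unfolding S.dissipation_def using t S.\<nu>
      by (subst Henstock_Kurzweil_Integration.integral_add,
          (auto intro!: integrable_continuous_interval continuous_intros)[2], simp only: integral_mult_right)
    also have "\<dots> \<le> 1 / \<nu> * ?D + C * (1 + ?D) * E"
      using E(2)[OF t, of i] C(1) D by (intro add_left_mono mult_left_mono) auto
    also have "\<dots> \<le> K * (1 + ?D)" using S.\<nu> by (simp add: K_def algebra_simps)
    finally show ?thesis .
  qed
  moreover have "K > 0" using S.\<nu> C(1) E(1) by (simp add: K_def add_pos_pos)
  ultimately show ?thesis by blast
qed

lemma f_bound: "\<exists>C>0. \<forall>i. \<forall>y\<in>{0..1}. \<forall>t\<in>{0..T}. f i y t \<le> C * (1 + S.dissipation i t)"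
proof -
  obtain c where c: "c > 0" "\<And>i y t. y \<in> {0..1} \<Longrightarrow> t \<in> {0..T} \<Longrightarrow> c \<le> v i y t" using v_lower by blast
  obtain C where C: "C > 0"
    "\<And>j i y t. j \<le> 2 * m + 4 \<Longrightarrow> y \<in> {0..1} \<Longrightarrow> t \<in> {0..T} \<Longrightarrow> \<theta> i y t ^ j \<le> C * (1 + S.dissipation i t)"
    using \<theta>_power_bound_le by blast
  obtain B where B: "B > 0"
    "\<And>i y t. y \<in> {0..1} \<Longrightarrow> t \<in> {0..T} \<Longrightarrow> b i y t \<bullet> b i y t \<le> B * (1 + S.dissipation i t)"
    using b_bound by blast
  have "f i y t \<le> (R / c * C + a / 3 * C + B / 2) * (1 + S.dissipation i t)"
    if y: "y \<in> {0..1}" and t: "t \<in> {0..T}" for i y t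
  proof -
    have "R * \<theta> i y t / v i y t \<le> R * \<theta> i y t / c"
      using c(1) c(2)[OF y t, of i] S.\<theta>_pos[OF y t, of i] S.R by (intro divide_left_mono) auto
    also have "\<dots> \<le> R / c * (C * (1 + S.dissipation i t))"
      using mult_left_mono[OF C(2)[of 1 y t i], of "R / c"] y t S.R c(1) by simp
    finally have "R * \<theta> i y t / v i y t \<le> R / c * (C * (1 + S.dissipation i t))" .
    moreover have "a / 3 * \<theta> i y t ^ 4 \<le> a / 3 * (C * (1 + S.dissipation i t))"
      using C(2)[of 4 y t i] y t S.a by (intro mult_left_mono) auto
    ultimately show ?thesis using B(2)[OF y t, of i] by (simp add: S.f_eq algebra_simps)
  qed
  moreover have "0 < R / c * C + a / 3 * C + B / 2" using c(1) C(1) B(1) S.R S.a by (simp add: add_pos_pos)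
  ultimately show ?thesis by blast
qed

text \<open>The growth rate \<open>f\<close> of \<open>logvol\<close> is bounded, uniformly in
  \<open>y\<close>, by a multiple of one plus the dissipation, and the latter is integrable in
  time.\<close>

lemma v_upper: "\<exists>C>0. \<forall>i. \<forall>y\<in>{0..1}. \<forall>t\<in>{0..T}. v i y t \<le> C"
proof -
  obtain B where B: "\<And>i y t. y \<in> {0..1} \<Longrightarrow> t \<in> {0..T} \<Longrightarrow> \<bar>integral {0..y} (\<lambda>x. u i x t)\<bar> \<le> B"
    using displacement_bound by blast
  obtain B' where B': "\<And>i y. y \<in> {0..1} \<Longrightarrow> \<bar>S.logvol i y 0\<bar> \<le> B'"
    using initial_logvol_bound by blast
  obtain C where C: "C > 0" "\<And>i y t. y \<in> {0..1} \<Longrightarrow> t \<in> {0..T} \<Longrightarrow> f i y t \<le> C * (1 + S.dissipation i t)"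
    using f_bound by blast
  obtain D where D: "D > 0" "\<And>i t. t \<in> {0..T} \<Longrightarrow> integral {0..t} (S.dissipation i) \<le> D"
    using dissipation_bound by blast
  let ?K = "(B + B' + C * (T + D)) / lam"
  have "v i y t \<le> exp ?K" if y: "y \<in> {0..1}" and t: "t \<in> {0..T}" for i y t
  proof -
    have cD: "continuous_on {0..t} (S.dissipation i)"
      using t by (intro continuous_on_subset[OF cont_dissipation]) auto
    have "integral {0..t} (\<lambda>s. f i y s) \<le> integral {0..t} (\<lambda>s. C * (1 + S.dissipation i s))"
      by (rule integral_mono_cont) (use t y C(2) in \<open>auto intro!: continuous_intros cD\<close>)
    also have "\<dots> = C * (t + integral {0..t} (S.dissipation i))"
      using t by (simp only: integral_mult_right, subst Henstock_Kurzweil_Integration.integral_add)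
        (auto intro!: integrable_continuous_interval cD)
    also have "\<dots> \<le> C * (T + D)" using t D(2)[OF t, of i] C(1) by (intro mult_left_mono) auto
    finally have "lam * ln (v i y t) \<le> B + B' + C * (T + D)"
      using S.logvol_eq[OF y t, of i] B[OF y t, of i] B'[OF y, of i] by (simp add: S.logvol_def)
    then have "ln (v i y t) \<le> ?K" using S.lam by (simp add: field_simps)
    then show ?thesis using S.v_pos[OF y t, of i] by (metis exp_le_cancel_iff exp_ln)
  qed
  then show ?thesis by (intro exI[of _ "exp ?K"]) auto
qed

end

text \<open>Made for terms such as \<open>|u_y| * q^2\<close> in which the supremum \<open>M\<close>
  of \<open>q^2\<close> costs a dissipative norm: a small share \<open>\<delta>\<close> of it is
  spent, and the rest is a product of two \<open>L^2\<close> norms that fits Gronwall's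
  inequality.\<close>

lemma integral_triple_le:
  fixes p q h :: "real \<Rightarrow> real"
  assumes cont: "continuous_on {0..1} p" "continuous_on {0..1} q" "continuous_on {0..1} h"
    and M: "\<And>y. y \<in> {0..1} \<Longrightarrow> (q y)\<^sup>2 \<le> M" and \<delta>: "0 < \<delta>"
  shows "integral {0..1} (\<lambda>y. \<bar>p y\<bar> * \<bar>q y\<bar> * \<bar>h y\<bar>)
    \<le> \<delta> * M + integral {0..1} (\<lambda>y. (p y)\<^sup>2) * integral {0..1} (\<lambda>y. (h y)\<^sup>2) / (4 * \<delta>)"
proof -
  let ?x = "integral {0..1} (\<lambda>y. \<bar>p y\<bar> * \<bar>h y\<bar>)"
  have "0 \<le> M" using M[of 0] by (meson atLeastAtMost_iff order_refl order_trans zero_le_one zero_le_power2)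
  have "integral {0..1} (\<lambda>y. \<bar>p y\<bar> * \<bar>q y\<bar> * \<bar>h y\<bar>) \<le> integral {0..1} (\<lambda>y. sqrt M * (\<bar>p y\<bar> * \<bar>h y\<bar>))"
  proof (rule integral_mono_cont)
    fix y :: real assume "y \<in> {0..1}"
    from real_sqrt_le_mono[OF M[OF this]] have "\<bar>q y\<bar> \<le> sqrt M" by simp
    then have "\<bar>q y\<bar> * (\<bar>p y\<bar> * \<bar>h y\<bar>) \<le> sqrt M * (\<bar>p y\<bar> * \<bar>h y\<bar>)" by (intro mult_right_mono) auto
    then show "\<bar>p y\<bar> * \<bar>q y\<bar> * \<bar>h y\<bar> \<le> sqrt M * (\<bar>p y\<bar> * \<bar>h y\<bar>)" by (simp add: mult_ac)
  qed (intro continuous_intros cont)+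
  also have "\<dots> = sqrt M * ?x" by simp
  also have "\<dots> \<le> (2 * \<delta>) * (sqrt M)\<^sup>2 / 2 + ?x\<^sup>2 / (2 * (2 * \<delta>))"
    using \<delta> by (intro young) simp
  also have "\<dots> = \<delta> * M + ?x\<^sup>2 / (4 * \<delta>)" using \<open>0 \<le> M\<close> by simp
  also have "?x\<^sup>2 \<le> integral {0..1} (\<lambda>y. (p y)\<^sup>2) * integral {0..1} (\<lambda>y. (h y)\<^sup>2)"
    using integral_Cauchy_Schwarz[of "\<lambda>y. \<bar>p y\<bar>" "\<lambda>y. \<bar>h y\<bar>"] cont
    by (simp add: continuous_on_rabs)
  finally show ?thesis using \<delta> by (simp add: divide_right_mono)
qed

lemma norm_add_square_le: "(norm (x + y))\<^sup>2 \<le> 2 * (norm x)\<^sup>2 + 2 * (norm (y::'a::real_normed_vector))\<^sup>2"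
proof -
  have "(norm (x + y))\<^sup>2 \<le> (norm x + norm y)\<^sup>2" by (intro power_mono norm_triangle_ineq) simp
  also note square_sum_le
  finally show ?thesis .
qed

context mhd_family begin

section \<open>Uniform bounds on the transverse fields\<close>

definition gradients where "gradients i t = integral {0..1} (\<lambda>y. (u_y i y t)\<^sup>2 + w_y i y t \<bullet> w_y i y t + b_y i y t \<bullet> b_y i y t)"

text \<open>The weight in all Gronwall arguments below. The summand 1 lets it dominate
  constants.\<close>

definition rate where "rate i t = 1 + S.dissipation i t + gradients i t"

lemma gradients_nonneg: "0 \<le> gradients i t"
  unfolding gradients_def by (rule integral_nonneg_Icc) simp

lemma rate_ge:
  assumes "t \<in> {0..T}"
  shows "1 + S.dissipation i t \<le> rate i t" "gradients i t \<le> rate i t" "1 \<le> rate i t"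
  using gradients_nonneg[of i t] dissipation_nonneg[OF assms, of i] by (simp_all add: rate_def)

lemma cont_gradients: "continuous_on {0..T} (gradients i)"
  unfolding gradients_def
  by (rule continuous_on_integral_param) (auto intro!: continuous_intros simp: case_prod_unfold)

lemma cont_rate: "continuous_on {0..T} (rate i)"
  unfolding rate_def by (intro continuous_intros cont_dissipation cont_gradients)

text \<open>The work of the pressure \<open>p\<close> is absorbed by half of the viscosity up to
  \<open>v * p^2 / (2 * lam)\<close>. One factor \<open>p\<close> is bounded pointwise by the
  dissipation; the other, \<open>v * p\<close>, has an integral bounded by the energy.\<close>

lemma gradients_bound: "\<exists>C>0. \<forall>i. \<forall>t\<in>{0..T}. integral {0..t} (gradients i) \<le> C"
proof -
  obtain E where E: "E > 0" "\<And>i t. t \<in> {0..T} \<Longrightarrow> integral {0..1} (\<lambda>y. \<theta> i y t) \<le> E"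
    "\<And>i t. t \<in> {0..T} \<Longrightarrow> integral {0..1} (\<lambda>y. v i y t * \<theta> i y t ^ 4) \<le> E"
    using energy_bounds by blast
  obtain V where V: "V > 0" "\<And>i y t. y \<in> {0..1} \<Longrightarrow> t \<in> {0..T} \<Longrightarrow> v i y t \<le> V" using v_upper by blast
  obtain C where C: "C > 0" "\<And>i y t. y \<in> {0..1} \<Longrightarrow> t \<in> {0..T} \<Longrightarrow> f i y t \<le> C * (1 + S.dissipation i t)"
    using f_bound by blast
  obtain D where D: "D > 0" "\<And>i t. t \<in> {0..T} \<Longrightarrow> integral {0..t} (S.dissipation i) \<le> D"
    using dissipation_bound by blast
  have "\<exists>B>0. \<forall>i. \<bar>S.kinetic i 0\<bar> \<le> B"
    unfolding S.kinetic_def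
  proof (rule initial_integral)
    fix i :: 'i and y :: real assume y: "y \<in> {0..1}"
    show "(u i y 0)\<^sup>2 / 2 + w i y 0 \<bullet> w i y 0 / 2 + v i y 0 * (b i y 0 \<bullet> b i y 0) / 2
      = (u undefined y 0)\<^sup>2 / 2 + w undefined y 0 \<bullet> w undefined y 0 / 2
        + v undefined y 0 * (b undefined y 0 \<bullet> b undefined y 0) / 2"
      using initial[OF y, of i undefined] by simp
  qed
  then obtain B where B: "B > 0" "\<And>i. \<bar>S.kinetic i 0\<bar> \<le> B" by blast
  \<comment> \<open>The half of the dissipative terms that survives the absorption, with
    \<open>v\<close> replaced by its upper bound.\<close>
  define k where "k = min lam (min \<mu> \<nu>) / (2 * V)"
  have k: "k > 0" using V(1) S.lam S.\<mu> S.\<nu> by (simp add: k_def)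
  define A where "A = C / (2 * lam) * (R * E + a / 3 * E)"
  have A: "A > 0" using C(1) S.lam S.R S.a E(1) by (simp add: A_def add_pos_pos)
  have "integral {0..t} (gradients i) \<le> (B + A * (T + D)) / k" if t: "t \<in> {0..T}" for i t
  proof -
    have cD: "continuous_on {0..t} (S.dissipation i)" "continuous_on {0..t} (gradients i)"
      using t by (auto intro: continuous_on_subset[OF cont_dissipation] continuous_on_subset[OF cont_gradients])
    have "0 \<le> S.kinetic i t"
      unfolding S.kinetic_def using t S.v_pos[of _ t i]
      by (intro integral_nonneg_Icc add_nonneg_nonneg divide_nonneg_nonneg mult_nonneg_nonneg) (auto simp: less_imp_le)
    also have "S.kinetic i t = S.kinetic i 0 + integral {0..t} (\<lambda>s. integral {0..1} (\<lambda>y.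
      (R * \<theta> i y s / v i y s + a / 3 * \<theta> i y s ^ 4) * u_y i y s
       - (lam * (u_y i y s)\<^sup>2 + \<mu> * (w_y i y s \<bullet> w_y i y s) + \<nu> * (b_y i y s \<bullet> b_y i y s)) / v i y s))"
      by (rule S.kinetic_eq[OF t])
    also have "integral {0..t} (\<lambda>s. integral {0..1} (\<lambda>y.
      (R * \<theta> i y s / v i y s + a / 3 * \<theta> i y s ^ 4) * u_y i y s
       - (lam * (u_y i y s)\<^sup>2 + \<mu> * (w_y i y s \<bullet> w_y i y s) + \<nu> * (b_y i y s \<bullet> b_y i y s)) / v i y s))
     \<le> integral {0..t} (\<lambda>s. A * (1 + S.dissipation i s) - k * gradients i s)"
    proof (rule integral_mono_cont)
      show "continuous_on {0..t} (\<lambda>s. integral {0..1} (\<lambda>y.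
        (R * \<theta> i y s / v i y s + a / 3 * \<theta> i y s ^ 4) * u_y i y s
         - (lam * (u_y i y s)\<^sup>2 + \<mu> * (w_y i y s \<bullet> w_y i y s) + \<nu> * (b_y i y s \<bullet> b_y i y s)) / v i y s))"
        by (rule continuous_on_integral_param) (use t in \<open>auto intro!: continuous_intros simp: case_prod_unfold\<close>)
    next
      fix s assume "s \<in> {0..t}"
      then have s: "s \<in> {0..T}" using t by auto
      let ?c = "C * (1 + S.dissipation i s) / (2 * lam)"
      have "integral {0..1} (\<lambda>y. (R * \<theta> i y s / v i y s + a / 3 * \<theta> i y s ^ 4) * u_y i y s
         - (lam * (u_y i y s)\<^sup>2 + \<mu> * (w_y i y s \<bullet> w_y i y s) + \<nu> * (b_y i y s \<bullet> b_y i y s)) / v i y s)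
       \<le> integral {0..1} (\<lambda>y. ?c * (R * \<theta> i y s + a / 3 * (v i y s * \<theta> i y s ^ 4))
          - k * ((u_y i y s)\<^sup>2 + w_y i y s \<bullet> w_y i y s + b_y i y s \<bullet> b_y i y s))"
      proof (rule integral_mono_cont)
        fix y :: real assume y: "y \<in> {0..1}"
        note p = S.v_pos[OF y s, of i] S.\<theta>_pos[OF y s, of i]
        let ?p = "R * \<theta> i y s / v i y s + a / 3 * \<theta> i y s ^ 4"
        let ?X = "lam * (u_y i y s)\<^sup>2 + \<mu> * (w_y i y s \<bullet> w_y i y s) + \<nu> * (b_y i y s \<bullet> b_y i y s)"
        have "?p \<le> C * (1 + S.dissipation i s)"
          using C(2)[OF y s, of i] inner_ge_zero[of "b i y s"] by (simp only: S.f_eq)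
        moreover have vp: "v i y s * ?p = R * \<theta> i y s + a / 3 * (v i y s * \<theta> i y s ^ 4)"
          using p by (simp add: field_simps)
        moreover have "0 \<le> R * \<theta> i y s + a / 3 * (v i y s * \<theta> i y s ^ 4)"
          using p S.R S.a by simp
        ultimately have "?p * (v i y s * ?p) \<le> C * (1 + S.dissipation i s) * (R * \<theta> i y s + a / 3 * (v i y s * \<theta> i y s ^ 4))"
          by (simp only: vp) (rule mult_right_mono)
        then have "?p\<^sup>2 * v i y s / (2 * lam) \<le> ?c * (R * \<theta> i y s + a / 3 * (v i y s * \<theta> i y s ^ 4))"
          using S.lam by (simp add: divide_right_mono power2_eq_square mult_ac)
        moreover have "?p * u_y i y s \<le> lam * (u_y i y s)\<^sup>2 / (2 * v i y s) + ?p\<^sup>2 * v i y s / (2 * lam)"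
          using young[of "lam / v i y s" "u_y i y s" ?p] p S.lam by (simp add: mult.commute)
        moreover have "lam * (u_y i y s)\<^sup>2 / (2 * v i y s) \<le> ?X / (2 * v i y s)"
          using p S.\<mu> S.\<nu> by (intro divide_right_mono) auto
        moreover have "k * ((u_y i y s)\<^sup>2 + w_y i y s \<bullet> w_y i y s + b_y i y s \<bullet> b_y i y s) \<le> ?X / (2 * v i y s)"
        proof -
          let ?m = "min lam (min \<mu> \<nu>)"
          have "?m * ((u_y i y s)\<^sup>2 + w_y i y s \<bullet> w_y i y s + b_y i y s \<bullet> b_y i y s) \<le> ?X"
            unfolding distrib_left by (intro add_mono mult_right_mono) auto
          then have "?m * ((u_y i y s)\<^sup>2 + w_y i y s \<bullet> w_y i y s + b_y i y s \<bullet> b_y i y s) / (2 * V) \<le> ?X / (2 * v i y s)"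
            using V(2)[OF y s, of i] p viscous_nonneg[of i y s] by (intro frac_le) auto
          then show ?thesis by (simp add: k_def)
        qed
        moreover have "?X / v i y s = ?X / (2 * v i y s) + ?X / (2 * v i y s)" by simp
        ultimately show "?p * u_y i y s - ?X / v i y s \<le> ?c * (R * \<theta> i y s + a / 3 * (v i y s * \<theta> i y s ^ 4))
          - k * ((u_y i y s)\<^sup>2 + w_y i y s \<bullet> w_y i y s + b_y i y s \<bullet> b_y i y s)"
          by linarith
      qed (use s S.lam in \<open>auto intro!: continuous_intros\<close>)
      also have "\<dots> = integral {0..1} (\<lambda>y. ?c * (R * \<theta> i y s + a / 3 * (v i y s * \<theta> i y s ^ 4))) - k * gradients i s"
        unfolding gradients_def using s S.lam
        by (subst Henstock_Kurzweil_Integration.integral_diff,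
          (auto intro!: integrable_continuous_interval continuous_intros)[2], simp only: integral_mult_right)
      also have "integral {0..1} (\<lambda>y. ?c * (R * \<theta> i y s + a / 3 * (v i y s * \<theta> i y s ^ 4)))
        = ?c * (R * integral {0..1} (\<lambda>y. \<theta> i y s) + a / 3 * integral {0..1} (\<lambda>y. v i y s * \<theta> i y s ^ 4))"
        using s
        by (simp only: integral_mult_right, subst Henstock_Kurzweil_Integration.integral_add,
          (auto intro!: integrable_continuous_interval continuous_intros)[2], simp only: integral_mult_right)
      also have "\<dots> \<le> ?c * (R * E + a / 3 * E)"
        using E(2,3)[OF s, of i] S.R S.a C(1) dissipation_nonneg[OF s, of i] S.lam
        by (intro mult_left_mono add_mono) auto
      also have "\<dots> = A * (1 + S.dissipation i s)" by (simp add: A_def)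
      finally show "integral {0..1} (\<lambda>y. (R * \<theta> i y s / v i y s + a / 3 * \<theta> i y s ^ 4) * u_y i y s
         - (lam * (u_y i y s)\<^sup>2 + \<mu> * (w_y i y s \<bullet> w_y i y s) + \<nu> * (b_y i y s \<bullet> b_y i y s)) / v i y s)
         \<le> A * (1 + S.dissipation i s) - k * gradients i s" by simp
    qed (intro continuous_intros cD)
    also have "integral {0..t} (\<lambda>s. A * (1 + S.dissipation i s) - k * gradients i s)
      = A * (t + integral {0..t} (S.dissipation i)) - k * integral {0..t} (gradients i)"
      using t
      by (subst Henstock_Kurzweil_Integration.integral_diff,
        (auto intro!: integrable_continuous_interval continuous_intros cD)[2], simp only: integral_mult_right,
        subst Henstock_Kurzweil_Integration.integral_add)
        (auto intro!: integrable_continuous_interval cD)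
    also have "A * (t + integral {0..t} (S.dissipation i)) \<le> A * (T + D)"
      using A D(2)[OF t, of i] t by (intro mult_left_mono) auto
    finally have "k * integral {0..t} (gradients i) \<le> B + A * (T + D)" using B(2)[of i] by simp
    then show ?thesis using k by (simp add: field_simps)
  qed
  moreover have "0 < (B + A * (T + D)) / k" using B(1) A D(1) k S.T by (simp add: add_pos_pos)
  ultimately show ?thesis by blast
qed

lemma rate_bound: "\<exists>C>0. \<forall>i. \<forall>t\<in>{0..T}. integral {0..t} (rate i) \<le> C"
proof -
  obtain D where D: "D > 0" "\<And>i t. t \<in> {0..T} \<Longrightarrow> integral {0..t} (S.dissipation i) \<le> D"
    using dissipation_bound by blast
  obtain G where G: "G > 0" "\<And>i t. t \<in> {0..T} \<Longrightarrow> integral {0..t} (gradients i) \<le> G"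
    using gradients_bound by blast
  have "integral {0..t} (rate i) \<le> T + D + G" if t: "t \<in> {0..T}" for i t
  proof -
    have cD: "continuous_on {0..t} (S.dissipation i)" "continuous_on {0..t} (gradients i)"
      using t by (auto intro: continuous_on_subset[OF cont_dissipation] continuous_on_subset[OF cont_gradients])
    have "integral {0..t} (rate i) = t + integral {0..t} (S.dissipation i) + integral {0..t} (gradients i)"
      unfolding rate_def using t
      by (subst Henstock_Kurzweil_Integration.integral_add,
        (auto intro!: integrable_continuous_interval continuous_intros cD)[2],
        subst Henstock_Kurzweil_Integration.integral_add,
        (auto intro!: integrable_continuous_interval continuous_intros cD)[2]) simp
    then show ?thesis using D(2)[OF t, of i] G(2)[OF t, of i] t by simp
  qed
  then show ?thesis using D(1) G(1) S.T by (intro exI[of _ "T + D + G"]) auto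
qed

text \<open>The weight has a time integral bounded independently of the index, so the exponential
  factor is uniform. The summand 1 in the bound keeps it positive when \<open>A = 0\<close>.\<close>

lemma gronwall_rate:
  assumes cont: "\<And>i. continuous_on {0..T} (h i)" and A: "0 \<le> A" and C: "0 < C"
    and le: "\<And>i t. t \<in> {0..T} \<Longrightarrow> h i t \<le> A + C * integral {0..t} (\<lambda>s. rate i s * h i s)"
  shows "\<exists>K>0. \<forall>i. \<forall>t\<in>{0..T}. h i t \<le> K"
proof -
  obtain B where B: "B > 0" "\<And>i t. t \<in> {0..T} \<Longrightarrow> integral {0..t} (rate i) \<le> B"
    using rate_bound by blast
  have "h i t \<le> A * exp (C * B) + 1" if t: "t \<in> {0..T}" for i t
  proof -
    have "h i t \<le> A * exp (integral {0..t} (\<lambda>s. C * rate i s))"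
    proof (rule gronwall_integral[OF cont _ _ _ t])
      show "continuous_on {0..T} (\<lambda>s. C * rate i s)" by (intro continuous_intros cont_rate)
      show "0 \<le> C * rate i t" if "t \<in> {0..T}" for t using C rate_ge(3)[OF that, of i] by simp
      show "h i t \<le> A + integral {0..t} (\<lambda>s. C * rate i s * h i s)" if "t \<in> {0..T}" for t
        using le[OF that, of i] by (simp add: mult.assoc)
    qed
    also have "\<dots> \<le> A * exp (C * B)" using B(2)[OF t, of i] A C by (simp add: mult_left_mono)
    finally show ?thesis by simp
  qed
  moreover have "A * exp (C * B) + 1 > 0" using A by (simp add: add_nonneg_pos)
  ultimately show ?thesis by blast
qed

definition transv where "transv i t = integral {0..1} (\<lambda>y. w_y i y t \<bullet> w_y i y t + b_y i y t \<bullet> b_y i y t)"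

lemma transv_nonneg: "0 \<le> transv i t"
  unfolding transv_def by (rule integral_nonneg_Icc) simp

lemma cont_transv: "continuous_on {0..T} (transv i)"
  unfolding transv_def
  by (rule continuous_on_integral_param) (auto intro!: continuous_intros simp: case_prod_unfold)

lemma transv_parts:
  assumes t: "t \<in> {0..T}"
  shows "integral {0..1} (\<lambda>y. w_y i y t \<bullet> w_y i y t) \<le> transv i t"
    and "integral {0..1} (\<lambda>y. b_y i y t \<bullet> b_y i y t) \<le> transv i t"
  unfolding transv_def by (rule integral_mono_cont; use t in \<open>auto intro!: continuous_intros\<close>)+

lemma u_y_square_le_rate: "t \<in> {0..T} \<Longrightarrow> integral {0..1} (\<lambda>y. (u_y i y t)\<^sup>2) \<le> rate i t"
  by (rule order_trans[OF _ rate_ge(2)], unfold gradients_def, rule integral_mono_cont)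
    (auto intro!: continuous_intros)

text \<open>Both fields vanish at \<open>y = 0\<close>, so they are controlled by their derivatives
  alone.\<close>

lemma w_b_le_transv:
  assumes y: "y \<in> {0..1}" and t: "t \<in> {0..T}"
  shows "w i y t \<bullet> w i y t \<le> transv i t" "b i y t \<bullet> b i y t \<le> transv i t"
proof -
  have z: "0 \<in> {0..1::real}" by simp
  have "(norm (w i y t - w i 0 t))\<^sup>2 \<le> integral {0..1} (\<lambda>y. (norm (w_y i y t))\<^sup>2)"
    by (rule norm_diff_square_le_integral_derivative[OF S.w_Dy[OF _ t] _ z y])
      (use t in \<open>auto intro!: continuous_intros\<close>)
  then show "w i y t \<bullet> w i y t \<le> transv i t"
    using transv_parts(1)[OF t, of i] S.boundary[of 0 t i] t by (simp add: power2_norm_eq_inner)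
  have "(norm (b i y t - b i 0 t))\<^sup>2 \<le> integral {0..1} (\<lambda>y. (norm (b_y i y t))\<^sup>2)"
    by (rule norm_diff_square_le_integral_derivative[OF S.b_Dy[OF _ t] _ z y])
      (use t in \<open>auto intro!: continuous_intros\<close>)
  then show "b i y t \<bullet> b i y t \<le> transv i t"
    using transv_parts(2)[OF t, of i] S.boundary[of 0 t i] t by (simp add: power2_norm_eq_inner)
qed

lemma integral_w_b_le_transv:
  assumes t: "t \<in> {0..T}"
  shows "integral {0..1} (\<lambda>y. w i y t \<bullet> w i y t) \<le> transv i t"
    and "integral {0..1} (\<lambda>y. b i y t \<bullet> b i y t) \<le> transv i t"
proof -
  have "integral {0..1} (\<lambda>y. w i y t \<bullet> w i y t) \<le> integral {0..1} (\<lambda>y::real. transv i t)"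
    by (rule integral_mono_cont) (use t w_b_le_transv(1) in \<open>auto intro!: continuous_intros\<close>)
  then show "integral {0..1} (\<lambda>y. w i y t \<bullet> w i y t) \<le> transv i t" by simp
  have "integral {0..1} (\<lambda>y. b i y t \<bullet> b i y t) \<le> integral {0..1} (\<lambda>y::real. transv i t)"
    by (rule integral_mono_cont) (use t w_b_le_transv(2) in \<open>auto intro!: continuous_intros\<close>)
  then show "integral {0..1} (\<lambda>y. b i y t \<bullet> b i y t) \<le> transv i t" by simp
qed

text \<open>The gradients are recovered from the fluxes \<open>\<zeta>\<close> and \<open>\<xi>\<close>, whose derivatives are controlled.\<close>

lemma gradient_sup:
  assumes "0 < k" "0 < V"
    and flux: "\<And>y. y \<in> {0..1} \<Longrightarrow> \<phi> y = g y + (k / vol y) *\<^sub>R g' y"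
    and vol: "\<And>y. y \<in> {0..1} \<Longrightarrow> 0 < vol y \<and> vol y \<le> V"
    and \<phi>: "\<And>y. y \<in> {0..1} \<Longrightarrow> (\<phi> has_vector_derivative \<phi>' y) (at y within {0..1})"
    and cont: "continuous_on {0..1} \<phi>'"
    and g: "\<And>y. y \<in> {0..1} \<Longrightarrow> (norm (g y))\<^sup>2 \<le> G"
    and y: "y \<in> {0..1}"
  shows "(norm (g' y :: 'e))\<^sup>2 \<le> 2 * (V / k)\<^sup>2 * (2 * integral {0..1} (\<lambda>y. (norm (\<phi> y))\<^sup>2)
    + 2 * integral {0..1} (\<lambda>y. (norm (\<phi>' y))\<^sup>2) + G)"
proof -
  have "g' y = (vol y / k) *\<^sub>R (\<phi> y + - g y)"
    using flux[OF y] vol[OF y] assms(1) by simp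
  then have "(norm (g' y))\<^sup>2 = (vol y / k)\<^sup>2 * (norm (\<phi> y + - g y))\<^sup>2"
    by (simp add: power_mult_distrib power_divide)
  also have "\<dots> \<le> (V / k)\<^sup>2 * (2 * (norm (\<phi> y))\<^sup>2 + 2 * (norm (- g y))\<^sup>2)"
    using vol[OF y] assms(1) by (intro mult_mono norm_add_square_le power_mono divide_right_mono) auto
  also have "\<dots> = 2 * (V / k)\<^sup>2 * ((norm (\<phi> y))\<^sup>2 + (norm (g y))\<^sup>2)" by (simp add: algebra_simps)
  also have "\<dots> \<le> 2 * (V / k)\<^sup>2 * (2 * integral {0..1} (\<lambda>y. (norm (\<phi> y))\<^sup>2)
    + 2 * integral {0..1} (\<lambda>y. (norm (\<phi>' y))\<^sup>2) + G)"
    by (intro mult_left_mono add_mono norm_square_le_H1[OF \<phi> cont y] g[OF y]) auto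
  finally show ?thesis .
qed

lemma flux_square_integral:
  fixes \<phi> g h :: "real \<Rightarrow> 'e"
  assumes "0 < k" "0 < c"
    and flux: "\<And>y. y \<in> {0..1} \<Longrightarrow> \<phi> y = g y + (k / vol y) *\<^sub>R h y"
    and vol: "\<And>y. y \<in> {0..1} \<Longrightarrow> c \<le> vol y"
    and cont: "continuous_on {0..1} g" "continuous_on {0..1} h" "continuous_on {0..1} \<phi>"
  shows "integral {0..1} (\<lambda>y. (norm (\<phi> y))\<^sup>2) \<le> 2 * integral {0..1} (\<lambda>y. g y \<bullet> g y)
    + 2 * (k / c)\<^sup>2 * integral {0..1} (\<lambda>y. h y \<bullet> h y)"
proof -
  have "integral {0..1} (\<lambda>y. (norm (\<phi> y))\<^sup>2) \<le> integral {0..1} (\<lambda>y. 2 * (g y \<bullet> g y) + 2 * (k / c)\<^sup>2 * (h y \<bullet> h y))"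
  proof (rule integral_mono_cont)
    fix y :: real assume y: "y \<in> {0..1}"
    have "(norm (\<phi> y))\<^sup>2 \<le> 2 * (norm (g y))\<^sup>2 + 2 * (norm ((k / vol y) *\<^sub>R h y))\<^sup>2"
      unfolding flux[OF y] by (rule norm_add_square_le)
    also have "(norm ((k / vol y) *\<^sub>R h y))\<^sup>2 = (k / vol y)\<^sup>2 * (norm (h y))\<^sup>2"
      by (simp add: power_mult_distrib power_divide)
    also have "\<dots> \<le> (k / c)\<^sup>2 * (norm (h y))\<^sup>2"
      using vol[OF y] assms(1,2) by (intro mult_right_mono power_mono divide_left_mono) auto
    finally show "(norm (\<phi> y))\<^sup>2 \<le> 2 * (g y \<bullet> g y) + 2 * (k / c)\<^sup>2 * (h y \<bullet> h y)"
      by (simp add: power2_norm_eq_inner)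
  qed (intro continuous_intros cont)+
  also have "\<dots> = 2 * integral {0..1} (\<lambda>y. g y \<bullet> g y) + 2 * (k / c)\<^sup>2 * integral {0..1} (\<lambda>y. h y \<bullet> h y)"
    by (subst Henstock_Kurzweil_Integration.integral_add)
      (auto intro!: integrable_continuous_interval continuous_intros cont)
  finally show ?thesis .
qed

text \<open>The space derivative of \<open>\<zeta>\<close> is \<open>w_t\<close>, so the supremum of
  \<open>\<zeta>\<close> is bounded by the \<open>L^2\<close> norms of \<open>\<zeta>\<close> and
  \<open>w_t\<close>.\<close>

lemma w_y_sup:
  "\<exists>C>0. \<forall>i. \<forall>y\<in>{0..1}. \<forall>t\<in>{0..T}. (norm (w_y i y t))\<^sup>2
    \<le> C * (transv i t + integral {0..1} (\<lambda>y. w_t i y t \<bullet> w_t i y t))"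
proof -
  obtain V where V: "V > 0" "\<And>i y t. y \<in> {0..1} \<Longrightarrow> t \<in> {0..T} \<Longrightarrow> v i y t \<le> V" using v_upper by blast
  obtain c where c: "c > 0" "\<And>i y t. y \<in> {0..1} \<Longrightarrow> t \<in> {0..T} \<Longrightarrow> c \<le> v i y t" using v_lower by blast
  define C where "C = 2 * (V / \<mu>)\<^sup>2 * (2 * (2 + 2 * (\<mu> / c)\<^sup>2) + 3)"
  have "(norm (w_y i y t))\<^sup>2 \<le> C * (transv i t + integral {0..1} (\<lambda>y. w_t i y t \<bullet> w_t i y t))"
    if y: "y \<in> {0..1}" and t: "t \<in> {0..T}" for i y t
  proof -
    let ?W = "integral {0..1} (\<lambda>y. w_t i y t \<bullet> w_t i y t)"
    have W: "0 \<le> ?W" by (rule integral_nonneg_Icc) simp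
    have "integral {0..1} (\<lambda>y. (norm (\<zeta> i y t))\<^sup>2) \<le> 2 * integral {0..1} (\<lambda>y. b i y t \<bullet> b i y t)
      + 2 * (\<mu> / c)\<^sup>2 * integral {0..1} (\<lambda>y. w_y i y t \<bullet> w_y i y t)"
      by (rule flux_square_integral[OF S.\<mu> c(1), of _ _ "\<lambda>y. v i y t"])
        (use t c(2) S.\<zeta>_eq in \<open>auto intro!: continuous_intros\<close>)
    also have "\<dots> \<le> 2 * transv i t + 2 * (\<mu> / c)\<^sup>2 * transv i t"
      using integral_w_b_le_transv(2)[OF t, of i] transv_parts(1)[OF t, of i]
      by (intro add_mono mult_left_mono) auto
    finally have Z: "integral {0..1} (\<lambda>y. (norm (\<zeta> i y t))\<^sup>2) \<le> (2 + 2 * (\<mu> / c)\<^sup>2) * transv i t"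
      by (simp add: algebra_simps)
    have "(norm (w_y i y t))\<^sup>2 \<le> 2 * (V / \<mu>)\<^sup>2 * (2 * integral {0..1} (\<lambda>y. (norm (\<zeta> i y t))\<^sup>2)
      + 2 * integral {0..1} (\<lambda>y. (norm (w_t i y t))\<^sup>2) + transv i t)"
      by (rule gradient_sup[OF S.\<mu> V(1) S.\<zeta>_eq _ S.\<zeta>_Dy[OF _ t] _ _ y])
        (use t V(2) S.v_pos w_b_le_transv(2)[OF _ t, of _ i] in \<open>auto intro!: continuous_intros simp: power2_norm_eq_inner\<close>)
    also have "\<dots> \<le> 2 * (V / \<mu>)\<^sup>2 * (2 * ((2 + 2 * (\<mu> / c)\<^sup>2) * transv i t) + 2 * ?W + transv i t)"
      using Z by (intro mult_left_mono add_mono) (auto simp: power2_norm_eq_inner)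
    also have "\<dots> \<le> 2 * (V / \<mu>)\<^sup>2 * ((2 * (2 + 2 * (\<mu> / c)\<^sup>2) + 3) * (transv i t + ?W))"
    proof (rule mult_left_mono)
      have "0 \<le> (4 + 4 * (\<mu> / c)\<^sup>2) * ?W" using W by (intro mult_nonneg_nonneg) auto
      then show "2 * ((2 + 2 * (\<mu> / c)\<^sup>2) * transv i t) + 2 * ?W + transv i t
        \<le> (2 * (2 + 2 * (\<mu> / c)\<^sup>2) + 3) * (transv i t + ?W)"
        using W transv_nonneg[of i t] by (simp add: algebra_simps)
    qed simp
    finally show ?thesis by (simp add: C_def mult.assoc)
  qed
  moreover have "C > 0"
    unfolding C_def using V(1) S.\<mu> by (intro mult_pos_pos add_nonneg_pos mult_nonneg_nonneg add_nonneg_nonneg) auto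
  ultimately show ?thesis by blast
qed

text \<open>Here the derivative of the flux is \<open>u_y b + v b_t\<close>. The factor
  \<open>rate\<close> pays for the first term: \<open>|b|^2 \<le> transv\<close> pointwise, and the
  integral of \<open>u_y^2\<close> is at most \<open>rate\<close>.\<close>

lemma b_y_sup:
  "\<exists>C>0. \<forall>i. \<forall>y\<in>{0..1}. \<forall>t\<in>{0..T}. (norm (b_y i y t))\<^sup>2
    \<le> C * (rate i t * transv i t + integral {0..1} (\<lambda>y. v i y t * (b_t i y t \<bullet> b_t i y t)))"
proof -
  obtain V where V: "V > 0" "\<And>i y t. y \<in> {0..1} \<Longrightarrow> t \<in> {0..T} \<Longrightarrow> v i y t \<le> V" using v_upper by blast
  obtain c where c: "c > 0" "\<And>i y t. y \<in> {0..1} \<Longrightarrow> t \<in> {0..T} \<Longrightarrow> c \<le> v i y t" using v_lower by blast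
  define k where "k = 2 + 2 * (\<nu> / c)\<^sup>2"
  define C where "C = 2 * (V / \<nu>)\<^sup>2 * (2 * k + 5 + 4 * V)"
  have "k \<ge> 0" by (simp add: k_def)
  have "(norm (b_y i y t))\<^sup>2 \<le> C * (rate i t * transv i t + integral {0..1} (\<lambda>y. v i y t * (b_t i y t \<bullet> b_t i y t)))"
    if y: "y \<in> {0..1}" and t: "t \<in> {0..T}" for i y t
  proof -
    let ?B = "integral {0..1} (\<lambda>y. v i y t * (b_t i y t \<bullet> b_t i y t))"
    let ?g = "transv i t"
    have B: "0 \<le> ?B" using S.v_pos[OF _ t, of _ i] by (intro integral_nonneg_Icc) (auto simp: less_imp_le)
    have r: "1 \<le> rate i t" by (rule rate_ge(3)[OF t])
    have "integral {0..1} (\<lambda>y. (norm (\<xi> i y t))\<^sup>2) \<le> 2 * integral {0..1} (\<lambda>y. w i y t \<bullet> w i y t)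
      + 2 * (\<nu> / c)\<^sup>2 * integral {0..1} (\<lambda>y. b_y i y t \<bullet> b_y i y t)"
      by (rule flux_square_integral[OF S.\<nu> c(1), of _ _ "\<lambda>y. v i y t"])
        (use t c(2) S.\<xi>_eq in \<open>auto intro!: continuous_intros\<close>)
    also have "\<dots> \<le> 2 * ?g + 2 * (\<nu> / c)\<^sup>2 * ?g"
      using integral_w_b_le_transv(1)[OF t, of i] transv_parts(2)[OF t, of i]
      by (intro add_mono mult_left_mono) auto
    finally have Z: "integral {0..1} (\<lambda>y. (norm (\<xi> i y t))\<^sup>2) \<le> k * ?g"
      by (simp add: k_def algebra_simps)
    have "integral {0..1} (\<lambda>y. (norm (u_y i y t *\<^sub>R b i y t + v i y t *\<^sub>R b_t i y t))\<^sup>2)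
      \<le> integral {0..1} (\<lambda>y. 2 * ?g * (u_y i y t)\<^sup>2 + 2 * V * (v i y t * (b_t i y t \<bullet> b_t i y t)))"
    proof (rule integral_mono_cont)
      fix y :: real assume y: "y \<in> {0..1}"
      note p = S.v_pos[OF y t, of i]
      have "(norm (u_y i y t *\<^sub>R b i y t + v i y t *\<^sub>R b_t i y t))\<^sup>2
        \<le> 2 * (norm (u_y i y t *\<^sub>R b i y t))\<^sup>2 + 2 * (norm (v i y t *\<^sub>R b_t i y t))\<^sup>2"
        by (rule norm_add_square_le)
      also have "\<dots> = 2 * ((u_y i y t)\<^sup>2 * (b i y t \<bullet> b i y t)) + 2 * (v i y t * (v i y t * (b_t i y t \<bullet> b_t i y t)))"
        by (simp add: power_mult_distrib power2_norm_eq_inner) (simp add: power2_eq_square)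
      also have "\<dots> \<le> 2 * ((u_y i y t)\<^sup>2 * ?g) + 2 * (V * (v i y t * (b_t i y t \<bullet> b_t i y t)))"
        using w_b_le_transv(2)[OF y t, of i] V(2)[OF y t, of i] p
        by (intro add_mono mult_left_mono mult_right_mono) auto
      finally show "(norm (u_y i y t *\<^sub>R b i y t + v i y t *\<^sub>R b_t i y t))\<^sup>2
        \<le> 2 * ?g * (u_y i y t)\<^sup>2 + 2 * V * (v i y t * (b_t i y t \<bullet> b_t i y t))" by (simp add: mult_ac)
    qed (use t in \<open>auto intro!: continuous_intros\<close>)
    also have "\<dots> = 2 * ?g * integral {0..1} (\<lambda>y. (u_y i y t)\<^sup>2) + 2 * V * ?B"
      using t by (subst Henstock_Kurzweil_Integration.integral_add,
        (auto intro!: integrable_continuous_interval continuous_intros)[2], simp only: integral_mult_right)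
    also have "\<dots> \<le> 2 * ?g * rate i t + 2 * V * ?B"
      using u_y_square_le_rate[OF t, of i] transv_nonneg[of i t] V(1)
      by (intro add_mono mult_left_mono) auto
    finally have Z': "integral {0..1} (\<lambda>y. (norm (u_y i y t *\<^sub>R b i y t + v i y t *\<^sub>R b_t i y t))\<^sup>2)
      \<le> 2 * (rate i t * ?g) + 2 * V * ?B" by (simp add: mult_ac)
    have "(norm (b_y i y t))\<^sup>2 \<le> 2 * (V / \<nu>)\<^sup>2 * (2 * integral {0..1} (\<lambda>y. (norm (\<xi> i y t))\<^sup>2)
      + 2 * integral {0..1} (\<lambda>y. (norm (u_y i y t *\<^sub>R b i y t + v i y t *\<^sub>R b_t i y t))\<^sup>2) + ?g)"
      by (rule gradient_sup[OF S.\<nu> V(1) S.\<xi>_eq _ S.\<xi>_Dy[OF _ t] _ _ y])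
        (use t V(2) S.v_pos w_b_le_transv(1)[OF _ t, of _ i] in \<open>auto intro!: continuous_intros simp: power2_norm_eq_inner\<close>)
    also have "\<dots> \<le> 2 * (V / \<nu>)\<^sup>2 * (2 * (k * ?g) + 2 * (2 * (rate i t * ?g) + 2 * V * ?B) + ?g)"
      using Z Z' by (intro mult_left_mono add_mono) auto
    also have "\<dots> \<le> 2 * (V / \<nu>)\<^sup>2 * ((2 * k + 5 + 4 * V) * (rate i t * ?g + ?B))"
    proof (rule mult_left_mono)
      have g: "?g \<le> rate i t * ?g" using mult_right_mono[OF r transv_nonneg] by simp
      have "k * ?g \<le> k * (rate i t * ?g)" using g \<open>k \<ge> 0\<close> by (rule mult_left_mono)
      moreover have "0 \<le> k * ?B" "0 \<le> V * (rate i t * ?g)"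
        using \<open>k \<ge> 0\<close> B V(1) r transv_nonneg[of i t] by auto
      ultimately show "2 * (k * ?g) + 2 * (2 * (rate i t * ?g) + 2 * V * ?B) + ?g
        \<le> (2 * k + 5 + 4 * V) * (rate i t * ?g + ?B)"
        using g B by (simp add: algebra_simps)
    qed simp
    finally show ?thesis by (simp add: C_def mult.assoc)
  qed
  moreover have "C > 0" using V(1) S.\<nu> \<open>k \<ge> 0\<close> by (simp add: C_def add_nonneg_pos)
  ultimately show ?thesis by blast
qed

text \<open>The terms \<open>u_y |w_y|^2\<close> and \<open>u_y |b_y|^2\<close> go through
  \<open>integral_triple_le\<close>, where the suprema of the gradients are bounded by the
  dissipation in \<open>w_t\<close> and \<open>b_t\<close>. The other indefinite terms are treated
  by Young's inequality.\<close>

lemma transverse_rate_bound: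
  "\<exists>C>0. \<forall>i. \<forall>t\<in>{0..T}. integral {0..1} (\<lambda>y. S.transverse_rate i y t) \<le> C * (rate i t * transv i t)"
proof -
  obtain c where c: "c > 0" "\<And>i y t. y \<in> {0..1} \<Longrightarrow> t \<in> {0..T} \<Longrightarrow> c \<le> v i y t" using v_lower by blast
  obtain Cw where Cw: "Cw > 0" "\<And>i y t. y \<in> {0..1} \<Longrightarrow> t \<in> {0..T} \<Longrightarrow> (norm (w_y i y t))\<^sup>2
    \<le> Cw * (transv i t + integral {0..1} (\<lambda>y. w_t i y t \<bullet> w_t i y t))" using w_y_sup by blast
  obtain Cb where Cb: "Cb > 0" "\<And>i y t. y \<in> {0..1} \<Longrightarrow> t \<in> {0..T} \<Longrightarrow> (norm (b_y i y t))\<^sup>2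
    \<le> Cb * (rate i t * transv i t + integral {0..1} (\<lambda>y. v i y t * (b_t i y t \<bullet> b_t i y t)))" using b_y_sup by blast
  define N where "N = (\<mu> + \<nu>) / (2 * c\<^sup>2)"
  have N: "N > 0" using S.\<mu> S.\<nu> c(1) by (simp add: N_def)
  \<comment> \<open>Young's inequality for the cross terms uses half of the dissipation in
    \<open>b_t\<close>. \<open>dw\<close> and \<open>db\<close> are chosen such that the triple
    products use half of the dissipation in \<open>w_t\<close> and the other half of that in
    \<open>b_t\<close>.\<close>
  define dw where "dw = 1 / (2 * N * Cw)"
  define db where "db = 1 / (2 * N * Cb)"
  have d: "dw > 0" "db > 0" "N * dw * Cw = 1 / 2" "N * db * Cb = 1 / 2"
    using N Cw(1) Cb(1) by (simp_all add: dw_def db_def)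
  define C where "C = 5 / c + 1 + N / (4 * dw) + N / (4 * db)"
  have "integral {0..1} (\<lambda>y. S.transverse_rate i y t) \<le> C * (rate i t * transv i t)" if t: "t \<in> {0..T}" for i t
  proof -
    let ?g = "transv i t" and ?r = "rate i t"
    let ?W = "integral {0..1} (\<lambda>y. w_t i y t \<bullet> w_t i y t)"
    let ?B = "integral {0..1} (\<lambda>y. v i y t * (b_t i y t \<bullet> b_t i y t))"
    let ?Uw = "integral {0..1} (\<lambda>y. \<bar>u_y i y t\<bar> * \<bar>norm (w_y i y t)\<bar> * \<bar>norm (w_y i y t)\<bar>)"
    let ?Ub = "integral {0..1} (\<lambda>y. \<bar>u_y i y t\<bar> * \<bar>norm (b_y i y t)\<bar> * \<bar>norm (b_y i y t)\<bar>)"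
    have r: "1 \<le> ?r" by (rule rate_ge(3)[OF t])
    have g: "0 \<le> ?g" "?g \<le> ?r * ?g"
      using transv_nonneg[of i t] mult_right_mono[OF r transv_nonneg[of i t]] by simp_all
    have cn: "continuous_on {0..1} (\<lambda>y. u_y i y t)" "continuous_on {0..1} (\<lambda>y. norm (w_y i y t))"
      "continuous_on {0..1} (\<lambda>y. norm (b_y i y t))" using t by (auto intro!: continuous_intros)
    have ur: "integral {0..1} (\<lambda>y. (u_y i y t)\<^sup>2) \<le> ?r" by (rule u_y_square_le_rate[OF t])
    have Uw: "?Uw \<le> dw * (Cw * (?g + ?W)) + ?r * ?g / (4 * dw)"
    proof -
      have "?Uw \<le> dw * (Cw * (?g + ?W))
        + integral {0..1} (\<lambda>y. (u_y i y t)\<^sup>2) * integral {0..1} (\<lambda>y. (norm (w_y i y t))\<^sup>2) / (4 * dw)"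
        by (rule integral_triple_le[OF cn(1,2,2) Cw(2)[OF _ t] d(1)])
      also have "integral {0..1} (\<lambda>y. (u_y i y t)\<^sup>2) * integral {0..1} (\<lambda>y. (norm (w_y i y t))\<^sup>2) \<le> ?r * ?g"
        using ur transv_parts(1)[OF t, of i] r by (intro mult_mono) (auto simp: power2_norm_eq_inner intro: integral_nonneg_Icc)
      finally show ?thesis using d by (simp add: divide_right_mono)
    qed
    have Ub: "?Ub \<le> db * (Cb * (?r * ?g + ?B)) + ?r * ?g / (4 * db)"
    proof -
      have "?Ub \<le> db * (Cb * (?r * ?g + ?B))
        + integral {0..1} (\<lambda>y. (u_y i y t)\<^sup>2) * integral {0..1} (\<lambda>y. (norm (b_y i y t))\<^sup>2) / (4 * db)"
        by (rule integral_triple_le[OF cn(1,3,3) Cb(2)[OF _ t] d(2)])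
      also have "integral {0..1} (\<lambda>y. (u_y i y t)\<^sup>2) * integral {0..1} (\<lambda>y. (norm (b_y i y t))\<^sup>2) \<le> ?r * ?g"
        using ur transv_parts(2)[OF t, of i] r by (intro mult_mono) (auto simp: power2_norm_eq_inner intro: integral_nonneg_Icc)
      finally show ?thesis using d by (simp add: divide_right_mono)
    qed
    have "integral {0..1} (\<lambda>y. S.transverse_rate i y t)
      \<le> integral {0..1} (\<lambda>y. (- (w_t i y t \<bullet> w_t i y t) - 1 / 2 * (v i y t * (b_t i y t \<bullet> b_t i y t)))
        + (?g / c * (u_y i y t)\<^sup>2 + 4 / c * (w_y i y t \<bullet> w_y i y t)
        + (N * (\<bar>u_y i y t\<bar> * \<bar>norm (w_y i y t)\<bar> * \<bar>norm (w_y i y t)\<bar>)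
         + N * (\<bar>u_y i y t\<bar> * \<bar>norm (b_y i y t)\<bar> * \<bar>norm (b_y i y t)\<bar>))))"
    proof (rule integral_mono_cont)
      fix y :: real assume y: "y \<in> {0..1}"
      note p = S.v_pos[OF y t, of i]
      have cv: "c \<le> v i y t" by (rule c(2)[OF y t])
      have 1: "- (u_y i y t * (b i y t \<bullet> b_t i y t)) \<le> v i y t * (b_t i y t \<bullet> b_t i y t) / 4 + ?g / c * (u_y i y t)\<^sup>2"
      proof -
        have "- (u_y i y t * (b i y t \<bullet> b_t i y t)) \<le> \<bar>u_y i y t\<bar> * \<bar>b i y t \<bullet> b_t i y t\<bar>"
          by (metis abs_ge_minus_self abs_mult)
        also have "\<dots> \<le> \<bar>u_y i y t\<bar> * (norm (b i y t) * norm (b_t i y t))"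
          by (intro mult_left_mono Cauchy_Schwarz_ineq2) simp
        also have "\<dots> = norm (b_t i y t) * (\<bar>u_y i y t\<bar> * norm (b i y t))" by simp
        also have "\<dots> \<le> (v i y t / 2) * (norm (b_t i y t))\<^sup>2 / 2 + (\<bar>u_y i y t\<bar> * norm (b i y t))\<^sup>2 / (2 * (v i y t / 2))"
          using p by (intro young) simp
        also have "\<dots> = v i y t * (b_t i y t \<bullet> b_t i y t) / 4 + (u_y i y t)\<^sup>2 * (b i y t \<bullet> b i y t) / v i y t"
          by (simp add: power2_norm_eq_inner power_mult_distrib)
        also have "(u_y i y t)\<^sup>2 * (b i y t \<bullet> b i y t) / v i y t \<le> (u_y i y t)\<^sup>2 * ?g / c"
          using w_b_le_transv(2)[OF y t, of i] cv c(1) g by (intro frac_le mult_left_mono) auto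
        finally show ?thesis by (simp add: mult.commute)
      qed
      have 2: "2 * (w_y i y t \<bullet> b_t i y t) \<le> v i y t * (b_t i y t \<bullet> b_t i y t) / 4 + 4 / c * (w_y i y t \<bullet> w_y i y t)"
      proof -
        have "2 * (w_y i y t \<bullet> b_t i y t) \<le> norm (b_t i y t) * (2 * norm (w_y i y t))"
          using norm_cauchy_schwarz[of "w_y i y t" "b_t i y t"] by (simp add: mult_ac)
        also have "\<dots> \<le> (v i y t / 2) * (norm (b_t i y t))\<^sup>2 / 2 + (2 * norm (w_y i y t))\<^sup>2 / (2 * (v i y t / 2))"
          using p by (intro young) simp
        also have "\<dots> = v i y t * (b_t i y t \<bullet> b_t i y t) / 4 + 4 * (w_y i y t \<bullet> w_y i y t) / v i y t"
          by (simp add: power2_norm_eq_inner power_mult_distrib)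
        also have "4 * (w_y i y t \<bullet> w_y i y t) / v i y t \<le> 4 * (w_y i y t \<bullet> w_y i y t) / c"
          using cv c(1) by (intro divide_left_mono) auto
        finally show ?thesis by simp
      qed
      have 3: "- (u_y i y t * (\<mu> * (w_y i y t \<bullet> w_y i y t) + \<nu> * (b_y i y t \<bullet> b_y i y t)) / (2 * (v i y t)\<^sup>2))
        \<le> N * (\<bar>u_y i y t\<bar> * \<bar>norm (w_y i y t)\<bar> * \<bar>norm (w_y i y t)\<bar>)
         + N * (\<bar>u_y i y t\<bar> * \<bar>norm (b_y i y t)\<bar> * \<bar>norm (b_y i y t)\<bar>)"
      proof -
        let ?w = "w_y i y t \<bullet> w_y i y t" and ?b = "b_y i y t \<bullet> b_y i y t"
        have "- (u_y i y t * (\<mu> * ?w + \<nu> * ?b) / (2 * (v i y t)\<^sup>2))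
          \<le> \<bar>u_y i y t\<bar> * (\<mu> * ?w + \<nu> * ?b) / (2 * (v i y t)\<^sup>2)"
        proof -
          have "- u_y i y t * ((\<mu> * ?w + \<nu> * ?b) / (2 * (v i y t)\<^sup>2)) \<le> \<bar>u_y i y t\<bar> * ((\<mu> * ?w + \<nu> * ?b) / (2 * (v i y t)\<^sup>2))"
            using S.\<mu> S.\<nu> by (intro mult_right_mono) auto
          then show ?thesis by simp
        qed
        also have "\<dots> \<le> \<bar>u_y i y t\<bar> * ((\<mu> + \<nu>) * (?w + ?b)) / (2 * c\<^sup>2)"
          using S.\<mu> S.\<nu> cv c(1)
          by (intro frac_le mult_left_mono power_mono) (auto simp: algebra_simps)
        also have "\<dots> = N * (\<bar>u_y i y t\<bar> * (?w + ?b))" by (simp add: N_def)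
        finally show ?thesis
          by (simp add: dot_square_norm power2_eq_square algebra_simps)
      qed
      show "S.transverse_rate i y t \<le> (- (w_t i y t \<bullet> w_t i y t) - 1 / 2 * (v i y t * (b_t i y t \<bullet> b_t i y t)))
        + (?g / c * (u_y i y t)\<^sup>2 + 4 / c * (w_y i y t \<bullet> w_y i y t)
        + (N * (\<bar>u_y i y t\<bar> * \<bar>norm (w_y i y t)\<bar> * \<bar>norm (w_y i y t)\<bar>)
         + N * (\<bar>u_y i y t\<bar> * \<bar>norm (b_y i y t)\<bar> * \<bar>norm (b_y i y t)\<bar>)))"
        unfolding S.transverse_rate_def using 1 2 3 by linarith
    qed (use t c(1) in \<open>auto intro!: continuous_intros continuous_on_slices[OF S.cont_transverse_rate]\<close>)
    also have "\<dots> = (- ?W - 1 / 2 * ?B) + (?g / c * integral {0..1} (\<lambda>y. (u_y i y t)\<^sup>2)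
      + 4 / c * integral {0..1} (\<lambda>y. w_y i y t \<bullet> w_y i y t) + (N * ?Uw + N * ?Ub))"
      using t by (intro integral_unique has_integral_add has_integral_diff has_integral_neg
          has_integral_mult_right integrable_integral integrable_continuous_interval)
        (auto intro!: continuous_intros)
    also have "\<dots> \<le> (- ?W - 1 / 2 * ?B) + (?g / c * ?r + 4 / c * ?g
      + (N * (dw * (Cw * (?g + ?W)) + ?r * ?g / (4 * dw)) + N * (db * (Cb * (?r * ?g + ?B)) + ?r * ?g / (4 * db))))"
      using ur transv_parts(1)[OF t, of i] Uw Ub g c(1) N
      by (intro add_mono mult_left_mono order_refl) auto
    also have "\<dots> = - ?W / 2 + ?r * ?g / c + 4 / c * ?g + ?g / 2 + ?r * ?g * (N / (4 * dw)) + ?r * ?g / 2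
      + ?r * ?g * (N / (4 * db))"
    proof -
      have "N * (dw * (Cw * (?g + ?W))) = (N * dw * Cw) * (?g + ?W)" by (simp add: mult.assoc)
      moreover have "N * (db * (Cb * (?r * ?g + ?B))) = (N * db * Cb) * (?r * ?g + ?B)" by (simp add: mult.assoc)
      ultimately show ?thesis unfolding d(3,4) distrib_left[of N] by (simp add: algebra_simps)
    qed
    also have "\<dots> \<le> ?r * ?g / c + 4 / c * (?r * ?g) + ?r * ?g / 2 + ?r * ?g * (N / (4 * dw)) + ?r * ?g / 2
      + ?r * ?g * (N / (4 * db))"
    proof -
      have "0 \<le> ?W" by (rule integral_nonneg_Icc) simp
      moreover have "4 / c * ?g \<le> 4 / c * (?r * ?g)" using g c(1) by (intro mult_left_mono) auto
      ultimately show ?thesis using g by linarith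
    qed
    also have "\<dots> = C * (?r * ?g)" by (simp add: C_def algebra_simps add_divide_distrib)
    finally show ?thesis .
  qed
  moreover have "C > 0" using c(1) N d by (simp add: C_def add_pos_pos)
  ultimately show ?thesis by blast
qed

text \<open>The term \<open>b \<bullet> w_y\<close> in \<open>transverse\<close> has no sign.
  Young's inequality moves it into half of the gradient terms and a multiple of the magnetic energy,
  so \<open>transverse\<close> controls \<open>transv\<close> up to a constant and Gronwall
  applies.\<close>

lemma transv_bound: "\<exists>C>0. \<forall>i. \<forall>t\<in>{0..T}. transv i t \<le> C"
proof -
  obtain E where E: "E > 0" "\<And>i t. t \<in> {0..T} \<Longrightarrow> integral {0..1} (\<lambda>y. v i y t * (b i y t \<bullet> b i y t)) \<le> E"
    using energy_bounds by blast
  obtain V where V: "V > 0" "\<And>i y t. y \<in> {0..1} \<Longrightarrow> t \<in> {0..T} \<Longrightarrow> v i y t \<le> V" using v_upper by blast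
  obtain c where c: "c > 0" "\<And>i y t. y \<in> {0..1} \<Longrightarrow> t \<in> {0..T} \<Longrightarrow> c \<le> v i y t" using v_lower by blast
  obtain C where C: "C > 0" "\<And>i t. t \<in> {0..T} \<Longrightarrow>
    integral {0..1} (\<lambda>y. S.transverse_rate i y t) \<le> C * (rate i t * transv i t)"
    using transverse_rate_bound by blast
  have "\<exists>B>0. \<forall>i. \<bar>S.transverse i 0\<bar> \<le> B"
    unfolding S.transverse_def
  proof (rule initial_integral)
    fix i :: 'i and y :: real assume y: "y \<in> {0..1}"
    show "(\<mu> * (w_y i y 0 \<bullet> w_y i y 0) + \<nu> * (b_y i y 0 \<bullet> b_y i y 0)) / (2 * v i y 0) + b i y 0 \<bullet> w_y i y 0
      = (\<mu> * (w_y undefined y 0 \<bullet> w_y undefined y 0) + \<nu> * (b_y undefined y 0 \<bullet> b_y undefined y 0)) / (2 * v undefined y 0)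
        + b undefined y 0 \<bullet> w_y undefined y 0"
      using initial[OF y, of i undefined] by simp
  qed
  then obtain B where B: "B > 0" "\<And>i. \<bar>S.transverse i 0\<bar> \<le> B" by blast
  define k where "k = min \<mu> \<nu> / (2 * V)"
  have k: "k > 0" using S.\<mu> S.\<nu> V(1) by (simp add: k_def)
  define A where "A = E / (2 * k * c)"
  have lower: "k / 2 * transv i t \<le> S.transverse i t + A" if t: "t \<in> {0..T}" for i t
  proof -
    have "k / 2 * transv i t = integral {0..1} (\<lambda>y. k / 2 * (w_y i y t \<bullet> w_y i y t + b_y i y t \<bullet> b_y i y t))"
      by (simp add: transv_def)
    also have "\<dots> \<le> integral {0..1} (\<lambda>y. ((\<mu> * (w_y i y t \<bullet> w_y i y t) + \<nu> * (b_y i y t \<bullet> b_y i y t)) / (2 * v i y t)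
      + b i y t \<bullet> w_y i y t) + 1 / (2 * k * c) * (v i y t * (b i y t \<bullet> b i y t)))"
    proof (rule integral_mono_cont)
      fix y :: real assume y: "y \<in> {0..1}"
      note p = S.v_pos[OF y t, of i]
      let ?w = "w_y i y t \<bullet> w_y i y t" and ?b = "b_y i y t \<bullet> b_y i y t"
      have "min \<mu> \<nu> * (?w + ?b) / (2 * V) \<le> (\<mu> * ?w + \<nu> * ?b) / (2 * v i y t)"
      proof (rule frac_le)
        show "min \<mu> \<nu> * (?w + ?b) \<le> \<mu> * ?w + \<nu> * ?b"
          unfolding distrib_left by (intro add_mono mult_right_mono) auto
      qed (use p V(2)[OF y t, of i] S.\<mu> S.\<nu> in auto)
      then have "k * (?w + ?b) \<le> (\<mu> * ?w + \<nu> * ?b) / (2 * v i y t)" by (simp add: k_def)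
      moreover have "- (b i y t \<bullet> w_y i y t) \<le> k / 2 * ?w + 1 / (2 * k * c) * (v i y t * (b i y t \<bullet> b i y t))"
      proof -
        have "- (b i y t \<bullet> w_y i y t) \<le> norm (w_y i y t) * norm (b i y t)"
          using norm_cauchy_schwarz[of "- b i y t" "w_y i y t"] by (simp add: mult.commute)
        also have "\<dots> \<le> k * (norm (w_y i y t))\<^sup>2 / 2 + (norm (b i y t))\<^sup>2 / (2 * k)" by (rule young[OF k])
        also have "(norm (b i y t))\<^sup>2 / (2 * k) \<le> 1 / (2 * k * c) * (v i y t * (b i y t \<bullet> b i y t))"
        proof -
          have "c * (b i y t \<bullet> b i y t) \<le> v i y t * (b i y t \<bullet> b i y t)"
            using c(2)[OF y t, of i] by (intro mult_right_mono) auto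
          then show ?thesis using k c(1) by (simp add: power2_norm_eq_inner field_simps)
        qed
        finally show ?thesis by (simp add: power2_norm_eq_inner)
      qed
      moreover have "0 \<le> k / 2 * ?b" using k by simp
      moreover have "k * (?w + ?b) = k / 2 * (?w + ?b) + k / 2 * ?w + k / 2 * ?b" by (simp add: algebra_simps)
      ultimately show "k / 2 * (?w + ?b) \<le> ((\<mu> * ?w + \<nu> * ?b) / (2 * v i y t)
        + b i y t \<bullet> w_y i y t) + 1 / (2 * k * c) * (v i y t * (b i y t \<bullet> b i y t))" by linarith
    qed (use t k c(1) in \<open>auto intro!: continuous_intros\<close>)
    also have "\<dots> = S.transverse i t + 1 / (2 * k * c) * integral {0..1} (\<lambda>y. v i y t * (b i y t \<bullet> b i y t))"
      unfolding S.transverse_def using t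
      by (intro integral_unique has_integral_add has_integral_mult_right integrable_integral
          integrable_continuous_interval) (auto intro!: continuous_intros)
    also have "\<dots> \<le> S.transverse i t + A"
      using mult_left_mono[OF E(2)[OF t, of i], of "1 / (2 * k * c)"] k c(1) by (simp add: A_def)
    finally show ?thesis .
  qed
  have "\<exists>K>0. \<forall>i. \<forall>t\<in>{0..T}. transv i t \<le> K"
  proof (rule gronwall_rate)
    fix i t assume t: "t \<in> {0..T}"
    have cr: "continuous_on {0..t} (\<lambda>s. rate i s * transv i s)"
      using t by (intro continuous_intros continuous_on_subset[OF cont_rate] continuous_on_subset[OF cont_transv]) auto
    have "k / 2 * transv i t \<le> S.transverse i 0
      + integral {0..t} (\<lambda>s. integral {0..1} (\<lambda>y. S.transverse_rate i y s)) + A"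
      using lower[OF t, of i] S.transverse_le[OF t, of i] by simp
    also have "integral {0..t} (\<lambda>s. integral {0..1} (\<lambda>y. S.transverse_rate i y s))
      \<le> integral {0..t} (\<lambda>s. C * (rate i s * transv i s))"
    proof (rule integral_mono_cont)
      show "continuous_on {0..t} (\<lambda>s. integral {0..1} (\<lambda>y. S.transverse_rate i y s))"
        using t by (intro continuous_on_subset[OF continuous_on_integral_param[OF S.cont_transverse_rate]]) auto
    qed (use t C(2) in \<open>auto intro!: continuous_intros cr\<close>)
    also have "\<dots> = C * integral {0..t} (\<lambda>s. rate i s * transv i s)" by simp
    finally have "k / 2 * transv i t \<le> B + A + C * integral {0..t} (\<lambda>s. rate i s * transv i s)"
      using B(2)[of i] by linarith
    then show "transv i t \<le> 2 / k * (B + A) + 2 / k * C * integral {0..t} (\<lambda>s. rate i s * transv i s)"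
      using mult_left_mono[of "k / 2 * transv i t" _ "2 / k"] k by (fastforce simp: distrib_left mult.assoc)
  qed (use k B(1) C(1) E(1) c(1) in \<open>auto intro!: cont_transv simp: A_def\<close>)
  then show ?thesis .
qed

section \<open>Pointwise control of the stress rate\<close>

text \<open>The relation \<open>g = O(G)\<close> with one constant for all members of the family,
  all \<open>y\<close> and all \<open>t\<close>. The rules below carry it through sums and products,
  so that long rates are estimated term by term without naming constants.\<close>

definition dom :: "('i \<Rightarrow> real \<Rightarrow> real \<Rightarrow> real) \<Rightarrow> ('i \<Rightarrow> real \<Rightarrow> real \<Rightarrow> real) \<Rightarrow> bool" where
  "dom g G \<longleftrightarrow> (\<exists>C\<ge>0. \<forall>i. \<forall>y\<in>{0..1}. \<forall>t\<in>{0..T}. \<bar>g i y t\<bar> \<le> C * G i y t)"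

abbreviation bd :: "('i \<Rightarrow> real \<Rightarrow> real \<Rightarrow> real) \<Rightarrow> bool" where "bd g \<equiv> dom g (\<lambda>_ _ _. 1)"

lemma domI:
  assumes "0 \<le> C" "\<And>i y t. y \<in> {0..1} \<Longrightarrow> t \<in> {0..T} \<Longrightarrow> \<bar>g i y t\<bar> \<le> C * G i y t"
  shows "dom g G"
  using assms unfolding dom_def by blast

lemma domE:
  assumes "dom g G"
  obtains C where "0 \<le> C" "\<And>i y t. y \<in> {0..1} \<Longrightarrow> t \<in> {0..T} \<Longrightarrow> \<bar>g i y t\<bar> \<le> C * G i y t"
  using assms unfolding dom_def by blast

lemma dom_le:
  assumes "\<And>i y t. y \<in> {0..1} \<Longrightarrow> t \<in> {0..T} \<Longrightarrow> \<bar>g i y t\<bar> \<le> G i y t"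
  shows "dom g G"
  by (rule domI[of 1]) (use assms in auto)

lemma dom_trans [trans]: assumes "dom g G" "dom G H" shows "dom g H"
proof -
  obtain C where C: "0 \<le> C" "\<And>i y t. y \<in> {0..1} \<Longrightarrow> t \<in> {0..T} \<Longrightarrow> \<bar>g i y t\<bar> \<le> C * G i y t"
    by (rule domE[OF assms(1)]) (rule that)
  obtain D where D: "0 \<le> D" "\<And>i y t. y \<in> {0..1} \<Longrightarrow> t \<in> {0..T} \<Longrightarrow> \<bar>G i y t\<bar> \<le> D * H i y t"
    by (rule domE[OF assms(2)]) (rule that)
  show ?thesis
  proof (rule domI)
    fix i :: 'i and y t :: real assume yt: "y \<in> {0..1}" "t \<in> {0..T}"
    have "\<bar>g i y t\<bar> \<le> C * G i y t" by (rule C(2)[OF yt])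
    also have "\<dots> \<le> C * \<bar>G i y t\<bar>" using C(1) by (intro mult_left_mono) auto
    also have "\<dots> \<le> C * (D * H i y t)" using D(2)[OF yt] C(1) by (rule mult_left_mono)
    finally show "\<bar>g i y t\<bar> \<le> (C * D) * H i y t" by simp
  qed (use C D in simp)
qed

lemma dom_add: assumes "dom g G" "dom h G" shows "dom (\<lambda>i y t. g i y t + h i y t) G"
proof -
  obtain C where C: "0 \<le> C" "\<And>i y t. y \<in> {0..1} \<Longrightarrow> t \<in> {0..T} \<Longrightarrow> \<bar>g i y t\<bar> \<le> C * G i y t"
    by (rule domE[OF assms(1)]) (rule that)
  obtain D where D: "0 \<le> D" "\<And>i y t. y \<in> {0..1} \<Longrightarrow> t \<in> {0..T} \<Longrightarrow> \<bar>h i y t\<bar> \<le> D * G i y t"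
    by (rule domE[OF assms(2)]) (rule that)
  show ?thesis
  proof (rule domI)
    fix i :: 'i and y t :: real assume yt: "y \<in> {0..1}" "t \<in> {0..T}"
    show "\<bar>g i y t + h i y t\<bar> \<le> (C + D) * G i y t"
      using C(2)[OF yt, of i] D(2)[OF yt, of i] by (simp add: distrib_right)
  qed (use C D in simp)
qed

lemma dom_minus: assumes "dom g G" shows "dom (\<lambda>i y t. - g i y t) G"
  using assms by (auto simp: dom_def)

lemma dom_diff: assumes "dom g G" "dom h G" shows "dom (\<lambda>i y t. g i y t - h i y t) G"
  using dom_add[OF assms(1) dom_minus[OF assms(2)]] by simp

lemma dom_mult: assumes "dom g G" "dom h H" shows "dom (\<lambda>i y t. g i y t * h i y t) (\<lambda>i y t. G i y t * H i y t)"
proof -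
  obtain C where C: "0 \<le> C" "\<And>i y t. y \<in> {0..1} \<Longrightarrow> t \<in> {0..T} \<Longrightarrow> \<bar>g i y t\<bar> \<le> C * G i y t"
    by (rule domE[OF assms(1)]) (rule that)
  obtain D where D: "0 \<le> D" "\<And>i y t. y \<in> {0..1} \<Longrightarrow> t \<in> {0..T} \<Longrightarrow> \<bar>h i y t\<bar> \<le> D * H i y t"
    by (rule domE[OF assms(2)]) (rule that)
  show ?thesis
  proof (rule domI)
    fix i :: 'i and y t :: real assume yt: "y \<in> {0..1}" "t \<in> {0..T}"
    have "\<bar>g i y t\<bar> * \<bar>h i y t\<bar> \<le> (C * G i y t) * (D * H i y t)"
      by (intro mult_mono C D yt) (auto intro: order_trans[OF abs_ge_zero C(2)[OF yt]])
    then show "\<bar>g i y t * h i y t\<bar> \<le> (C * D) * (G i y t * H i y t)" by (simp add: abs_mult mult_ac)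
  qed (use C D in simp)
qed

lemma dom_mult_left: "bd g \<Longrightarrow> dom h H \<Longrightarrow> dom (\<lambda>i y t. g i y t * h i y t) H"
  using dom_mult[of g "\<lambda>_ _ _. 1" h H] by simp

lemma dom_mult_right: "dom g G \<Longrightarrow> bd h \<Longrightarrow> dom (\<lambda>i y t. g i y t * h i y t) G"
  using dom_mult[of g G h "\<lambda>_ _ _. 1"] by simp

lemma bd_const: "bd (\<lambda>_ _ _. k)"
  by (rule domI[of "\<bar>k\<bar>"]) auto

lemma bd_power: "bd g \<Longrightarrow> bd (\<lambda>i y t. g i y t ^ j)"
  by (induction j) (auto intro: bd_const dom_mult_left)

lemma bd_v: "bd v"
proof -
  obtain V where "V > 0" "\<And>i y t. y \<in> {0..1} \<Longrightarrow> t \<in> {0..T} \<Longrightarrow> v i y t \<le> V" using v_upper by blast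
  then show ?thesis using S.v_pos by (intro domI[of V]) (auto simp: abs_of_pos)
qed

lemma bd_inverse_v: "bd (\<lambda>i y t. 1 / v i y t)"
proof -
  obtain c where c: "c > 0" "\<And>i y t. y \<in> {0..1} \<Longrightarrow> t \<in> {0..T} \<Longrightarrow> c \<le> v i y t" using v_lower by blast
  show ?thesis
  proof (rule domI[of "1 / c"])
    fix i :: 'i and y t :: real assume yt: "y \<in> {0..1}" "t \<in> {0..T}"
    show "\<bar>1 / v i y t\<bar> \<le> 1 / c * 1"
      using c(1) c(2)[OF yt, of i] by (simp add: frac_le)
  qed (use c in simp)
qed

lemma bd_norm_b: "bd (\<lambda>i y t. norm (b i y t))" and bd_norm_w: "bd (\<lambda>i y t. norm (w i y t))"
proof -
  obtain C where C: "C > 0" "\<And>i t. t \<in> {0..T} \<Longrightarrow> transv i t \<le> C" using transv_bound by blast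
  have "norm (b i y t) \<le> sqrt C" "norm (w i y t) \<le> sqrt C" if "y \<in> {0..1}" "t \<in> {0..T}" for i y t
    using w_b_le_transv[OF that, of i] C(2)[OF that(2), of i]
    by (auto simp: norm_eq_sqrt_inner intro!: real_sqrt_le_mono)
  then show "bd (\<lambda>i y t. norm (b i y t))" "bd (\<lambda>i y t. norm (w i y t))"
    using C(1) by (auto intro!: domI[of "sqrt C"])
qed

lemma bd_b_b: "bd (\<lambda>i y t. b i y t \<bullet> b i y t)"
  using bd_power[OF bd_norm_b, of 2] by (simp add: power2_norm_eq_inner)

lemma dom_norm_\<xi>: "dom (\<lambda>i y t. norm (\<xi> i y t)) (\<lambda>i y t. 1 + norm (b_y i y t))"
proof -
  have "dom (\<lambda>i y t. norm (\<xi> i y t)) (\<lambda>i y t. norm (w i y t) + \<nu> * (1 / v i y t) * norm (b_y i y t))"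
  proof (rule dom_le)
    fix i :: 'i and y t :: real assume yt: "y \<in> {0..1}" "t \<in> {0..T}"
    have "norm (\<xi> i y t) \<le> norm (w i y t) + norm ((\<nu> / v i y t) *\<^sub>R b_y i y t)"
      unfolding S.\<xi>_eq by (rule norm_triangle_ineq)
    then show "\<bar>norm (\<xi> i y t)\<bar> \<le> norm (w i y t) + \<nu> * (1 / v i y t) * norm (b_y i y t)"
      using S.v_pos[OF yt, of i] S.\<nu> by simp
  qed
  also have "dom (\<lambda>i y t. norm (w i y t) + \<nu> * (1 / v i y t) * norm (b_y i y t)) (\<lambda>i y t. 1 + norm (b_y i y t))"
  proof (rule dom_add)
    show "dom (\<lambda>i y t. norm (w i y t)) (\<lambda>i y t. 1 + norm (b_y i y t))"
      by (rule dom_trans[OF bd_norm_w dom_le]) simp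
    show "dom (\<lambda>i y t. \<nu> * (1 / v i y t) * norm (b_y i y t)) (\<lambda>i y t. 1 + norm (b_y i y t))"
      by (intro dom_mult_left[OF dom_mult_left[OF bd_const bd_inverse_v] dom_le]) simp
  qed
  finally show ?thesis .
qed

end

text \<open>\<open>L\<close> is twice as large as convexity demands: the margin keeps the
  coefficient of \<open>u_t\<close> in \<open>H_y\<close> at least 1/2, see
  \<open>H_y_lower\<close>.\<close>

locale mhd_family_stress = mhd_family +
  fixes L :: real
  assumes L: "0 < L" and L_large: "y \<in> {0..1} \<Longrightarrow> t \<in> {0..T} \<Longrightarrow> 2 * \<bar>R - Cv / 3\<bar> \<le> L * v i y t"
begin

section \<open>Size of the multiplier and of its derivatives\<close>

abbreviation c where "c \<equiv> R - Cv / 3"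

sublocale P: mhd_stress lam \<mu> \<nu> R a Cv T "v i" "v_y i" "u i" "u_y i" "u_t i" "\<theta> i" "\<theta>_y i" "\<theta>_t i" "F i" "F_y i"
      "f i" "\<sigma> i" "w i" "w_y i" "w_t i" "b i" "b_y i" "b_t i" "\<zeta> i" "\<xi> i" L c for i
proof unfold_locales
  fix y t :: real and i assume "y \<in> {0..1}" "t \<in> {0..T}"
  then have "2 * \<bar>c\<bar> \<le> L * v i y t" by (rule L_large)
  then show "\<bar>c\<bar> \<le> L * v i y t" by (rule order_trans[rotated]) simp
qed (simp_all add: L)

lemma r_bounds: "0 < P.r i y t" "P.r i y t \<le> 1"
  by (simp_all add: P.r_def add_pos_nonneg)

lemma s_r: "2 * \<bar>P.s i y t\<bar> * P.r i y t \<le> 1" "(P.s i y t)\<^sup>2 * P.r i y t \<le> 1"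
proof -
  have "2 * \<bar>P.s i y t\<bar> \<le> 1 + (P.s i y t)\<^sup>2"
    using sum_squares_bound[of 1 "\<bar>P.s i y t\<bar>"] by simp
  then show "2 * \<bar>P.s i y t\<bar> * P.r i y t \<le> 1" "(P.s i y t)\<^sup>2 * P.r i y t \<le> 1"
    by (simp_all add: P.r_def add_pos_nonneg)
qed

lemma bd_1_r: "bd (\<lambda>i y t. 1 - P.r i y t)" and bd_s_r: "bd (\<lambda>i y t. P.s i y t * P.r i y t)"
  and bd_arctan: "bd (\<lambda>i y t. arctan (P.s i y t))"
proof -
  show "bd (\<lambda>i y t. 1 - P.r i y t)"
  proof (rule dom_le)
    show "\<bar>1 - P.r i y t\<bar> \<le> 1" for i y t using r_bounds[of i y t] by simp
  qed
  show "bd (\<lambda>i y t. P.s i y t * P.r i y t)"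
  proof (rule dom_le)
    show "\<bar>P.s i y t * P.r i y t\<bar> \<le> 1" for i y t
      using s_r(1)[of i y t] r_bounds[of i y t] by (simp add: abs_mult)
  qed
  show "bd (\<lambda>i y t. arctan (P.s i y t))"
  proof (rule domI[of "pi / 2"])
    show "\<bar>arctan (P.s i y t)\<bar> \<le> pi / 2 * 1" for i y t
      using arctan_bounded[of "P.s i y t"] by (simp add: abs_if)
  qed simp
qed

lemma dom_\<theta>: "dom \<theta> (\<lambda>i y t. 1 + \<theta> i y t)"
  by (rule dom_le) (use S.\<theta>_pos in \<open>auto simp: abs_of_pos\<close>)

lemma dom_l: "dom P.l (\<lambda>i y t. 1 + \<theta> i y t)"
proof (rule domI[of L])
  fix i and y t :: real assume yt: "y \<in> {0..1}" "t \<in> {0..T}"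
  then show "\<bar>P.l i y t\<bar> \<le> L * (1 + \<theta> i y t)" using P.l_pos[OF yt, of i] by (simp add: P.l_def)
qed (use L in simp)

lemma dom_H: "dom P.H (\<lambda>i y t. \<bar>\<sigma> i y t\<bar> + \<theta> i y t)"
proof -
  have \<sigma>: "dom \<sigma> (\<lambda>i y t. \<bar>\<sigma> i y t\<bar> + \<theta> i y t)" and \<theta>: "dom \<theta> (\<lambda>i y t. \<bar>\<sigma> i y t\<bar> + \<theta> i y t)"
    using S.\<theta>_pos by (auto intro!: dom_le simp: less_imp_le)
  have "dom (\<lambda>i y t. \<sigma> i y t + c * (1 / v i y t) * \<theta> i y t * (1 - P.r i y t)) (\<lambda>i y t. \<bar>\<sigma> i y t\<bar> + \<theta> i y t)"
    by (rule dom_add[OF \<sigma> dom_mult_right[OF dom_mult_left[OF dom_mult_left[OF bd_const bd_inverse_v] \<theta>] bd_1_r]])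
  then show ?thesis by (simp add: P.H_def[abs_def])
qed

lemma dom_K: "dom P.K (\<lambda>i y t. 1 + \<theta> i y t)"
proof -
  have "dom (\<lambda>i y t. (- c) * ((P.l i y t + L * \<theta> i y t) * arctan (P.s i y t) - L * \<theta> i y t * (P.s i y t * P.r i y t))
    - c\<^sup>2 * (1 / v i y t) * \<theta> i y t * (1 - P.r i y t)) (\<lambda>i y t. 1 + \<theta> i y t)"
    by (rule dom_diff[OF dom_mult_left[OF bd_const dom_diff[OF
          dom_mult_right[OF dom_add[OF dom_l dom_mult_left[OF bd_const dom_\<theta>]] bd_arctan]
          dom_mult_right[OF dom_mult_left[OF bd_const dom_\<theta>] bd_s_r]]]
        dom_mult_right[OF dom_mult_left[OF dom_mult_left[OF bd_const bd_inverse_v] dom_\<theta>] bd_1_r]])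
  then show ?thesis by (simp add: P.K_def[abs_def])
qed

text \<open>The two summands of the heat capacity are used in turn: \<open>Cv\<close> for the first
  bound, \<open>4 a v \<theta>^3\<close> together with the bound on \<open>1 / v\<close> for the
  second.\<close>

lemma bd_inverse_e: "bd (\<lambda>i y t. 1 / P.e i y t)" and bd_\<theta>3_e: "bd (\<lambda>i y t. \<theta> i y t ^ 3 / P.e i y t)"
proof -
  show "bd (\<lambda>i y t. 1 / P.e i y t)"
  proof (rule domI[of "1 / Cv"])
    fix i and y t :: real assume yt: "y \<in> {0..1}" "t \<in> {0..T}"
    have "Cv \<le> P.e i y t"
      using S.v_pos[OF yt, of i] S.\<theta>_pos[OF yt, of i] S.a by (simp add: P.e_def)
    then show "\<bar>1 / P.e i y t\<bar> \<le> 1 / Cv * 1" using S.Cv by (simp add: frac_le)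
  qed (use S.Cv in simp)
  have "bd (\<lambda>i y t. 1 / (4 * a) * (1 / v i y t))" by (intro dom_mult_left bd_const bd_inverse_v)
  moreover have "dom (\<lambda>i y t. \<theta> i y t ^ 3 / P.e i y t) (\<lambda>i y t. 1 / (4 * a) * (1 / v i y t))"
  proof (rule dom_le)
    fix i and y t :: real assume yt: "y \<in> {0..1}" "t \<in> {0..T}"
    note p = S.v_pos[OF yt, of i] S.\<theta>_pos[OF yt, of i]
    have "\<theta> i y t ^ 3 / P.e i y t \<le> \<theta> i y t ^ 3 / (4 * a * v i y t * \<theta> i y t ^ 3)"
      using p S.a S.Cv by (intro divide_left_mono) (auto simp: P.e_def intro!: mult_pos_pos add_pos_pos)
    also have "\<dots> = 1 / (4 * a) * (1 / v i y t)" using p by simp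
    finally show "\<bar>\<theta> i y t ^ 3 / P.e i y t\<bar> \<le> 1 / (4 * a) * (1 / v i y t)"
      using p P.e_pos[OF yt, of i] by simp
  qed
  ultimately show "bd (\<lambda>i y t. \<theta> i y t ^ 3 / P.e i y t)" by (rule dom_trans[rotated])
qed

lemma dom_Z: "dom P.Z (\<lambda>i y t. 1 + \<bar>\<sigma> i y t\<bar> + \<theta> i y t)"
proof -
  have H: "dom P.H (\<lambda>i y t. 1 + \<bar>\<sigma> i y t\<bar> + \<theta> i y t)"
    by (rule dom_trans[OF dom_H dom_le]) (use S.\<theta>_pos in \<open>auto simp: less_imp_le abs_of_nonneg\<close>)
  have K: "dom P.K (\<lambda>i y t. 1 + \<bar>\<sigma> i y t\<bar> + \<theta> i y t)"
    by (rule dom_trans[OF dom_K dom_le]) (use S.\<theta>_pos in \<open>auto simp: less_imp_le abs_of_nonneg\<close>)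
  have "dom (\<lambda>i y t. (- 1 / 3) * P.H i y t + P.K i y t * (1 / P.e i y t)) (\<lambda>i y t. 1 + \<bar>\<sigma> i y t\<bar> + \<theta> i y t)"
    by (rule dom_add[OF dom_mult_left[OF bd_const H] dom_mult_right[OF K bd_inverse_e]])
  then show ?thesis by (simp add: P.Z_def[abs_def])
qed

text \<open>All derivatives of the cut-off are linear in \<open>u_t = \<sigma>_y\<close>, \<open>\<theta>_y\<close> and \<open>v_y\<close>.\<close>

definition G where "G i y t = \<bar>\<theta>_y i y t\<bar> + \<theta> i y t * \<bar>v_y i y t\<bar>"

text \<open>\<open>l * s_y\<close> contains \<open>L * s * \<theta>_y\<close> with the unbounded
  factor \<open>s\<close>; the factor \<open>r\<close> tames it, since
  \<open>2 |s| r \<le> 1\<close>.\<close>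

lemma dom_l_r_s_y: "dom (\<lambda>i y t. P.l i y t * (P.r i y t * P.s_y i y t)) (\<lambda>i y t. \<bar>u_t i y t\<bar> + G i y t)"
proof -
  have "dom (\<lambda>i y t. P.l i y t * (P.r i y t * P.s_y i y t)) (\<lambda>i y t. \<bar>u_t i y t\<bar> + L * \<bar>\<theta>_y i y t\<bar>)"
  proof (rule dom_le)
    fix i and y t :: real assume yt: "y \<in> {0..1}" "t \<in> {0..T}"
    have e: "P.l i y t * (P.r i y t * P.s_y i y t) = P.r i y t * u_t i y t - L * (P.s i y t * P.r i y t) * \<theta>_y i y t"
    proof -
      have "P.l i y t * (P.r i y t * P.s_y i y t) = P.r i y t * (u_t i y t - L * P.s i y t * \<theta>_y i y t)"
        using P.l_nz[OF yt, of i] by (simp add: P.s_y_def)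
      then show ?thesis by (simp add: algebra_simps)
    qed
    have "\<bar>P.r i y t * u_t i y t - L * (P.s i y t * P.r i y t) * \<theta>_y i y t\<bar> \<le> \<bar>P.r i y t * u_t i y t\<bar> + \<bar>L * (P.s i y t * P.r i y t) * \<theta>_y i y t\<bar>" by (rule abs_triangle_ineq4)
    also have "\<dots> = P.r i y t * \<bar>u_t i y t\<bar> + L * (\<bar>P.s i y t\<bar> * P.r i y t) * \<bar>\<theta>_y i y t\<bar>"
      using r_bounds[of i y t] L by (simp add: abs_mult)
    also have "\<dots> \<le> 1 * \<bar>u_t i y t\<bar> + L * 1 * \<bar>\<theta>_y i y t\<bar>"
      using r_bounds[of i y t] s_r(1)[of i y t] L by (intro add_mono mult_right_mono mult_left_mono) auto
    finally show "\<bar>P.l i y t * (P.r i y t * P.s_y i y t)\<bar> \<le> \<bar>u_t i y t\<bar> + L * \<bar>\<theta>_y i y t\<bar>"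
      unfolding e by simp
  qed
  also have "dom (\<lambda>i y t. \<bar>u_t i y t\<bar> + L * \<bar>\<theta>_y i y t\<bar>) (\<lambda>i y t. \<bar>u_t i y t\<bar> + G i y t)"
    by (intro dom_add dom_mult_left[OF bd_const] dom_le)
      (use S.\<theta>_pos in \<open>auto simp: G_def less_imp_le\<close>)
  finally show ?thesis .
qed

lemma bd_\<theta>_l: "bd (\<lambda>i y t. \<theta> i y t / P.l i y t)"
proof (rule domI[of "1 / L"])
  fix i and y t :: real assume yt: "y \<in> {0..1}" "t \<in> {0..T}"
  have "\<theta> i y t / P.l i y t \<le> (1 + \<theta> i y t) / P.l i y t"
    using P.l_pos[OF yt, of i] by (intro divide_right_mono) auto
  also have "\<dots> = 1 / L" using S.\<theta>_pos[OF yt, of i] L by (simp add: P.l_def)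
  finally show "\<bar>\<theta> i y t / P.l i y t\<bar> \<le> 1 / L * 1"
    using S.\<theta>_pos[OF yt, of i] P.l_pos[OF yt, of i] by simp
qed (use L in simp)

text \<open>As \<open>\<theta> / l \<le> 1 / L\<close>, a factor \<open>l\<close> may be exchanged
  for \<open>\<theta>\<close>.\<close>

lemma dom_\<theta>_r_s_y: "dom (\<lambda>i y t. \<theta> i y t * (P.r i y t * P.s_y i y t)) (\<lambda>i y t. \<bar>u_t i y t\<bar> + G i y t)"
proof -
  from dom_mult_left[OF bd_\<theta>_l dom_l_r_s_y]
  have "dom (\<lambda>i y t. \<theta> i y t / P.l i y t * (P.l i y t * (P.r i y t * P.s_y i y t))) (\<lambda>i y t. \<bar>u_t i y t\<bar> + G i y t)" .
  moreover have "dom (\<lambda>i y t. \<theta> i y t * (P.r i y t * P.s_y i y t))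
    (\<lambda>i y t. \<bar>\<theta> i y t / P.l i y t * (P.l i y t * (P.r i y t * P.s_y i y t))\<bar>)"
    by (rule dom_le) (use P.l_nz in simp)
  ultimately show ?thesis
    by (elim domE) (auto simp: dom_def)
qed

lemma dom_\<theta>_r_y: "dom (\<lambda>i y t. \<theta> i y t * P.r_y i y t) (\<lambda>i y t. \<bar>u_t i y t\<bar> + G i y t)"
proof -
  have "dom (\<lambda>i y t. (- 2) * (P.s i y t * P.r i y t) * (\<theta> i y t * (P.r i y t * P.s_y i y t))) (\<lambda>i y t. \<bar>u_t i y t\<bar> + G i y t)"
    by (intro dom_mult_left[OF dom_mult_left] bd_const bd_s_r dom_\<theta>_r_s_y)
  then show ?thesis by (simp add: P.r_y_def[abs_def] power2_eq_square mult_ac)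
qed

lemma dom_\<theta>_y: "dom \<theta>_y (\<lambda>i y t. \<bar>u_t i y t\<bar> + G i y t)"
  and dom_\<theta>_v_y: "dom (\<lambda>i y t. \<theta> i y t * v_y i y t) (\<lambda>i y t. \<bar>u_t i y t\<bar> + G i y t)"
  and dom_u_t: "dom u_t (\<lambda>i y t. \<bar>u_t i y t\<bar> + G i y t)"
  using S.\<theta>_pos by (auto intro!: dom_le simp: G_def less_imp_le abs_mult add_increasing)

lemma dom_H_y: "dom P.H_y (\<lambda>i y t. \<bar>u_t i y t\<bar> + G i y t)"
proof -
  have "dom (\<lambda>i y t. u_t i y t + c * (1 / v i y t) * \<theta>_y i y t * (1 - P.r i y t)
    - c * (1 / v i y t) ^ 2 * (\<theta> i y t * v_y i y t) * (1 - P.r i y t)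
    - c * (1 / v i y t) * (\<theta> i y t * P.r_y i y t)) (\<lambda>i y t. \<bar>u_t i y t\<bar> + G i y t)"
    by (rule dom_diff[OF dom_diff[OF dom_add[OF dom_u_t
          dom_mult_right[OF dom_mult_left[OF dom_mult_left[OF bd_const bd_inverse_v] dom_\<theta>_y] bd_1_r]]
        dom_mult_right[OF dom_mult_left[OF dom_mult_left[OF bd_const bd_power[OF bd_inverse_v]] dom_\<theta>_v_y] bd_1_r]]
        dom_mult_left[OF dom_mult_left[OF bd_const bd_inverse_v] dom_\<theta>_r_y]])
  then show ?thesis by (simp add: P.H_y_def[abs_def] power_one_over mult_ac)
qed

lemma bd_s2_r: "bd (\<lambda>i y t. (P.s i y t)\<^sup>2 * P.r i y t)"
proof (rule dom_le)
  show "\<bar>(P.s i y t)\<^sup>2 * P.r i y t\<bar> \<le> 1" for i y t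
    using s_r(2)[of i y t] r_bounds[of i y t] by (simp add: abs_mult)
qed

lemma dom_K_y: "dom P.K_y (\<lambda>i y t. \<bar>u_t i y t\<bar> + G i y t)"
proof -
  have "dom (\<lambda>i y t. (- c) * (((2 * L) * \<theta>_y i y t * arctan (P.s i y t) + (P.l i y t * (P.r i y t * P.s_y i y t)
      + L * (\<theta> i y t * (P.r i y t * P.s_y i y t)))
    - L * \<theta>_y i y t * (P.s i y t * P.r i y t))
    - L * (\<theta> i y t * (P.r i y t * P.s_y i y t)
       + (- 2) * ((P.s i y t)\<^sup>2 * P.r i y t) * (\<theta> i y t * (P.r i y t * P.s_y i y t))))
    - c\<^sup>2 * (1 / v i y t) * \<theta>_y i y t * (1 - P.r i y t)
    + c\<^sup>2 * (1 / v i y t) ^ 2 * (\<theta> i y t * v_y i y t) * (1 - P.r i y t)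
    + c\<^sup>2 * (1 / v i y t) * (\<theta> i y t * P.r_y i y t)) (\<lambda>i y t. \<bar>u_t i y t\<bar> + G i y t)"
    by (rule dom_add[OF dom_add[OF dom_diff[OF dom_mult_left[OF bd_const
        dom_diff[OF dom_diff[OF dom_add[OF
            dom_mult_right[OF dom_mult_left[OF bd_const dom_\<theta>_y] bd_arctan]
            dom_add[OF dom_l_r_s_y dom_mult_left[OF bd_const dom_\<theta>_r_s_y]]]
          dom_mult_right[OF dom_mult_left[OF bd_const dom_\<theta>_y] bd_s_r]]
        dom_mult_left[OF bd_const dom_add[OF dom_\<theta>_r_s_y
            dom_mult_left[OF dom_mult_left[OF bd_const bd_s2_r] dom_\<theta>_r_s_y]]]]]
      dom_mult_right[OF dom_mult_left[OF dom_mult_left[OF bd_const bd_inverse_v] dom_\<theta>_y] bd_1_r]]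
      dom_mult_right[OF dom_mult_left[OF dom_mult_left[OF bd_const bd_power[OF bd_inverse_v]] dom_\<theta>_v_y] bd_1_r]]
      dom_mult_left[OF dom_mult_left[OF bd_const bd_inverse_v] dom_\<theta>_r_y]])
  moreover have "P.K_y i y t = (- c) * (((2 * L) * \<theta>_y i y t * arctan (P.s i y t) + (P.l i y t * (P.r i y t * P.s_y i y t)
      + L * (\<theta> i y t * (P.r i y t * P.s_y i y t)))
    - L * \<theta>_y i y t * (P.s i y t * P.r i y t))
    - L * (\<theta> i y t * (P.r i y t * P.s_y i y t)
       + (- 2) * ((P.s i y t)\<^sup>2 * P.r i y t) * (\<theta> i y t * (P.r i y t * P.s_y i y t))))
    - c\<^sup>2 * (1 / v i y t) * \<theta>_y i y t * (1 - P.r i y t)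
    + c\<^sup>2 * (1 / v i y t) ^ 2 * (\<theta> i y t * v_y i y t) * (1 - P.r i y t)
    + c\<^sup>2 * (1 / v i y t) * (\<theta> i y t * P.r_y i y t)" for i y t
  proof -
    \<comment> \<open>Of the square of \<open>r\<close> in \<open>r_y\<close>, one factor tames
      \<open>s^2\<close> and the other goes with \<open>s_y\<close>.\<close>
    have r_y: "P.s i y t * P.r_y i y t = (- 2) * ((P.s i y t)\<^sup>2 * P.r i y t) * (P.r i y t * P.s_y i y t)"
      by (simp add: P.r_y_def power2_eq_square mult_ac)
    have e1: "L * \<theta> i y t * (P.s_y i y t * P.r i y t + P.s i y t * P.r_y i y t)
      = L * (\<theta> i y t * (P.r i y t * P.s_y i y t)
       + (- 2) * ((P.s i y t)\<^sup>2 * P.r i y t) * (\<theta> i y t * (P.r i y t * P.s_y i y t)))"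
      unfolding r_y by (simp add: algebra_simps)
    then show ?thesis
      unfolding P.K_y_def e1 by (simp add: power_one_over algebra_simps)
  qed
  ultimately show ?thesis by (simp only: dom_def)
qed

end

lemma mult_le_squares: "x * y \<le> x\<^sup>2 + (y::real)\<^sup>2"
  using sum_squares_bound[of x y] zero_le_power2[of x] zero_le_power2[of y] by linarith

context mhd_family_stress begin

text \<open>In \<open>K * e_y / e^2\<close> the powers of \<open>\<theta>\<close> in
  \<open>e_y\<close> are absorbed by one factor \<open>1 / e\<close>, the other factor is bounded,
  and \<open>K\<close> contributes \<open>1 + \<theta>\<close>. So \<open>\<theta>_y\<close> and
  \<open>v_y\<close> carry the weight \<open>1 + \<theta>\<close>, while \<open>u_t\<close> keeps a
  constant one.\<close>

lemma dom_Z_y: "dom P.Z_y (\<lambda>i y t. \<bar>u_t i y t\<bar> + (1 + \<theta> i y t) * (\<bar>\<theta>_y i y t\<bar> + \<bar>v_y i y t\<bar>))"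
proof -
  let ?G = "\<lambda>i y t. \<bar>u_t i y t\<bar> + (1 + \<theta> i y t) * (\<bar>\<theta>_y i y t\<bar> + \<bar>v_y i y t\<bar>)"
  have G: "dom (\<lambda>i y t. \<bar>u_t i y t\<bar> + G i y t) ?G"
  proof (rule dom_le)
    fix i and y t :: real assume yt: "y \<in> {0..1}" "t \<in> {0..T}"
    show "\<bar>\<bar>u_t i y t\<bar> + G i y t\<bar> \<le> ?G i y t"
      using S.\<theta>_pos[OF yt, of i] by (simp add: G_def algebra_simps)
  qed
  have \<theta>2: "bd (\<lambda>i y t. \<theta> i y t ^ 2 / P.e i y t)"
  proof (rule dom_trans)
    show "bd (\<lambda>i y t. 1 / P.e i y t + \<theta> i y t ^ 3 / P.e i y t)" by (rule dom_add[OF bd_inverse_e bd_\<theta>3_e])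
    show "dom (\<lambda>i y t. \<theta> i y t ^ 2 / P.e i y t) (\<lambda>i y t. 1 / P.e i y t + \<theta> i y t ^ 3 / P.e i y t)"
    proof (rule dom_le)
      fix i and y t :: real assume yt: "y \<in> {0..1}" "t \<in> {0..T}"
      have "\<theta> i y t ^ 2 / P.e i y t \<le> (1 + \<theta> i y t ^ 3) / P.e i y t"
        using S.\<theta>_pos[OF yt, of i] P.e_pos[OF yt, of i]
        by (intro divide_right_mono power_le_one_plus_power) auto
      then show "\<bar>\<theta> i y t ^ 2 / P.e i y t\<bar> \<le> 1 / P.e i y t + \<theta> i y t ^ 3 / P.e i y t"
        using P.e_pos[OF yt, of i] by (simp add: add_divide_distrib)
    qed
  qed
  have ey: "dom (\<lambda>i y t. (4 * a) * (\<theta> i y t ^ 3 / P.e i y t) * (1 / P.e i y t) * v_y i y t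
      + (12 * a) * v i y t * (\<theta> i y t ^ 2 / P.e i y t) * (1 / P.e i y t) * \<theta>_y i y t)
      (\<lambda>i y t. \<bar>\<theta>_y i y t\<bar> + \<bar>v_y i y t\<bar>)"
    by (rule dom_add[OF
          dom_mult_left[OF dom_mult_left[OF dom_mult_left[OF bd_const bd_\<theta>3_e] bd_inverse_e] dom_le]
          dom_mult_left[OF dom_mult_left[OF dom_mult_left[OF dom_mult_left[OF bd_const bd_v] \<theta>2] bd_inverse_e] dom_le]])
      auto
  have K: "dom (\<lambda>i y t. P.K i y t * ((4 * a) * (\<theta> i y t ^ 3 / P.e i y t) * (1 / P.e i y t) * v_y i y t
      + (12 * a) * v i y t * (\<theta> i y t ^ 2 / P.e i y t) * (1 / P.e i y t) * \<theta>_y i y t)) ?G"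
    by (rule dom_trans[OF dom_mult[OF dom_K ey] dom_le])
      (use S.\<theta>_pos in \<open>auto simp: abs_mult less_imp_le abs_of_nonneg add_nonneg_nonneg\<close>)
  have "dom (\<lambda>i y t. (- 1 / 3) * P.H_y i y t + (1 / P.e i y t) * P.K_y i y t
    - P.K i y t * ((4 * a) * (\<theta> i y t ^ 3 / P.e i y t) * (1 / P.e i y t) * v_y i y t
      + (12 * a) * v i y t * (\<theta> i y t ^ 2 / P.e i y t) * (1 / P.e i y t) * \<theta>_y i y t)) ?G"
    by (rule dom_diff[OF dom_add[OF dom_mult_left[OF bd_const dom_trans[OF dom_H_y G]]
          dom_mult_left[OF bd_inverse_e dom_trans[OF dom_K_y G]]] K])
  moreover have "P.Z_y i y t = (- 1 / 3) * P.H_y i y t + (1 / P.e i y t) * P.K_y i y t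
    - P.K i y t * ((4 * a) * (\<theta> i y t ^ 3 / P.e i y t) * (1 / P.e i y t) * v_y i y t
      + (12 * a) * v i y t * (\<theta> i y t ^ 2 / P.e i y t) * (1 / P.e i y t) * \<theta>_y i y t)" for i y t
    unfolding P.Z_y_def P.e_y_def
    by (simp add: power2_eq_square add_divide_distrib distrib_left mult_ac)
  ultimately show ?thesis by (simp only: dom_def)
qed

text \<open>
  In the stress rate, \<open>X\<close> bounds the factors of \<open>u_t\<close> and \<open>Y\<close> all terms without \<open>u_t\<close>; since \<open>X\<^sup>2\<close> is again
  bounded by \<open>Y\<close>, the dissipation \<open>u_t\<^sup>2\<close> absorbs the mixed terms.
\<close>

definition X where "X i y t = \<bar>\<theta>_y i y t\<bar> + \<theta> i y t * \<bar>v_y i y t\<bar> + \<bar>F i y t\<bar> + (1 + norm (b_y i y t))"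

definition Y where "Y i y t = (F i y t * \<theta>_y i y t * (1 + \<theta> i y t) + (\<theta>_y i y t)\<^sup>2 + (F i y t)\<^sup>2)
  + ((1 + (\<theta> i y t)\<^sup>2) * ((v_y i y t)\<^sup>2 + (\<sigma> i y t)\<^sup>2 + 1) + \<theta> i y t ^ 4 + (u_y i y t)\<^sup>2)
  + (\<sigma> i y t)\<^sup>2 * \<bar>u_y i y t\<bar> + (1 + \<bar>\<sigma> i y t\<bar> + \<theta> i y t) * (w_y i y t \<bullet> w_y i y t + b_y i y t \<bullet> b_y i y t)"

text \<open>\<open>Y\<close> multiplied out into monomials, without the nonnegative terms in
  \<open>w_y\<close>: the form in which linear arithmetic can compare single monomials with
  it.\<close>

lemma Y_ge:
  assumes yt: "y \<in> {0..1}" "t \<in> {0..T}"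
  shows "F i y t * \<theta>_y i y t * (1 + \<theta> i y t) + (\<theta>_y i y t)\<^sup>2 + (F i y t)\<^sup>2 + (v_y i y t)\<^sup>2
    + (\<theta> i y t)\<^sup>2 * (v_y i y t)\<^sup>2 + (\<sigma> i y t)\<^sup>2 + (\<theta> i y t)\<^sup>2 * (\<sigma> i y t)\<^sup>2 + 1 + (\<theta> i y t)\<^sup>2 + \<theta> i y t ^ 4
    + (u_y i y t)\<^sup>2 + (\<sigma> i y t)\<^sup>2 * \<bar>u_y i y t\<bar> + b_y i y t \<bullet> b_y i y t
    + (\<bar>\<sigma> i y t\<bar> + \<theta> i y t) * (b_y i y t \<bullet> b_y i y t) \<le> Y i y t"
proof -
  have "0 \<le> (1 + \<bar>\<sigma> i y t\<bar> + \<theta> i y t) * (w_y i y t \<bullet> w_y i y t)" using S.\<theta>_pos[OF yt, of i] by simp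
  then show ?thesis by (simp add: Y_def algebra_simps)
qed

lemma Y_parts:
  assumes yt: "y \<in> {0..1}" "t \<in> {0..T}"
  shows "0 \<le> F i y t * \<theta>_y i y t * (1 + \<theta> i y t)" "0 \<le> (\<theta> i y t)\<^sup>2 * (v_y i y t)\<^sup>2"
    "0 \<le> (\<theta> i y t)\<^sup>2 * (\<sigma> i y t)\<^sup>2" "0 \<le> \<theta> i y t ^ 4" "0 \<le> (\<sigma> i y t)\<^sup>2 * \<bar>u_y i y t\<bar>"
    "0 \<le> (\<bar>\<sigma> i y t\<bar> + \<theta> i y t) * (b_y i y t \<bullet> b_y i y t)"
  using F_\<theta>_y_nonneg[OF yt, of i] S.\<theta>_pos[OF yt, of i] by simp_all

definition W where "W i y t = \<bar>u_t i y t\<bar> * X i y t + Y i y t"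

lemma X_nonneg: "y \<in> {0..1} \<Longrightarrow> t \<in> {0..T} \<Longrightarrow> 0 \<le> X i y t"
  unfolding X_def using S.\<theta>_pos[of y t i] by (intro add_nonneg_nonneg mult_nonneg_nonneg) auto

lemma X_square_le: assumes yt: "y \<in> {0..1}" "t \<in> {0..T}" shows "(X i y t)\<^sup>2 \<le> 28 * Y i y t"
proof -
  have "(X i y t)\<^sup>2 \<le> 2 * (\<bar>\<theta>_y i y t\<bar> + \<theta> i y t * \<bar>v_y i y t\<bar>)\<^sup>2 + 2 * (\<bar>F i y t\<bar> + (1 + norm (b_y i y t)))\<^sup>2"
    using square_sum_le[of "\<bar>\<theta>_y i y t\<bar> + \<theta> i y t * \<bar>v_y i y t\<bar>" "\<bar>F i y t\<bar> + (1 + norm (b_y i y t))"]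
    by (simp add: X_def add.assoc)
  moreover have "(\<bar>\<theta>_y i y t\<bar> + \<theta> i y t * \<bar>v_y i y t\<bar>)\<^sup>2 \<le> 2 * (\<theta>_y i y t)\<^sup>2 + 2 * ((\<theta> i y t)\<^sup>2 * (v_y i y t)\<^sup>2)"
    using square_sum_le[of "\<bar>\<theta>_y i y t\<bar>" "\<theta> i y t * \<bar>v_y i y t\<bar>"] by (simp add: power_mult_distrib)
  moreover have "(\<bar>F i y t\<bar> + (1 + norm (b_y i y t)))\<^sup>2 \<le> 2 * (F i y t)\<^sup>2 + 2 * (1 + norm (b_y i y t))\<^sup>2"
    using square_sum_le[of "\<bar>F i y t\<bar>" "1 + norm (b_y i y t)"] by simp
  moreover have "(1 + norm (b_y i y t))\<^sup>2 \<le> 2 + 2 * (b_y i y t \<bullet> b_y i y t)"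
    using square_sum_le[of 1 "norm (b_y i y t)"] by (simp add: power2_norm_eq_inner)
  ultimately show ?thesis
    using Y_ge[OF yt, of i] Y_parts[OF yt, of i] zero_le_power2[of "\<theta>_y i y t"] zero_le_power2[of "F i y t"]
      zero_le_power2[of "v_y i y t"] zero_le_power2[of "\<sigma> i y t"] zero_le_power2[of "\<theta> i y t"]
      zero_le_power2[of "u_y i y t"] inner_ge_zero[of "b_y i y t"] by linarith
qed

lemma dom_W_I:
  assumes "\<And>i y t. y \<in> {0..1} \<Longrightarrow> t \<in> {0..T} \<Longrightarrow> \<bar>g i y t\<bar> \<le> \<bar>u_t i y t\<bar> * X i y t + 12 * Y i y t"
  shows "dom g W"
proof (rule domI[of 12])
  fix i and y t :: real assume yt: "y \<in> {0..1}" "t \<in> {0..T}"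
  show "\<bar>g i y t\<bar> \<le> 12 * W i y t"
    using assms[OF yt, of i] mult_nonneg_nonneg[OF abs_ge_zero[of "u_t i y t"] X_nonneg[OF yt, of i]]
    by (simp add: W_def distrib_left)
qed simp

text \<open>One bound for each product that the estimates of \<open>H\<close>, \<open>Z\<close>,
  \<open>K\<close> and their derivatives create in the stress rate. Multiplied out, a summand is
  either \<open>|u_t|\<close> times a part of \<open>X\<close>, or is bounded by monomials of
  \<open>Y\<close>, by \<open>x y \<le> x^2 + y^2\<close> where necessary. The factor 12 is
  generous.\<close>

lemma dom_W_terms:
  shows "dom (\<lambda>i y t. ((\<sigma> i y t)\<^sup>2 + (\<bar>\<sigma> i y t\<bar> + \<theta> i y t) * \<bar>\<sigma> i y t\<bar>) * \<bar>u_y i y t\<bar>) W" (is "dom ?g1 W")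
    and "dom (\<lambda>i y t. \<bar>F i y t\<bar> * (\<bar>u_t i y t\<bar> + (1 + \<theta> i y t) * (\<bar>\<theta>_y i y t\<bar> + \<bar>v_y i y t\<bar>))) W" (is "dom ?g2 W")
    and "dom (\<lambda>i y t. (1 + \<bar>\<sigma> i y t\<bar> + \<theta> i y t) * ((\<bar>\<sigma> i y t\<bar> + 1) * \<bar>u_y i y t\<bar>)) W" (is "dom ?g3 W")
    and "dom (\<lambda>i y t. (1 + \<bar>\<sigma> i y t\<bar> + \<theta> i y t) * (w_y i y t \<bullet> w_y i y t + b_y i y t \<bullet> b_y i y t)) W" (is "dom ?g4 W")
    and "dom (\<lambda>i y t. (1 + \<theta> i y t) * \<theta> i y t * \<bar>u_y i y t\<bar>) W" (is "dom ?g5 W")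
    and "dom (\<lambda>i y t. (\<bar>u_t i y t\<bar> + G i y t) * (1 + norm (b_y i y t))) W" (is "dom ?g6 W")
    and "dom (\<lambda>i y t. (\<bar>\<sigma> i y t\<bar> + \<theta> i y t) * (norm (b_y i y t) * (1 + norm (b_y i y t)))) W" (is "dom ?g7 W")
    and "dom (\<lambda>i y t. (\<bar>\<sigma> i y t\<bar> + \<theta> i y t) * \<bar>u_y i y t\<bar>) W" (is "dom ?g8 W")
proof -
  have main: "0 \<le> ?g1 i y t \<and> ?g1 i y t \<le> 12 * Y i y t"
    "0 \<le> ?g2 i y t \<and> ?g2 i y t \<le> \<bar>u_t i y t\<bar> * X i y t + 12 * Y i y t"
    "0 \<le> ?g3 i y t \<and> ?g3 i y t \<le> 12 * Y i y t"
    "0 \<le> ?g4 i y t \<and> ?g4 i y t \<le> 12 * Y i y t"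
    "0 \<le> ?g5 i y t \<and> ?g5 i y t \<le> 12 * Y i y t"
    "0 \<le> ?g6 i y t \<and> ?g6 i y t \<le> \<bar>u_t i y t\<bar> * X i y t + 12 * Y i y t"
    "0 \<le> ?g7 i y t \<and> ?g7 i y t \<le> 12 * Y i y t"
    "0 \<le> ?g8 i y t \<and> ?g8 i y t \<le> 12 * Y i y t"
    if yt: "y \<in> {0..1}" "t \<in> {0..T}" for i y t
  proof -
    define s where "s = \<bar>\<sigma> i y t\<bar>"
    define h where "h = \<theta> i y t"
    define p where "p = \<bar>u_y i y t\<bar>"
    define q where "q = \<bar>\<theta>_y i y t\<bar>"
    define V where "V = \<bar>v_y i y t\<bar>"
    define f where "f = \<bar>F i y t\<bar>"
    define A where "A = \<bar>u_t i y t\<bar>"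
    define nb where "nb = norm (b_y i y t)"
    define y' where "y' = Y i y t"
    have nn: "0 \<le> s" "0 \<le> h" "0 \<le> p" "0 \<le> q" "0 \<le> V" "0 \<le> f" "0 \<le> A" "0 \<le> nb"
      using S.\<theta>_pos[OF yt, of i] by (simp_all add: s_def h_def p_def q_def V_def f_def A_def nb_def)
    have sq: "(\<sigma> i y t)\<^sup>2 = s\<^sup>2" "(\<theta> i y t)\<^sup>2 = h\<^sup>2" "(u_y i y t)\<^sup>2 = p\<^sup>2" "(\<theta>_y i y t)\<^sup>2 = q\<^sup>2" "(v_y i y t)\<^sup>2 = V\<^sup>2"
      "(F i y t)\<^sup>2 = f\<^sup>2" "b_y i y t \<bullet> b_y i y t = nb\<^sup>2"
      by (simp_all add: s_def h_def p_def q_def V_def f_def nb_def power2_norm_eq_inner)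
    have Fq: "F i y t * \<theta>_y i y t = f * q"
      using F_\<theta>_y_nonneg[OF yt, of i] by (simp add: f_def q_def flip: abs_mult)
    have Y: "f * q * (1 + h) + q\<^sup>2 + f\<^sup>2 + V\<^sup>2 + h\<^sup>2 * V\<^sup>2 + s\<^sup>2 + h\<^sup>2 * s\<^sup>2 + 1 + h\<^sup>2 + h ^ 4 + p\<^sup>2 + s\<^sup>2 * p
        + nb\<^sup>2 + (s + h) * nb\<^sup>2 \<le> y'"
      using Y_ge[OF yt, of i] unfolding sq Fq
      by (simp add: s_def[symmetric] h_def[symmetric] p_def[symmetric] nb_def[symmetric] y'_def[symmetric])
    have parts: "0 \<le> f * q * (1 + h)" "0 \<le> q\<^sup>2" "0 \<le> f\<^sup>2" "0 \<le> V\<^sup>2" "0 \<le> h\<^sup>2 * V\<^sup>2" "0 \<le> s\<^sup>2" "0 \<le> h\<^sup>2 * s\<^sup>2"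
      "0 \<le> h\<^sup>2" "0 \<le> h ^ 4" "0 \<le> p\<^sup>2" "0 \<le> s\<^sup>2 * p" "0 \<le> nb\<^sup>2" "0 \<le> (s + h) * nb\<^sup>2"
      using nn by simp_all
    have XE: "X i y t = q + h * V + f + (1 + nb)"
      by (simp add: X_def q_def h_def V_def f_def nb_def)
    have m1: "h * s * p \<le> h\<^sup>2 * s\<^sup>2 + p\<^sup>2" using mult_le_squares[of "h * s" p] by (simp add: power_mult_distrib)
    have m2: "f * V \<le> f\<^sup>2 + V\<^sup>2" "f * (h * V) \<le> f\<^sup>2 + h\<^sup>2 * V\<^sup>2"
      using mult_le_squares[of f V] mult_le_squares[of f "h * V"] by (simp_all add: power_mult_distrib)
    have m3: "s * p \<le> s\<^sup>2 + p\<^sup>2" "p \<le> 1 + p\<^sup>2" "h * p \<le> h\<^sup>2 + p\<^sup>2" "h\<^sup>2 * p \<le> h ^ 4 + p\<^sup>2"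
      using mult_le_squares[of s p] mult_le_squares[of 1 p] mult_le_squares[of h p] mult_le_squares[of "h\<^sup>2" p] by simp_all
    have m4: "q * nb \<le> q\<^sup>2 + nb\<^sup>2" "q \<le> 1 + q\<^sup>2" "h * V * nb \<le> h\<^sup>2 * V\<^sup>2 + nb\<^sup>2" "h * V \<le> 1 + h\<^sup>2 * V\<^sup>2"
      using mult_le_squares[of q nb] mult_le_squares[of 1 q] mult_le_squares[of "h * V" nb] mult_le_squares[of 1 "h * V"]
      by (simp_all add: power_mult_distrib)
    have m5: "s * nb \<le> s\<^sup>2 + nb\<^sup>2" "h * nb \<le> h\<^sup>2 + nb\<^sup>2"
      using mult_le_squares[of s nb] mult_le_squares[of h nb] by simp_all
    have e1: "(s\<^sup>2 + (s + h) * s) * p \<le> 12 * y'"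
    proof -
      have "(s\<^sup>2 + (s + h) * s) * p = 2 * (s\<^sup>2 * p) + h * s * p" by (simp add: power2_eq_square algebra_simps)
      then show ?thesis using m1 Y parts by linarith
    qed
    have e2: "f * (A + (1 + h) * (q + V)) \<le> A * X i y t + 12 * y'"
    proof -
      have "f * (A + (1 + h) * (q + V)) = A * f + f * q * (1 + h) + f * V + f * (h * V)" by (simp add: algebra_simps)
      moreover have "A * f \<le> A * X i y t" unfolding XE using nn by (intro mult_left_mono) auto
      ultimately show ?thesis using m2 Y parts by linarith
    qed
    have e3: "(1 + s + h) * ((s + 1) * p) \<le> 12 * y'"
    proof -
      have "(1 + s + h) * ((s + 1) * p) = s\<^sup>2 * p + 2 * (s * p) + h * s * p + p + h * p"
        by (simp add: power2_eq_square algebra_simps)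
      then show ?thesis using m1 m3 Y parts by linarith
    qed
    have e5: "(1 + h) * h * p \<le> 12 * y'"
    proof -
      have "(1 + h) * h * p = h * p + h\<^sup>2 * p" by (simp add: power2_eq_square algebra_simps)
      then show ?thesis using m3 Y parts by linarith
    qed
    have e6: "(A + (q + h * V)) * (1 + nb) \<le> A * X i y t + 12 * y'"
    proof -
      have "(A + (q + h * V)) * (1 + nb) = A * (1 + nb) + q + q * nb + h * V + h * V * nb" by (simp add: algebra_simps)
      moreover have "A * (1 + nb) \<le> A * X i y t" unfolding XE using nn by (intro mult_left_mono) auto
      ultimately show ?thesis using m4 Y parts by linarith
    qed
    have e7: "(s + h) * (nb * (1 + nb)) \<le> 12 * y'"
    proof -
      have "(s + h) * (nb * (1 + nb)) = s * nb + h * nb + (s + h) * nb\<^sup>2" by (simp add: power2_eq_square algebra_simps)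
      then show ?thesis using m5 Y parts by linarith
    qed
    have e8: "(s + h) * p \<le> 12 * y'"
    proof -
      have "(s + h) * p = s * p + h * p" by (simp add: algebra_simps)
      then show ?thesis using m3 Y parts by linarith
    qed
    note defs = s_def[symmetric] h_def[symmetric] p_def[symmetric] q_def[symmetric] V_def[symmetric]
      f_def[symmetric] A_def[symmetric] nb_def[symmetric] y'_def[symmetric]
    show "0 \<le> ?g1 i y t \<and> ?g1 i y t \<le> 12 * Y i y t" unfolding sq defs using e1 nn by simp
    show "0 \<le> ?g2 i y t \<and> ?g2 i y t \<le> \<bar>u_t i y t\<bar> * X i y t + 12 * Y i y t" unfolding defs using e2 nn by simp
    show "0 \<le> ?g3 i y t \<and> ?g3 i y t \<le> 12 * Y i y t" unfolding defs using e3 nn by simp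
    show "0 \<le> ?g5 i y t \<and> ?g5 i y t \<le> 12 * Y i y t" unfolding defs using e5 nn by simp
    show "0 \<le> ?g6 i y t \<and> ?g6 i y t \<le> \<bar>u_t i y t\<bar> * X i y t + 12 * Y i y t" unfolding G_def defs using e6 nn by simp
    show "0 \<le> ?g7 i y t \<and> ?g7 i y t \<le> 12 * Y i y t" unfolding defs using e7 nn by simp
    show "0 \<le> ?g8 i y t \<and> ?g8 i y t \<le> 12 * Y i y t" unfolding defs using e8 nn by simp
    show "0 \<le> ?g4 i y t \<and> ?g4 i y t \<le> 12 * Y i y t"
    proof -
      have "0 \<le> ?g4 i y t" using S.\<theta>_pos[OF yt, of i] by simp
      moreover have "?g4 i y t \<le> Y i y t"
        using Y_parts[OF yt, of i] by (simp add: Y_def)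
      ultimately show ?thesis by simp
    qed
  qed
  have Xp: "0 \<le> \<bar>u_t i y t\<bar> * X i y t" if "y \<in> {0..1}" "t \<in> {0..T}" for i y t
    using X_nonneg[OF that, of i] by simp
  show "dom ?g1 W" by (rule dom_W_I) (use main(1) Xp in \<open>simp add: add_increasing\<close>)
  show "dom ?g2 W" by (rule dom_W_I) (use main(2) in simp)
  show "dom ?g3 W" by (rule dom_W_I) (use main(3) Xp in \<open>simp add: add_increasing\<close>)
  show "dom ?g4 W" by (rule dom_W_I) (use main(4) Xp in \<open>simp add: add_increasing\<close>)
  show "dom ?g5 W" by (rule dom_W_I) (use main(5) Xp in \<open>simp add: add_increasing\<close>)
  show "dom ?g6 W" by (rule dom_W_I) (use main(6) in simp)
  show "dom ?g7 W" by (rule dom_W_I) (use main(7) Xp in \<open>simp add: add_increasing\<close>)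
  show "dom ?g8 W" by (rule dom_W_I) (use main(8) Xp in \<open>simp add: add_increasing\<close>)
qed

lemma dom_abs: "dom g (\<lambda>i y t. \<bar>g i y t\<bar>)"
  by (rule dom_le) simp

text \<open>\<open>r_y\<close> contains \<open>s_y\<close> and thereby \<open>u_t\<close>.
  Collecting terms gives \<open>H_y = u_t * (1 + \<eta>) + E\<close> with
  \<open>|\<eta>| \<le> 1/2\<close> and \<open>E\<close> free of \<open>u_t\<close>, so the cut-off
  destroys at most half of the dissipation.\<close>

lemma H_y_lower:
  "\<exists>C\<ge>0. \<forall>i. \<forall>y\<in>{0..1}. \<forall>t\<in>{0..T}. (u_t i y t)\<^sup>2 / 2 - C * (\<bar>u_t i y t\<bar> * X i y t) \<le> P.H_y i y t * u_t i y t"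
proof -
  define E where "E = (\<lambda>i y t. c * (1 / v i y t) * \<theta>_y i y t * (1 - P.r i y t)
    - c * (1 / v i y t) ^ 2 * (\<theta> i y t * v_y i y t) * (1 - P.r i y t)
    - (2 * c * L) * (1 / v i y t) * (\<theta> i y t / P.l i y t) * ((P.s i y t)\<^sup>2 * P.r i y t) * P.r i y t * \<theta>_y i y t)"
  have bd_r: "bd P.r" using r_bounds by (auto intro!: dom_le simp: abs_of_pos)
  have d\<theta>: "dom \<theta>_y G" and dv: "dom (\<lambda>i y t. \<theta> i y t * v_y i y t) G"
    using S.\<theta>_pos by (auto intro!: dom_le simp: G_def less_imp_le abs_mult abs_of_pos)
  have "dom E G"
    unfolding E_def
    by (rule dom_diff[OF dom_diff[OF
          dom_mult_right[OF dom_mult_left[OF dom_mult_left[OF bd_const bd_inverse_v] d\<theta>] bd_1_r]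
          dom_mult_right[OF dom_mult_left[OF dom_mult_left[OF bd_const bd_power[OF bd_inverse_v]] dv] bd_1_r]]
        dom_mult_left[OF dom_mult_left[OF dom_mult_left[OF dom_mult_left[OF dom_mult_left[OF bd_const bd_inverse_v]
            bd_\<theta>_l] bd_s2_r] bd_r] d\<theta>]])
  then obtain C where C: "0 \<le> C" "\<And>i y t. y \<in> {0..1} \<Longrightarrow> t \<in> {0..T} \<Longrightarrow> \<bar>E i y t\<bar> \<le> C * G i y t"
    by (rule domE) (rule that)
  have "(u_t i y t)\<^sup>2 / 2 - C * (\<bar>u_t i y t\<bar> * X i y t) \<le> P.H_y i y t * u_t i y t"
    if yt: "y \<in> {0..1}" "t \<in> {0..T}" for i y t
  proof -
    note p = S.v_pos[OF yt, of i] S.\<theta>_pos[OF yt, of i] P.l_pos[OF yt, of i] r_bounds[of i y t]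
    define \<eta> where "\<eta> = 2 * c / v i y t * (\<theta> i y t / P.l i y t) * (P.s i y t * P.r i y t) * P.r i y t"
    have Hy: "P.H_y i y t = u_t i y t * (1 + \<eta>) + E i y t"
    proof -
      \<comment> \<open>Separates the contribution of \<open>u_t\<close> (here \<open>x\<close>) to
        the \<open>r_y\<close> term from that of \<open>\<theta>_y\<close> (here
        \<open>z\<close>).\<close>
      have key: "k / V * h * - (2 * s * r\<^sup>2 * ((x - L * s * z) / l))
        = (2 * k * L) * (1 / V) * (h / l) * (s\<^sup>2 * r) * r * z - x * (2 * k / V * (h / l) * (s * r) * r)"
        for k V h s r x z l :: real
        by (simp add: diff_divide_distrib power2_eq_square algebra_simps)
      show ?thesis
        unfolding P.H_y_def P.r_y_def P.s_y_def key \<eta>_def E_def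
        by (simp only: distrib_left mult_1_right power_one_over times_divide_eq_right times_divide_eq_left mult_1_left)
          (simp only: mult_ac)
    qed
    have "\<bar>\<eta>\<bar> = (\<bar>c\<bar> / v i y t) * (\<theta> i y t / P.l i y t) * (2 * \<bar>P.s i y t\<bar> * P.r i y t) * P.r i y t"
      unfolding \<eta>_def abs_mult abs_divide using p by simp
    also have "\<dots> \<le> (L / 2) * (1 / L) * 1 * 1"
    proof (intro mult_mono)
      show "\<bar>c\<bar> / v i y t \<le> L / 2" using L_large[OF yt, of i] p by (simp add: field_simps)
      show "\<theta> i y t / P.l i y t \<le> 1 / L"
        using p L by (simp add: P.l_def frac_le_eq divide_le_0_iff field_simps)
    qed (use p L s_r(1)[of i y t] in auto)
    finally have "\<bar>\<eta>\<bar> \<le> 1 / 2" using L by simp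
    then have "1 / 2 \<le> 1 + \<eta>" by (simp add: abs_le_iff)
    then have "(u_t i y t)\<^sup>2 * (1 / 2) \<le> (u_t i y t)\<^sup>2 * (1 + \<eta>)" by (rule mult_left_mono) simp
    moreover have "- (C * (\<bar>u_t i y t\<bar> * X i y t)) \<le> E i y t * u_t i y t"
    proof -
      have "\<bar>E i y t\<bar> * \<bar>u_t i y t\<bar> \<le> (C * X i y t) * \<bar>u_t i y t\<bar>"
      proof (rule mult_right_mono)
        have "G i y t \<le> X i y t" by (simp add: G_def X_def)
        then show "\<bar>E i y t\<bar> \<le> C * X i y t"
          using C(2)[OF yt, of i] mult_left_mono[OF _ C(1)] by (meson order_trans)
      qed simp
      then have "\<bar>E i y t * u_t i y t\<bar> \<le> C * (\<bar>u_t i y t\<bar> * X i y t)" by (simp add: abs_mult mult_ac)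
      then show ?thesis by linarith
    qed
    moreover have "P.H_y i y t * u_t i y t = (u_t i y t)\<^sup>2 * (1 + \<eta>) + E i y t * u_t i y t"
      unfolding Hy by (simp add: power2_eq_square algebra_simps)
    ultimately show ?thesis by linarith
  qed
  then show ?thesis using C(1) by blast
qed

text \<open>Adding \<open>lam * (H_y * u_t)\<close> takes away the dissipative term; the others are
  matched one by one with the products in \<open>dom_W_terms\<close>.\<close>

lemma dom_stress_rate: "dom (\<lambda>i y t. P.stress_rate i y t + lam * (P.H_y i y t * u_t i y t)) W"
proof -
  have H\<sigma>: "dom (\<lambda>i y t. 1 / 2 * (\<sigma> i y t)\<^sup>2 - P.H i y t * \<sigma> i y t)
    (\<lambda>i y t. (\<sigma> i y t)\<^sup>2 + (\<bar>\<sigma> i y t\<bar> + \<theta> i y t) * \<bar>\<sigma> i y t\<bar>)"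
  proof (rule dom_diff)
    show "dom (\<lambda>i y t. 1 / 2 * (\<sigma> i y t)\<^sup>2) (\<lambda>i y t. (\<sigma> i y t)\<^sup>2 + (\<bar>\<sigma> i y t\<bar> + \<theta> i y t) * \<bar>\<sigma> i y t\<bar>)"
      using S.\<theta>_pos by (intro dom_mult_left[OF bd_const dom_le]) (auto simp: less_imp_le)
    show "dom (\<lambda>i y t. P.H i y t * \<sigma> i y t) (\<lambda>i y t. (\<sigma> i y t)\<^sup>2 + (\<bar>\<sigma> i y t\<bar> + \<theta> i y t) * \<bar>\<sigma> i y t\<bar>)"
      by (rule dom_trans[OF dom_mult[OF dom_H dom_abs[of \<sigma>]] dom_le])
        (use S.\<theta>_pos in \<open>auto simp: less_imp_le abs_mult abs_of_nonneg add_nonneg_nonneg\<close>)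
  qed
  have T1: "dom (\<lambda>i y t. (1 / 2 * (\<sigma> i y t)\<^sup>2 - P.H i y t * \<sigma> i y t) * u_y i y t) W"
    by (rule dom_trans[OF dom_mult[OF H\<sigma> dom_abs[of u_y]] dom_W_terms(1)])
  have T2: "dom (\<lambda>i y t. F i y t * P.Z_y i y t) W"
    by (rule dom_trans[OF dom_mult[OF dom_abs[of F] dom_Z_y] dom_W_terms(2)])
  have "dom (\<lambda>i y t. \<sigma> i y t + 1 / 2 * (b i y t \<bullet> b i y t)) (\<lambda>i y t. \<bar>\<sigma> i y t\<bar> + 1)"
    by (rule dom_add[OF dom_le dom_mult_left[OF bd_const dom_trans[OF bd_b_b dom_le]]]) simp_all
  from dom_mult[OF dom_Z dom_mult[OF this dom_abs[of u_y]]]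
  have T3: "dom (\<lambda>i y t. P.Z i y t * ((\<sigma> i y t + 1 / 2 * (b i y t \<bullet> b i y t)) * u_y i y t)) W"
    by (rule dom_trans[OF _ dom_W_terms(3)])
  have "dom (\<lambda>i y t. (1 / v i y t) * (\<mu> * (w_y i y t \<bullet> w_y i y t) + \<nu> * (b_y i y t \<bullet> b_y i y t)))
    (\<lambda>i y t. w_y i y t \<bullet> w_y i y t + b_y i y t \<bullet> b_y i y t)"
    by (rule dom_mult_left[OF bd_inverse_v dom_add[OF dom_mult_left[OF bd_const dom_le] dom_mult_left[OF bd_const dom_le]]])
      simp_all
  from dom_mult[OF dom_Z this]
  have T4: "dom (\<lambda>i y t. P.Z i y t * ((1 / v i y t) * (\<mu> * (w_y i y t \<bullet> w_y i y t) + \<nu> * (b_y i y t \<bullet> b_y i y t)))) W"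
    by (rule dom_trans[OF _ dom_W_terms(4)])
  have "dom \<theta> \<theta>" using S.\<theta>_pos by (auto intro!: dom_le simp: abs_of_pos)
  from dom_mult_left[OF dom_mult_left[OF bd_const bd_\<theta>3_e] dom_mult[OF dom_mult[OF dom_K this] dom_abs[of u_y]]]
  \<comment> \<open>The power \<open>\<theta>^4\<close> divided by \<open>e\<close> is the bounded
    quotient \<open>\<theta>^3 / e\<close> times one factor \<open>\<theta>\<close>.\<close>
  have T5: "dom (\<lambda>i y t. a * (\<theta> i y t ^ 3 / P.e i y t) * (P.K i y t * \<theta> i y t * u_y i y t)) W"
    by (rule dom_trans[OF _ dom_W_terms(5)])
  have n\<xi>: "dom (\<lambda>i y t. norm (b i y t) * norm (\<xi> i y t)) (\<lambda>i y t. 1 + norm (b_y i y t))"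
    by (rule dom_mult_left[OF bd_norm_b dom_norm_\<xi>])
  have b\<xi>: "dom (\<lambda>i y t. b i y t \<bullet> \<xi> i y t) (\<lambda>i y t. 1 + norm (b_y i y t))"
    by (rule dom_trans[OF dom_le n\<xi>]) (rule Cauchy_Schwarz_ineq2)
  have T6: "dom (\<lambda>i y t. P.H_y i y t * (b i y t \<bullet> \<xi> i y t)) W"
    by (rule dom_trans[OF dom_mult[OF dom_H_y b\<xi>] dom_W_terms(6)])
  have n\<xi>': "dom (\<lambda>i y t. norm (b_y i y t) * norm (\<xi> i y t)) (\<lambda>i y t. norm (b_y i y t) * (1 + norm (b_y i y t)))"
    by (rule dom_mult[OF dom_le dom_norm_\<xi>]) simp
  have b\<xi>': "dom (\<lambda>i y t. b_y i y t \<bullet> \<xi> i y t) (\<lambda>i y t. norm (b_y i y t) * (1 + norm (b_y i y t)))"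
    by (rule dom_trans[OF dom_le n\<xi>']) (rule Cauchy_Schwarz_ineq2)
  have T7: "dom (\<lambda>i y t. P.H i y t * (b_y i y t \<bullet> \<xi> i y t)) W"
    by (rule dom_trans[OF dom_mult[OF dom_H b\<xi>'] dom_W_terms(7)])
  have T8: "dom (\<lambda>i y t. P.H i y t * u_y i y t * (1 / 2 * (b i y t \<bullet> b i y t))) W"
    by (rule dom_mult_right[OF dom_trans[OF dom_mult[OF dom_H dom_abs[of u_y]] dom_W_terms(8)]
          dom_mult_left[OF bd_const bd_b_b]])
  have "dom (\<lambda>i y t. (1 / 2 * (\<sigma> i y t)\<^sup>2 - P.H i y t * \<sigma> i y t) * u_y i y t - F i y t * P.Z_y i y t
      + P.Z i y t * ((\<sigma> i y t + 1 / 2 * (b i y t \<bullet> b i y t)) * u_y i y t)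
      + P.Z i y t * ((1 / v i y t) * (\<mu> * (w_y i y t \<bullet> w_y i y t) + \<nu> * (b_y i y t \<bullet> b_y i y t)))
      - a * (\<theta> i y t ^ 3 / P.e i y t) * (P.K i y t * \<theta> i y t * u_y i y t)
      + P.H_y i y t * (b i y t \<bullet> \<xi> i y t) + P.H i y t * (b_y i y t \<bullet> \<xi> i y t)
      + P.H i y t * u_y i y t * (1 / 2 * (b i y t \<bullet> b i y t))) W"
    by (rule dom_add[OF dom_add[OF dom_add[OF dom_diff[OF dom_add[OF dom_add[OF dom_diff[OF T1 T2] T3] T4] T5] T6] T7] T8])
  moreover have "P.stress_rate i y t + lam * (P.H_y i y t * u_t i y t)
    = (1 / 2 * (\<sigma> i y t)\<^sup>2 - P.H i y t * \<sigma> i y t) * u_y i y t - F i y t * P.Z_y i y t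
      + P.Z i y t * ((\<sigma> i y t + 1 / 2 * (b i y t \<bullet> b i y t)) * u_y i y t)
      + P.Z i y t * ((1 / v i y t) * (\<mu> * (w_y i y t \<bullet> w_y i y t) + \<nu> * (b_y i y t \<bullet> b_y i y t)))
      - a * (\<theta> i y t ^ 3 / P.e i y t) * (P.K i y t * \<theta> i y t * u_y i y t)
      + P.H_y i y t * (b i y t \<bullet> \<xi> i y t) + P.H i y t * (b_y i y t \<bullet> \<xi> i y t)
      + P.H i y t * u_y i y t * (1 / 2 * (b i y t \<bullet> b i y t))" for i y t
  proof -
    have t5: "P.K i y t / P.e i y t * (a * \<theta> i y t ^ 4 * u_y i y t)
      = a * (\<theta> i y t ^ 3 / P.e i y t) * (P.K i y t * \<theta> i y t * u_y i y t)"
      by (simp add: power4_eq_xxxx power3_eq_cube mult_ac)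
    show ?thesis
      unfolding P.stress_rate_def t5 by (simp add: distrib_left add_divide_distrib)
  qed
  ultimately show ?thesis by (simp only: dom_def)
qed

text \<open>Of the dissipation \<open>lam / 2\<close> left by \<open>H_y_lower\<close>, Young's
  inequality spends \<open>lam / 4\<close> on the mixed term \<open>|u_t| * X\<close>; its
  counterpart \<open>X^2\<close> is bounded by \<open>Y\<close>.\<close>

lemma stress_rate_bound:
  "\<exists>C\<ge>0. \<forall>i. \<forall>y\<in>{0..1}. \<forall>t\<in>{0..T}. P.stress_rate i y t \<le> - (lam / 4) * (u_t i y t)\<^sup>2 + C * Y i y t"
proof -
  obtain C1 where C1: "0 \<le> C1" "\<And>i y t. y \<in> {0..1} \<Longrightarrow> t \<in> {0..T} \<Longrightarrow>
    (u_t i y t)\<^sup>2 / 2 - C1 * (\<bar>u_t i y t\<bar> * X i y t) \<le> P.H_y i y t * u_t i y t"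
    using H_y_lower by blast
  obtain C2 where C2: "0 \<le> C2" "\<And>i y t. y \<in> {0..1} \<Longrightarrow> t \<in> {0..T} \<Longrightarrow>
    \<bar>P.stress_rate i y t + lam * (P.H_y i y t * u_t i y t)\<bar> \<le> C2 * W i y t"
    by (rule domE[OF dom_stress_rate]) (rule that)
  define D where "D = lam * C1 + C2"
  have "P.stress_rate i y t \<le> - (lam / 4) * (u_t i y t)\<^sup>2 + (28 * D\<^sup>2 / lam + C2) * Y i y t"
    if yt: "y \<in> {0..1}" "t \<in> {0..T}" for i y t
  proof -
    let ?A = "\<bar>u_t i y t\<bar>"
    have "lam * ((u_t i y t)\<^sup>2 / 2 - C1 * (?A * X i y t)) \<le> lam * (P.H_y i y t * u_t i y t)"
      using C1(2)[OF yt, of i] S.lam by (intro mult_left_mono) auto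
    moreover have "P.stress_rate i y t + lam * (P.H_y i y t * u_t i y t) \<le> C2 * W i y t"
      using C2(2)[OF yt, of i] by linarith
    ultimately have "P.stress_rate i y t \<le> - (lam / 2) * (u_t i y t)\<^sup>2 + ?A * (D * X i y t) + C2 * Y i y t"
      by (simp add: W_def D_def algebra_simps)
    also have "?A * (D * X i y t) \<le> (lam / 2) * ?A\<^sup>2 / 2 + (D * X i y t)\<^sup>2 / (2 * (lam / 2))"
      using S.lam by (intro young) simp
    also have "\<dots> = (lam / 4) * (u_t i y t)\<^sup>2 + D\<^sup>2 / lam * (X i y t)\<^sup>2" by (simp add: power_mult_distrib)
    also have "D\<^sup>2 / lam * (X i y t)\<^sup>2 \<le> D\<^sup>2 / lam * (28 * Y i y t)"
      using X_square_le[OF yt, of i] S.lam by (intro mult_left_mono) auto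
    finally show ?thesis by (simp add: algebra_simps)
  qed
  moreover have "0 \<le> 28 * D\<^sup>2 / lam + C2" using S.lam C2(1) by simp
  ultimately show ?thesis by blast
qed

end

text \<open>Low temperatures are covered by \<open>1 / x^2\<close>, the weight in the entropy
  dissipation, high ones by the largest power.\<close>

lemma one_le_inverse_square_plus_power:
  assumes "0 < (x::real)" "j \<le> k" "0 < k"
  shows "x ^ j \<le> 1 / x\<^sup>2 + x ^ k"
proof (cases "x \<le> 1")
  case True
  then have "x ^ j \<le> 1" "x\<^sup>2 \<le> 1" "0 \<le> x ^ k" using assms by (simp_all add: power_le_one)
  moreover from this(2) have "1 \<le> 1 / x\<^sup>2" using assms by (simp add: field_simps)
  ultimately show ?thesis by linarith
next
  case False
  then have "x ^ j \<le> x ^ k" using assms by (intro power_increasing) auto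
  then show ?thesis by (simp add: add_increasing)
qed

context mhd_family_stress begin

section \<open>The Lyapunov functional\<close>

text \<open>
  Sum of the heat dissipation in the entropy identity and in the moment identity of order \<open>2 m + 4\<close>. It
  controls \<open>\<theta>\<^sup>j F \<theta>_y\<close> for all \<open>j \<le> 2 m + 3\<close>.
\<close>

definition Lm where "Lm i y t = F i y t * \<theta>_y i y t / (\<theta> i y t)\<^sup>2 + \<theta> i y t ^ (2 * m + 3) * (F i y t * \<theta>_y i y t)"

lemma Lm_nonneg: "y \<in> {0..1} \<Longrightarrow> t \<in> {0..T} \<Longrightarrow> 0 \<le> Lm i y t"
  unfolding Lm_def using F_\<theta>_y_nonneg[of y t i] S.\<theta>_pos[of y t i] by simp

lemma power_F_\<theta>_y_le:
  assumes yt: "y \<in> {0..1}" "t \<in> {0..T}" and "j \<le> 2 * m + 3"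
  shows "\<theta> i y t ^ j * (F i y t * \<theta>_y i y t) \<le> Lm i y t"
proof -
  have "\<theta> i y t ^ j * (F i y t * \<theta>_y i y t) \<le> (1 / (\<theta> i y t)\<^sup>2 + \<theta> i y t ^ (2 * m + 3)) * (F i y t * \<theta>_y i y t)"
    using S.\<theta>_pos[OF yt, of i] F_\<theta>_y_nonneg[OF yt, of i] assms(3)
    by (intro mult_right_mono one_le_inverse_square_plus_power) auto
  then show ?thesis by (simp add: Lm_def distrib_right)
qed

lemma dom_F_\<theta>_y_Lm: "j \<le> 2 * m + 3 \<Longrightarrow> dom (\<lambda>i y t. \<theta> i y t ^ j * (F i y t * \<theta>_y i y t)) Lm"
  using power_F_\<theta>_y_le S.\<theta>_pos F_\<theta>_y_nonneg by (intro dom_le) (simp add: abs_of_nonneg less_imp_le)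

lemma dom_\<theta>_y_Lm: "j \<le> 2 * m + 3 \<Longrightarrow> dom (\<lambda>i y t. \<theta> i y t ^ j * (\<theta>_y i y t)\<^sup>2) Lm"
proof -
  assume j: "j \<le> 2 * m + 3"
  have "dom (\<lambda>i y t. 1 / k1 * v i y t * (\<theta> i y t ^ j * (F i y t * \<theta>_y i y t))) Lm"
    by (rule dom_mult_left[OF dom_mult_left[OF bd_const bd_v] dom_F_\<theta>_y_Lm[OF j]])
  moreover have "dom (\<lambda>i y t. \<theta> i y t ^ j * (\<theta>_y i y t)\<^sup>2) (\<lambda>i y t. 1 / k1 * v i y t * (\<theta> i y t ^ j * (F i y t * \<theta>_y i y t)))"
  proof (rule dom_le)
    fix i and y t :: real assume yt: "y \<in> {0..1}" "t \<in> {0..T}"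
    note p = S.\<theta>_pos[OF yt, of i]
    have "k1 * (\<theta>_y i y t)\<^sup>2 \<le> k1 * (1 + \<theta> i y t ^ (2 * m)) * (\<theta>_y i y t)\<^sup>2"
      using k1 p by (intro mult_right_mono) auto
    also note F_lower[OF yt, of i]
    finally have "(\<theta>_y i y t)\<^sup>2 \<le> 1 / k1 * v i y t * (F i y t * \<theta>_y i y t)" using k1 by (simp add: field_simps)
    then have "\<theta> i y t ^ j * (\<theta>_y i y t)\<^sup>2 \<le> \<theta> i y t ^ j * (1 / k1 * v i y t * (F i y t * \<theta>_y i y t))"
      using p by (intro mult_left_mono) auto
    then show "\<bar>\<theta> i y t ^ j * (\<theta>_y i y t)\<^sup>2\<bar> \<le> 1 / k1 * v i y t * (\<theta> i y t ^ j * (F i y t * \<theta>_y i y t))"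
      using p by (simp add: mult_ac)
  qed
  ultimately show ?thesis by (rule dom_trans[rotated])
qed

text \<open>This is what fixes the order of the moment: the upper growth condition bounds
  \<open>F^2\<close> by \<open>F * \<theta>_y\<close> with a weight up to
  \<open>\<theta>^(2 m + 3)\<close>, which is the heat dissipation of the moment of order
  \<open>2 m + 4\<close>.\<close>

lemma dom_F_Lm: "dom (\<lambda>i y t. (F i y t)\<^sup>2) Lm"
proof -
  have "dom (\<lambda>i y t. k2 * (1 / v i y t) * ((1 + \<theta> i y t ^ (2 * m + 3)) * (F i y t * \<theta>_y i y t))) Lm"
  proof (rule dom_mult_left[OF dom_mult_left[OF bd_const bd_inverse_v] domI[of 2]])
    fix i and y t :: real assume yt: "y \<in> {0..1}" "t \<in> {0..T}"
    show "\<bar>(1 + \<theta> i y t ^ (2 * m + 3)) * (F i y t * \<theta>_y i y t)\<bar> \<le> 2 * Lm i y t"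
      using power_F_\<theta>_y_le[OF yt, of 0 i] power_F_\<theta>_y_le[OF yt, of "2 * m + 3" i] S.\<theta>_pos[OF yt, of i]
        F_\<theta>_y_nonneg[OF yt, of i] by (simp add: distrib_right)
  qed simp
  moreover have "dom (\<lambda>i y t. (F i y t)\<^sup>2) (\<lambda>i y t. k2 * (1 / v i y t) * ((1 + \<theta> i y t ^ (2 * m + 3)) * (F i y t * \<theta>_y i y t)))"
  proof (rule dom_le)
    fix i and y t :: real assume yt: "y \<in> {0..1}" "t \<in> {0..T}"
    have "v i y t * (v i y t * (F i y t)\<^sup>2) \<le> v i y t * (k2 * ((1 + \<theta> i y t ^ (2 * m + 3)) * (F i y t * \<theta>_y i y t)))"
      using F_upper[OF yt, of i] by (simp add: power_mult_distrib power2_eq_square mult_ac)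
    then have "v i y t * (F i y t)\<^sup>2 \<le> k2 * ((1 + \<theta> i y t ^ (2 * m + 3)) * (F i y t * \<theta>_y i y t))"
      using S.v_pos[OF yt, of i] by (simp only: mult_le_cancel_left_pos)
    then show "\<bar>(F i y t)\<^sup>2\<bar> \<le> k2 * (1 / v i y t) * ((1 + \<theta> i y t ^ (2 * m + 3)) * (F i y t * \<theta>_y i y t))"
      using S.v_pos[OF yt, of i] by (simp add: field_simps)
  qed
  ultimately show ?thesis by (rule dom_trans[rotated])
qed

lemma dom_\<theta>_power: "j \<le> 2 * m + 4 \<Longrightarrow> dom (\<lambda>i y t. \<theta> i y t ^ j) (\<lambda>i y t. rate i t)"
proof -
  assume j: "j \<le> 2 * m + 4"
  obtain C where C: "C > 0"
    "\<And>j i y t. j \<le> 2 * m + 4 \<Longrightarrow> y \<in> {0..1} \<Longrightarrow> t \<in> {0..T} \<Longrightarrow> \<theta> i y t ^ j \<le> C * (1 + S.dissipation i t)"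
    using \<theta>_power_bound_le by blast
  show ?thesis
  proof (rule domI[of C])
    fix i and y t :: real assume yt: "y \<in> {0..1}" "t \<in> {0..T}"
    have "\<theta> i y t ^ j \<le> C * (1 + S.dissipation i t)" by (rule C(2)[OF j yt])
    also have "\<dots> \<le> C * rate i t" using rate_ge(1)[OF yt(2), of i] C(1) by (intro mult_left_mono) auto
    finally show "\<bar>\<theta> i y t ^ j\<bar> \<le> C * rate i t" using S.\<theta>_pos[OF yt, of i] by simp
  qed (use C(1) in simp)
qed

lemma dom_1_rate: "dom (\<lambda>_ _ _. k) (\<lambda>i y t. rate i t)"
  by (rule dom_trans[OF bd_const dom_le]) (simp add: rate_ge(3))

text \<open>Solving the definition of \<open>n\<close> gives \<open>v_y = v * (n + u) / lam\<close>,
  so \<open>n\<close> and the kinetic energy control the volume gradient.\<close>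

lemma dom_v_y: "dom (\<lambda>i y t. (v_y i y t)\<^sup>2) (\<lambda>i y t. (S.n i y t)\<^sup>2 + (u i y t)\<^sup>2)"
proof -
  have "dom (\<lambda>i y t. (1 / lam)\<^sup>2 * v i y t ^ 2 * (2 * (S.n i y t)\<^sup>2 + 2 * (u i y t)\<^sup>2)) (\<lambda>i y t. (S.n i y t)\<^sup>2 + (u i y t)\<^sup>2)"
    by (rule dom_mult_left[OF dom_mult_left[OF bd_const bd_power[OF bd_v]] domI[of 2]]) auto
  moreover have "dom (\<lambda>i y t. (v_y i y t)\<^sup>2) (\<lambda>i y t. (1 / lam)\<^sup>2 * v i y t ^ 2 * (2 * (S.n i y t)\<^sup>2 + 2 * (u i y t)\<^sup>2))"
  proof (rule dom_le)
    fix i and y t :: real assume yt: "y \<in> {0..1}" "t \<in> {0..T}"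
    have "v_y i y t = 1 / lam * v i y t * (S.n i y t + u i y t)"
      using S.v_nz[OF yt, of i] S.lam by (simp add: S.n_def)
    then have "(v_y i y t)\<^sup>2 = (1 / lam)\<^sup>2 * v i y t ^ 2 * (S.n i y t + u i y t)\<^sup>2" by (simp only: power_mult_distrib)
    also have "\<dots> \<le> (1 / lam)\<^sup>2 * v i y t ^ 2 * (2 * (S.n i y t)\<^sup>2 + 2 * (u i y t)\<^sup>2)"
      by (intro mult_left_mono square_sum_le) simp
    finally show "\<bar>(v_y i y t)\<^sup>2\<bar> \<le> (1 / lam)\<^sup>2 * v i y t ^ 2 * (2 * (S.n i y t)\<^sup>2 + 2 * (u i y t)\<^sup>2)" by simp
  qed
  ultimately show ?thesis by (rule dom_trans[rotated])
qed

text \<open>The terms that Gronwall can absorb: an integrable function of time multiplied by squares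
  whose integrals are bounded or are among the functionals.\<close>

definition Rt where "Rt i y t = rate i t * (1 + (\<sigma> i y t)\<^sup>2 + (S.n i y t)\<^sup>2 + (u i y t)\<^sup>2)"

lemma Rt_nonneg: "t \<in> {0..T} \<Longrightarrow> 0 \<le> Rt i y t"
  unfolding Rt_def using rate_ge(3)[of t i] by (intro mult_nonneg_nonneg add_nonneg_nonneg) auto

lemma dom_Rt: assumes "dom g (\<lambda>i y t. rate i t)" "dom h (\<lambda>i y t. 1 + (\<sigma> i y t)\<^sup>2 + (S.n i y t)\<^sup>2 + (u i y t)\<^sup>2)"
  shows "dom (\<lambda>i y t. g i y t * h i y t) Rt"
  unfolding Rt_def by (rule dom_mult[OF assms])

text \<open>The heat terms go into \<open>Lm\<close>. Squares with weight up to
  \<open>\<theta>^2\<close>, and \<open>\<theta>^4\<close> itself, go into \<open>Rt\<close>, since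
  these powers are bounded by \<open>rate\<close>. The terms \<open>\<sigma>^2 * |u_y|\<close> and
  \<open>|\<sigma>|\<close> times transverse gradients are kept, as they need the supremum of
  \<open>\<sigma>\<close>.\<close>

lemma Y_bound:
  "\<exists>C\<ge>0. \<forall>i. \<forall>y\<in>{0..1}. \<forall>t\<in>{0..T}. Y i y t \<le> C * (Lm i y t + Rt i y t) + (u_y i y t)\<^sup>2
    + (\<sigma> i y t)\<^sup>2 * \<bar>u_y i y t\<bar> + (\<bar>\<sigma> i y t\<bar> + C * rate i t) * (w_y i y t \<bullet> w_y i y t + b_y i y t \<bullet> b_y i y t)"
proof -
  have "dom (\<lambda>i y t. \<theta> i y t ^ 0 * (F i y t * \<theta>_y i y t) + \<theta> i y t ^ 1 * (F i y t * \<theta>_y i y t)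
     + \<theta> i y t ^ 0 * (\<theta>_y i y t)\<^sup>2 + (F i y t)\<^sup>2) Lm"
    by (rule dom_add[OF dom_add[OF dom_add[OF dom_F_\<theta>_y_Lm dom_F_\<theta>_y_Lm] dom_\<theta>_y_Lm] dom_F_Lm]) auto
  then have "dom (\<lambda>i y t. F i y t * \<theta>_y i y t * (1 + \<theta> i y t) + (\<theta>_y i y t)\<^sup>2 + (F i y t)\<^sup>2) Lm"
    by (simp add: algebra_simps)
  then obtain C1 where C1: "0 \<le> C1" "\<And>i y t. y \<in> {0..1} \<Longrightarrow> t \<in> {0..T} \<Longrightarrow>
    \<bar>F i y t * \<theta>_y i y t * (1 + \<theta> i y t) + (\<theta>_y i y t)\<^sup>2 + (F i y t)\<^sup>2\<bar> \<le> C1 * Lm i y t"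
    by (rule domE) (rule that)
  have vy: "dom (\<lambda>i y t. (v_y i y t)\<^sup>2) (\<lambda>i y t. 1 + (\<sigma> i y t)\<^sup>2 + (S.n i y t)\<^sup>2 + (u i y t)\<^sup>2)"
    by (rule dom_trans[OF dom_v_y dom_le]) simp
  have \<sigma>1: "dom (\<lambda>i y t. (\<sigma> i y t)\<^sup>2 + 1) (\<lambda>i y t. 1 + (\<sigma> i y t)\<^sup>2 + (S.n i y t)\<^sup>2 + (u i y t)\<^sup>2)"
    by (rule dom_le) simp
  have one: "dom (\<lambda>_ _ _. 1) (\<lambda>i y t. 1 + (\<sigma> i y t)\<^sup>2 + (S.n i y t)\<^sup>2 + (u i y t)\<^sup>2)"
    by (rule dom_le) simp
  have "dom (\<lambda>i y t. (1 + \<theta> i y t ^ 2) * ((v_y i y t)\<^sup>2 + ((\<sigma> i y t)\<^sup>2 + 1)) + \<theta> i y t ^ 4 * 1) Rt"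
    by (rule dom_add[OF dom_Rt[OF dom_add[OF dom_1_rate dom_\<theta>_power] dom_add[OF vy \<sigma>1]] dom_Rt[OF dom_\<theta>_power one]]) auto
  then obtain C2 where C2: "0 \<le> C2" "\<And>i y t. y \<in> {0..1} \<Longrightarrow> t \<in> {0..T} \<Longrightarrow>
    \<bar>(1 + \<theta> i y t ^ 2) * ((v_y i y t)\<^sup>2 + ((\<sigma> i y t)\<^sup>2 + 1)) + \<theta> i y t ^ 4 * 1\<bar> \<le> C2 * Rt i y t"
    by (rule domE) (rule that)
  have "dom (\<lambda>i y t. 1 + \<theta> i y t ^ 1) (\<lambda>i y t. rate i t)"
    by (rule dom_add[OF dom_1_rate dom_\<theta>_power]) simp
  then obtain C3 where C3: "0 \<le> C3" "\<And>i y t. y \<in> {0..1} \<Longrightarrow> t \<in> {0..T} \<Longrightarrow> \<bar>1 + \<theta> i y t ^ 1\<bar> \<le> C3 * rate i t"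
    by (rule domE) (rule that)
  define C where "C = C1 + C2 + C3"
  have "Y i y t \<le> C * (Lm i y t + Rt i y t) + (u_y i y t)\<^sup>2
    + (\<sigma> i y t)\<^sup>2 * \<bar>u_y i y t\<bar> + (\<bar>\<sigma> i y t\<bar> + C * rate i t) * (w_y i y t \<bullet> w_y i y t + b_y i y t \<bullet> b_y i y t)"
    if yt: "y \<in> {0..1}" "t \<in> {0..T}" for i y t
  proof -
    have r: "0 \<le> rate i t" using rate_ge(3)[OF yt(2), of i] by simp
    have "C1 * Lm i y t \<le> C * Lm i y t" "C2 * Rt i y t \<le> C * Rt i y t"
      using C1(1) C2(1) C3(1) Lm_nonneg[OF yt, of i] Rt_nonneg[OF yt(2), of i y]
      by (auto simp: C_def intro!: mult_right_mono)
    moreover have "(1 + \<bar>\<sigma> i y t\<bar> + \<theta> i y t) * (w_y i y t \<bullet> w_y i y t + b_y i y t \<bullet> b_y i y t)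
      \<le> (\<bar>\<sigma> i y t\<bar> + C * rate i t) * (w_y i y t \<bullet> w_y i y t + b_y i y t \<bullet> b_y i y t)"
    proof (rule mult_right_mono)
      have "C3 * rate i t \<le> C * rate i t" using C1(1) C2(1) r by (intro mult_right_mono) (auto simp: C_def)
      then show "1 + \<bar>\<sigma> i y t\<bar> + \<theta> i y t \<le> \<bar>\<sigma> i y t\<bar> + C * rate i t" using C3(2)[OF yt, of i] by simp
    qed simp
    ultimately show ?thesis
      using C1(2)[OF yt, of i] C2(2)[OF yt, of i] by (simp add: Y_def distrib_left)
  qed
  moreover have "0 \<le> C" using C1(1) C2(1) C3(1) by (simp add: C_def)
  ultimately show ?thesis by blast
qed

definition \<Sigma> where "\<Sigma> i t = integral {0..1} (\<lambda>y. (\<sigma> i y t)\<^sup>2)"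
definition N where "N i t = integral {0..1} (\<lambda>y. (S.n i y t)\<^sup>2)"
definition U where "U i t = integral {0..1} (\<lambda>y. (u_t i y t)\<^sup>2)"
definition ILm where "ILm i t = integral {0..1} (\<lambda>y. Lm i y t)"

lemma \<Sigma>_N_nonneg: "0 \<le> \<Sigma> i t" "0 \<le> N i t" "0 \<le> U i t"
  unfolding \<Sigma>_def N_def U_def by (rule integral_nonneg_Icc, simp)+

lemma cont_Lm: "continuous_on ({0..1} \<times> {0..T}) (\<lambda>(y, t). Lm i y t)"
  unfolding Lm_def case_prod_unfold by (auto intro!: continuous_intros)

lemma cont_Y: "continuous_on ({0..1} \<times> {0..T}) (\<lambda>(y, t). Y i y t)"
  unfolding Y_def case_prod_unfold by (auto intro!: continuous_intros)

lemma cont_Rt: "continuous_on ({0..1} \<times> {0..T}) (\<lambda>(y, t). Rt i y t)"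
  unfolding Rt_def case_prod_unfold
  by (auto intro!: continuous_intros continuous_on_compose2[OF cont_rate])

lemmas cont_slices [continuous_intros] =
  continuous_on_slices[OF cont_Lm] continuous_on_slices[OF cont_Y] continuous_on_slices[OF cont_Rt]

lemma Rt_integral: "\<exists>C\<ge>0. \<forall>i. \<forall>t\<in>{0..T}. integral {0..1} (\<lambda>y. Rt i y t) \<le> C * (rate i t * (1 + \<Sigma> i t + N i t))"
proof -
  obtain E where E: "E > 0" "\<And>i t. t \<in> {0..T} \<Longrightarrow> integral {0..1} (\<lambda>y. (u i y t)\<^sup>2) \<le> E"
    using energy_bounds by blast
  have "integral {0..1} (\<lambda>y. Rt i y t) \<le> (1 + E) * (rate i t * (1 + \<Sigma> i t + N i t))" if t: "t \<in> {0..T}" for i t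
  proof -
    have r: "0 \<le> rate i t" using rate_ge(3)[OF t, of i] by simp
    have "integral {0..1} (\<lambda>y. 1 + (\<sigma> i y t)\<^sup>2 + (S.n i y t)\<^sup>2 + (u i y t)\<^sup>2)
      = 1 + \<Sigma> i t + N i t + integral {0..1} (\<lambda>y. (u i y t)\<^sup>2)"
      unfolding \<Sigma>_def N_def using t
      by (intro integral_unique has_integral_add integrable_integral integrable_continuous_interval)
        (auto intro!: continuous_intros has_integral_const_real[of 1 0 1, simplified])
    then have "integral {0..1} (\<lambda>y. Rt i y t) = rate i t * (1 + \<Sigma> i t + N i t + integral {0..1} (\<lambda>y. (u i y t)\<^sup>2))"
      by (simp add: Rt_def)
    also have "\<dots> \<le> rate i t * ((1 + E) * (1 + \<Sigma> i t + N i t))"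
    proof (rule mult_left_mono[OF _ r])
      have "0 \<le> E * (\<Sigma> i t + N i t)" using E(1) \<Sigma>_N_nonneg[of i t] by simp
      then show "1 + \<Sigma> i t + N i t + integral {0..1} (\<lambda>y. (u i y t)\<^sup>2) \<le> (1 + E) * (1 + \<Sigma> i t + N i t)"
        using E(2)[OF t, of i] by (simp add: algebra_simps)
    qed
    finally show ?thesis by (simp add: mult_ac)
  qed
  then show ?thesis using E(1) by (intro exI[of _ "1 + E"]) auto
qed

text \<open>\<open>\<sigma>\<close> vanishes at \<open>y = 0\<close> and has space derivative
  \<open>u_t\<close>.\<close>

lemma \<sigma>_square_le_U: assumes y: "y \<in> {0..1}" and t: "t \<in> {0..T}" shows "(\<sigma> i y t)\<^sup>2 \<le> U i t"
proof -
  have z: "0 \<in> {0..1::real}" by simp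
  have "(norm (\<sigma> i y t - \<sigma> i 0 t))\<^sup>2 \<le> integral {0..1} (\<lambda>y. (norm (u_t i y t))\<^sup>2)"
    by (rule norm_diff_square_le_integral_derivative[OF _ _ z y])
      (use t S.\<sigma>_Dy[of _ t i] in \<open>auto intro!: continuous_intros simp flip: has_real_derivative_iff_has_vector_derivative\<close>)
  then show ?thesis using S.boundary[of 0 t i] t by (simp add: U_def)
qed

text \<open>The supremum of \<open>\<sigma>^2\<close> costs \<open>U\<close>, the dissipation of the
  stress functional, of which only a small share may be spent. For \<open>|\<sigma>|\<close> times
  the transverse gradients this succeeds because the integral of their squares is already
  bounded.\<close>

lemma Y_integral:
  assumes \<delta>: "0 < \<delta>"
  shows "\<exists>C\<ge>0. \<forall>i. \<forall>t\<in>{0..T}. integral {0..1} (\<lambda>y. Y i y t) \<le> \<delta> * U i t + C * (ILm i t + rate i t * (1 + \<Sigma> i t + N i t))"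
proof -
  obtain C1 where C1: "0 \<le> C1" "\<And>i y t. y \<in> {0..1} \<Longrightarrow> t \<in> {0..T} \<Longrightarrow> Y i y t \<le> C1 * (Lm i y t + Rt i y t) + (u_y i y t)\<^sup>2
    + (\<sigma> i y t)\<^sup>2 * \<bar>u_y i y t\<bar> + (\<bar>\<sigma> i y t\<bar> + C1 * rate i t) * (w_y i y t \<bullet> w_y i y t + b_y i y t \<bullet> b_y i y t)"
    using Y_bound by blast
  obtain C2 where C2: "0 \<le> C2" "\<And>i t. t \<in> {0..T} \<Longrightarrow> integral {0..1} (\<lambda>y. Rt i y t) \<le> C2 * (rate i t * (1 + \<Sigma> i t + N i t))"
    using Rt_integral by blast
  obtain B where B: "B > 0" "\<And>i t. t \<in> {0..T} \<Longrightarrow> transv i t \<le> B" using transv_bound by blast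
  \<comment> \<open>\<open>e\<close> and \<open>d\<close> allot half of \<open>\<delta>\<close> to
    each of the two terms that involve the supremum of \<open>\<sigma>\<close>.\<close>
  define e where "e = \<delta> / 2"
  define d where "d = \<delta> / (2 * B)"
  have ed: "0 < e" "0 < d" "d * B = \<delta> / 2" using \<delta> B(1) by (simp_all add: e_def d_def)
  define C where "C = C1 + C1 * C2 + 1 + 1 / (4 * e) + (1 / (4 * d) + C1) * B"
  have "integral {0..1} (\<lambda>y. Y i y t) \<le> \<delta> * U i t + C * (ILm i t + rate i t * (1 + \<Sigma> i t + N i t))"
    if t: "t \<in> {0..T}" for i t
  proof -
    let ?r = "rate i t" and ?S = "rate i t * (1 + \<Sigma> i t + N i t)"
    have r: "1 \<le> ?r" by (rule rate_ge(3)[OF t])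
    have nn: "0 \<le> \<Sigma> i t" "0 \<le> N i t" "0 \<le> U i t" by (rule \<Sigma>_N_nonneg)+
    have rS: "?r \<le> ?S" "?r * \<Sigma> i t \<le> ?S" using r nn by (simp_all add: distrib_left)
    have I0: "0 \<le> ILm i t" unfolding ILm_def using t by (intro integral_nonneg_Icc Lm_nonneg) auto
    have tv: "integral {0..1} (\<lambda>y. w_y i y t \<bullet> w_y i y t + b_y i y t \<bullet> b_y i y t) \<le> B"
      using B(2)[OF t, of i] by (simp add: transv_def)
    have tri: "integral {0..1} (\<lambda>y. \<bar>u_y i y t\<bar> * \<bar>\<sigma> i y t\<bar> * \<bar>\<sigma> i y t\<bar>) \<le> e * U i t + ?S / (4 * e)"
    proof -
      have "integral {0..1} (\<lambda>y. \<bar>u_y i y t\<bar> * \<bar>\<sigma> i y t\<bar> * \<bar>\<sigma> i y t\<bar>)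
        \<le> e * U i t + integral {0..1} (\<lambda>y. (u_y i y t)\<^sup>2) * integral {0..1} (\<lambda>y. (\<sigma> i y t)\<^sup>2) / (4 * e)"
        by (rule integral_triple_le[OF _ _ _ \<sigma>_square_le_U[OF _ t] ed(1)]) (use t in \<open>auto intro!: continuous_intros\<close>)
      also have "integral {0..1} (\<lambda>y. (u_y i y t)\<^sup>2) * integral {0..1} (\<lambda>y. (\<sigma> i y t)\<^sup>2) \<le> ?r * \<Sigma> i t"
        using u_y_square_le_rate[OF t, of i] nn(1) by (auto simp: \<Sigma>_def intro!: mult_right_mono)
      also note rS(2)
      finally show ?thesis using ed(1) by (simp add: divide_right_mono)
    qed
    have s\<sigma>: "\<bar>\<sigma> i y t\<bar> \<le> d * U i t + 1 / (4 * d)" if y: "y \<in> {0..1}" for y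
    proof -
      have "\<bar>\<sigma> i y t\<bar> \<le> 2 * d * \<bar>\<sigma> i y t\<bar>\<^sup>2 / 2 + 1\<^sup>2 / (2 * (2 * d))"
        using young[of "2 * d" "\<bar>\<sigma> i y t\<bar>" 1] ed(2) by simp
      moreover have "d * (\<sigma> i y t)\<^sup>2 \<le> d * U i t" using \<sigma>_square_le_U[OF y t, of i] ed(2) by (intro mult_left_mono) auto
      ultimately show ?thesis by simp
    qed
    have "integral {0..1} (\<lambda>y. Y i y t) \<le> integral {0..1} (\<lambda>y. C1 * (Lm i y t + Rt i y t) + (u_y i y t)\<^sup>2
      + \<bar>u_y i y t\<bar> * \<bar>\<sigma> i y t\<bar> * \<bar>\<sigma> i y t\<bar>
      + (d * U i t + 1 / (4 * d) + C1 * ?r) * (w_y i y t \<bullet> w_y i y t + b_y i y t \<bullet> b_y i y t))"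
    proof (rule integral_mono_cont)
      fix y :: real assume y: "y \<in> {0..1}"
      have "(\<bar>\<sigma> i y t\<bar> + C1 * ?r) * (w_y i y t \<bullet> w_y i y t + b_y i y t \<bullet> b_y i y t)
        \<le> (d * U i t + 1 / (4 * d) + C1 * ?r) * (w_y i y t \<bullet> w_y i y t + b_y i y t \<bullet> b_y i y t)"
        using s\<sigma>[OF y] by (intro mult_right_mono) auto
      moreover have "(\<sigma> i y t)\<^sup>2 * \<bar>u_y i y t\<bar> = \<bar>u_y i y t\<bar> * \<bar>\<sigma> i y t\<bar> * \<bar>\<sigma> i y t\<bar>"
        by (simp add: power2_eq_square mult.assoc)
      ultimately show "Y i y t \<le> C1 * (Lm i y t + Rt i y t) + (u_y i y t)\<^sup>2
        + \<bar>u_y i y t\<bar> * \<bar>\<sigma> i y t\<bar> * \<bar>\<sigma> i y t\<bar>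
        + (d * U i t + 1 / (4 * d) + C1 * ?r) * (w_y i y t \<bullet> w_y i y t + b_y i y t \<bullet> b_y i y t)"
        using C1(2)[OF y t, of i] by linarith
    qed (use t in \<open>auto intro!: continuous_intros\<close>)
    also have "\<dots> = C1 * (ILm i t + integral {0..1} (\<lambda>y. Rt i y t)) + integral {0..1} (\<lambda>y. (u_y i y t)\<^sup>2)
      + integral {0..1} (\<lambda>y. \<bar>u_y i y t\<bar> * \<bar>\<sigma> i y t\<bar> * \<bar>\<sigma> i y t\<bar>)
      + (d * U i t + 1 / (4 * d) + C1 * ?r) * integral {0..1} (\<lambda>y. w_y i y t \<bullet> w_y i y t + b_y i y t \<bullet> b_y i y t)"
      unfolding ILm_def using t
      by (intro integral_unique has_integral_add has_integral_mult_right integrable_integral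
          integrable_continuous_interval) (auto intro!: continuous_intros)
    also have "\<dots> \<le> C1 * (ILm i t + C2 * ?S) + ?r + (e * U i t + ?S / (4 * e)) + (d * U i t + 1 / (4 * d) + C1 * ?r) * B"
      using C1(1) C2(2)[OF t, of i] u_y_square_le_rate[OF t, of i] tri tv nn ed r
      by (intro add_mono mult_left_mono) auto
    also have "\<dots> = \<delta> * U i t + (C1 * ILm i t + C1 * C2 * ?S + ?r + ?S / (4 * e) + (1 / (4 * d) + C1 * ?r) * B)"
    proof -
      have "d * U i t * B = \<delta> / 2 * U i t"
        unfolding ed(3)[symmetric] by (simp only: mult_ac)
      then have *: "(d * U i t + 1 / (4 * d) + C1 * ?r) * B = \<delta> / 2 * U i t + (1 / (4 * d) + C1 * ?r) * B"
        by (simp only: add.assoc distrib_right[of "d * U i t"])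
      show ?thesis unfolding * by (simp add: e_def algebra_simps)
    qed
    also have "\<dots> \<le> \<delta> * U i t + C * (ILm i t + ?S)"
    proof -
      have "(1 / (4 * d) + C1 * ?r) * B \<le> ((1 / (4 * d) + C1) * ?S) * B"
      proof (rule mult_right_mono)
        have "1 / (4 * d) * 1 \<le> 1 / (4 * d) * ?S" using order_trans[OF r rS(1)] ed(2) by (intro mult_left_mono) (assumption, simp)
        moreover have "C1 * ?r \<le> C1 * ?S" using rS(1) C1(1) by (rule mult_left_mono)
        ultimately show "1 / (4 * d) + C1 * ?r \<le> (1 / (4 * d) + C1) * ?S" by (simp add: distrib_right)
      qed (use B(1) in simp)
      moreover have "0 \<le> (C1 * C2 + 1 + 1 / (4 * e) + (1 / (4 * d) + C1) * B) * ILm i t"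
        using C1(1) C2(1) ed B(1) I0 by (intro mult_nonneg_nonneg add_nonneg_nonneg) auto
      moreover have "0 \<le> C1 * ?S" using C1(1) rS(1) r by simp
      moreover have "C * (x + z) = C1 * x + C1 * C2 * z + z + z / (4 * e) + ((1 / (4 * d) + C1) * z) * B
        + (C1 * C2 + 1 + 1 / (4 * e) + (1 / (4 * d) + C1) * B) * x + C1 * z" for x z
        by (simp add: C_def algebra_simps add_divide_distrib)
      ultimately show ?thesis using rS(1) by simp
    qed
    finally show ?thesis .
  qed
  moreover have "0 \<le> C" unfolding C_def using C1(1) C2(1) ed B(1) by (intro add_nonneg_nonneg mult_nonneg_nonneg) auto
  ultimately show ?thesis by blast
qed

section \<open>Growth of the moment and of the volume gradient\<close>

lemma dom_abs_iff: "dom (\<lambda>i y t. \<bar>g i y t\<bar>) B \<longleftrightarrow> dom g B"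
  by (simp add: dom_def)

abbreviation \<Theta> where "\<Theta> i t \<equiv> S.moment i (2 * m + 4) t"

lemma moment_density:
  assumes yt: "y \<in> {0..1}" "t \<in> {0..T}"
  shows "0 \<le> Cv / real (2 * m + 4 + 1) * \<theta> i y t ^ (2 * m + 4 + 1)"
    "0 \<le> 4 * a / real (2 * m + 4 + 4) * v i y t * \<theta> i y t ^ (2 * m + 4 + 4)"
  using S.v_pos[OF yt, of i] S.\<theta>_pos[OF yt, of i] S.Cv S.a by simp_all

lemma \<Theta>_nonneg: "t \<in> {0..T} \<Longrightarrow> 0 \<le> \<Theta> i t"
  unfolding S.moment_def by (intro integral_nonneg_Icc add_nonneg_nonneg moment_density)

text \<open>The radiation part of the moment of order \<open>2 m + 4\<close> has the exponent
  \<open>2 m + 8\<close>; its weight \<open>v\<close> is removed by the lower bound on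
  \<open>v\<close>.\<close>

lemma \<theta>8_integral: "\<exists>C\<ge>0. \<forall>i. \<forall>t\<in>{0..T}. integral {0..1} (\<lambda>y. \<theta> i y t ^ (2 * m + 8)) \<le> C * \<Theta> i t"
proof -
  have "dom (\<lambda>i y t. real (2 * m + 8) / (4 * a) * (1 / v i y t)) (\<lambda>_ _ _. 1)"
    by (rule dom_mult_left[OF bd_const bd_inverse_v])
  then obtain C where C: "0 \<le> C" "\<And>i y t. y \<in> {0..1} \<Longrightarrow> t \<in> {0..T} \<Longrightarrow> \<bar>real (2 * m + 8) / (4 * a) * (1 / v i y t)\<bar> \<le> C * 1"
    by (rule domE) (rule that)
  have "integral {0..1} (\<lambda>y. \<theta> i y t ^ (2 * m + 8)) \<le> C * \<Theta> i t" if t: "t \<in> {0..T}" for i t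
  proof -
    have "integral {0..1} (\<lambda>y. \<theta> i y t ^ (2 * m + 8)) \<le> integral {0..1} (\<lambda>y. C * (Cv / real (2 * m + 4 + 1) * \<theta> i y t ^ (2 * m + 4 + 1)
        + 4 * a / real (2 * m + 4 + 4) * v i y t * \<theta> i y t ^ (2 * m + 4 + 4)))"
    proof (rule integral_mono_cont)
      fix y :: real assume y: "y \<in> {0..1}"
      note d = moment_density[OF y t, of i]
      let ?B = "4 * a / real (2 * m + 8) * v i y t * \<theta> i y t ^ (2 * m + 8)"
      have e: "2 * m + 4 + 4 = 2 * m + 8" by simp
      have "\<theta> i y t ^ (2 * m + 8) = real (2 * m + 8) / (4 * a) * (1 / v i y t) * ?B"
        using S.v_nz[OF y t, of i] S.a by (simp del: of_nat_add of_nat_mult)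
      also have "\<dots> \<le> C * ?B"
        using order_trans[OF abs_ge_self C(2)[OF y t, of i]] d(2)[unfolded e]
        by (intro mult_right_mono) simp_all
      also have "\<dots> \<le> C * (Cv / real (2 * m + 4 + 1) * \<theta> i y t ^ (2 * m + 4 + 1) + ?B)"
        using C(1) d(1) by (intro mult_left_mono) auto
      finally show "\<theta> i y t ^ (2 * m + 8) \<le> C * (Cv / real (2 * m + 4 + 1) * \<theta> i y t ^ (2 * m + 4 + 1)
        + 4 * a / real (2 * m + 4 + 4) * v i y t * \<theta> i y t ^ (2 * m + 4 + 4))"
        unfolding e .
    qed (use t in \<open>auto intro!: continuous_intros\<close>)
    then show ?thesis by (simp only: S.moment_def integral_mult_right)
  qed
  then show ?thesis using C(1) by blast
qed

definition moment_source where "moment_source i y t =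
    \<theta> i y t ^ (2 * m + 4) * ((lam * u_y i y t / v i y t - (R * \<theta> i y t / v i y t + a / 3 * \<theta> i y t ^ 4)) * u_y i y t
        + (\<mu> * (w_y i y t \<bullet> w_y i y t) + \<nu> * (b_y i y t \<bullet> b_y i y t)) / v i y t)
    - a * real (2 * m + 4) / real (2 * m + 4 + 4) * \<theta> i y t ^ (2 * m + 4 + 4) * u_y i y t"

text \<open>Expressed through \<open>\<sigma>\<close> and \<open>f\<close>, \<open>u_y\<close> is at
  most of order \<open>1 + |\<sigma>| + \<theta>^4\<close>, so apart from transverse gradients the
  source is of order \<open>\<theta>^(2 m + 4) * (1 + \<sigma>^2 + \<theta>^8)\<close>. The highest
  power is regrouped as \<open>\<theta>^4 * \<theta>^(2 m + 8)\<close>: the first factor is bounded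
  by \<open>rate\<close>, the second by the density of the moment.\<close>

lemma dom_moment_source: "dom moment_source
  (\<lambda>i y t. rate i t * (1 + (\<sigma> i y t)\<^sup>2 + (w_y i y t \<bullet> w_y i y t + b_y i y t \<bullet> b_y i y t) + \<theta> i y t ^ (2 * m + 8)))"
proof -
  let ?B = "\<lambda>i y t. rate i t * (1 + (\<sigma> i y t)\<^sup>2 + (w_y i y t \<bullet> w_y i y t + b_y i y t \<bullet> b_y i y t) + \<theta> i y t ^ (2 * m + 8))"
  let ?k = "2 * m + 4"
  have \<theta>p: "0 \<le> \<theta> i y t" if "y \<in> {0..1}" "t \<in> {0..T}" for i y t using S.\<theta>_pos[OF that, of i] by simp
  have fp: "dom f (\<lambda>i y t. 1 + \<theta> i y t ^ 4)"
  proof -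
    have \<theta>1: "dom \<theta> (\<lambda>i y t. 1 + \<theta> i y t ^ 4)"
    proof (rule dom_le)
      fix i and y t :: real assume yt: "y \<in> {0..1}" "t \<in> {0..T}"
      show "\<bar>\<theta> i y t\<bar> \<le> 1 + \<theta> i y t ^ 4" using power_le_one_plus_power[OF \<theta>p[OF yt, of i], of 1 4] \<theta>p[OF yt, of i] by simp
    qed
    have "dom (\<lambda>i y t. R * (1 / v i y t) * \<theta> i y t + a / 3 * \<theta> i y t ^ 4 + 1 / 2 * (b i y t \<bullet> b i y t)) (\<lambda>i y t. 1 + \<theta> i y t ^ 4)"
      by (rule dom_add[OF dom_add[OF dom_mult_left[OF dom_mult_left[OF bd_const bd_inverse_v] \<theta>1]
            dom_mult_left[OF bd_const dom_le]] dom_mult_left[OF bd_const dom_trans[OF bd_b_b dom_le]]]) simp_all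
    then show ?thesis by (simp add: S.f_eq[abs_def])
  qed
  have uy: "dom u_y (\<lambda>i y t. 1 + \<bar>\<sigma> i y t\<bar> + \<theta> i y t ^ 4)"
  proof -
    have 1: "dom (\<lambda>i y t. 1 / lam * v i y t * (\<sigma> i y t + f i y t)) (\<lambda>i y t. 1 + \<bar>\<sigma> i y t\<bar> + \<theta> i y t ^ 4)"
      by (rule dom_mult_left[OF dom_mult_left[OF bd_const bd_v] dom_add[OF dom_le dom_trans[OF fp dom_le]]]) simp_all
    have 2: "dom u_y (\<lambda>i y t. \<bar>1 / lam * v i y t * (\<sigma> i y t + f i y t)\<bar>)"
    proof (rule dom_le)
      fix i and y t :: real assume yt: "y \<in> {0..1}" "t \<in> {0..T}"
      show "\<bar>u_y i y t\<bar> \<le> \<bar>1 / lam * v i y t * (\<sigma> i y t + f i y t)\<bar>"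
        using S.v_nz[OF yt, of i] S.lam by (simp add: S.\<sigma>_eq)
    qed
    show ?thesis by (rule dom_trans[OF 2 iffD2[OF dom_abs_iff 1]])
  qed
  have p8: "dom (\<lambda>i y t. \<theta> i y t ^ ?k * (1 + (\<sigma> i y t)\<^sup>2 + \<theta> i y t ^ 8)) ?B"
  proof -
    have "dom (\<lambda>i y t. \<theta> i y t ^ ?k * (1 + (\<sigma> i y t)\<^sup>2) + \<theta> i y t ^ 4 * \<theta> i y t ^ (2 * m + 8)) ?B"
    proof (rule dom_add)
      show "dom (\<lambda>i y t. \<theta> i y t ^ ?k * (1 + (\<sigma> i y t)\<^sup>2)) ?B"
        by (rule dom_mult[OF dom_\<theta>_power dom_le]) (use \<theta>p in auto)
      show "dom (\<lambda>i y t. \<theta> i y t ^ 4 * \<theta> i y t ^ (2 * m + 8)) ?B"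
        by (rule dom_mult[OF dom_\<theta>_power dom_le]) (use \<theta>p in auto)
    qed
    then show ?thesis by (simp add: distrib_left flip: power_add)
  qed
  have sq: "dom (\<lambda>i y t. (1 + \<bar>\<sigma> i y t\<bar> + \<theta> i y t ^ 4) * (1 + \<bar>\<sigma> i y t\<bar> + \<theta> i y t ^ 4)) (\<lambda>i y t. 1 + (\<sigma> i y t)\<^sup>2 + \<theta> i y t ^ 8)"
  proof (rule domI[of 4])
    fix i and y t :: real assume yt: "y \<in> {0..1}" "t \<in> {0..T}"
    have "(1 + \<bar>\<sigma> i y t\<bar> + \<theta> i y t ^ 4)\<^sup>2 \<le> 2 * (1 + \<bar>\<sigma> i y t\<bar>)\<^sup>2 + 2 * (\<theta> i y t ^ 4)\<^sup>2" by (rule square_sum_le)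
    also have "(1 + \<bar>\<sigma> i y t\<bar>)\<^sup>2 \<le> 2 * 1\<^sup>2 + 2 * \<bar>\<sigma> i y t\<bar>\<^sup>2" by (rule square_sum_le)
    also have "(\<theta> i y t ^ 4)\<^sup>2 = \<theta> i y t ^ 8" by (simp flip: power_mult)
    also have "2 * (2 * 1\<^sup>2 + 2 * \<bar>\<sigma> i y t\<bar>\<^sup>2) + 2 * \<theta> i y t ^ 8 \<le> 4 * (1 + (\<sigma> i y t)\<^sup>2 + \<theta> i y t ^ 8)"
      by simp
    finally show "\<bar>(1 + \<bar>\<sigma> i y t\<bar> + \<theta> i y t ^ 4) * (1 + \<bar>\<sigma> i y t\<bar> + \<theta> i y t ^ 4)\<bar> \<le> 4 * (1 + (\<sigma> i y t)\<^sup>2 + \<theta> i y t ^ 8)"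
      using \<theta>p[OF yt, of i] by (simp add: power2_eq_square)
  qed simp
  have \<sigma>\<beta>: "dom (\<lambda>i y t. \<sigma> i y t + 1 / 2 * (b i y t \<bullet> b i y t)) (\<lambda>i y t. 1 + \<bar>\<sigma> i y t\<bar> + \<theta> i y t ^ 4)"
    by (rule dom_add[OF dom_le dom_mult_left[OF bd_const dom_trans[OF bd_b_b dom_le]]]) (use \<theta>p in simp_all)
  have A: "dom (\<lambda>i y t. \<theta> i y t ^ ?k * ((\<sigma> i y t + 1 / 2 * (b i y t \<bullet> b i y t)) * u_y i y t)) ?B"
  proof (rule dom_trans[OF _ p8])
    show "dom (\<lambda>i y t. \<theta> i y t ^ ?k * ((\<sigma> i y t + 1 / 2 * (b i y t \<bullet> b i y t)) * u_y i y t))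
      (\<lambda>i y t. \<theta> i y t ^ ?k * (1 + (\<sigma> i y t)\<^sup>2 + \<theta> i y t ^ 8))"
      by (rule dom_mult[OF dom_le dom_trans[OF dom_mult[OF \<sigma>\<beta> uy] sq]]) (use \<theta>p in simp)
  qed
  have Q: "dom (\<lambda>i y t. \<theta> i y t ^ ?k * ((1 / v i y t) * (\<mu> * (w_y i y t \<bullet> w_y i y t) + \<nu> * (b_y i y t \<bullet> b_y i y t)))) ?B"
    by (rule dom_mult[OF dom_\<theta>_power dom_mult_left[OF bd_inverse_v dom_add[OF dom_mult_left[OF bd_const dom_le]
          dom_mult_left[OF bd_const dom_le]]]]) (use \<theta>p in auto)
  have D: "dom (\<lambda>i y t. a * real ?k / real (?k + 4) * (\<theta> i y t ^ ?k * (\<theta> i y t ^ 4 * u_y i y t))) ?B"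
  proof (rule dom_mult_left[OF bd_const dom_trans[OF _ p8]])
    have "dom (\<lambda>i y t. \<theta> i y t ^ 4) (\<lambda>i y t. 1 + \<bar>\<sigma> i y t\<bar> + \<theta> i y t ^ 4)"
      by (rule dom_le) (use \<theta>p in simp)
    from dom_mult[OF dom_le dom_trans[OF dom_mult[OF this uy] sq]]
    show "dom (\<lambda>i y t. \<theta> i y t ^ ?k * (\<theta> i y t ^ 4 * u_y i y t)) (\<lambda>i y t. \<theta> i y t ^ ?k * (1 + (\<sigma> i y t)\<^sup>2 + \<theta> i y t ^ 8))"
      using \<theta>p by simp
  qed
  have "dom (\<lambda>i y t. \<theta> i y t ^ ?k * ((\<sigma> i y t + 1 / 2 * (b i y t \<bullet> b i y t)) * u_y i y t)
    + \<theta> i y t ^ ?k * ((1 / v i y t) * (\<mu> * (w_y i y t \<bullet> w_y i y t) + \<nu> * (b_y i y t \<bullet> b_y i y t)))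
    - a * real ?k / real (?k + 4) * (\<theta> i y t ^ ?k * (\<theta> i y t ^ 4 * u_y i y t))) ?B"
    by (rule dom_diff[OF dom_add[OF A Q] D])
  moreover have "moment_source i y t = \<theta> i y t ^ ?k * ((\<sigma> i y t + 1 / 2 * (b i y t \<bullet> b i y t)) * u_y i y t)
    + \<theta> i y t ^ ?k * ((1 / v i y t) * (\<mu> * (w_y i y t \<bullet> w_y i y t) + \<nu> * (b_y i y t \<bullet> b_y i y t)))
    - a * real ?k / real (?k + 4) * (\<theta> i y t ^ ?k * (\<theta> i y t ^ 4 * u_y i y t))" for i y t
  proof -
    have s: "lam * u_y i y t / v i y t - (R * \<theta> i y t / v i y t + a / 3 * \<theta> i y t ^ 4) = \<sigma> i y t + 1 / 2 * (b i y t \<bullet> b i y t)"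
      by (simp add: S.\<sigma>_eq S.f_eq)
    show ?thesis
      unfolding moment_source_def s power_add[of _ ?k 4]
      by (simp only: distrib_left[of "\<theta> i y t ^ ?k"] mult.assoc times_divide_eq_left mult_1_left)
  qed
  ultimately show ?thesis by (simp only: dom_def)
qed

definition I\<theta> where "I\<theta> i t = integral {0..1} (\<lambda>y. \<theta> i y t ^ (2 * m + 3) * (F i y t * \<theta>_y i y t))"

lemma cont_moment_source: "continuous_on ({0..1} \<times> {0..T}) (\<lambda>(y, t). moment_source i y t)"
  unfolding moment_source_def case_prod_unfold by (auto intro!: continuous_intros)

lemma moment_bound:
  "\<exists>C\<ge>0. \<forall>i. \<forall>t\<in>{0..T}. integral {0..1} (\<lambda>y. moment_source i y t) \<le> C * (rate i t * (1 + \<Sigma> i t + \<Theta> i t))"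
proof -
  obtain C where C: "0 \<le> C" "\<And>i y t. y \<in> {0..1} \<Longrightarrow> t \<in> {0..T} \<Longrightarrow> \<bar>moment_source i y t\<bar> \<le> C * (rate i t * (1 + (\<sigma> i y t)\<^sup>2
    + (w_y i y t \<bullet> w_y i y t + b_y i y t \<bullet> b_y i y t) + \<theta> i y t ^ (2 * m + 8)))"
    by (rule domE[OF dom_moment_source]) (rule that)
  obtain B where B: "B > 0" "\<And>i t. t \<in> {0..T} \<Longrightarrow> transv i t \<le> B" using transv_bound by blast
  obtain D where D: "0 \<le> D" "\<And>i t. t \<in> {0..T} \<Longrightarrow> integral {0..1} (\<lambda>y. \<theta> i y t ^ (2 * m + 8)) \<le> D * \<Theta> i t"
    using \<theta>8_integral by blast
  have "integral {0..1} (\<lambda>y. moment_source i y t) \<le> C * (1 + B + D) * (rate i t * (1 + \<Sigma> i t + \<Theta> i t))"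
    if t: "t \<in> {0..T}" for i t
  proof -
    have r: "0 \<le> rate i t" using rate_ge(3)[OF t, of i] by simp
    have "integral {0..1} (\<lambda>y. moment_source i y t) \<le> integral {0..1} (\<lambda>y. (C * rate i t) * (1 + (\<sigma> i y t)\<^sup>2
      + (w_y i y t \<bullet> w_y i y t + b_y i y t \<bullet> b_y i y t) + \<theta> i y t ^ (2 * m + 8)))"
    proof (rule integral_mono_cont)
      fix y :: real assume y: "y \<in> {0..1}"
      show "moment_source i y t \<le> (C * rate i t) * (1 + (\<sigma> i y t)\<^sup>2
        + (w_y i y t \<bullet> w_y i y t + b_y i y t \<bullet> b_y i y t) + \<theta> i y t ^ (2 * m + 8))"
        using C(2)[OF y t, of i] by (simp add: mult.assoc)
    qed (use t in \<open>auto intro!: continuous_intros continuous_on_slices[OF cont_moment_source]\<close>)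
    also have "\<dots> = (C * rate i t) * (1 + \<Sigma> i t + transv i t + integral {0..1} (\<lambda>y. \<theta> i y t ^ (2 * m + 8)))"
      unfolding \<Sigma>_def transv_def using t
      by (intro integral_unique has_integral_mult_right has_integral_add integrable_integral
          integrable_continuous_interval has_integral_const_real[of 1 0 1, simplified])
        (auto intro!: continuous_intros)
    also have "\<dots> \<le> (C * rate i t) * ((1 + B + D) * (1 + \<Sigma> i t + \<Theta> i t))"
    proof (rule mult_left_mono)
      have "0 \<le> (B + D) * \<Sigma> i t" "0 \<le> (1 + B) * \<Theta> i t"
        using B(1) D(1) \<Sigma>_N_nonneg(1)[of i t] \<Theta>_nonneg[OF t, of i] by simp_all
      then show "1 + \<Sigma> i t + transv i t + integral {0..1} (\<lambda>y. \<theta> i y t ^ (2 * m + 8)) \<le> (1 + B + D) * (1 + \<Sigma> i t + \<Theta> i t)"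
        using B(2)[OF t, of i] D(2)[OF t, of i] D(1) by (simp add: algebra_simps)
    qed (use C(1) r in simp)
    finally show ?thesis by (simp add: mult_ac)
  qed
  then show ?thesis using C(1) B(1) D(1) by (intro exI[of _ "C * (1 + B + D)"]) auto
qed

text \<open>\<open>f_y\<close> is linear in \<open>\<theta>_y\<close>, \<open>v_y\<close> and
  \<open>b_y\<close>. With a weight \<open>g\<close>, each product \<open>g * n * h\<close> is split
  into \<open>g * n^2\<close> and \<open>g * h^2\<close>. For \<open>h = \<theta>_y\<close> the
  second part is bounded by \<open>Lm\<close>, for \<open>h = v_y\<close> by \<open>Rt\<close>, and
  for \<open>h = |b_y|\<close> its integral is already known to be bounded.\<close>

lemma n_rate_bound:
  "\<exists>C\<ge>0. \<forall>i. \<forall>t\<in>{0..T}. integral {0..1} (\<lambda>y. 2 * S.n i y t * S.f_y i y t) \<le> C * (ILm i t + rate i t * (1 + \<Sigma> i t + N i t))"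
proof -
  let ?G = "\<lambda>i y t. Lm i y t + Rt i y t + b_y i y t \<bullet> b_y i y t"
  have nn: "0 \<le> Lm i y t" "0 \<le> Rt i y t" "0 \<le> \<theta> i y t" if "y \<in> {0..1}" "t \<in> {0..T}" for i y t
    using Lm_nonneg[OF that] Rt_nonneg[OF that(2)] S.\<theta>_pos[OF that] by (auto intro: less_imp_le)
  have n2: "dom (\<lambda>i y t. (S.n i y t)\<^sup>2) (\<lambda>i y t. 1 + (\<sigma> i y t)\<^sup>2 + (S.n i y t)\<^sup>2 + (u i y t)\<^sup>2)"
    by (rule dom_le) simp
  have RtG: "dom Rt ?G" by (rule dom_le) (use nn in simp)
  have LmG: "dom Lm ?G" by (rule dom_le) (use nn in simp)
  have prod: "dom (\<lambda>i y t. g i y t * S.n i y t * h i y t) (\<lambda>i y t. \<bar>g i y t\<bar> * (S.n i y t)\<^sup>2 + \<bar>g i y t\<bar> * (h i y t)\<^sup>2)" for g h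
  proof (rule dom_le)
    fix i and y t :: real
    have "\<bar>S.n i y t\<bar> * \<bar>h i y t\<bar> \<le> (S.n i y t)\<^sup>2 + (h i y t)\<^sup>2"
      using mult_le_squares[of "\<bar>S.n i y t\<bar>" "\<bar>h i y t\<bar>"] by simp
    then have "\<bar>g i y t\<bar> * (\<bar>S.n i y t\<bar> * \<bar>h i y t\<bar>) \<le> \<bar>g i y t\<bar> * ((S.n i y t)\<^sup>2 + (h i y t)\<^sup>2)"
      by (rule mult_left_mono) simp
    then show "\<bar>g i y t * S.n i y t * h i y t\<bar> \<le> \<bar>g i y t\<bar> * (S.n i y t)\<^sup>2 + \<bar>g i y t\<bar> * (h i y t)\<^sup>2"
      by (simp add: abs_mult distrib_left mult.assoc)
  qed
  have gn: "dom (\<lambda>i y t. \<bar>\<theta> i y t ^ j\<bar> * (S.n i y t)\<^sup>2) ?G" if "j \<le> 2 * m + 4" for j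
    by (rule dom_trans[OF dom_Rt[OF _ n2] RtG])
      (use dom_\<theta>_power[OF that] in \<open>simp add: dom_def\<close>)
  have \<theta>y: "dom (\<lambda>i y t. \<theta> i y t ^ j * S.n i y t * \<theta>_y i y t) ?G" if "j \<le> 2 * m + 3" for j
  proof (rule dom_trans[OF prod dom_add[OF gn]])
    show "dom (\<lambda>i y t. \<bar>\<theta> i y t ^ j\<bar> * (\<theta>_y i y t)\<^sup>2) ?G"
      by (rule dom_trans[OF _ dom_trans[OF dom_\<theta>_y_Lm[OF that] LmG]]) (rule dom_le, use nn in simp)
  qed (use that in simp)
  have vy: "dom (\<lambda>i y t. \<theta> i y t ^ 1 * S.n i y t * v_y i y t) ?G"
  proof (rule dom_trans[OF prod dom_add[OF gn]])
    have "dom (\<lambda>i y t. (v_y i y t)\<^sup>2) (\<lambda>i y t. 1 + (\<sigma> i y t)\<^sup>2 + (S.n i y t)\<^sup>2 + (u i y t)\<^sup>2)"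
      by (rule dom_trans[OF dom_v_y dom_le]) simp
    then have vv: "dom (\<lambda>i y t. \<theta> i y t ^ 1 * (v_y i y t)\<^sup>2) Rt"
      by (intro dom_Rt dom_\<theta>_power) auto
    show "dom (\<lambda>i y t. \<bar>\<theta> i y t ^ 1\<bar> * (v_y i y t)\<^sup>2) ?G"
      by (rule dom_trans[OF dom_le dom_trans[OF vv RtG]]) (use nn in simp)
  qed simp
  have bby: "dom (\<lambda>i y t. norm (b i y t) * S.n i y t * norm (b_y i y t)) ?G"
  proof (rule dom_trans[OF prod dom_add])
    have "dom (\<lambda>i y t. 1 * (S.n i y t)\<^sup>2) Rt" by (rule dom_Rt[OF dom_1_rate n2])
    then have n: "dom (\<lambda>i y t. (S.n i y t)\<^sup>2) ?G" using dom_trans[OF _ RtG] by simp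
    have nb: "bd (\<lambda>i y t. \<bar>norm (b i y t)\<bar>)" using bd_norm_b by (simp add: dom_def)
    show "dom (\<lambda>i y t. \<bar>norm (b i y t)\<bar> * (S.n i y t)\<^sup>2) ?G" by (rule dom_mult_left[OF nb n])
    show "dom (\<lambda>i y t. \<bar>norm (b i y t)\<bar> * (norm (b_y i y t))\<^sup>2) ?G"
      by (rule dom_mult_left[OF nb dom_le]) (use nn in \<open>simp add: power2_norm_eq_inner\<close>)
  qed
  have bb: "dom (\<lambda>i y t. S.n i y t * (b i y t \<bullet> b_y i y t)) ?G"
  proof (rule dom_trans[OF dom_le])
    fix i and y t :: real
    show "\<bar>S.n i y t * (b i y t \<bullet> b_y i y t)\<bar> \<le> \<bar>norm (b i y t) * S.n i y t * norm (b_y i y t)\<bar>"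
      using mult_left_mono[OF Cauchy_Schwarz_ineq2[of "b i y t" "b_y i y t"], of "\<bar>S.n i y t\<bar>"]
      by (simp add: abs_mult mult_ac)
    show "dom (\<lambda>i y t. \<bar>norm (b i y t) * S.n i y t * norm (b_y i y t)\<bar>) ?G"
      using bby by (simp add: dom_def)
  qed
  have "dom (\<lambda>i y t. 2 * R * (1 / v i y t) * (\<theta> i y t ^ 0 * S.n i y t * \<theta>_y i y t)
     + 8 * a / 3 * (\<theta> i y t ^ 3 * S.n i y t * \<theta>_y i y t)
     - 2 * R * (1 / v i y t) ^ 2 * (\<theta> i y t ^ 1 * S.n i y t * v_y i y t) + 2 * (S.n i y t * (b i y t \<bullet> b_y i y t))) ?G"
    by (rule dom_add[OF dom_diff[OF dom_add[OF
          dom_mult_left[OF dom_mult_left[OF bd_const bd_inverse_v] \<theta>y]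
          dom_mult_left[OF bd_const \<theta>y]]
          dom_mult_left[OF dom_mult_left[OF bd_const bd_power[OF bd_inverse_v]] vy]]
          dom_mult_left[OF bd_const bb]]) auto
  moreover have "2 * S.n i y t * S.f_y i y t = 2 * R * (1 / v i y t) * (\<theta> i y t ^ 0 * S.n i y t * \<theta>_y i y t)
     + 8 * a / 3 * (\<theta> i y t ^ 3 * S.n i y t * \<theta>_y i y t)
     - 2 * R * (1 / v i y t) ^ 2 * (\<theta> i y t ^ 1 * S.n i y t * v_y i y t) + 2 * (S.n i y t * (b i y t \<bullet> b_y i y t))" for i y t
    by (simp add: S.f_y_def power_one_over algebra_simps)
  ultimately have "dom (\<lambda>i y t. 2 * S.n i y t * S.f_y i y t) ?G" by (simp only: dom_def)
  then obtain C where C: "0 \<le> C" "\<And>i y t. y \<in> {0..1} \<Longrightarrow> t \<in> {0..T} \<Longrightarrow> \<bar>2 * S.n i y t * S.f_y i y t\<bar> \<le> C * ?G i y t"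
    by (rule domE) (rule that)
  obtain D where D: "0 \<le> D" "\<And>i t. t \<in> {0..T} \<Longrightarrow> integral {0..1} (\<lambda>y. Rt i y t) \<le> D * (rate i t * (1 + \<Sigma> i t + N i t))"
    using Rt_integral by blast
  obtain B where B: "B > 0" "\<And>i t. t \<in> {0..T} \<Longrightarrow> transv i t \<le> B" using transv_bound by blast
  have "integral {0..1} (\<lambda>y. 2 * S.n i y t * S.f_y i y t) \<le> C * (1 + D + B) * (ILm i t + rate i t * (1 + \<Sigma> i t + N i t))"
    if t: "t \<in> {0..T}" for i t
  proof -
    let ?S = "rate i t * (1 + \<Sigma> i t + N i t)"
    have r: "1 \<le> rate i t" by (rule rate_ge(3)[OF t])
    have S1: "1 \<le> ?S"
      using mult_mono[of 1 "rate i t" 1 "1 + \<Sigma> i t + N i t"] r \<Sigma>_N_nonneg[of i t] by simp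
    have I0: "0 \<le> ILm i t" unfolding ILm_def using t by (intro integral_nonneg_Icc Lm_nonneg) auto
    have "integral {0..1} (\<lambda>y. 2 * S.n i y t * S.f_y i y t) \<le> integral {0..1} (\<lambda>y. C * ?G i y t)"
    proof (rule integral_mono_cont)
      show "2 * S.n i y t * S.f_y i y t \<le> C * ?G i y t" if "y \<in> {0..1}" for y
        using C(2)[OF that t, of i] by linarith
    qed (use t in \<open>auto intro!: continuous_intros\<close>)
    also have "\<dots> = C * (ILm i t + integral {0..1} (\<lambda>y. Rt i y t) + integral {0..1} (\<lambda>y. b_y i y t \<bullet> b_y i y t))"
      unfolding ILm_def using t
      by (intro integral_unique has_integral_mult_right has_integral_add integrable_integral
          integrable_continuous_interval) (auto intro!: continuous_intros)
    also have "\<dots> \<le> C * (ILm i t + D * ?S + B * ?S)"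
    proof (rule mult_left_mono[OF _ C(1)])
      have "integral {0..1} (\<lambda>y. b_y i y t \<bullet> b_y i y t) \<le> B * 1"
        using transv_parts(2)[OF t, of i] B(2)[OF t, of i] by simp
      also have "\<dots> \<le> B * ?S" using S1 B(1) by (intro mult_left_mono) auto
      finally show "ILm i t + integral {0..1} (\<lambda>y. Rt i y t) + integral {0..1} (\<lambda>y. b_y i y t \<bullet> b_y i y t)
        \<le> ILm i t + D * ?S + B * ?S" using D(2)[OF t, of i] by simp
    qed
    also have "\<dots> \<le> C * ((1 + D + B) * (ILm i t + ?S))"
    proof (rule mult_left_mono[OF _ C(1)])
      have "0 \<le> (D + B) * ILm i t" using D(1) B(1) I0 by simp
      then show "ILm i t + D * ?S + B * ?S \<le> (1 + D + B) * (ILm i t + ?S)"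
        using S1 by (simp add: distrib_right distrib_left)
    qed
    finally show ?thesis by (simp add: mult.assoc)
  qed
  then show ?thesis using C(1) D(1) B(1) by (intro exI[of _ "C * (1 + D + B)"]) auto
qed

text \<open>In the correction, \<open>c * \<theta> * \<sigma>\<close> is absorbed by half of the
  quadratic term, and the arctan term is at most quadratic in \<open>\<theta>\<close>, as arctan is
  bounded. The remainders are controlled by the energy through
  \<open>\<theta>^2 \<le> 1 + \<theta>^4\<close>.\<close>

lemma stress_lower: "\<exists>k>0. \<exists>C\<ge>0. \<forall>i. \<forall>t\<in>{0..T}. k * \<Sigma> i t \<le> P.stress i t + C"
proof -
  obtain v0 where v0: "v0 > 0" "\<And>i y t. y \<in> {0..1} \<Longrightarrow> t \<in> {0..T} \<Longrightarrow> v0 \<le> v i y t" using v_lower by blast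
  obtain E where E: "E > 0" "\<And>i t. t \<in> {0..T} \<Longrightarrow> integral {0..1} (\<lambda>y. v i y t * \<theta> i y t ^ 4) \<le> E"
    using energy_bounds by blast
  define A where "A = c\<^sup>2 / v0 + 4 * \<bar>c\<bar> * L"
  have A: "0 \<le> A" using v0(1) L by (simp add: A_def)
  have "v0 / 4 * \<Sigma> i t \<le> P.stress i t + A * (1 + E / v0)" if t: "t \<in> {0..T}" for i t
  proof -
    have "v0 / 4 * \<Sigma> i t = integral {0..1} (\<lambda>y. v0 / 4 * (\<sigma> i y t)\<^sup>2)" by (simp add: \<Sigma>_def)
    also have "\<dots> \<le> integral {0..1} (\<lambda>y. psi L c (v i y t) (\<sigma> i y t) (\<theta> i y t) + A * (1 + 1 / v0 * (v i y t * \<theta> i y t ^ 4)))"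
    proof (rule integral_mono_cont)
      fix y :: real assume y: "y \<in> {0..1}"
      note p = S.v_pos[OF y t, of i] S.\<theta>_pos[OF y t, of i]
      define h where "h = \<theta> i y t"
      define s where "s = \<sigma> i y t"
      have h: "0 \<le> h" using p by (simp add: h_def)
      have "\<bar>c * (h * s)\<bar> = \<bar>s\<bar> * (\<bar>c\<bar> * h)" using h by (simp add: abs_mult mult_ac)
      also have "\<dots> \<le> (v0 / 2) * \<bar>s\<bar>\<^sup>2 / 2 + (\<bar>c\<bar> * h)\<^sup>2 / (2 * (v0 / 2))"
        using v0(1) by (intro young) simp
      also have "\<dots> = v0 / 4 * s\<^sup>2 + c\<^sup>2 / v0 * h\<^sup>2" by (simp add: power_mult_distrib)
      finally have 1: "\<bar>c * (h * s)\<bar> \<le> v0 / 4 * s\<^sup>2 + c\<^sup>2 / v0 * h\<^sup>2" .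
      have 2: "\<bar>c * (h * (L * (1 + h)) * arctan (s / (L * (1 + h))))\<bar> \<le> \<bar>c\<bar> * L * (2 * (h + h\<^sup>2))"
      proof -
        have "\<bar>arctan (s / (L * (1 + h)))\<bar> \<le> 2"
          using arctan_bounded[of "s / (L * (1 + h))"] pi_less_4 by (simp add: abs_if)
        then have "\<bar>c\<bar> * (h * (L * (1 + h))) * \<bar>arctan (s / (L * (1 + h)))\<bar> \<le> \<bar>c\<bar> * (h * (L * (1 + h))) * 2"
          using h L by (intro mult_left_mono) auto
        moreover have "\<bar>k * (h * (L * (1 + h)) * q)\<bar> = \<bar>k\<bar> * (h * (L * (1 + h))) * \<bar>q\<bar>" for k q
          using h L by (simp add: abs_mult)
        moreover have "\<bar>k\<bar> * (h * (L * (1 + h))) * 2 = \<bar>k\<bar> * L * (2 * (h + h\<^sup>2))" for k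
          by (simp add: power2_eq_square algebra_simps)
        ultimately show ?thesis by simp
      qed
      have h1: "h \<le> 1 + h ^ 4" "h\<^sup>2 \<le> 1 + h ^ 4"
        using power_le_one_plus_power[OF h, of 1 4] power_le_one_plus_power[OF h, of 2 4] by simp_all
      have "c\<^sup>2 / v0 * h\<^sup>2 \<le> c\<^sup>2 / v0 * (1 + h ^ 4)" using h1 v0(1) by (intro mult_left_mono) auto
      moreover have "\<bar>c\<bar> * L * (2 * (h + h\<^sup>2)) \<le> \<bar>c\<bar> * L * (4 * (1 + h ^ 4))"
        using h1 L by (intro mult_left_mono) auto
      moreover have "(x + 4 * \<bar>y\<bar> * L) * z = x * z + \<bar>y\<bar> * L * (4 * z)" for x y z by (simp add: algebra_simps)
      ultimately have 3: "c\<^sup>2 / v0 * h\<^sup>2 + \<bar>c\<bar> * L * (2 * (h + h\<^sup>2)) \<le> A * (1 + h ^ 4)"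
        unfolding A_def by simp
      have 4: "A * (1 + h ^ 4) \<le> A * (1 + 1 / v0 * (v i y t * h ^ 4))"
      proof (rule mult_left_mono[OF _ A])
        have "v0 * h ^ 4 \<le> v i y t * h ^ 4" using v0(2)[OF y t, of i] h by (intro mult_right_mono) auto
        then show "1 + h ^ 4 \<le> 1 + 1 / v0 * (v i y t * h ^ 4)" using v0(1) by (simp add: field_simps)
      qed
      have 5: "v0 * s\<^sup>2 / 2 \<le> v i y t * s\<^sup>2 / 2" using v0(2)[OF y t, of i] by (simp add: mult_right_mono)
      have "psi L c (v i y t) s h = v i y t * s\<^sup>2 / 2 + c * (h * s) - c * (h * (L * (1 + h)) * arctan (s / (L * (1 + h))))"
        unfolding psi_def by (simp only: right_diff_distrib[of c] add_diff_eq)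
      with 1 2 3 4 5 have "v0 / 4 * s\<^sup>2 \<le> psi L c (v i y t) s h + A * (1 + 1 / v0 * (v i y t * h ^ 4))" by linarith
      then show "v0 / 4 * (\<sigma> i y t)\<^sup>2 \<le> psi L c (v i y t) (\<sigma> i y t) (\<theta> i y t) + A * (1 + 1 / v0 * (v i y t * \<theta> i y t ^ 4))"
        by (simp only: h_def s_def)
    next
      show "continuous_on {0..1} (\<lambda>y. psi L c (v i y t) (\<sigma> i y t) (\<theta> i y t) + A * (1 + 1 / v0 * (v i y t * \<theta> i y t ^ 4)))"
        unfolding psi_def using t v0(1) by (auto intro!: continuous_intros simp flip: P.l_def)
    qed (use t in \<open>auto intro!: continuous_intros\<close>)
    also have "\<dots> = P.stress i t + A * (1 + 1 / v0 * integral {0..1} (\<lambda>y. v i y t * \<theta> i y t ^ 4))"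
      unfolding P.stress_def using t v0(1)
      by (intro integral_unique has_integral_add has_integral_mult_right integrable_integral
          integrable_continuous_interval has_integral_const_real[of 1 0 1, simplified])
        (auto intro!: continuous_intros simp: psi_def simp flip: P.l_def)
    also have "\<dots> \<le> P.stress i t + A * (1 + E / v0)"
      using A v0(1) E(2)[OF t, of i] by (intro add_left_mono mult_left_mono) (auto intro: divide_right_mono)
    finally show ?thesis .
  qed
  moreover have "0 \<le> A * (1 + E / v0)" using A v0(1) E(1) by simp
  ultimately show ?thesis using v0(1) by (intro exI[of _ "v0 / 4"] exI[of _ "A * (1 + E / v0)"] conjI allI ballI) auto
qed

section \<open>Closing the estimate\<close>

lemma initial_functionals: "\<exists>B\<ge>0. \<forall>i. \<bar>\<Theta> i 0\<bar> \<le> B \<and> \<bar>P.stress i 0\<bar> \<le> B \<and> \<bar>N i 0\<bar> \<le> B"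
proof -
  have \<sigma>0: "\<sigma> i y 0 = \<sigma> undefined y 0" if y: "y \<in> {0..1}" for i y
    using initial[OF y, of i undefined] by (simp add: S.\<sigma>_eq S.f_eq)
  have "\<exists>B>0. \<forall>i. \<bar>\<Theta> i 0\<bar> \<le> B"
    unfolding S.moment_def
  proof (rule initial_integral)
    fix i and y :: real assume y: "y \<in> {0..1}"
    show "Cv / real (2 * m + 4 + 1) * \<theta> i y 0 ^ (2 * m + 4 + 1) + 4 * a / real (2 * m + 4 + 4) * v i y 0 * \<theta> i y 0 ^ (2 * m + 4 + 4)
      = Cv / real (2 * m + 4 + 1) * \<theta> undefined y 0 ^ (2 * m + 4 + 1)
        + 4 * a / real (2 * m + 4 + 4) * v undefined y 0 * \<theta> undefined y 0 ^ (2 * m + 4 + 4)"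
      using initial[OF y, of i undefined] by simp
  qed
  then obtain B1 where B1: "B1 > 0" "\<And>i. \<bar>\<Theta> i 0\<bar> \<le> B1" by blast
  have "\<exists>B>0. \<forall>i. \<bar>P.stress i 0\<bar> \<le> B"
    unfolding P.stress_def
  proof (rule initial_integral)
    fix i and y :: real assume y: "y \<in> {0..1}"
    show "psi L c (v i y 0) (\<sigma> i y 0) (\<theta> i y 0) = psi L c (v undefined y 0) (\<sigma> undefined y 0) (\<theta> undefined y 0)"
      using initial[OF y, of i undefined] \<sigma>0[OF y, of i] by simp
  qed
  then obtain B2 where B2: "B2 > 0" "\<And>i. \<bar>P.stress i 0\<bar> \<le> B2" by blast
  have "\<exists>B>0. \<forall>i. \<bar>N i 0\<bar> \<le> B"
    unfolding N_def
  proof (rule initial_integral)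
    fix i and y :: real assume y: "y \<in> {0..1}"
    show "(S.n i y 0)\<^sup>2 = (S.n undefined y 0)\<^sup>2"
      using initial[OF y, of i undefined] by (simp add: S.n_def)
  qed
  then obtain B3 where B3: "B3 > 0" "\<And>i. \<bar>N i 0\<bar> \<le> B3" by blast
  show ?thesis
  proof (intro exI[of _ "B1 + B2 + B3"] conjI allI)
    show "\<bar>\<Theta> i 0\<bar> \<le> B1 + B2 + B3" "\<bar>P.stress i 0\<bar> \<le> B1 + B2 + B3" "\<bar>N i 0\<bar> \<le> B1 + B2 + B3" for i
      using B1(2)[of i] B2(2)[of i] B3(2)[of i] B1(1) B2(1) B3(1) by linarith+
  qed (use B1(1) B2(1) B3(1) in simp)
qed

lemma cont_functionals: "continuous_on {0..T} (\<Sigma> i)" "continuous_on {0..T} (N i)" "continuous_on {0..T} (\<Theta> i)"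
  "continuous_on {0..T} (I\<theta> i)" "continuous_on {0..T} (ILm i)"
  unfolding \<Sigma>_def N_def S.moment_def I\<theta>_def ILm_def
  by (rule continuous_on_integral_param, auto intro!: continuous_intros simp: case_prod_unfold)+

lemma I\<theta>_nonneg: "t \<in> {0..T} \<Longrightarrow> 0 \<le> I\<theta> i t"
  unfolding I\<theta>_def using S.\<theta>_pos[of _ t i]
  by (intro integral_nonneg_Icc mult_nonneg_nonneg[OF zero_le_power F_\<theta>_y_nonneg]) (auto simp: less_imp_le)

lemma ILm_le: assumes t: "t \<in> {0..T}" shows "ILm i t \<le> S.dissipation i t + I\<theta> i t"
proof -
  have "ILm i t = integral {0..1} (\<lambda>y. F i y t * \<theta>_y i y t / (\<theta> i y t)\<^sup>2) + I\<theta> i t"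
    unfolding ILm_def I\<theta>_def Lm_def using t
    by (intro integral_unique has_integral_add integrable_integral integrable_continuous_interval)
      (auto intro!: continuous_intros)
  moreover have "integral {0..1} (\<lambda>y. F i y t * \<theta>_y i y t / (\<theta> i y t)\<^sup>2) \<le> S.dissipation i t"
    unfolding S.dissipation_def
  proof (rule integral_mono_cont)
    fix y :: real assume y: "y \<in> {0..1}"
    show "F i y t * \<theta>_y i y t / (\<theta> i y t)\<^sup>2 \<le> F i y t * \<theta>_y i y t / (\<theta> i y t)\<^sup>2
      + (lam * (u_y i y t)\<^sup>2 + \<mu> * (w_y i y t \<bullet> w_y i y t) + \<nu> * (b_y i y t \<bullet> b_y i y t)) / (v i y t * \<theta> i y t)"
      using viscous_nonneg[of i y t] S.v_pos[OF y t, of i] S.\<theta>_pos[OF y t, of i] by simp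
  qed (use t in \<open>auto intro!: continuous_intros\<close>)
  ultimately show ?thesis by simp
qed

lemma stress_growth:
  "\<exists>C\<ge>0. \<forall>i. \<forall>t\<in>{0..T}. integral {0..1} (\<lambda>y. P.stress_rate i y t) \<le> C * (ILm i t + rate i t * (1 + \<Sigma> i t + N i t))"
proof -
  obtain C1 where C1: "0 \<le> C1" "\<And>i y t. y \<in> {0..1} \<Longrightarrow> t \<in> {0..T} \<Longrightarrow>
    P.stress_rate i y t \<le> - (lam / 4) * (u_t i y t)\<^sup>2 + C1 * Y i y t"
    using stress_rate_bound by blast
  \<comment> \<open>The share of \<open>U\<close> that \<open>Y\<close> brings in must not exceed
    the remaining dissipation \<open>lam / 4\<close>; the summand 1 covers
    \<open>C1 = 0\<close>.\<close>
  define \<delta> where "\<delta> = lam / (4 * (C1 + 1))"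
  have \<delta>: "0 < \<delta>" "C1 * \<delta> \<le> lam / 4" using C1(1) S.lam by (simp_all add: \<delta>_def field_simps)
  obtain C2 where C2: "0 \<le> C2" "\<And>i t. t \<in> {0..T} \<Longrightarrow>
    integral {0..1} (\<lambda>y. Y i y t) \<le> \<delta> * U i t + C2 * (ILm i t + rate i t * (1 + \<Sigma> i t + N i t))"
    using Y_integral[OF \<delta>(1)] by blast
  have "integral {0..1} (\<lambda>y. P.stress_rate i y t) \<le> C1 * C2 * (ILm i t + rate i t * (1 + \<Sigma> i t + N i t))"
    if t: "t \<in> {0..T}" for i t
  proof -
    let ?Z = "ILm i t + rate i t * (1 + \<Sigma> i t + N i t)"
    have "integral {0..1} (\<lambda>y. P.stress_rate i y t) \<le> integral {0..1} (\<lambda>y. - (lam / 4) * (u_t i y t)\<^sup>2 + C1 * Y i y t)"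
      by (rule integral_mono_cont[OF _ _ C1(2)])
        (use t in \<open>auto intro!: continuous_intros continuous_on_slices[OF P.cont_stress_rate]\<close>)
    also have "\<dots> = - (lam / 4) * U i t + C1 * integral {0..1} (\<lambda>y. Y i y t)"
      unfolding U_def using t
      by (intro integral_unique has_integral_add has_integral_mult_right integrable_integral
          integrable_continuous_interval) (auto intro!: continuous_intros)
    also have "\<dots> \<le> - (lam / 4) * U i t + C1 * (\<delta> * U i t + C2 * ?Z)"
      using C2(2)[OF t, of i] C1(1) by (intro add_left_mono mult_left_mono) auto
    also have "\<dots> = (C1 * \<delta>) * U i t - lam / 4 * U i t + C1 * C2 * ?Z" by (simp add: distrib_left)
    also have "\<dots> \<le> C1 * C2 * ?Z" using mult_right_mono[OF \<delta>(2) \<Sigma>_N_nonneg(3)[of i t]] by simp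
    finally show ?thesis .
  qed
  then show ?thesis using C1(1) C2(1) by (intro exI[of _ "C1 * C2"]) auto
qed

text \<open>The summand 1 turns constant terms in the growth estimates into multiples of the
  functional.\<close>

definition total where "total i t = 1 + \<Sigma> i t + N i t + \<Theta> i t"

lemma total_ge: assumes t: "t \<in> {0..T}"
  shows "1 \<le> total i t" "1 + \<Sigma> i t + N i t \<le> total i t" "1 + \<Sigma> i t + \<Theta> i t \<le> total i t"
  using \<Sigma>_N_nonneg[of i t] \<Theta>_nonneg[OF t, of i] by (simp_all add: total_def)

lemma cont_total: "continuous_on {0..T} (total i)"
  unfolding total_def by (intro continuous_intros cont_functionals)

text \<open>The growth of \<open>stress\<close> and of \<open>N\<close> contains the heat
  dissipation \<open>I\<theta>\<close> with factors \<open>C1\<close> and \<open>C2\<close>; the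
  moment alone provides it with a negative sign. A large multiple of the moment therefore makes the
  sum close.\<close>

lemma lyapunov: "\<exists>k>0. \<exists>A\<ge>0. \<exists>C>0. \<forall>i. \<forall>t\<in>{0..T}.
  k * total i t + integral {0..t} (I\<theta> i) \<le> A + C * integral {0..t} (\<lambda>s. rate i s * total i s)"
proof -
  obtain C1 where C1: "0 \<le> C1" "\<And>i t. t \<in> {0..T} \<Longrightarrow> integral {0..1} (\<lambda>y. P.stress_rate i y t)
    \<le> C1 * (ILm i t + rate i t * (1 + \<Sigma> i t + N i t))" using stress_growth by blast
  obtain C2 where C2: "0 \<le> C2" "\<And>i t. t \<in> {0..T} \<Longrightarrow> integral {0..1} (\<lambda>y. 2 * S.n i y t * S.f_y i y t)
    \<le> C2 * (ILm i t + rate i t * (1 + \<Sigma> i t + N i t))" using n_rate_bound by blast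
  obtain C3 where C3: "0 \<le> C3" "\<And>i t. t \<in> {0..T} \<Longrightarrow> integral {0..1} (\<lambda>y. moment_source i y t)
    \<le> C3 * (rate i t * (1 + \<Sigma> i t + \<Theta> i t))" using moment_bound by blast
  obtain k C4 where kC4: "0 < k" "0 \<le> C4" "\<And>i t. t \<in> {0..T} \<Longrightarrow> k * \<Sigma> i t \<le> P.stress i t + C4"
    using stress_lower by blast
  obtain B where B: "0 \<le> B" "\<And>i. \<bar>\<Theta> i 0\<bar> \<le> B" "\<And>i. \<bar>P.stress i 0\<bar> \<le> B" "\<And>i. \<bar>N i 0\<bar> \<le> B"
    using initial_functionals by blast
  \<comment> \<open>Beyond the \<open>C1 + C2\<close> needed for absorption, the extra 1 leaves one
    copy of \<open>I\<theta>\<close> on the left, which yields the space-time bound in the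
    end.\<close>
  define M where "M = C1 + C2 + 1"
  define C where "C = M * C3 + 2 * (C1 + C2) + 1"
  have M: "1 \<le> M" using C1(1) C2(1) by (simp add: M_def)
  have C: "0 < C" using C1(1) C2(1) C3(1) M by (simp add: C_def add_nonneg_pos)
  have bound: "M * (integral {0..1} (\<lambda>y. moment_source i y s) - real (2 * m + 4) * I\<theta> i s)
      + integral {0..1} (\<lambda>y. P.stress_rate i y s) + integral {0..1} (\<lambda>y. 2 * S.n i y s * S.f_y i y s)
    \<le> C * (rate i s * total i s) - I\<theta> i s" if s: "s \<in> {0..T}" for i s
  proof -
    let ?T = "rate i s * total i s"
    have r: "1 \<le> rate i s" by (rule rate_ge(3)[OF s])
    have I: "0 \<le> I\<theta> i s" by (rule I\<theta>_nonneg[OF s])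
    have T1: "rate i s * (1 + \<Sigma> i s + N i s) \<le> ?T" "rate i s * (1 + \<Sigma> i s + \<Theta> i s) \<le> ?T"
      using total_ge[OF s, of i] r by (auto intro!: mult_left_mono)
    have "rate i s * 1 \<le> ?T" using total_ge(1)[OF s, of i] r by (intro mult_left_mono) auto
    then have D: "S.dissipation i s \<le> ?T" and T0: "0 \<le> ?T" using rate_ge(1)[OF s, of i] r by linarith+
    \<comment> \<open>The entropy dissipation and the rate term are each at most \<open>?T\<close>;
      hence the factor 2 in \<open>C\<close>.\<close>
    have "ILm i s + rate i s * (1 + \<Sigma> i s + N i s) \<le> I\<theta> i s + 2 * ?T"
      using ILm_le[OF s, of i] D T1 by linarith
    then have "(C1 + C2) * (ILm i s + rate i s * (1 + \<Sigma> i s + N i s)) \<le> (C1 + C2) * (I\<theta> i s + 2 * ?T)"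
      using C1(1) C2(1) by (intro mult_left_mono) auto
    moreover have "M * integral {0..1} (\<lambda>y. moment_source i y s) \<le> M * (C3 * ?T)"
    proof (rule mult_left_mono)
      show "integral {0..1} (\<lambda>y. moment_source i y s) \<le> C3 * ?T"
        using C3(2)[OF s, of i] mult_left_mono[OF T1(2) C3(1)] by linarith
    qed (use M in simp)
    moreover have "M * I\<theta> i s \<le> M * (real (2 * m + 4) * I\<theta> i s)"
      using mult_right_mono[OF _ I, of 1 "real (2 * m + 4)"] M by (intro mult_left_mono) auto
    ultimately show ?thesis
      using C1(2)[OF s, of i] C2(2)[OF s, of i] T0
      by (simp only: M_def C_def distrib_right distrib_left right_diff_distrib mult_1_left mult.assoc[of "_::real" "_::real"]
          flip: add.assoc)
  qed
  show ?thesis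
  proof (intro exI conjI allI ballI)
    let ?k = "min k (min 1 M)"
    show "0 < ?k" using kC4(1) M by simp
    show "0 \<le> (M + 2) * B + C4 + ?k" using M B(1) kC4 by simp
    show "0 < C" by (rule C)
    fix i t assume t: "t \<in> {0..T}"
    have cs: "continuous_on {0..t} g" if "continuous_on {0..T} g" for g :: "real \<Rightarrow> real"
      using t by (intro continuous_on_subset[OF that]) auto
    have c1: "continuous_on {0..t} (\<lambda>s. integral {0..1} (\<lambda>y. moment_source i y s))"
      "continuous_on {0..t} (\<lambda>s. integral {0..1} (\<lambda>y. P.stress_rate i y s))"
      by (intro cs continuous_on_integral_param cont_moment_source P.cont_stress_rate)+
    have c2: "continuous_on {0..t} (\<lambda>s. integral {0..1} (\<lambda>y. 2 * S.n i y s * S.f_y i y s))"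
      by (intro cs continuous_on_integral_param) (auto intro!: continuous_intros simp: case_prod_unfold)
    have c3: "continuous_on {0..t} (I\<theta> i)" "continuous_on {0..t} (rate i)" "continuous_on {0..t} (total i)"
      by (intro cs cont_functionals cont_rate cont_total)+
    have mom: "\<Theta> i t = \<Theta> i 0 + integral {0..t} (\<lambda>s. integral {0..1} (\<lambda>y. moment_source i y s) - real (2 * m + 4) * I\<theta> i s)"
    proof -
      have "\<Theta> i t = \<Theta> i 0 + integral {0..t} (\<lambda>s. integral {0..1} (\<lambda>y. moment_source i y s
        - real (2 * m + 4) * (\<theta> i y s ^ (2 * m + 4 - 1) * (F i y s * \<theta>_y i y s))))"
        unfolding moment_source_def by (rule S.moment_eq[OF t])
      also have "integral {0..t} (\<lambda>s. integral {0..1} (\<lambda>y. moment_source i y s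
        - real (2 * m + 4) * (\<theta> i y s ^ (2 * m + 4 - 1) * (F i y s * \<theta>_y i y s))))
        = integral {0..t} (\<lambda>s. integral {0..1} (\<lambda>y. moment_source i y s) - real (2 * m + 4) * I\<theta> i s)"
      proof (rule Henstock_Kurzweil_Integration.integral_cong)
        fix s assume "s \<in> {0..t}"
        then have s: "s \<in> {0..T}" using t by auto
        have e: "2 * m + 4 - 1 = 2 * m + 3" by simp
        show "integral {0..1} (\<lambda>y. moment_source i y s - real (2 * m + 4) * (\<theta> i y s ^ (2 * m + 4 - 1) * (F i y s * \<theta>_y i y s)))
          = integral {0..1} (\<lambda>y. moment_source i y s) - real (2 * m + 4) * I\<theta> i s"
          unfolding I\<theta>_def e using s
          by (intro integral_unique has_integral_diff has_integral_mult_right integrable_integral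
              integrable_continuous_interval) (auto intro!: continuous_intros continuous_on_slices[OF cont_moment_source])
      qed
      finally show ?thesis .
    qed
    have Nt: "N i t = N i 0 + integral {0..t} (\<lambda>s. integral {0..1} (\<lambda>y. 2 * S.n i y s * S.f_y i y s))"
      unfolding N_def by (rule S.n_square_eq[OF t])
    have "M * \<Theta> i t + P.stress i t + N i t \<le> M * \<Theta> i 0 + P.stress i 0 + N i 0
      + (M * integral {0..t} (\<lambda>s. integral {0..1} (\<lambda>y. moment_source i y s) - real (2 * m + 4) * I\<theta> i s)
        + integral {0..t} (\<lambda>s. integral {0..1} (\<lambda>y. P.stress_rate i y s))
        + integral {0..t} (\<lambda>s. integral {0..1} (\<lambda>y. 2 * S.n i y s * S.f_y i y s)))"
      unfolding mom Nt using P.stress_le[OF t, of i] by (simp add: distrib_left)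
    also have "M * integral {0..t} (\<lambda>s. integral {0..1} (\<lambda>y. moment_source i y s) - real (2 * m + 4) * I\<theta> i s)
        + integral {0..t} (\<lambda>s. integral {0..1} (\<lambda>y. P.stress_rate i y s))
        + integral {0..t} (\<lambda>s. integral {0..1} (\<lambda>y. 2 * S.n i y s * S.f_y i y s))
      = integral {0..t} (\<lambda>s. M * (integral {0..1} (\<lambda>y. moment_source i y s) - real (2 * m + 4) * I\<theta> i s)
        + integral {0..1} (\<lambda>y. P.stress_rate i y s) + integral {0..1} (\<lambda>y. 2 * S.n i y s * S.f_y i y s))"
      by (intro integral_unique[symmetric] has_integral_add has_integral_mult_right integrable_integral
          integrable_continuous_interval continuous_intros c1 c2 c3)
    also have "\<dots> \<le> integral {0..t} (\<lambda>s. C * (rate i s * total i s) - I\<theta> i s)"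
      by (rule integral_mono_cont[OF _ _ bound]) (use t in \<open>auto intro!: continuous_intros c1 c2 c3\<close>)
    also have "\<dots> = C * integral {0..t} (\<lambda>s. rate i s * total i s) - integral {0..t} (I\<theta> i)"
      by (intro integral_unique has_integral_diff has_integral_mult_right integrable_integral
          integrable_continuous_interval continuous_intros c3)
    finally have main: "M * \<Theta> i t + P.stress i t + N i t + integral {0..t} (I\<theta> i)
      \<le> M * \<Theta> i 0 + P.stress i 0 + N i 0 + C * integral {0..t} (\<lambda>s. rate i s * total i s)" by simp
    have "M * \<Theta> i 0 \<le> M * B" using B(2)[of i] M by (intro mult_left_mono) auto
    then have init: "M * \<Theta> i 0 + P.stress i 0 + N i 0 \<le> (M + 2) * B"
      using B(3)[of i] B(4)[of i] by (simp add: distrib_right)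
    have "?k * \<Sigma> i t \<le> k * \<Sigma> i t" "?k * N i t \<le> 1 * N i t" "?k * \<Theta> i t \<le> M * \<Theta> i t"
      by (rule mult_right_mono; use \<Sigma>_N_nonneg[of i t] \<Theta>_nonneg[OF t, of i] in simp)+
    then have "?k * total i t \<le> ?k + P.stress i t + C4 + N i t + M * \<Theta> i t"
      using kC4(3)[OF t, of i] by (simp add: total_def distrib_left)
    with main init show "?k * total i t + integral {0..t} (I\<theta> i)
      \<le> (M + 2) * B + C4 + ?k + C * integral {0..t} (\<lambda>s. rate i s * total i s)" by linarith
  qed
qed

text \<open>The exponents suffice, since \<open>8 \<le> 2 m + 8\<close> and
  \<open>3 \<le> 2 m + 3\<close>. Gronwall bounds \<open>total\<close>; inserted back into
  \<open>lyapunov\<close>, this bounds the time integral of \<open>I\<theta>\<close>, and together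
  with the entropy dissipation that of \<open>Lm\<close>.\<close>

lemma heat_bound_stress:
  "\<exists>C>0. \<forall>i. \<forall>t\<in>{0..T}. integral {0..1} (\<lambda>y. \<theta> i y t ^ 8)
    + integral {0..t} (\<lambda>s. integral {0..1} (\<lambda>y. v i y s * F i y s * \<theta> i y s ^ 3 * \<theta>_y i y s)) \<le> C"
proof -
  obtain k A C where kAC: "k > 0" "A \<ge> 0" "C > 0" "\<And>i t. t \<in> {0..T} \<Longrightarrow>
    k * total i t + integral {0..t} (I\<theta> i) \<le> A + C * integral {0..t} (\<lambda>s. rate i s * total i s)"
    using lyapunov by blast
  have I: "0 \<le> integral {0..t} (I\<theta> i)" if "t \<in> {0..T}" for i t
    using that I\<theta>_nonneg by (intro integral_nonneg_Icc) auto
  have "\<exists>K>0. \<forall>i. \<forall>t\<in>{0..T}. total i t \<le> K"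
  proof (rule gronwall_rate[OF cont_total])
    show "total i t \<le> A / k + C / k * integral {0..t} (\<lambda>s. rate i s * total i s)" if "t \<in> {0..T}" for i t
    proof -
      have "total i t * k \<le> A + C * integral {0..t} (\<lambda>s. rate i s * total i s)"
        using kAC(4)[OF that, of i] I[OF that, of i] by (simp add: mult.commute)
      then have "total i t \<le> (A + C * integral {0..t} (\<lambda>s. rate i s * total i s)) / k"
        using kAC(1) by (simp only: pos_le_divide_eq)
      then show ?thesis by (simp add: add_divide_distrib)
    qed
  qed (use kAC in auto)
  then obtain K where K: "K > 0" "\<And>i t. t \<in> {0..T} \<Longrightarrow> total i t \<le> K" by blast
  obtain B where B: "B > 0" "\<And>i t. t \<in> {0..T} \<Longrightarrow> integral {0..t} (rate i) \<le> B"
    using rate_bound by blast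
  obtain D where D: "D > 0" "\<And>i t. t \<in> {0..T} \<Longrightarrow> integral {0..t} (S.dissipation i) \<le> D"
    using dissipation_bound by blast
  obtain V where V: "V > 0" "\<And>i y t. y \<in> {0..1} \<Longrightarrow> t \<in> {0..T} \<Longrightarrow> v i y t \<le> V" using v_upper by blast
  obtain C8 where C8: "0 \<le> C8" "\<And>i t. t \<in> {0..T} \<Longrightarrow> integral {0..1} (\<lambda>y. \<theta> i y t ^ (2 * m + 8)) \<le> C8 * \<Theta> i t"
    using \<theta>8_integral by blast
  define J where "J = A + C * (K * B)"
  have J: "J \<ge> 0" using kAC K(1) B(1) by (simp add: J_def)
  have "integral {0..1} (\<lambda>y. \<theta> i y t ^ 8)
    + integral {0..t} (\<lambda>s. integral {0..1} (\<lambda>y. v i y s * F i y s * \<theta> i y s ^ 3 * \<theta>_y i y s)) \<le> (1 + C8 * K) + V * (D + J)"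
    if t: "t \<in> {0..T}" for i t
  proof (rule add_mono)
    have "integral {0..1} (\<lambda>y. \<theta> i y t ^ 8) \<le> integral {0..1} (\<lambda>y. 1 + \<theta> i y t ^ (2 * m + 8))"
      by (rule integral_mono_cont) (use t S.\<theta>_pos[of _ t i] in \<open>auto intro!: continuous_intros power_le_one_plus_power simp: less_imp_le\<close>)
    also have "\<dots> = 1 + integral {0..1} (\<lambda>y. \<theta> i y t ^ (2 * m + 8))"
      using t by (intro integral_unique has_integral_add has_integral_const_real[of 1 0 1, simplified]
          integrable_integral integrable_continuous_interval) (auto intro!: continuous_intros)
    also have "integral {0..1} (\<lambda>y. \<theta> i y t ^ (2 * m + 8)) \<le> C8 * K"
    proof -
      have "\<Theta> i t \<le> K" using K(2)[OF t, of i] total_ge[OF t, of i] \<Sigma>_N_nonneg[of i t] by (simp add: total_def)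
      then show ?thesis using C8(2)[OF t, of i] mult_left_mono[OF _ C8(1)] by (meson order_trans)
    qed
    finally show "integral {0..1} (\<lambda>y. \<theta> i y t ^ 8) \<le> 1 + C8 * K" by simp
    have cs: "continuous_on {0..t} g" if "continuous_on {0..T} g" for g :: "real \<Rightarrow> real"
      using t by (intro continuous_on_subset[OF that]) auto
    have c3: "continuous_on {0..t} (I\<theta> i)" "continuous_on {0..t} (rate i)" "continuous_on {0..t} (total i)"
      "continuous_on {0..t} (S.dissipation i)"
      by (intro cs cont_functionals cont_rate cont_total cont_dissipation)+
    have "integral {0..t} (\<lambda>s. integral {0..1} (\<lambda>y. v i y s * F i y s * \<theta> i y s ^ 3 * \<theta>_y i y s))
      \<le> integral {0..t} (\<lambda>s. V * (S.dissipation i s + I\<theta> i s))"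
    proof (rule integral_mono_cont)
      show "continuous_on {0..t} (\<lambda>s. integral {0..1} (\<lambda>y. v i y s * F i y s * \<theta> i y s ^ 3 * \<theta>_y i y s))"
        by (intro cs continuous_on_integral_param) (auto intro!: continuous_intros simp: case_prod_unfold)
      fix s assume "s \<in> {0..t}"
      then have s: "s \<in> {0..T}" using t by auto
      have "integral {0..1} (\<lambda>y. v i y s * F i y s * \<theta> i y s ^ 3 * \<theta>_y i y s) \<le> integral {0..1} (\<lambda>y. V * Lm i y s)"
      proof (rule integral_mono_cont)
        fix y :: real assume y: "y \<in> {0..1}"
        have "v i y s * (\<theta> i y s ^ 3 * (F i y s * \<theta>_y i y s)) \<le> V * Lm i y s"
          using V(1) V(2)[OF y s, of i] power_F_\<theta>_y_le[OF y s, of 3 i] F_\<theta>_y_nonneg[OF y s, of i] S.\<theta>_pos[OF y s, of i]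
          by (intro mult_mono) auto
        then show "v i y s * F i y s * \<theta> i y s ^ 3 * \<theta>_y i y s \<le> V * Lm i y s" by (simp add: mult_ac)
      qed (use s in \<open>auto intro!: continuous_intros\<close>)
      also have "\<dots> = V * ILm i s" by (simp add: ILm_def)
      also have "\<dots> \<le> V * (S.dissipation i s + I\<theta> i s)" using ILm_le[OF s, of i] V(1) by (intro mult_left_mono) auto
      finally show "integral {0..1} (\<lambda>y. v i y s * F i y s * \<theta> i y s ^ 3 * \<theta>_y i y s) \<le> V * (S.dissipation i s + I\<theta> i s)" .
    qed (intro continuous_intros c3)
    also have "\<dots> = V * (integral {0..t} (S.dissipation i) + integral {0..t} (I\<theta> i))"
      by (intro integral_unique has_integral_mult_right has_integral_add integrable_integral
          integrable_continuous_interval c3)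
    also have "\<dots> \<le> V * (D + J)"
    proof -
      have "integral {0..t} (\<lambda>s. rate i s * total i s) \<le> integral {0..t} (\<lambda>s. K * rate i s)"
      proof (rule integral_mono_cont)
        fix s assume "s \<in> {0..t}"
        then have s: "s \<in> {0..T}" using t by auto
        show "rate i s * total i s \<le> K * rate i s"
          using mult_left_mono[OF K(2)[OF s, of i], of "rate i s"] rate_ge(3)[OF s, of i] by (simp add: mult.commute)
      qed (intro continuous_intros c3)+
      also have "\<dots> = K * integral {0..t} (rate i)" by simp
      also have "\<dots> \<le> K * B" using B(2)[OF t, of i] K(1) by (intro mult_left_mono) auto
      finally have "C * integral {0..t} (\<lambda>s. rate i s * total i s) \<le> C * (K * B)" using kAC(3) by simp
      moreover have "0 \<le> k * total i t" using kAC(1) total_ge(1)[OF t, of i] by simp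
      ultimately have "integral {0..t} (I\<theta> i) \<le> J" using kAC(4)[OF t, of i] unfolding J_def by linarith
      then show ?thesis using D(2)[OF t, of i] V(1) by (intro mult_left_mono) auto
    qed
    finally show "integral {0..t} (\<lambda>s. integral {0..1} (\<lambda>y. v i y s * F i y s * \<theta> i y s ^ 3 * \<theta>_y i y s)) \<le> V * (D + J)" .
  qed
  moreover have "0 < (1 + C8 * K) + V * (D + J)"
    using C8(1) K(1) V(1) D(1) J by (intro add_pos_nonneg) auto
  ultimately show ?thesis by blast
qed

end

lemma (in mhd_family) heat_bound:
  "\<exists>C>0. \<forall>i. \<forall>t\<in>{0..T}. integral {0..1} (\<lambda>y. \<theta> i y t ^ 8)
    + integral {0..t} (\<lambda>s. integral {0..1} (\<lambda>y. v i y s * F i y s * \<theta> i y s ^ 3 * \<theta>_y i y s)) \<le> C"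
proof -
  obtain v0 where v0: "v0 > 0" "\<And>i y t. y \<in> {0..1} \<Longrightarrow> t \<in> {0..T} \<Longrightarrow> v0 \<le> v i y t" using v_lower by blast
  \<comment> \<open>It depends only on the uniform lower bound of \<open>v\<close>, hence serves the
    whole family; the summand 1 keeps it positive when \<open>R = Cv / 3\<close>.\<close>
  define L where "L = 2 * \<bar>R - Cv / 3\<bar> / v0 + 1"
  have L: "0 < L" using v0(1) by (simp add: L_def add_nonneg_pos)
  interpret mhd_family_stress lam \<mu> \<nu> R a Cv T k1 k2 m v v_y u u_y u_t \<theta> \<theta>_y \<theta>_t F F_y f \<sigma> w w_y w_t b b_y b_t \<zeta> \<xi> L
  proof unfold_locales
    fix i and y t :: real assume yt: "y \<in> {0..1}" "t \<in> {0..T}"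
    have "2 * \<bar>R - Cv / 3\<bar> = (2 * \<bar>R - Cv / 3\<bar> / v0) * v0" using v0(1) by simp
    also have "\<dots> \<le> L * v i y t"
      using v0(1) v0(2)[OF yt, of i] by (intro mult_mono) (auto simp: L_def)
    finally show "2 * \<bar>R - Cv / 3\<bar> \<le> L * v i y t" .
  qed (rule L)
  show ?thesis by (rule heat_bound_stress)
qed

section \<open>Classical solutions\<close>

lemma C1_yD:
  assumes "C1_y T f" "y \<in> {0..1}" "t \<in> {0..T}"
  shows "((\<lambda>y. f y t) has_vector_derivative Dy f y t) (at y within {0..1})"
  using assms unfolding C1_y_def Dy_def by (auto simp flip: vector_derivative_works)

lemma C1_tD:
  assumes "C1_t T f" "y \<in> {0..1}" "t \<in> {0..T}"
  shows "((\<lambda>t. f y t) has_vector_derivative Dt T f y t) (at t within {0..T})"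
  using assms unfolding C1_t_def Dt_def by (auto simp flip: vector_derivative_works)

lemma C1_y_cont: "C1_y T f \<Longrightarrow> continuous_on ({0..1} \<times> {0..T}) (\<lambda>(y, t). Dy f y t)"
  by (simp add: C1_y_def)

lemma C1_t_cont: "C1_t T f \<Longrightarrow> continuous_on ({0..1} \<times> {0..T}) (\<lambda>(y, t). Dt T f y t)"
  by (simp add: C1_t_def)

lemma Dy_eqI:
  assumes "y \<in> {0..1}" "((\<lambda>y. f y t) has_vector_derivative d) (at y within {0..1})"
  shows "Dy f y t = d"
  unfolding Dy_def using vector_derivative_within_cbox[of 0 1 y "\<lambda>y. f y t" d] assms by simp

lemma Dt_eqI:
  assumes "0 < T" "t \<in> {0..T}" "((\<lambda>t. f y t) has_vector_derivative d) (at t within {0..T})"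
  shows "Dt T f y t = d"
  unfolding Dt_def using vector_derivative_within_cbox[of 0 T t "f y" d] assms by simp

text \<open>\<open>Dy\<close> at a fixed time sees only the profile at that time. At time 0, where
  solutions share their profiles, it shows that they share the initial gradients too.\<close>

lemma Dy_cong:
  assumes f: "C1_y T f" and "y \<in> {0..1}" "t \<in> {0..T}" and eq: "\<And>x. x \<in> {0..1} \<Longrightarrow> f x t = g x t"
  shows "Dy f y t = Dy g y t"
proof (rule Dy_eqI[symmetric])
  show "((\<lambda>y. g y t) has_vector_derivative Dy f y t) (at y within {0..1})"
    by (rule has_vector_derivative_transform[OF assms(2) eq[symmetric] C1_yD[OF assms(1-3)]])
qed fact

text \<open>Needed for the heat flux, as \<open>\<kappa>\<close> is not assumed to be continuous.\<close>

lemma continuous_on_of_Dy: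
  fixes f :: "real \<Rightarrow> real \<Rightarrow> real"
  assumes f: "C1_y T f" and f0: "\<And>t. t \<in> {0..T} \<Longrightarrow> f 0 t = 0"
  shows "continuous_on ({0..1} \<times> {0..T}) (\<lambda>(y, t). f y t)"
proof -
  let ?Q = "{0..1::real} \<times> {0..T}"
  \<comment> \<open>Rescaling by \<open>y\<close> moves the variable endpoint into the integrand, so
    that joint continuity becomes that of a parameter integral over a fixed interval.\<close>
  have f_eq: "f y t = integral {0..1} (\<lambda>x. y * Dy f (y * x) t)" if y: "y \<in> {0..1}" and t: "t \<in> {0..T}" for y t
  proof -
    have "((\<lambda>x. y * Dy f (y * x) t) has_integral f (y * 1) t - f (y * 0) t) {0..1}"
    proof (rule fundamental_theorem_of_calculus)
      fix x :: real assume x: "x \<in> {0..1}"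
      then have yx: "y * x \<in> {0..1}" using y by (auto simp: mult_le_one)
      have img: "(\<lambda>x. y * x) ` {0..1} \<subseteq> {0..1}" using y by (auto simp: mult_le_one)
      have "((\<lambda>x. y * x) has_vector_derivative y) (at x within {0..1})"
        by (auto intro!: derivative_eq_intros)
      from vector_diff_chain_within[OF this has_vector_derivative_within_subset[OF C1_yD[OF f yx t] img]]
      show "((\<lambda>x. f (y * x) t) has_vector_derivative y * Dy f (y * x) t) (at x within {0..1})"
        by (simp add: o_def)
    qed simp
    from integral_unique[OF this] show ?thesis using f0[OF t] by simp
  qed
  have "continuous_on ?Q (\<lambda>z. integral (cbox 0 1) (\<lambda>x. fst z * Dy f (fst z * x) (snd z)))"
  proof (rule integral_continuous_on_param)
    have "continuous_on (?Q \<times> {0..1}) (\<lambda>p. (\<lambda>(y, t). Dy f y t) (fst (fst p) * snd p, snd (fst p)))"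
      by (rule continuous_on_compose2[OF C1_y_cont[OF f]]) (auto intro!: continuous_intros simp: mult_le_one)
    then show "continuous_on (?Q \<times> cbox 0 1) (\<lambda>(z, x). fst z * Dy f (fst z * x) (snd z))"
      by (auto intro!: continuous_intros simp: case_prod_unfold)
  qed
  then show ?thesis
    by (rule continuous_on_eq) (auto simp: f_eq)
qed

text \<open>The equations are required in the open rectangle only; they extend to its closure by
  density and continuity.\<close>

lemma eq_on_closed_box:
  fixes g h :: "real \<Rightarrow> real \<Rightarrow> 'a::real_normed_vector"
  assumes T: "0 < T"
    and g: "continuous_on ({0..1} \<times> {0..T}) (\<lambda>(y, t). g y t)"
    and h: "continuous_on ({0..1} \<times> {0..T}) (\<lambda>(y, t). h y t)"
    and eq: "\<And>y t. y \<in> {0<..<1} \<Longrightarrow> t \<in> {0<..<T} \<Longrightarrow> g y t = h y t"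
    and y: "y \<in> {0..1}" and t: "t \<in> {0..T}"
  shows "g y t = h y t"
proof -
  have cl: "closure ({0<..<1} \<times> {0<..<T}) = {0..1::real} \<times> {0..T}"
    using T by (simp add: closure_Times)
  have "(\<lambda>z. g (fst z) (snd z) - h (fst z) (snd z)) z = 0" if "z = (y, t)" for z
  proof (rule continuous_constant_on_closure[where S = "{0<..<1} \<times> {0<..<T}"])
    show "continuous_on (closure ({0<..<1} \<times> {0<..<T})) (\<lambda>z. g (fst z) (snd z) - h (fst z) (snd z))"
      unfolding cl using g h by (intro continuous_intros) (simp_all add: case_prod_unfold)
    show "z \<in> closure ({0<..<1} \<times> {0<..<T})" unfolding cl using y t that by simp
  qed (use eq in auto)
  then show ?thesis by simp
qed

text \<open>The derivatives of \<open>\<sigma>\<close>, \<open>\<zeta>\<close> and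
  \<open>\<xi>\<close> are written out by the product and quotient rules, which shows their
  continuity on the closed rectangle; the equations then identify them with time derivatives inside,
  hence everywhere. The heat flux is not expanded but treated as one function that is continuously
  differentiable in \<open>y\<close>, so \<open>\<kappa>\<close> is never differentiated.\<close>

lemma mhd_of_solution:
  fixes v u \<theta> :: "real \<Rightarrow> real \<Rightarrow> real" and w b :: "real \<Rightarrow> real \<Rightarrow> real^2"
  assumes pos: "lam > 0" "\<mu> > 0" "\<nu> > 0" "R > 0" "a > 0" "Cv > 0" "T > 0"
    and sm: "smooth_fields \<kappa> T v u w b \<theta>"
    and sol: "solution_P lam \<mu> \<nu> R a Cv \<kappa> T v0 u0 w0 b0 \<theta>0 v u w b \<theta>"
  defines "F \<equiv> \<lambda>y t. \<kappa> (1 / v y t) (\<theta> y t) / v y t * Dy \<theta> y t"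
    and "f \<equiv> \<lambda>y t. R * \<theta> y t / v y t + a / 3 * \<theta> y t ^ 4 + b y t \<bullet> b y t / 2"
  shows "mhd lam \<mu> \<nu> R a Cv T v (Dy v) u (Dy u) (Dt T u) \<theta> (Dy \<theta>) (Dt T \<theta>) F (Dy F) f
    (\<lambda>y t. lam * Dy u y t / v y t - f y t) w (Dy w) (Dt T w) b (Dy b) (Dt T b)
    (\<lambda>y t. b y t + (\<mu> / v y t) *\<^sub>R Dy w y t) (\<lambda>y t. w y t + (\<nu> / v y t) *\<^sub>R Dy b y t)"
proof -
  let ?Q = "{0..1::real} \<times> {0..T}"
  have C: "C1_y T v" "C1_y T u" "C1_y T w" "C1_y T b" "C1_y T \<theta>"
    "C1_t T v" "C1_t T u" "C1_t T w" "C1_t T b" "C1_t T \<theta>"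
    "C1_y T (Dy u)" "C1_y T (Dy w)" "C1_y T (Dy b)" "C1_y T F"
    using sm unfolding smooth_fields_def F_def by auto
  note dv = C(1)[THEN C1_yD] and du = C(2)[THEN C1_yD] and dw = C(3)[THEN C1_yD] and db = C(4)[THEN C1_yD]
    and d\<theta> = C(5)[THEN C1_yD] and tv = C(6)[THEN C1_tD] and tu = C(7)[THEN C1_tD] and tw = C(8)[THEN C1_tD]
    and tb = C(9)[THEN C1_tD] and t\<theta> = C(10)[THEN C1_tD]
    and duy = C(11)[THEN C1_yD] and dwy = C(12)[THEN C1_yD] and dby = C(13)[THEN C1_yD]
    and dF = C(14)[THEN C1_yD]
  note has_real = has_real_derivative_iff_has_vector_derivative
  have p: "v y t > 0" "\<theta> y t > 0" if "y \<in> {0..1}" "t \<in> {0..T}" for y t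
    using sol that unfolding solution_P_def by auto
  have nz: "v y t \<noteq> 0" if "y \<in> {0..1}" "t \<in> {0..T}" for y t using p(1)[OF that] by simp
  have bd: "lam * Dy u y t / v y t - pressure R a (v y t) (\<theta> y t) = 0 \<and> w y t = 0 \<and> b y t = 0 \<and> Dy \<theta> y t = 0"
    if "y = 0 \<or> y = 1" "t \<in> {0..T}" for y t
    using sol that unfolding solution_P_def by blast
  have cc: "continuous_on ?Q (\<lambda>(y, t). v y t)" "continuous_on ?Q (\<lambda>(y, t). u y t)"
    "continuous_on ?Q (\<lambda>(y, t). w y t)" "continuous_on ?Q (\<lambda>(y, t). b y t)"
    "continuous_on ?Q (\<lambda>(y, t). \<theta> y t)"
    by (rule continuous_on_of_partials; fact dv tv C1_y_cont[OF C(1)] C1_t_cont[OF C(6)]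
        du tu C1_y_cont[OF C(2)] C1_t_cont[OF C(7)] dw tw C1_y_cont[OF C(3)] C1_t_cont[OF C(8)]
        db tb C1_y_cont[OF C(4)] C1_t_cont[OF C(9)] d\<theta> t\<theta> C1_y_cont[OF C(5)] C1_t_cont[OF C(10)])+
  have cF: "continuous_on ?Q (\<lambda>(y, t). F y t)"
    by (rule continuous_on_of_Dy[OF C(14)]) (use bd in \<open>simp add: F_def\<close>)
  note cont = cc C(1-5)[THEN C1_y_cont] C(11-14)[THEN C1_y_cont] C(6-10)[THEN C1_t_cont]
  note [continuous_intros] = cont[unfolded case_prod_unfold]
  have nzQ: "\<forall>z\<in>?Q. v (fst z) (snd z) \<noteq> 0" using nz by auto

  define \<sigma>y where "\<sigma>y y t = lam * Dy (Dy u) y t / v y t - lam * Dy u y t * Dy v y t / (v y t)\<^sup>2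
    - (R * Dy \<theta> y t / v y t - R * \<theta> y t * Dy v y t / (v y t)\<^sup>2 + 4 * a / 3 * \<theta> y t ^ 3 * Dy \<theta> y t
      + b y t \<bullet> Dy b y t)" for y t
  define \<zeta>y where "\<zeta>y y t = Dy b y t + ((\<mu> / v y t) *\<^sub>R Dy (Dy w) y t - (\<mu> * Dy v y t / (v y t)\<^sup>2) *\<^sub>R Dy w y t)" for y t
  define \<xi>y where "\<xi>y y t = Dy w y t + ((\<nu> / v y t) *\<^sub>R Dy (Dy b) y t - (\<nu> * Dy v y t / (v y t)\<^sup>2) *\<^sub>R Dy b y t)" for y t
  have c\<sigma>: "continuous_on ?Q (\<lambda>(y, t). \<sigma>y y t)" and c\<zeta>: "continuous_on ?Q (\<lambda>(y, t). \<zeta>y y t)"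
    and c\<xi>: "continuous_on ?Q (\<lambda>(y, t). \<xi>y y t)"
    unfolding \<sigma>y_def \<zeta>y_def \<xi>y_def case_prod_unfold
    using nzQ by (auto intro!: continuous_intros)
  have \<sigma>_Dy: "((\<lambda>y. lam * Dy u y t / v y t - f y t) has_real_derivative \<sigma>y y t) (at y within {0..1})"
    and \<zeta>_Dy: "((\<lambda>y. b y t + (\<mu> / v y t) *\<^sub>R Dy w y t) has_vector_derivative \<zeta>y y t) (at y within {0..1})"
    and \<xi>_Dy: "((\<lambda>y. w y t + (\<nu> / v y t) *\<^sub>R Dy b y t) has_vector_derivative \<xi>y y t) (at y within {0..1})"
    if yt: "y \<in> {0..1}" "t \<in> {0..T}" for y t
  proof -
    note D = dv[OF yt, folded has_real] d\<theta>[OF yt, folded has_real] duy[OF yt, folded has_real]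
    have bb: "((\<lambda>y. b y t \<bullet> b y t) has_real_derivative 2 * (b y t \<bullet> Dy b y t)) (at y within {0..1})"
      using bounded_bilinear.has_vector_derivative[OF bounded_bilinear_inner db[OF yt] db[OF yt]] by (simp add: has_real inner_commute)
    show "((\<lambda>y. lam * Dy u y t / v y t - f y t) has_real_derivative \<sigma>y y t) (at y within {0..1})"
      unfolding f_def \<sigma>y_def
      by (rule derivative_eq_intros D bb nz[OF yt] refl numeral_neq_zero)+
        (use nz[OF yt] in \<open>simp add: field_simps power2_eq_square\<close>)
    have q: "((\<lambda>y. k / v y t) has_real_derivative - (k * Dy v y t / (v y t)\<^sup>2)) (at y within {0..1})" for k
      by (rule derivative_eq_intros D nz[OF yt] refl)+ (simp add: power2_eq_square)
    show "((\<lambda>y. b y t + (\<mu> / v y t) *\<^sub>R Dy w y t) has_vector_derivative \<zeta>y y t) (at y within {0..1})"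
      unfolding \<zeta>y_def
      using has_vector_derivative_add[OF db[OF yt] has_vector_derivative_scaleR[OF q dwy[OF yt]]] by simp
    show "((\<lambda>y. w y t + (\<nu> / v y t) *\<^sub>R Dy b y t) has_vector_derivative \<xi>y y t) (at y within {0..1})"
      unfolding \<xi>y_def
      using has_vector_derivative_add[OF dw[OF yt] has_vector_derivative_scaleR[OF q dby[OF yt]]] by simp
  qed
  have pde: "Dt T v y t = Dy u y t"
      "Dt T u y t = Dy (\<lambda>y t. - pressure R a (v y t) (\<theta> y t) - (norm (b y t))\<^sup>2 / 2 + lam * Dy u y t / v y t) y t"
      "Dt T w y t = Dy (\<lambda>y t. b y t + (\<mu> / v y t) *\<^sub>R Dy w y t) y t"
      "Dt T (\<lambda>y t. v y t *\<^sub>R b y t) y t = Dy (\<lambda>y t. w y t + (\<nu> / v y t) *\<^sub>R Dy b y t) y t"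
      "Dt T (\<lambda>y t. internal_energy Cv a (v y t) (\<theta> y t)) y t = Dy F y t
          + (- pressure R a (v y t) (\<theta> y t) + lam / v y t * Dy u y t) * Dy u y t
          + \<mu> * (norm (Dy w y t))\<^sup>2 / v y t + \<nu> * (norm (Dy b y t))\<^sup>2 / v y t"
    if "y \<in> {0<..<1}" "t \<in> {0<..<T}" for y t
    using sol that unfolding solution_P_def F_def by blast+
  have inQ: "y \<in> {0..1}" "t \<in> {0..T}" if "y \<in> {0<..<1}" "t \<in> {0<..<T}" for y t :: real using that by auto
  have v_t: "Dt T v y t = Dy u y t" if "y \<in> {0..1}" "t \<in> {0..T}" for y t
    by (rule eq_on_closed_box[OF pos(7) _ _ _ that]) (auto intro: cont pde)
  have u_t: "Dt T u y t = \<sigma>y y t" if "y \<in> {0..1}" "t \<in> {0..T}" for y t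
  proof (rule eq_on_closed_box[OF pos(7) _ c\<sigma> _ that])
    fix y t :: real assume i: "y \<in> {0<..<1}" "t \<in> {0<..<T}"
    have e: "(\<lambda>y t. - pressure R a (v y t) (\<theta> y t) - (norm (b y t))\<^sup>2 / 2 + lam * Dy u y t / v y t)
      = (\<lambda>y t. lam * Dy u y t / v y t - f y t)"
      by (simp add: fun_eq_iff f_def pressure_def power2_norm_eq_inner)
    show "Dt T u y t = \<sigma>y y t"
      unfolding pde(2)[OF i] e by (intro Dy_eqI inQ(1)[OF i] \<sigma>_Dy[OF inQ[OF i], unfolded has_real])
  qed (rule cont)
  have w_t: "Dt T w y t = \<zeta>y y t" if "y \<in> {0..1}" "t \<in> {0..T}" for y t
  proof (rule eq_on_closed_box[OF pos(7) _ c\<zeta> _ that])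
    fix y t :: real assume i: "y \<in> {0<..<1}" "t \<in> {0<..<T}"
    show "Dt T w y t = \<zeta>y y t"
      unfolding pde(3)[OF i] by (intro Dy_eqI inQ(1)[OF i] \<zeta>_Dy[OF inQ[OF i]])
  qed (rule cont)
  have b_t: "Dy u y t *\<^sub>R b y t + v y t *\<^sub>R Dt T b y t = \<xi>y y t" if "y \<in> {0..1}" "t \<in> {0..T}" for y t
  proof (rule eq_on_closed_box[OF pos(7) _ c\<xi> _ that])
    fix y t :: real assume i: "y \<in> {0<..<1}" "t \<in> {0<..<T}"
    have "((\<lambda>t. v y t *\<^sub>R b y t) has_vector_derivative Dy u y t *\<^sub>R b y t + v y t *\<^sub>R Dt T b y t) (at t within {0..T})"
      using has_vector_derivative_scaleR[OF tv[OF inQ[OF i], folded has_real] tb[OF inQ[OF i]]]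
      by (simp add: v_t[OF inQ[OF i]] add.commute)
    from Dt_eqI[where f = "\<lambda>y t. v y t *\<^sub>R b y t", OF pos(7) inQ(2)[OF i] this]
      Dy_eqI[where f = "\<lambda>y t. w y t + (\<nu> / v y t) *\<^sub>R Dy b y t", OF inQ(1)[OF i] \<xi>_Dy[OF inQ[OF i]]]
    show "Dy u y t *\<^sub>R b y t + v y t *\<^sub>R Dt T b y t = \<xi>y y t"
      using pde(4)[OF i] by simp
  qed (auto intro!: continuous_intros simp: case_prod_unfold)
  have e_t: "(Cv + 4 * a * v y t * \<theta> y t ^ 3) * Dt T \<theta> y t + a * \<theta> y t ^ 4 * Dy u y t
      = Dy F y t + (lam * Dy u y t / v y t - (R * \<theta> y t / v y t + a / 3 * \<theta> y t ^ 4)) * Dy u y t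
        + (\<mu> * (Dy w y t \<bullet> Dy w y t) + \<nu> * (Dy b y t \<bullet> Dy b y t)) / v y t"
    if "y \<in> {0..1}" "t \<in> {0..T}" for y t
  proof (rule eq_on_closed_box[OF pos(7) _ _ _ that])
    fix y t :: real assume i: "y \<in> {0<..<1}" "t \<in> {0<..<T}"
    note D = tv[OF inQ[OF i], folded has_real] t\<theta>[OF inQ[OF i], folded has_real]
    have de: "((\<lambda>t. internal_energy Cv a (v y t) (\<theta> y t)) has_real_derivative
      (Cv + 4 * a * v y t * \<theta> y t ^ 3) * Dt T \<theta> y t + a * \<theta> y t ^ 4 * Dy u y t) (at t within {0..T})"
      unfolding internal_energy_def
      by (rule derivative_eq_intros D refl)+ (simp add: v_t[OF inQ[OF i]] algebra_simps)
    have e: "- pressure R a (v y t) (\<theta> y t) + lam / v y t * Dy u y t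
      = lam * Dy u y t / v y t - (R * \<theta> y t / v y t + a / 3 * \<theta> y t ^ 4)"
      by (simp add: pressure_def)
    from Dt_eqI[where f = "\<lambda>y t. internal_energy Cv a (v y t) (\<theta> y t)",
        OF pos(7) inQ(2)[OF i] de[unfolded has_real]]
    show "(Cv + 4 * a * v y t * \<theta> y t ^ 3) * Dt T \<theta> y t + a * \<theta> y t ^ 4 * Dy u y t
      = Dy F y t + (lam * Dy u y t / v y t - (R * \<theta> y t / v y t + a / 3 * \<theta> y t ^ 4)) * Dy u y t
        + (\<mu> * (Dy w y t \<bullet> Dy w y t) + \<nu> * (Dy b y t \<bullet> Dy b y t)) / v y t"
      using pde(5)[OF i] unfolding e by (simp add: power2_norm_eq_inner add_divide_distrib)
  qed (use nzQ in \<open>auto intro!: continuous_intros simp: case_prod_unfold\<close>)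
  have D: "((\<lambda>t. v y t) has_real_derivative Dy u y t) (at t within {0..T})"
    "((\<lambda>y. lam * Dy u y t / v y t - f y t) has_real_derivative Dt T u y t) (at y within {0..1})"
    "((\<lambda>y. b y t + (\<mu> / v y t) *\<^sub>R Dy w y t) has_vector_derivative Dt T w y t) (at y within {0..1})"
    "((\<lambda>y. w y t + (\<nu> / v y t) *\<^sub>R Dy b y t) has_vector_derivative Dy u y t *\<^sub>R b y t + v y t *\<^sub>R Dt T b y t)
      (at y within {0..1})"
    if "y \<in> {0..1}" "t \<in> {0..T}" for y t
    using tv[OF that] \<sigma>_Dy[OF that] \<zeta>_Dy[OF that] \<xi>_Dy[OF that]
    unfolding has_real v_t[OF that] u_t[OF that] w_t[OF that] b_t[OF that] by simp_all
  have B: "lam * Dy u y t / v y t - f y t = 0 \<and> w y t = 0 \<and> b y t = 0 \<and> F y t = 0"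
    if "y = 0 \<or> y = 1" "t \<in> {0..T}" for y t
    using bd[OF that] by (simp add: f_def F_def pressure_def)
  show ?thesis
    by (rule mhd.intro)
      (assumption | rule pos p refl f_def[THEN meta_eq_to_obj_eq, THEN fun_cong, THEN fun_cong] cont cF e_t D dw db tw tb B
        dv[folded has_real] du[folded has_real] d\<theta>[folded has_real] tu[folded has_real] t\<theta>[folded has_real]
        dF[folded has_real])+
qed

section \<open>From the law for the conductivity to a family of solutions\<close>

lemma powr_le_one_plus_powr:
  fixes x :: real
  assumes "0 < x" "0 \<le> p" "p \<le> q"
  shows "x powr p \<le> 1 + x powr q"
proof (cases "1 \<le> x")
  case True
  then show ?thesis using powr_mono[OF assms(3), of x] by simp
next
  case False
  then have "x powr p \<le> 1" using powr_mono'[OF assms(2), of x] assms(1) by simp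
  then show ?thesis using powr_ge_zero[of x q] by linarith
qed

theorem lemma3p9:
  fixes lam \<mu> \<nu> R a Cv \<kappa>1 \<kappa>2 q T :: real
    and \<kappa> :: "real \<Rightarrow> real \<Rightarrow> real"
    and v0 u0 \<theta>0 :: "real \<Rightarrow> real"
    and w0 b0 :: "real \<Rightarrow> real^2"
  assumes "lam > 0" "\<mu> > 0" "\<nu> > 0" "R > 0" "a > 0" "Cv > 0" "\<kappa>1 > 0" "\<kappa>2 > 0" "q \<ge> 0"
    and "\<And>\<rho> \<theta>. \<rho> > 0 \<Longrightarrow> \<theta> > 0 \<Longrightarrow>
           \<kappa>1 * (1 + \<theta> powr q) \<le> \<kappa> \<rho> \<theta> \<and> \<kappa> \<rho> \<theta> \<le> \<kappa>2 * (1 + \<theta> powr q)"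
    and "T > 0"
    and "initial_data_I v0 u0 w0 b0 \<theta>0"
  shows "\<exists>C>0. \<forall>v u w b \<theta>.
           smooth_fields \<kappa> T v u w b \<theta> \<longrightarrow>
           solution_P lam \<mu> \<nu> R a Cv \<kappa> T v0 u0 w0 b0 \<theta>0 v u w b \<theta> \<longrightarrow>
           (\<forall>t\<in>{0..T}.
              integral {0..1} (\<lambda>y. \<theta> y t ^ 8)
              + integral {0..t} (\<lambda>s. integral {0..1} (\<lambda>y.
                  \<kappa> (1 / v y s) (\<theta> y s) * \<theta> y s ^ 3 * (Dy \<theta> y s)\<^sup>2))
              \<le> C
                + C * sqrt (integral {0..t} (\<lambda>s. integral {0..1} (\<lambda>y. (norm (Dy (Dy w) y s))\<^sup>2)))
                + C * sqrt (integral {0..t} (\<lambda>s. integral {0..1} (\<lambda>y. (norm (Dy (Dy b) y s))\<^sup>2))))"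
proof (rule ccontr)
  let ?lhs = "\<lambda>v \<theta> t. integral {0..1} (\<lambda>y. \<theta> y t ^ 8)
    + integral {0..t} (\<lambda>s. integral {0..1} (\<lambda>y. \<kappa> (1 / v y s) (\<theta> y s) * \<theta> y s ^ 3 * (Dy \<theta> y s)\<^sup>2))"
  assume neg: "\<not> ?thesis"
  have "\<forall>n::nat. \<exists>v u w b \<theta> t. smooth_fields \<kappa> T v u w b \<theta> \<and> solution_P lam \<mu> \<nu> R a Cv \<kappa> T v0 u0 w0 b0 \<theta>0 v u w b \<theta>
    \<and> t \<in> {0..T} \<and> real n < ?lhs v \<theta> t"
  proof
    fix n :: nat
    from neg obtain v u w b \<theta> t where s: "smooth_fields \<kappa> T v u w b \<theta>"
      "solution_P lam \<mu> \<nu> R a Cv \<kappa> T v0 u0 w0 b0 \<theta>0 v u w b \<theta>" "t \<in> {0..T}"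
      and gt: "\<not> ?lhs v \<theta> t \<le> real (Suc n)
        + real (Suc n) * sqrt (integral {0..t} (\<lambda>s. integral {0..1} (\<lambda>y. (norm (Dy (Dy w) y s))\<^sup>2)))
        + real (Suc n) * sqrt (integral {0..t} (\<lambda>s. integral {0..1} (\<lambda>y. (norm (Dy (Dy b) y s))\<^sup>2)))"
      using of_nat_0_less_iff[of "Suc n", where 'a = real] by blast
    \<comment> \<open>The square roots are nonnegative, so violating the inequality with the
      constant \<open>Suc n\<close> already makes the left-hand side exceed \<open>n\<close>. What
      has to be contradicted is thus the absence of a constant bound.\<close>
    have "0 \<le> real (Suc n) * sqrt (integral {0..t} (\<lambda>s. integral {0..1} (\<lambda>y. (norm (Dy (Dy g) y s))\<^sup>2)))"
      for g :: "real \<Rightarrow> real \<Rightarrow> real^2"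
      by (intro mult_nonneg_nonneg real_sqrt_ge_zero integral_nonneg_Icc) auto
    from this[of w] this[of b] gt have "real n < ?lhs v \<theta> t" by simp
    with s show "\<exists>v u w b \<theta> t. smooth_fields \<kappa> T v u w b \<theta>
      \<and> solution_P lam \<mu> \<nu> R a Cv \<kappa> T v0 u0 w0 b0 \<theta>0 v u w b \<theta> \<and> t \<in> {0..T} \<and> real n < ?lhs v \<theta> t" by blast
  qed
  from this[unfolded choice_iff] obtain v u w b \<theta> t where sm: "\<And>n. smooth_fields \<kappa> T (v n) (u n) (w n) (b n) (\<theta> n)"
    and sol: "\<And>n. solution_P lam \<mu> \<nu> R a Cv \<kappa> T v0 u0 w0 b0 \<theta>0 (v n) (u n) (w n) (b n) (\<theta> n)"
    and t: "\<And>n. t n \<in> {0..T}" and gt: "\<And>n::nat. real n < ?lhs (v n) (\<theta> n) (t n)"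
    by blast
  note pos = assms(1-6) assms(11)
  \<comment> \<open>Integer powers replace \<open>\<theta> powr q\<close>: the floor gives
    \<open>2 m \<le> q < 2 m + 2\<close>, which lies in the range that the growth conditions of the
    family admit.\<close>
  define m where "m = nat \<lfloor>q / 2\<rfloor>"
  have m: "real (2 * m) \<le> q" "q \<le> real (2 * m + 3)"
    using assms(9) unfolding m_def by linarith+
  let ?F = "\<lambda>n y t. \<kappa> (1 / v n y t) (\<theta> n y t) / v n y t * Dy (\<theta> n) y t"
  let ?f = "\<lambda>n y t. R * \<theta> n y t / v n y t + a / 3 * \<theta> n y t ^ 4 + b n y t \<bullet> b n y t / 2"
  have p: "v n y s > 0" "\<theta> n y s > 0" if "y \<in> {0..1}" "s \<in> {0..T}" for n y s
    using sol[of n] that unfolding solution_P_def by auto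
  have vF: "v n y s * ?F n y s = \<kappa> (1 / v n y s) (\<theta> n y s) * Dy (\<theta> n) y s" if "y \<in> {0..1}" "s \<in> {0..T}" for n y s
    using p(1)[OF that, of n] by simp
  \<comment> \<open>Passing between \<open>powr q\<close> and integer powers costs a factor 2 on
    each side, because \<open>x \<le> 1 + z\<close> implies \<open>1 + x \<le> 2 * (1 + z)\<close>
    for nonnegative \<open>z\<close>; hence the constants \<open>\<kappa>1 / 2\<close> and
    \<open>2 * \<kappa>2\<close>.\<close>
  have \<kappa>_ge: "\<kappa>1 / 2 * (1 + h ^ (2 * m)) \<le> \<kappa> r h" and \<kappa>_le: "\<kappa> r h \<le> 2 * \<kappa>2 * (1 + h ^ (2 * m + 3))"
    if rh: "0 < r" "0 < h" for r h
  proof -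
    have "h ^ (2 * m) \<le> 1 + h powr q" "h powr q \<le> 1 + h ^ (2 * m + 3)"
      using powr_le_one_plus_powr[OF rh(2) _ m(1)] powr_le_one_plus_powr[OF rh(2) assms(9) m(2)] rh
      by (simp_all only: powr_realpow)
    moreover have "1 + x \<le> 2 * (1 + z)" if "x \<le> 1 + z" "0 \<le> z" for x z :: real
      using that by simp
    ultimately have "1 + h ^ (2 * m) \<le> 2 * (1 + h powr q)" "1 + h powr q \<le> 2 * (1 + h ^ (2 * m + 3))"
      using powr_ge_zero[of h q] zero_le_power[OF less_imp_le[OF rh(2)], of "2 * m + 3"] by blast+
    then have "\<kappa>1 / 2 * (1 + h ^ (2 * m)) \<le> \<kappa>1 / 2 * (2 * (1 + h powr q))"
      "\<kappa>2 * (1 + h powr q) \<le> \<kappa>2 * (2 * (1 + h ^ (2 * m + 3)))"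
      using assms(7,8) by (auto intro!: mult_left_mono)
    with assms(10)[OF rh] show "\<kappa>1 / 2 * (1 + h ^ (2 * m)) \<le> \<kappa> r h" "\<kappa> r h \<le> 2 * \<kappa>2 * (1 + h ^ (2 * m + 3))"
      by (simp_all add: algebra_simps)
  qed
  interpret mhd_family lam \<mu> \<nu> R a Cv T "\<kappa>1 / 2" "2 * \<kappa>2" m v "\<lambda>n. Dy (v n)" u "\<lambda>n. Dy (u n)" "\<lambda>n. Dt T (u n)"
    \<theta> "\<lambda>n. Dy (\<theta> n)" "\<lambda>n. Dt T (\<theta> n)" ?F "\<lambda>n. Dy (?F n)" ?f "\<lambda>n y t. lam * Dy (u n) y t / v n y t - ?f n y t"
    w "\<lambda>n. Dy (w n)" "\<lambda>n. Dt T (w n)" b "\<lambda>n. Dy (b n)" "\<lambda>n. Dt T (b n)"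
    "\<lambda>n y t. b n y t + (\<mu> / v n y t) *\<^sub>R Dy (w n) y t" "\<lambda>n y t. w n y t + (\<nu> / v n y t) *\<^sub>R Dy (b n) y t"
  proof (rule mhd_family.intro)
    show "mhd lam \<mu> \<nu> R a Cv T (v n) (Dy (v n)) (u n) (Dy (u n)) (Dt T (u n)) (\<theta> n) (Dy (\<theta> n)) (Dt T (\<theta> n))
      (?F n) (Dy (?F n)) (?f n) (\<lambda>y t. lam * Dy (u n) y t / v n y t - ?f n y t)
      (w n) (Dy (w n)) (Dt T (w n)) (b n) (Dy (b n)) (Dt T (b n))
      (\<lambda>y t. b n y t + (\<mu> / v n y t) *\<^sub>R Dy (w n) y t) (\<lambda>y t. w n y t + (\<nu> / v n y t) *\<^sub>R Dy (b n) y t)" for n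
      by (rule mhd_of_solution[OF pos sm sol])
    show "0 < \<kappa>1 / 2" "0 < 2 * \<kappa>2" using assms(7,8) by auto
    fix n and y s :: real assume ys: "y \<in> {0..1}" "s \<in> {0..T}"
    let ?k = "\<kappa> (1 / v n y s) (\<theta> n y s)"
    have r: "0 < 1 / v n y s" "0 < \<theta> n y s" using p[OF ys, of n] by auto
    have k0: "0 \<le> ?k" using \<kappa>_ge[OF r] assms(7) r(2)
      by (smt (verit) divide_pos_pos mult_nonneg_nonneg zero_le_power)
    have e: "v n y s * (?F n y s * Dy (\<theta> n) y s) = ?k * (Dy (\<theta> n) y s)\<^sup>2"
      unfolding mult.assoc[symmetric] vF[OF ys, of n, unfolded mult.assoc[symmetric]] by (simp add: power2_eq_square)
    show "\<kappa>1 / 2 * (1 + \<theta> n y s ^ (2 * m)) * (Dy (\<theta> n) y s)\<^sup>2 \<le> v n y s * (?F n y s * Dy (\<theta> n) y s)"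
      unfolding e by (rule mult_right_mono[OF \<kappa>_ge[OF r]]) simp
    \<comment> \<open>One factor \<open>\<kappa>\<close> is estimated by its growth, the other stays
      in the heat dissipation.\<close>
    have "(v n y s * ?F n y s)\<^sup>2 = ?k * (?k * (Dy (\<theta> n) y s)\<^sup>2)"
      unfolding vF[OF ys] by (simp add: power2_eq_square)
    also have "\<dots> \<le> 2 * \<kappa>2 * (1 + \<theta> n y s ^ (2 * m + 3)) * (?k * (Dy (\<theta> n) y s)\<^sup>2)"
      using k0 by (intro mult_right_mono \<kappa>_le[OF r]) auto
    finally show "(v n y s * ?F n y s)\<^sup>2 \<le> 2 * \<kappa>2 * (1 + \<theta> n y s ^ (2 * m + 3)) * (v n y s * (?F n y s * Dy (\<theta> n) y s))"
      unfolding e .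
  next
    fix i j :: nat and y :: real assume y: "y \<in> {0..1}"
    have s: "v n x 0 = v0 x" "u n x 0 = u0 x" "w n x 0 = w0 x" "b n x 0 = b0 x" "\<theta> n x 0 = \<theta>0 x" if "x \<in> {0..1}" for n x
      using sol[of n] that unfolding solution_P_def by auto
    have "C1_y T (v i)" "C1_y T (u i)" "C1_y T (w i)" "C1_y T (b i)"
      using sm[of i] unfolding smooth_fields_def by auto
    then have "Dy (v i) y 0 = Dy (v j) y 0" "Dy (u i) y 0 = Dy (u j) y 0"
      "Dy (w i) y 0 = Dy (w j) y 0" "Dy (b i) y 0 = Dy (b j) y 0"
      by (auto intro!: Dy_cong[OF _ y] simp: s assms(11) less_imp_le)
    then show "v i y 0 = v j y 0 \<and> Dy (v i) y 0 = Dy (v j) y 0 \<and> u i y 0 = u j y 0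
      \<and> Dy (u i) y 0 = Dy (u j) y 0 \<and> \<theta> i y 0 = \<theta> j y 0 \<and> w i y 0 = w j y 0 \<and> Dy (w i) y 0 = Dy (w j) y 0
      \<and> b i y 0 = b j y 0 \<and> Dy (b i) y 0 = Dy (b j) y 0"
      by (simp add: s[OF y])
  qed
  obtain C where C: "\<And>n t. t \<in> {0..T} \<Longrightarrow> integral {0..1} (\<lambda>y. \<theta> n y t ^ 8)
    + integral {0..t} (\<lambda>s. integral {0..1} (\<lambda>y. v n y s * ?F n y s * \<theta> n y s ^ 3 * Dy (\<theta> n) y s)) \<le> C"
    using heat_bound by blast
  obtain n where n: "C \<le> real n" using real_arch_simple by blast
  have "integral {0..t n} (\<lambda>s. integral {0..1} (\<lambda>y. v n y s * ?F n y s * \<theta> n y s ^ 3 * Dy (\<theta> n) y s))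
    = integral {0..t n} (\<lambda>s. integral {0..1} (\<lambda>y. \<kappa> (1 / v n y s) (\<theta> n y s) * \<theta> n y s ^ 3 * (Dy (\<theta> n) y s)\<^sup>2))"
  proof (intro Henstock_Kurzweil_Integration.integral_cong)
    fix s y :: real assume "s \<in> {0..t n}" "y \<in> {0..1}"
    then have ys: "y \<in> {0..1}" "s \<in> {0..T}" using t[of n] by auto
    show "v n y s * ?F n y s * \<theta> n y s ^ 3 * Dy (\<theta> n) y s = \<kappa> (1 / v n y s) (\<theta> n y s) * \<theta> n y s ^ 3 * (Dy (\<theta> n) y s)\<^sup>2"
      unfolding vF[OF ys] by (simp add: power2_eq_square)
  qed
  with C[OF t[of n], of n] gt[of n] n show False by linarith
qed

end
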